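(* Let initial data $\Phi(\cdot,t=0)\in C^{8}_{per}(\Omega)$ and $\Psi(\cdot,t=0)\in C^{6}_{per}(\Omega)$ be given, and suppose that the exact solution $(\Phi,\Psi)$ on $[0,T]$ of the binary fluid-surfactant system $$\Phi_t=\mathcal{M}\Delta\mu_\phi,\qquad \Psi_t=\mathcal{M}\Delta\mu_\rho,\qquad \mu_\phi=\frac{\delta G}{\delta\phi}(\Phi,\Psi),\quad \mu_\rho=\frac{\delta G}{\delta\rho}(\Phi,\Psi),$$ with periodic boundary conditions, is of regularity class $$\Phi\in H^{2}(0,T;C_{per}(\Omega))\cap L^{\infty}(0,T;C_{per}^{8}(\Omega)),\qquad \Psi\in H^{2}(0,T;C_{per}(\Omega))\cap L^{\infty}(0,T;C_{per}^{6}(\Omega)).$$ Let $(\phi^m,\rho^m)$ be the numerical solution of the scheme given in the context, with $\phi^0=\mathcal{P}_h\Phi_N(\cdot,0)$, $\rho^0=\mathcal{P}_h\Psi_N(\cdot,0)$, and let $\tilde\phi^m=\mathcal{P}_h\Phi_N(\cdot,t_m)-\phi^m$, $\tilde\rho^m=\mathcal{P}_h\Psi_N(\cdot,t_m)-\rho^m$, $t_m=m\Delta t$. Then, provided that $\Delta t$ is sufficiently small, for all positive integers $n$ such that $t_{n+1}\le T$, we have $$\|\tilde{\phi}^{n+1}\|_{-1,h}+\|\tilde{\rho}^{n+1}\|_{-1,h}+\Big(\mathcal{M}\Delta t\sum_{k=0}^{n+1}\big(\eta^{2}\|\Delta_{h}\tilde{\phi}^{k}\|_{2}^{2}+\varepsilon\|\nabla_{h}\tilde{\phi}^{k}\|_{2}^{2}+\xi\|\nabla_{h}\tilde{\rho}^{k}\|_{2}^{2}\big)\Big)^{\frac12}\le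 C(\Delta t+h^{2}),$$ where $C>0$ is independent of $n$, $\Delta t$ and $h$.
   Context: Parameters: $\alpha,\beta,\varepsilon,\eta,\xi,\delta,\mathcal{M},T>0$ are fixed constants; $\Delta t$ being "sufficiently small" means smaller than a constant which may depend on these parameters, and $C$ may also depend on them and on the exact solution. $\Omega=(0,L)^2$. Free energy: with $f(\phi)=\frac14\phi^2(1-\phi)^2$, $H(\rho)=\rho\ln\rho+(1-\rho)\ln(1-\rho)$ and $|\nabla^\delta\phi|=(|\nabla\phi|^2+\delta^2)^{1/2}$, $$G(\phi,\rho)=\int_\Omega\Big(\frac{f(\phi)}{\varepsilon}+\frac{\varepsilon}{2}|\nabla\phi|^2+\frac{\eta^2}{2}|\Delta\phi|^2+\frac{\xi}{2}|\nabla\rho|^2+\frac{\alpha}{2}(\rho-|\nabla^\delta\phi|)^2+\beta H(\rho)\Big)\,d\boldsymbol{x},$$ so that $\frac{\delta G}{\delta\phi}=\frac{f'(\phi)}{\varepsilon}-(\varepsilon+\alpha)\Delta\phi+\eta^2\Delta^2\phi+\alpha\nabla\cdot\big(\frac{\rho\nabla\phi}{|\nabla^\delta\phi|}\big)$ and $\frac{\delta G}{\delta\rho}=\alpha\rho-\alpha|\nabla^\delta\phi|-\xi\Delta\rho+\beta H'(\rho)$. The density of the exact solution satisfies $0<\Psi<1$ (so that $H'(\Psi)$ is defined). Grid: $N=2K+1\in\mathbb{N}$, $h=L/N$, $p_i=(i-\frac12)h$. $\mathcal{C}_{per}$ is the space of real (cell-centered) grid functions $\nu=(\nu_{i,j})_{i,j\in\mathbb{Z}}$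 that are $N$-periodic in each index, $\nu_{i,j}$ being the value at $(p_i,p_j)$. Differences: $(D_x\nu)_{i+\frac12,j}=\frac{1}{h}(\nu_{i+1,j}-\nu_{i,j})$, $(D_y\nu)_{i,j+\frac12}=\frac1h(\nu_{i,j+1}-\nu_{i,j})$; $\nabla_h\nu=(D_x\nu,D_y\nu)$. For an edge-centered $\vec f=(f^x,f^y)$, $(\nabla_h\cdot\vec f)_{i,j}=\frac1h(f^x_{i+\frac12,j}-f^x_{i-\frac12,j})+\frac1h(f^y_{i,j+\frac12}-f^y_{i,j-\frac12})$; $\Delta_h=\nabla_h\cdot\nabla_h$ is the periodic five-point Laplacian. Norms: $\langle\nu,\zeta\rangle_\Omega=h^2\sum_{i,j=1}^N\nu_{i,j}\zeta_{i,j}$, $\|\nu\|_2^2=\langle\nu,\nu\rangle_\Omega$, $\|\nabla_h\nu\|_2^2=h^2\sum_{i,j=1}^N\big((D_x\nu)_{i+\frac12,j}^2+(D_y\nu)_{i,j+\frac12}^2\big)$, and for mean-zero $\nu\in\mathcal{C}_{per}$, $\|\nu\|_{-1,h}^2=\langle\nu,(-\Delta_h)^{-1}\nu\rangle_\Omega$, where $(-\Delta_h)^{-1}\nu$ is the unique mean-zero $\psi\in\mathcal{C}_{per}$ with $-\Delta_h\psi=\nu$. (The error functions $\tilde\phi^m,\tilde\rho^m$ have zero mean by mass conservation.) Projection and interpolation: $\Phi_N(\cdot,t)=\mathcal{P}_N\Phi(\cdot,t)$ and $\Psi_N(\cdot,t)=\mathcal{P}_N\Psi(\cdot,t)$ are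 the spatial Fourier projections onto the space of ($\Omega$-periodic) trigonometric polynomials of degree up to and including $K$. $\mathcal{P}_h$ is point-wise interpolation on the grid: $(\mathcal{P}_hu)_{i,j}=u(p_i,p_j)$. Scheme: given $\phi^n,\rho^n\in\mathcal{C}_{per}$, find $\phi^{n+1},\rho^{n+1}\in\mathcal{C}_{per}$ with $0<\rho^{n+1}<1$ point-wise such that $$\frac{\phi^{n+1}-\phi^{n}}{\Delta t}=\mathcal{M}\Delta_h\mu_\phi^{n+1},\qquad \frac{\rho^{n+1}-\rho^{n}}{\Delta t}=\mathcal{M}\Delta_h\mu_\rho^{n+1},$$ $$\mu_{\phi}^{n+1}=\frac{1}{\varepsilon}\Big(\phi^{n+1}-\frac12\Big)^{3}-\Big(\varepsilon+\alpha+\frac{\alpha}{\delta}\Big)\Delta_h\phi^{n+1}+\eta^{2}\Delta_h^{2}\phi^{n+1}+\alpha\nabla_h\cdot\Big(\mathcal{A}\Big(\frac{\rho^{n+1}}{\mathcal{A}|\nabla_h^\delta\phi^{n+1}|}\Big)\nabla_h\phi^{n+1}\Big)-\frac{1}{4\varepsilon}\Big(\phi^{n}-\frac12\Big)+\frac{\alpha}{\delta}\Delta_h\phi^{n},$$ $$\mu_{\rho}^{n+1}=-\xi\Delta_h\rho^{n+1}+\beta\big(\ln\rho^{n+1}-\ln(1-\rho^{n+1})\big)+\sqrt2\,\alpha\rho^{n+1}-\alpha\,\mathcal{A}|\nabla_h^\delta\phi^{n+1}|-\alpha(\sqrt2-1)\rho^{n}.$$ Here $\mathcal{A}|\nabla_h^\delta\phi|_{i,j}>0$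 is defined by $$\big(\mathcal{A}|\nabla_h^\delta\phi|_{i,j}\big)^2=\tfrac12\big((D_x\phi)_{i+\frac12,j}^2+(D_x\phi)_{i-\frac12,j}^2+(D_y\phi)_{i,j+\frac12}^2+(D_y\phi)_{i,j-\frac12}^2\big)+\delta^2,$$ and, for cell-centered $g$, the outer $\mathcal{A}(g)$ is the arithmetic average onto edges: $\mathcal{A}(g)_{i+\frac12,j}=\frac12(g_{i,j}+g_{i+1,j})$, $\mathcal{A}(g)_{i,j+\frac12}=\frac12(g_{i,j}+g_{i,j+1})$. All nonlinear operations on grid functions are point-wise. *)

theory Defs
  imports "HOL-Analysis.Analysis"
begin

section \<open>Periodic function spaces\<close>

text \<open>Functions on \<open>\<Omega> = (0,L)\<^sup>2\<close> with periodic boundary conditions are represented by their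
  \<open>L\<close>-periodic extensions to the whole plane.\<close>

definition C_per :: "real \<Rightarrow> (real \<times> real \<Rightarrow> real) \<Rightarrow> bool" where
  "C_per L u \<longleftrightarrow> continuous_on UNIV u \<and> (\<forall>x y. u (x + L, y) = u (x, y) \<and> u (x, y + L) = u (x, y))"

definition pdx :: "(real \<times> real \<Rightarrow> real) \<Rightarrow> real \<times> real \<Rightarrow> real" where
  "pdx u z = deriv (\<lambda>s. u (s, snd z)) (fst z)"

definition pdy :: "(real \<times> real \<Rightarrow> real) \<Rightarrow> real \<times> real \<Rightarrow> real" where
  "pdy u z = deriv (\<lambda>s. u (fst z, s)) (snd z)"

definition partially_differentiable :: "(real \<times> real \<Rightarrow> real) \<Rightarrow> bool" where
  "partially_differentiable u \<longleftrightarrow>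
     (\<forall>x y. (\<lambda>s. u (s, y)) differentiable (at x) \<and> (\<lambda>s. u (x, s)) differentiable (at y))"

primrec Ck_per :: "real \<Rightarrow> nat \<Rightarrow> (real \<times> real \<Rightarrow> real) \<Rightarrow> bool" where
  "Ck_per L 0 u \<longleftrightarrow> C_per L u"
| "Ck_per L (Suc k) u \<longleftrightarrow>
     C_per L u \<and> partially_differentiable u \<and> Ck_per L k (pdx u) \<and> Ck_per L k (pdy u)"

definition sup_norm :: "(real \<times> real \<Rightarrow> real) \<Rightarrow> real" where
  "sup_norm u = (SUP z. \<bar>u z\<bar>)"

primrec Ck_norm :: "nat \<Rightarrow> (real \<times> real \<Rightarrow> real) \<Rightarrow> real" where
  "Ck_norm 0 u = sup_norm u"
| "Ck_norm (Suc k) u = max (sup_norm u) (max (Ck_norm k (pdx u)) (Ck_norm k (pdy u)))"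

section \<open>Bochner spaces in time\<close>

text \<open>The first argument of \<open>u\<close> is time. The spaces of values, \<open>C\<^sub>p\<^sub>e\<^sub>r\<close> and \<open>C\<^sup>k\<^sub>p\<^sub>e\<^sub>r\<close>, are separable,
  and point evaluations separate their points and generate their Borel sets; hence strong
  measurability amounts to measurability of \<open>t \<mapsto> u t z\<close> for every \<open>z\<close>.\<close>

definition L2_C_per :: "real \<Rightarrow> real \<Rightarrow> (real \<Rightarrow> real \<times> real \<Rightarrow> real) \<Rightarrow> bool" where
  "L2_C_per T L u \<longleftrightarrow>
     (\<forall>z. (\<lambda>t. u t z) \<in> borel_measurable (lebesgue_on {0<..<T})) \<and>
     (AE t in lebesgue_on {0<..<T}. C_per L (u t)) \<and>
     integrable (lebesgue_on {0<..<T}) (\<lambda>t. (sup_norm (u t))\<^sup>2)"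

definition Linf_Ck_per :: "real \<Rightarrow> real \<Rightarrow> nat \<Rightarrow> (real \<Rightarrow> real \<times> real \<Rightarrow> real) \<Rightarrow> bool" where
  "Linf_Ck_per T L k u \<longleftrightarrow>
     (\<forall>z. (\<lambda>t. u t z) \<in> borel_measurable (lebesgue_on {0<..<T})) \<and>
     (\<exists>B. AE t in lebesgue_on {0<..<T}. Ck_per L k (u t) \<and> Ck_norm k (u t) \<le> B)"

definition time_test_function :: "real \<Rightarrow> (real \<Rightarrow> real) \<Rightarrow> bool" where
  "time_test_function T \<theta> \<longleftrightarrow>
     (\<forall>k t. (deriv ^^ k) \<theta> differentiable (at t)) \<and>
     (\<exists>a b. 0 < a \<and> b < T \<and> (\<forall>t. t \<notin> {a..b} \<longrightarrow> \<theta> t = 0))"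

text \<open>The defining identity of the weak derivative is one between \<open>C\<^sub>p\<^sub>e\<^sub>r\<close>-valued Bochner integrals;
  as point evaluations are continuous linear functionals, it may be read point-wise in space.\<close>

definition weak_time_derivative ::
  "real \<Rightarrow> (real \<Rightarrow> real \<times> real \<Rightarrow> real) \<Rightarrow> (real \<Rightarrow> real \<times> real \<Rightarrow> real) \<Rightarrow> bool" where
  "weak_time_derivative T u v \<longleftrightarrow>
     (\<forall>\<theta> z. time_test_function T \<theta> \<longrightarrow>
        (LINT t|lebesgue_on {0<..<T}. u t z * deriv \<theta> t) =
        - (LINT t|lebesgue_on {0<..<T}. v t z * \<theta> t))"

text \<open>An element of \<open>H\<^sup>2(0,T;C\<^sub>p\<^sub>e\<^sub>r)\<close> is identified with its representative in \<open>C([0,T];C\<^sub>p\<^sub>e\<^sub>r)\<close>, so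
  that its values at individual times make sense.\<close>

definition H2_C_per :: "real \<Rightarrow> real \<Rightarrow> (real \<Rightarrow> real \<times> real \<Rightarrow> real) \<Rightarrow> bool" where
  "H2_C_per T L u \<longleftrightarrow>
     (\<forall>t\<in>{0..T}. C_per L (u t)) \<and>
     continuous_on ({0..T} \<times> UNIV) (\<lambda>(t, z). u t z) \<and>
     L2_C_per T L u \<and>
     (\<exists>v w. L2_C_per T L v \<and> L2_C_per T L w \<and>
        weak_time_derivative T u v \<and> weak_time_derivative T v w)"

section \<open>The binary fluid-surfactant system\<close>

definition laplacian :: "(real \<times> real \<Rightarrow> real) \<Rightarrow> real \<times> real \<Rightarrow> real" where
  "laplacian u z = pdx (pdx u) z + pdy (pdy u) z"

definition divergence ::
  "(real \<times> real \<Rightarrow> real) \<Rightarrow> (real \<times> real \<Rightarrow> real) \<Rightarrow> real \<times> real \<Rightarrow> real" where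
  "divergence a b z = pdx a z + pdy b z"

definition reg_grad_norm :: "real \<Rightarrow> (real \<times> real \<Rightarrow> real) \<Rightarrow> real \<times> real \<Rightarrow> real" where
  "reg_grad_norm \<delta> \<phi> z = sqrt ((pdx \<phi> z)\<^sup>2 + (pdy \<phi> z)\<^sup>2 + \<delta>\<^sup>2)"

definition double_well :: "real \<Rightarrow> real" where
  "double_well s = (1/4) * s\<^sup>2 * (1 - s)\<^sup>2"

definition mixing_entropy :: "real \<Rightarrow> real" where
  "mixing_entropy s = s * ln s + (1 - s) * ln (1 - s)"

text \<open>The chemical potentials are the variational derivatives \<open>\<delta>G/\<delta>\<phi>\<close> and \<open>\<delta>G/\<delta>\<rho>\<close> of
  \<open>G(\<phi>,\<rho>) = \<integral>\<^sub>\<Omega> f(\<phi>)/\<epsilon> + \<epsilon>/2 |\<nabla>\<phi>|\<^sup>2 + \<eta>\<^sup>2/2 |\<Delta>\<phi>|\<^sup>2 + \<xi>/2 |\<nabla>\<rho>|\<^sup>2 + \<alpha>/2 (\<rho> - |\<nabla>\<^sup>\<delta>\<phi>|)\<^sup>2 + \<beta> H(\<rho>)\<close>,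
  where \<open>f\<close> is \<^const>\<open>double_well\<close>, \<open>H\<close> is \<^const>\<open>mixing_entropy\<close>, and \<open>|\<nabla>\<^sup>\<delta>\<phi>|\<close> is
  \<^const>\<open>reg_grad_norm\<close>.\<close>

definition mu_phi ::
  "real \<Rightarrow> real \<Rightarrow> real \<Rightarrow> real \<Rightarrow> (real \<times> real \<Rightarrow> real) \<Rightarrow> (real \<times> real \<Rightarrow> real) \<Rightarrow> real \<times> real \<Rightarrow> real" where
  "mu_phi \<alpha> \<epsilon> \<eta> \<delta> \<phi> \<rho> z =
     deriv double_well (\<phi> z) / \<epsilon> - (\<epsilon> + \<alpha>) * laplacian \<phi> z + \<eta>\<^sup>2 * laplacian (laplacian \<phi>) z
     + \<alpha> * divergence (\<lambda>w. \<rho> w * pdx \<phi> w / reg_grad_norm \<delta> \<phi> w)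
                      (\<lambda>w. \<rho> w * pdy \<phi> w / reg_grad_norm \<delta> \<phi> w) z"

definition mu_rho ::
  "real \<Rightarrow> real \<Rightarrow> real \<Rightarrow> real \<Rightarrow> (real \<times> real \<Rightarrow> real) \<Rightarrow> (real \<times> real \<Rightarrow> real) \<Rightarrow> real \<times> real \<Rightarrow> real" where
  "mu_rho \<alpha> \<beta> \<xi> \<delta> \<phi> \<rho> z =
     \<alpha> * \<rho> z - \<alpha> * reg_grad_norm \<delta> \<phi> z - \<xi> * laplacian \<rho> z + \<beta> * deriv mixing_entropy (\<rho> z)"

text \<open>The spatial regularity is \<open>L\<^sup>\<infinity>\<close> in time, so the equations are required for almost every time.\<close>

definition exact_solution ::
  "real \<Rightarrow> real \<Rightarrow> real \<Rightarrow> real \<Rightarrow> real \<Rightarrow> real \<Rightarrow> real \<Rightarrow> real \<Rightarrow> real \<Rightarrow>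
   (real \<Rightarrow> real \<times> real \<Rightarrow> real) \<Rightarrow> (real \<Rightarrow> real \<times> real \<Rightarrow> real) \<Rightarrow> bool" where
  "exact_solution \<alpha> \<beta> \<epsilon> \<eta> \<xi> \<delta> \<M> T L \<Phi> \<Psi> \<longleftrightarrow>
     (\<forall>t\<in>{0..T}. \<forall>z. 0 < \<Psi> t z \<and> \<Psi> t z < 1) \<and>
     (AE t in lebesgue_on {0<..<T}. \<forall>z.
        ((\<lambda>s. \<Phi> s z) has_real_derivative \<M> * laplacian (mu_phi \<alpha> \<epsilon> \<eta> \<delta> (\<Phi> t) (\<Psi> t)) z) (at t) \<and>
        ((\<lambda>s. \<Psi> s z) has_real_derivative \<M> * laplacian (mu_rho \<alpha> \<beta> \<xi> \<delta> (\<Phi> t) (\<Psi> t)) z) (at t))"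

section \<open>Fourier projection\<close>

definition fourier_mode :: "real \<Rightarrow> int \<Rightarrow> int \<Rightarrow> real \<times> real \<Rightarrow> complex" where
  "fourier_mode L k l z = cis (2 * pi * (of_int k * fst z + of_int l * snd z) / L)"

definition fourier_coeff :: "real \<Rightarrow> (real \<times> real \<Rightarrow> real) \<Rightarrow> int \<Rightarrow> int \<Rightarrow> complex" where
  "fourier_coeff L u k l =
     integral (cbox (0, 0) (L, L)) (\<lambda>z. of_real (u z) * cnj (fourier_mode L k l z)) / of_real (L\<^sup>2)"

text \<open>Degree at most \<open>K\<close> means degree at most \<open>K\<close> in each variable; the sum is real for real \<open>u\<close>.\<close>

definition fourier_proj :: "real \<Rightarrow> nat \<Rightarrow> (real \<times> real \<Rightarrow> real) \<Rightarrow> real \<times> real \<Rightarrow> real" where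
  "fourier_proj L K u z =
     Re (\<Sum>k\<in>{- int K..int K}. \<Sum>l\<in>{- int K..int K}. fourier_coeff L u k l * fourier_mode L k l z)"

section \<open>Grid functions\<close>

text \<open>A cell-centered function has its value at \<open>(p\<^sub>i, p\<^sub>j)\<close> stored at index \<open>(i, j)\<close>. An edge-centered
  field is a pair; the first component at \<open>(i, j)\<close> is the value at \<open>(i+1/2, j)\<close>, the second one the
  value at \<open>(i, j+1/2)\<close>.\<close>

type_synonym grid_fun = "int \<Rightarrow> int \<Rightarrow> real"

definition grid_per :: "nat \<Rightarrow> grid_fun \<Rightarrow> bool" where
  "grid_per N \<nu> \<longleftrightarrow> (\<forall>i j. \<nu> (i + int N) j = \<nu> i j \<and> \<nu> i (j + int N) = \<nu> i j)"

definition grid_interp :: "real \<Rightarrow> (real \<times> real \<Rightarrow> real) \<Rightarrow> grid_fun" where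
  "grid_interp h u i j = u ((of_int i - 1/2) * h, (of_int j - 1/2) * h)"

definition Dx :: "real \<Rightarrow> grid_fun \<Rightarrow> grid_fun" where
  "Dx h \<nu> i j = (\<nu> (i + 1) j - \<nu> i j) / h"

definition Dy :: "real \<Rightarrow> grid_fun \<Rightarrow> grid_fun" where
  "Dy h \<nu> i j = (\<nu> i (j + 1) - \<nu> i j) / h"

definition div_h :: "real \<Rightarrow> grid_fun \<times> grid_fun \<Rightarrow> grid_fun" where
  "div_h h f i j = (fst f i j - fst f (i - 1) j) / h + (snd f i j - snd f i (j - 1)) / h"

definition grad_h :: "real \<Rightarrow> grid_fun \<Rightarrow> grid_fun \<times> grid_fun" where
  "grad_h h \<nu> = (Dx h \<nu>, Dy h \<nu>)"

definition lap_h :: "real \<Rightarrow> grid_fun \<Rightarrow> grid_fun" where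
  "lap_h h \<nu> = div_h h (grad_h h \<nu>)"

definition edge_avg :: "grid_fun \<Rightarrow> grid_fun \<times> grid_fun" where
  "edge_avg g = (\<lambda>i j. (g i j + g (i + 1) j) / 2, \<lambda>i j. (g i j + g i (j + 1)) / 2)"

definition edge_mult :: "grid_fun \<times> grid_fun \<Rightarrow> grid_fun \<times> grid_fun \<Rightarrow> grid_fun \<times> grid_fun" where
  "edge_mult f g = (\<lambda>i j. fst f i j * fst g i j, \<lambda>i j. snd f i j * snd g i j)"

definition avg_grad_norm :: "real \<Rightarrow> real \<Rightarrow> grid_fun \<Rightarrow> grid_fun" where
  "avg_grad_norm \<delta> h \<phi> i j =
     sqrt ((1/2) * ((Dx h \<phi> i j)\<^sup>2 + (Dx h \<phi> (i - 1) j)\<^sup>2 + (Dy h \<phi> i j)\<^sup>2 + (Dy h \<phi> i (j - 1))\<^sup>2) + \<delta>\<^sup>2)"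

definition grid_inner :: "real \<Rightarrow> nat \<Rightarrow> grid_fun \<Rightarrow> grid_fun \<Rightarrow> real" where
  "grid_inner h N \<nu> \<zeta> = h\<^sup>2 * (\<Sum>i\<in>{1..int N}. \<Sum>j\<in>{1..int N}. \<nu> i j * \<zeta> i j)"

definition grid_norm2 :: "real \<Rightarrow> nat \<Rightarrow> grid_fun \<Rightarrow> real" where
  "grid_norm2 h N \<nu> = sqrt (grid_inner h N \<nu> \<nu>)"

definition grad_norm2 :: "real \<Rightarrow> nat \<Rightarrow> grid_fun \<Rightarrow> real" where
  "grad_norm2 h N \<nu> =
     sqrt (h\<^sup>2 * (\<Sum>i\<in>{1..int N}. \<Sum>j\<in>{1..int N}. (Dx h \<nu> i j)\<^sup>2 + (Dy h \<nu> i j)\<^sup>2))"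

definition mean_zero :: "nat \<Rightarrow> grid_fun \<Rightarrow> bool" where
  "mean_zero N \<nu> \<longleftrightarrow> (\<Sum>i\<in>{1..int N}. \<Sum>j\<in>{1..int N}. \<nu> i j) = 0"

text \<open>The next two definitions are meaningful only for periodic \<open>\<nu>\<close> of zero mean.\<close>

definition inv_neg_lap_h :: "real \<Rightarrow> nat \<Rightarrow> grid_fun \<Rightarrow> grid_fun" where
  "inv_neg_lap_h h N \<nu> = (THE \<psi>. grid_per N \<psi> \<and> mean_zero N \<psi> \<and> (\<forall>i j. - lap_h h \<psi> i j = \<nu> i j))"

definition norm_m1 :: "real \<Rightarrow> nat \<Rightarrow> grid_fun \<Rightarrow> real" where
  "norm_m1 h N \<nu> = sqrt (grid_inner h N \<nu> (inv_neg_lap_h h N \<nu>))"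

section \<open>The numerical scheme\<close>

definition mu_phi_h ::
  "real \<Rightarrow> real \<Rightarrow> real \<Rightarrow> real \<Rightarrow> real \<Rightarrow> grid_fun \<Rightarrow> grid_fun \<Rightarrow> grid_fun \<Rightarrow> grid_fun" where
  "mu_phi_h \<alpha> \<epsilon> \<eta> \<delta> h \<phi> \<phi>' \<rho>' i j =
     (1/\<epsilon>) * (\<phi>' i j - 1/2) ^ 3 - (\<epsilon> + \<alpha> + \<alpha>/\<delta>) * lap_h h \<phi>' i j
     + \<eta>\<^sup>2 * lap_h h (lap_h h \<phi>') i j
     + \<alpha> * div_h h (edge_mult (edge_avg (\<lambda>k l. \<rho>' k l / avg_grad_norm \<delta> h \<phi>' k l)) (grad_h h \<phi>')) i j
     - 1/(4*\<epsilon>) * (\<phi> i j - 1/2) + \<alpha>/\<delta> * lap_h h \<phi> i j"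

definition mu_rho_h ::
  "real \<Rightarrow> real \<Rightarrow> real \<Rightarrow> real \<Rightarrow> real \<Rightarrow> grid_fun \<Rightarrow> grid_fun \<Rightarrow> grid_fun \<Rightarrow> grid_fun" where
  "mu_rho_h \<alpha> \<beta> \<xi> \<delta> h \<rho> \<phi>' \<rho>' i j =
     - \<xi> * lap_h h \<rho>' i j + \<beta> * (ln (\<rho>' i j) - ln (1 - \<rho>' i j)) + sqrt 2 * \<alpha> * \<rho>' i j
     - \<alpha> * avg_grad_norm \<delta> h \<phi>' i j - \<alpha> * (sqrt 2 - 1) * \<rho> i j"

definition scheme_step ::
  "real \<Rightarrow> real \<Rightarrow> real \<Rightarrow> real \<Rightarrow> real \<Rightarrow> real \<Rightarrow> real \<Rightarrow> real \<Rightarrow> nat \<Rightarrow> real \<Rightarrow>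
   grid_fun \<Rightarrow> grid_fun \<Rightarrow> grid_fun \<Rightarrow> grid_fun \<Rightarrow> bool" where
  "scheme_step \<alpha> \<beta> \<epsilon> \<eta> \<xi> \<delta> \<M> h N dt \<phi> \<rho> \<phi>' \<rho>' \<longleftrightarrow>
     grid_per N \<phi>' \<and> grid_per N \<rho>' \<and> (\<forall>i j. 0 < \<rho>' i j \<and> \<rho>' i j < 1) \<and>
     (\<forall>i j. (\<phi>' i j - \<phi> i j) / dt = \<M> * lap_h h (mu_phi_h \<alpha> \<epsilon> \<eta> \<delta> h \<phi> \<phi>' \<rho>') i j) \<and>
     (\<forall>i j. (\<rho>' i j - \<rho> i j) / dt = \<M> * lap_h h (mu_rho_h \<alpha> \<beta> \<xi> \<delta> h \<rho> \<phi>' \<rho>') i j)"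

definition numerical_solution ::
  "real \<Rightarrow> real \<Rightarrow> real \<Rightarrow> real \<Rightarrow> real \<Rightarrow> real \<Rightarrow> real \<Rightarrow> real \<Rightarrow> real \<Rightarrow> nat \<Rightarrow> real \<Rightarrow>
   (real \<times> real \<Rightarrow> real) \<Rightarrow> (real \<times> real \<Rightarrow> real) \<Rightarrow> (nat \<Rightarrow> grid_fun) \<Rightarrow> (nat \<Rightarrow> grid_fun) \<Rightarrow> bool" where
  "numerical_solution \<alpha> \<beta> \<epsilon> \<eta> \<xi> \<delta> \<M> T L K dt \<Phi>0 \<Psi>0 \<phi> \<rho> \<longleftrightarrow>
     (let N = 2 * K + 1; h = L / real N in
        \<phi> 0 = grid_interp h (fourier_proj L K \<Phi>0) \<and>
        \<rho> 0 = grid_interp h (fourier_proj L K \<Psi>0) \<and>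
        (\<forall>m. real (Suc m) * dt \<le> T \<longrightarrow>
           scheme_step \<alpha> \<beta> \<epsilon> \<eta> \<xi> \<delta> \<M> h N dt (\<phi> m) (\<rho> m) (\<phi> (Suc m)) (\<rho> (Suc m))))"

definition grid_error ::
  "real \<Rightarrow> nat \<Rightarrow> real \<Rightarrow> (real \<Rightarrow> real \<times> real \<Rightarrow> real) \<Rightarrow> (nat \<Rightarrow> grid_fun) \<Rightarrow> nat \<Rightarrow> grid_fun" where
  "grid_error L K dt U u m i j =
     grid_interp (L / real (2 * K + 1)) (fourier_proj L K (U (real m * dt))) i j - u m i j"

end

(* The scheme is compared with reference grid functions: the sampled exact solution, shifted by a
   constant of size O(h^5) for phi and contracted towards its mean by O(h^3) for rho, so that the grid
   means are exactly the conserved masses and rho stays inside (0, 1). The defect is paired with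
   (-Delta_h)^(-1) v, so that only the chemical potentials themselves, at one good time of each step,
   are compared with the discrete ones; central differences cost O(h^2), and the time difference costs
   an integral of the second time derivative over the step, whose squares sum up to O(dt^2).
   Testing the error equations with the errors, the implicit part of the potentials is monotone and
   the explicit part is absorbed by interpolation between the H^(-1) and the gradient norms, so that a
   discrete Gronwall inequality applies. The reference functions differ from the Fourier projections by
   O(h^4) and O(h^3) in the maximum norm, which inverse estimates turn into O(h^2) in all norms used. *)
theory Submission
  imports Defs
begin

subsection \<open>Summation by parts on the periodic grid\<close>

text \<open>Two obstacles shape the proof. The equation and the spatial regularity hold only at
  almost every time, and the second time derivative is a weak one, square integrable in time. Hence
  no Fourier projection is ever differentiated in time: the equation is used at good times strictly
  inside a step, values at other times are reached by density and Lipschitz continuity, and weak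
  derivatives enter through smooth test functions, pointwise in space. Secondly, nothing keeps the
  numerical density uniformly away from 0 and 1. Its logarithm is therefore never estimated;
  monotonicity gives the logarithmic terms a sign, and bounds for logarithms are needed only for the
  exact solution and its reference. The coupling of gradient and density is the one implicit term
  that is not monotone; the stabilising terms of the splitting, together with the quadratic terms of
  the energy, pay for it. Smallness of the time step is required by Gronwall alone, with a constant
  that depends on the parameters but not on the exact solution, so the threshold can be fixed before
  the solution is.\<close>

lemma sum_shift_periodic:
  fixes g :: "int \<Rightarrow> real"
  assumes "\<And>i. g (i + int N) = g i"
  shows "(\<Sum>i\<in>{1..int N}. g (i + 1)) = (\<Sum>i\<in>{1..int N}. g i)"
proof (cases "N = 0")
  case False
  have "(\<Sum>i\<in>{1..int N}. g (i + 1)) = (\<Sum>i\<in>{2..int N + 1}. g i)"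
    by (rule sum.reindex_bij_witness[where i = "\<lambda>i. i - 1" and j = "\<lambda>i. i + 1"]) auto
  also have "\<dots> = g (int N + 1) + (\<Sum>i\<in>{2..int N}. g i)"
  proof -
    have "{2..int N + 1} = insert (int N + 1) {2..int N}" using False by auto
    then show ?thesis by simp
  qed
  also have "g (int N + 1) = g 1" using assms[of 1] by (simp add: add.commute)
  also have "g 1 + (\<Sum>i\<in>{2..int N}. g i) = (\<Sum>i\<in>{1..int N}. g i)"
  proof -
    have "{1..int N} = insert 1 {2..int N}" using False by auto
    then show ?thesis by simp
  qed
  finally show ?thesis .
qed simp

lemma grid_per_x: "grid_per N f \<Longrightarrow> f (i + int N) j = f i j"
  and grid_per_y: "grid_per N f \<Longrightarrow> f i (j + int N) = f i j"
  by (auto simp: grid_per_def)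

text \<open>Difference operators evaluated one period later produce indices of the form
  \<open>i + int N + k\<close>. These variants let simplification remove the period in front of the
  offset, so that periodicity of composed operators needs no index arithmetic.\<close>

lemma grid_per_x_shift: "grid_per N f \<Longrightarrow> f (i + int N + k) j = f (i + k) j"
  and grid_per_y_shift: "grid_per N f \<Longrightarrow> f i (j + int N + k) = f i (j + k)"
  and grid_per_x_shift': "grid_per N f \<Longrightarrow> f (i + int N - k) j = f (i - k) j"
  and grid_per_y_shift': "grid_per N f \<Longrightarrow> f i (j + int N - k) = f i (j - k)"
proof -
  have *: "a + int N + k = (a + k) + int N" "a + int N - k = (a - k) + int N" for a by auto
  show "grid_per N f \<Longrightarrow> f (i + int N + k) j = f (i + k) j"
    "grid_per N f \<Longrightarrow> f i (j + int N + k) = f i (j + k)"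
    "grid_per N f \<Longrightarrow> f (i + int N - k) j = f (i - k) j"
    "grid_per N f \<Longrightarrow> f i (j + int N - k) = f i (j - k)"
    unfolding * by (auto simp: grid_per_def)
qed

lemmas grid_per_simps =
  grid_per_x grid_per_y grid_per_x_shift grid_per_y_shift grid_per_x_shift' grid_per_y_shift'

lemma grid_per_const [simp]: "grid_per N (\<lambda>i j. c)"
  by (simp add: grid_per_def)

lemma grid_per_add: "grid_per N f \<Longrightarrow> grid_per N g \<Longrightarrow> grid_per N (\<lambda>i j. f i j + g i j)"
  and grid_per_diff: "grid_per N f \<Longrightarrow> grid_per N g \<Longrightarrow> grid_per N (\<lambda>i j. f i j - g i j)"
  and grid_per_mult: "grid_per N f \<Longrightarrow> grid_per N g \<Longrightarrow> grid_per N (\<lambda>i j. f i j * g i j)"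
  and grid_per_scale: "grid_per N f \<Longrightarrow> grid_per N (\<lambda>i j. c * f i j)"
  and grid_per_shift_x: "grid_per N f \<Longrightarrow> grid_per N (\<lambda>i j. f (i + k) j)"
  and grid_per_shift_y: "grid_per N f \<Longrightarrow> grid_per N (\<lambda>i j. f i (j + k))"
  by (auto simp: grid_per_def grid_per_x_shift grid_per_y_shift)

lemma grid_per_Dx: "grid_per N f \<Longrightarrow> grid_per N (Dx h f)"
  and grid_per_Dy: "grid_per N f \<Longrightarrow> grid_per N (Dy h f)"
  unfolding grid_per_def[of N "Dx h f"] grid_per_def[of N "Dy h f"] Dx_def Dy_def
  by (simp_all add: grid_per_simps)

lemma grid_per_div: "grid_per N (fst F) \<Longrightarrow> grid_per N (snd F) \<Longrightarrow> grid_per N (div_h h F)"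
  unfolding grid_per_def[of N "div_h h F"] div_h_def by (simp add: grid_per_simps)

lemma grid_per_lap: "grid_per N f \<Longrightarrow> grid_per N (lap_h h f)"
  unfolding lap_h_def grad_h_def by (intro grid_per_div) (simp_all add: grid_per_Dx grid_per_Dy)

lemma gsum_shift_x:
  assumes "grid_per N f"
  shows "(\<Sum>i\<in>{1..int N}. \<Sum>j\<in>{1..int N}. f (i + 1) j) = (\<Sum>i\<in>{1..int N}. \<Sum>j\<in>{1..int N}. f i j)"
  using sum_shift_periodic[of "\<lambda>i. \<Sum>j\<in>{1..int N}. f i j" N] assms by (simp add: grid_per_x)

lemma gsum_shift_y:
  assumes "grid_per N f"
  shows "(\<Sum>i\<in>{1..int N}. \<Sum>j\<in>{1..int N}. f i (j + 1)) = (\<Sum>i\<in>{1..int N}. \<Sum>j\<in>{1..int N}. f i j)"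
  using sum_shift_periodic[of "f _" N] assms by (simp add: grid_per_y)

section \<open>Bilinearity of the discrete inner products\<close>

lemma grid_inner_add_left: "grid_inner h N (\<lambda>i j. f i j + g i j) v = grid_inner h N f v + grid_inner h N g v"
  and grid_inner_diff_left: "grid_inner h N (\<lambda>i j. f i j - g i j) v = grid_inner h N f v - grid_inner h N g v"
  and grid_inner_add_right: "grid_inner h N v (\<lambda>i j. f i j + g i j) = grid_inner h N v f + grid_inner h N v g"
  and grid_inner_diff_right: "grid_inner h N v (\<lambda>i j. f i j - g i j) = grid_inner h N v f - grid_inner h N v g"
  and grid_inner_scale_left: "grid_inner h N (\<lambda>i j. c * f i j) v = c * grid_inner h N f v"
  and grid_inner_scale_right: "grid_inner h N v (\<lambda>i j. c * f i j) = c * grid_inner h N v f"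
  and grid_inner_minus_left: "grid_inner h N (\<lambda>i j. - f i j) v = - grid_inner h N f v"
  and grid_inner_minus_right: "grid_inner h N v (\<lambda>i j. - f i j) = - grid_inner h N v f"
  by (simp_all add: grid_inner_def algebra_simps sum.distrib sum_subtractf sum_distrib_left sum_negf)

lemma grid_inner_commute: "grid_inner h N f g = grid_inner h N g f"
  by (simp add: grid_inner_def mult.commute)

lemma grid_inner_self_nonneg: "0 \<le> grid_inner h N f f"
  by (simp add: grid_inner_def sum_nonneg)

lemma grid_inner_cong:
  "(\<And>i j. f i j = f' i j) \<Longrightarrow> (\<And>i j. g i j = g' i j) \<Longrightarrow> grid_inner h N f g = grid_inner h N f' g'"
  by (simp add: grid_inner_def)

lemma grid_inner_mono:
  "(\<And>i j. f i j * g i j \<le> f' i j * g' i j) \<Longrightarrow> grid_inner h N f g \<le> grid_inner h N f' g'"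
  unfolding grid_inner_def by (intro mult_left_mono sum_mono) auto

lemma grid_inner_shift_x:
  "grid_per N f \<Longrightarrow> grid_per N g \<Longrightarrow>
    grid_inner h N (\<lambda>i j. f (i + 1) j) (\<lambda>i j. g (i + 1) j) = grid_inner h N f g"
  unfolding grid_inner_def using gsum_shift_x[of N "\<lambda>i j. f i j * g i j"] by (simp add: grid_per_mult)

lemma grid_inner_shift_y:
  "grid_per N f \<Longrightarrow> grid_per N g \<Longrightarrow>
    grid_inner h N (\<lambda>i j. f i (j + 1)) (\<lambda>i j. g i (j + 1)) = grid_inner h N f g"
  unfolding grid_inner_def using gsum_shift_y[of N "\<lambda>i j. f i j * g i j"] by (simp add: grid_per_mult)

text \<open>Shifting both factors by one leaves the inner product unchanged, so a backward shift of
  one factor is a forward shift of the other. Summation by parts rests on nothing else.\<close>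

lemma grid_inner_backshift_x:
  assumes "grid_per N f" "grid_per N g"
  shows "grid_inner h N (\<lambda>i j. f (i - 1) j) g = grid_inner h N f (\<lambda>i j. g (i + 1) j)"
  using grid_inner_shift_x[of N "\<lambda>i j. f (i - 1) j" g h] assms
    grid_per_shift_x[of N f "-1"] by simp

lemma grid_inner_backshift_y:
  assumes "grid_per N f" "grid_per N g"
  shows "grid_inner h N (\<lambda>i j. f i (j - 1)) g = grid_inner h N f (\<lambda>i j. g i (j + 1))"
  using grid_inner_shift_y[of N "\<lambda>i j. f i (j - 1)" g h] assms
    grid_per_shift_y[of N f "-1"] by simp

text \<open>The discrete Gauss theorem: the backward differences inside \<open>div_h\<close> become
  forward differences of \<open>v\<close> when the shifts are moved over, and periodicity leaves no
  boundary terms.\<close>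

lemma grid_inner_div:
  assumes "grid_per N (fst F)" "grid_per N (snd F)" "grid_per N v"
  shows "grid_inner h N (div_h h F) v =
    - (grid_inner h N (fst F) (Dx h v) + grid_inner h N (snd F) (Dy h v))"
proof -
  have 1: "grid_inner h N (div_h h F) v =
     (grid_inner h N (fst F) v - grid_inner h N (\<lambda>i j. fst F (i - 1) j) v) / h +
     (grid_inner h N (snd F) v - grid_inner h N (\<lambda>i j. snd F i (j - 1)) v) / h"
    by (simp add: grid_inner_def div_h_def diff_divide_distrib add_divide_distrib algebra_simps
        sum.distrib sum_subtractf sum_distrib_left sum_divide_distrib)
  have 2: "grid_inner h N G (Dx h v) = (grid_inner h N G (\<lambda>i j. v (i + 1) j) - grid_inner h N G v) / h"
    "grid_inner h N G (Dy h v) = (grid_inner h N G (\<lambda>i j. v i (j + 1)) - grid_inner h N G v) / h" for G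
    by (simp_all add: grid_inner_def Dx_def Dy_def diff_divide_distrib add_divide_distrib algebra_simps
        sum.distrib sum_subtractf sum_distrib_left sum_divide_distrib)
  show ?thesis
    unfolding 1 2 using assms
    by (simp add: grid_inner_backshift_x grid_inner_backshift_y diff_divide_distrib)
qed

text \<open>The polar form of the square of \<open>grad_norm2\<close>, so that the energy of a
  difference can be expanded bilinearly.\<close>

definition grad_inner :: "real \<Rightarrow> nat \<Rightarrow> grid_fun \<Rightarrow> grid_fun \<Rightarrow> real" where
  "grad_inner h N u v = grid_inner h N (Dx h u) (Dx h v) + grid_inner h N (Dy h u) (Dy h v)"

lemma grid_inner_lap:
  "grid_per N u \<Longrightarrow> grid_per N v \<Longrightarrow> grid_inner h N (lap_h h u) v = - grad_inner h N u v"
  unfolding lap_h_def grad_inner_def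
  by (subst grid_inner_div) (simp_all add: grad_h_def grid_per_Dx grid_per_Dy)

lemma grad_inner_commute: "grad_inner h N u v = grad_inner h N v u"
  by (simp add: grad_inner_def grid_inner_commute)

lemma grad_inner_self_nonneg: "0 \<le> grad_inner h N f f"
  by (simp add: grad_inner_def grid_inner_self_nonneg)

lemma grid_inner_lap_swap:
  "grid_per N u \<Longrightarrow> grid_per N v \<Longrightarrow> grid_inner h N (lap_h h u) v = grid_inner h N u (lap_h h v)"
  by (metis grid_inner_lap grid_inner_commute grad_inner_commute)

lemma grid_norm2_sq: "(grid_norm2 h N f)\<^sup>2 = grid_inner h N f f"
  by (simp add: grid_norm2_def grid_inner_self_nonneg)

lemma grad_norm2_eq: "grad_norm2 h N f = sqrt (grad_inner h N f f)"
  by (simp add: grad_norm2_def grad_inner_def grid_inner_def power2_eq_square sum.distrib distrib_left)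

lemma grad_norm2_sq: "(grad_norm2 h N f)\<^sup>2 = grad_inner h N f f"
  by (simp add: grad_norm2_eq grad_inner_self_nonneg)

lemma grid_norm2_nonneg: "0 \<le> grid_norm2 h N f"
  by (simp add: grid_norm2_def grid_inner_self_nonneg)

lemma grad_norm2_nonneg: "0 \<le> grad_norm2 h N f"
  by (simp add: grad_norm2_eq grad_inner_self_nonneg)

lemma Dx_add: "Dx h (\<lambda>i j. f i j + g i j) = (\<lambda>i j. Dx h f i j + Dx h g i j)"
  and Dy_add: "Dy h (\<lambda>i j. f i j + g i j) = (\<lambda>i j. Dy h f i j + Dy h g i j)"
  and Dx_diff: "Dx h (\<lambda>i j. f i j - g i j) = (\<lambda>i j. Dx h f i j - Dx h g i j)"
  and Dy_diff: "Dy h (\<lambda>i j. f i j - g i j) = (\<lambda>i j. Dy h f i j - Dy h g i j)"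
  and Dx_scale: "Dx h (\<lambda>i j. c * f i j) = (\<lambda>i j. c * Dx h f i j)"
  and Dy_scale: "Dy h (\<lambda>i j. c * f i j) = (\<lambda>i j. c * Dy h f i j)"
  by (simp_all add: Dx_def Dy_def fun_eq_iff algebra_simps diff_divide_distrib add_divide_distrib)

lemma lap_h_add: "lap_h h (\<lambda>i j. f i j + g i j) = (\<lambda>i j. lap_h h f i j + lap_h h g i j)"
  and lap_h_diff: "lap_h h (\<lambda>i j. f i j - g i j) = (\<lambda>i j. lap_h h f i j - lap_h h g i j)"
  and lap_h_scale: "lap_h h (\<lambda>i j. c * f i j) = (\<lambda>i j. c * lap_h h f i j)"
  and lap_h_const: "lap_h h (\<lambda>i j. c) = (\<lambda>i j. 0)"
  by (simp_all add: lap_h_def grad_h_def div_h_def Dx_def Dy_def fun_eq_iff algebra_simps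
      diff_divide_distrib add_divide_distrib)

lemma lap_h_explicit:
  "lap_h h f i j = (f (i + 1) j - 2 * f i j + f (i - 1) j) / h\<^sup>2 + (f i (j + 1) - 2 * f i j + f i (j - 1)) / h\<^sup>2"
  by (simp add: lap_h_def grad_h_def div_h_def Dx_def Dy_def power2_eq_square diff_divide_distrib
      add_divide_distrib)

lemma grad_inner_add_left: "grad_inner h N (\<lambda>i j. f i j + g i j) v = grad_inner h N f v + grad_inner h N g v"
  and grad_inner_diff_left: "grad_inner h N (\<lambda>i j. f i j - g i j) v = grad_inner h N f v - grad_inner h N g v"
  and grad_inner_diff_right: "grad_inner h N v (\<lambda>i j. f i j - g i j) = grad_inner h N v f - grad_inner h N v g"
  and grad_inner_add_right: "grad_inner h N v (\<lambda>i j. f i j + g i j) = grad_inner h N v f + grad_inner h N v g"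
  and grad_inner_scale_left: "grad_inner h N (\<lambda>i j. c * f i j) v = c * grad_inner h N f v"
  and grad_inner_scale_right: "grad_inner h N v (\<lambda>i j. c * f i j) = c * grad_inner h N v f"
  by (simp_all add: grad_inner_def Dx_add Dy_add Dx_diff Dy_diff Dx_scale Dy_scale grid_inner_add_left
      grid_inner_diff_left grid_inner_add_right grid_inner_diff_right grid_inner_scale_left
      grid_inner_scale_right algebra_simps)

text \<open>A quadratic polynomial in \<open>t\<close> that is nowhere negative has no positive
  discriminant. Isolating this makes Cauchy-Schwarz available for every semi-inner product that
  occurs: on cells, on gradients, and in time.\<close>

lemma discriminant_bound:
  fixes a b c :: real
  assumes "\<And>t. 0 \<le> a + 2 * t * b + t\<^sup>2 * c" "0 \<le> a" "0 \<le> c"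
  shows "\<bar>b\<bar> \<le> sqrt a * sqrt c"
proof -
  have "b\<^sup>2 \<le> a * c"
  proof (cases "c = 0")
    case True
    have "b = 0"
    proof (rule ccontr)
      assume "b \<noteq> 0"
      \<comment> \<open>With \<open>c = 0\<close> the polynomial is affine, and this argument would
        give it the value -1.\<close>
      have "0 \<le> a + 2 * (- (a + 1) / (2 * b)) * b" using assms(1)[of "- (a + 1) / (2 * b)"] True by simp
      also have "\<dots> = -1" using \<open>b \<noteq> 0\<close> by (simp add: field_simps)
      finally show False by simp
    qed
    then show ?thesis using True by simp
  next
    case False
    then have "c > 0" using assms by simp
    \<comment> \<open>The minimiser of the polynomial.\<close>
    have "0 \<le> a + 2 * (- b / c) * b + (- b / c)\<^sup>2 * c" by (rule assms(1))
    also have "\<dots> = a - b\<^sup>2 / c" using \<open>c > 0\<close> by (simp add: field_simps power2_eq_square)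
    finally show ?thesis using \<open>c > 0\<close> by (simp add: field_simps)
  qed
  then have "sqrt (b\<^sup>2) \<le> sqrt (a * c)" by (rule real_sqrt_le_mono)
  then show ?thesis by (simp add: real_sqrt_mult)
qed

lemma grid_inner_Cauchy: "\<bar>grid_inner h N f g\<bar> \<le> grid_norm2 h N f * grid_norm2 h N g"
proof -
  have "0 \<le> grid_inner h N f f + 2 * t * grid_inner h N f g + t\<^sup>2 * grid_inner h N g g" for t
  proof -
    have "0 \<le> grid_inner h N (\<lambda>i j. f i j + t * g i j) (\<lambda>i j. f i j + t * g i j)"
      by (rule grid_inner_self_nonneg)
    also have "\<dots> = grid_inner h N f f + 2 * t * grid_inner h N f g + t\<^sup>2 * grid_inner h N g g"
      by (simp add: grid_inner_add_left grid_inner_add_right grid_inner_scale_left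
          grid_inner_scale_right grid_inner_commute[of h N g f] power2_eq_square algebra_simps)
    finally show ?thesis .
  qed
  then show ?thesis unfolding grid_norm2_def
    by (rule discriminant_bound) (simp_all add: grid_inner_self_nonneg)
qed

lemma grad_inner_Cauchy: "\<bar>grad_inner h N f g\<bar> \<le> grad_norm2 h N f * grad_norm2 h N g"
proof -
  have "0 \<le> grad_inner h N f f + 2 * t * grad_inner h N f g + t\<^sup>2 * grad_inner h N g g" for t
  proof -
    have "0 \<le> grad_inner h N (\<lambda>i j. f i j + t * g i j) (\<lambda>i j. f i j + t * g i j)"
      by (rule grad_inner_self_nonneg)
    also have "\<dots> = grad_inner h N f f + 2 * t * grad_inner h N f g + t\<^sup>2 * grad_inner h N g g"
      by (simp add: grad_inner_add_left grad_inner_add_right grad_inner_scale_left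
          grad_inner_scale_right grad_inner_commute[of h N g f] power2_eq_square algebra_simps)
    finally show ?thesis .
  qed
  then show ?thesis unfolding grad_norm2_eq
    by (rule discriminant_bound) (simp_all add: grad_inner_self_nonneg)
qed

subsection \<open>The discrete Poincar\'e inequality\<close>

text \<open>Telescoping along one grid line, then Cauchy-Schwarz over the increments; the sum is
  enlarged to the whole period so that the bound is the same for every pair of points.\<close>

lemma sq_diff_le_sum_diffs:
  fixes g :: "int \<Rightarrow> real"
  assumes "a \<in> {1..int N}" "b \<in> {1..int N}"
  shows "(g a - g b)\<^sup>2 \<le> real N * (\<Sum>i\<in>{1..int N}. (g (i + 1) - g i)\<^sup>2)"
proof -
  have tele: "g (c + int n) - g c = (\<Sum>i\<in>{c..<c + int n}. g (i + 1) - g i)" for c n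
  proof (induction n)
    case (Suc n)
    have "{c..<c + int (Suc n)} = insert (c + int n) {c..<c + int n}" by auto
    then show ?case using Suc by (simp add: algebra_simps)
  qed simp
  have main: "(g a - g b)\<^sup>2 \<le> real N * (\<Sum>i\<in>{1..int N}. (g (i + 1) - g i)\<^sup>2)"
    if "a \<in> {1..int N}" "b \<in> {1..int N}" "b \<le> a" for a b
  proof -
    obtain n where n: "a = b + int n" using \<open>b \<le> a\<close> zle_iff_zadd by auto
    have sub: "{b..<a} \<subseteq> {1..int N}" using that by auto
    have "\<bar>g a - g b\<bar> = \<bar>\<Sum>i\<in>{b..<a}. g (i + 1) - g i\<bar>" using tele[of b n] n by simp
    also have "\<dots> \<le> (\<Sum>i\<in>{b..<a}. \<bar>g (i + 1) - g i\<bar>)" by (rule sum_abs)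
    also have "\<dots> \<le> (\<Sum>i\<in>{1..int N}. \<bar>g (i + 1) - g i\<bar>)" by (rule sum_mono2) (use sub in auto)
    finally have "\<bar>g a - g b\<bar>\<^sup>2 \<le> (\<Sum>i\<in>{1..int N}. \<bar>g (i + 1) - g i\<bar> * 1)\<^sup>2"
      by (intro power_mono) auto
    also have "\<dots> \<le> (\<Sum>i\<in>{1..int N}. \<bar>g (i + 1) - g i\<bar>\<^sup>2) * (\<Sum>i\<in>{1..int N}. 1\<^sup>2)"
      by (rule Cauchy_Schwarz_ineq_sum)
    finally show ?thesis by (simp add: mult.commute)
  qed
  show ?thesis
  proof (cases "b \<le> a")
    case True
    then show ?thesis using main assms by blast
  next
    case False
    then show ?thesis using main[of b a] assms by (simp add: power2_commute)
  qed
qed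

text \<open>For mean zero, the sum of \<open>(f i j - f k l)^2\<close> over all pairs of cells is
  \<open>2 * N^2\<close> times the sum of the squares. Each difference is split at the corner cell
  \<open>(k, j)\<close> into a path in the first index and one in the second. The constant
  \<open>N * h\<close> is the side length of the square.\<close>

lemma Poincare_grid:
  assumes "mean_zero N f" "h > 0"
  shows "grid_norm2 h N f \<le> real N * h * grad_norm2 h N f"
proof (cases "N = 0")
  case True
  then show ?thesis by (simp add: grid_norm2_def grid_inner_def)
next
  case False
  let ?I = "{1..int N}"
  define S where "S = (\<Sum>i\<in>?I. \<Sum>j\<in>?I. (f i j)\<^sup>2)"
  define X where "X = (\<Sum>i\<in>?I. \<Sum>j\<in>?I. (Dx h f i j)\<^sup>2)"
  define Y where "Y = (\<Sum>i\<in>?I. \<Sum>j\<in>?I. (Dy h f i j)\<^sup>2)"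
  have z: "(\<Sum>i\<in>?I. \<Sum>j\<in>?I. f i j) = 0" using assms by (simp add: mean_zero_def)
  have "(\<Sum>i\<in>?I. \<Sum>j\<in>?I. \<Sum>k\<in>?I. \<Sum>l\<in>?I. (f i j - f k l)\<^sup>2) =
      (\<Sum>i\<in>?I. \<Sum>j\<in>?I. real N ^ 2 * (f i j)\<^sup>2 + S - 2 * f i j * (\<Sum>k\<in>?I. \<Sum>l\<in>?I. f k l))"
    by (simp add: S_def power2_diff sum.distrib sum_subtractf sum_distrib_left mult.assoc power2_eq_square[of "real N"])
  also have "\<dots> = 2 * real N ^ 2 * S"
    unfolding z by (simp add: sum.distrib sum_distrib_left[symmetric] S_def power2_eq_square)
  finally have L: "(\<Sum>i\<in>?I. \<Sum>j\<in>?I. \<Sum>k\<in>?I. \<Sum>l\<in>?I. (f i j - f k l)\<^sup>2) = 2 * real N ^ 2 * S" .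
  have R: "(f i j - f k l)\<^sup>2 \<le> 2 * (real N * h\<^sup>2 * (\<Sum>a\<in>?I. (Dx h f a j)\<^sup>2)) +
        2 * (real N * h\<^sup>2 * (\<Sum>a\<in>?I. (Dy h f k a)\<^sup>2))"
    if "i \<in> ?I" "j \<in> ?I" "k \<in> ?I" "l \<in> ?I" for i j k l
  proof -
    have "(f i j - f k l)\<^sup>2 \<le> 2 * (f i j - f k j)\<^sup>2 + 2 * (f k j - f k l)\<^sup>2"
      using sum_squares_bound[of "f i j - f k j" "f k j - f k l"] by (simp add: power2_eq_square algebra_simps)
    moreover have "(f i j - f k j)\<^sup>2 \<le> real N * (\<Sum>a\<in>?I. (f (a + 1) j - f a j)\<^sup>2)"
      by (rule sq_diff_le_sum_diffs[of i N k "\<lambda>i. f i j"]) (use that in auto)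
    moreover have "(f k j - f k l)\<^sup>2 \<le> real N * (\<Sum>a\<in>?I. (f k (a + 1) - f k a)\<^sup>2)"
      by (rule sq_diff_le_sum_diffs) (use that in auto)
    moreover have "(f (a + 1) j - f a j)\<^sup>2 = h\<^sup>2 * (Dx h f a j)\<^sup>2" "(f k (a + 1) - f k a)\<^sup>2 = h\<^sup>2 * (Dy h f k a)\<^sup>2" for a
      using assms by (simp_all add: Dx_def Dy_def power_divide)
    ultimately show ?thesis by (simp add: sum_distrib_left[symmetric] mult.assoc)
  qed
  have "(\<Sum>i\<in>?I. \<Sum>j\<in>?I. \<Sum>k\<in>?I. \<Sum>l\<in>?I. (f i j - f k l)\<^sup>2) \<le>
     (\<Sum>i\<in>?I. \<Sum>j\<in>?I. \<Sum>k\<in>?I. \<Sum>l\<in>?I. 2 * (real N * h\<^sup>2 * (\<Sum>a\<in>?I. (Dx h f a j)\<^sup>2)) +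
        2 * (real N * h\<^sup>2 * (\<Sum>a\<in>?I. (Dy h f k a)\<^sup>2)))"
    by (intro sum_mono R)
  also have "\<dots> = 2 * real N ^ 4 * h\<^sup>2 * (X + Y)"
  proof -
    have "(\<Sum>j\<in>?I. \<Sum>a\<in>?I. (Dx h f a j)\<^sup>2) = X" unfolding X_def by (rule sum.swap)
    then show ?thesis
      by (simp add: sum.distrib sum_distrib_left[symmetric] Y_def algebra_simps eval_nat_numeral)
  qed
  finally have "2 * real N ^ 2 * S \<le> 2 * real N ^ 4 * h\<^sup>2 * (X + Y)" unfolding L .
  then have "(2 * real N ^ 2) * S \<le> (2 * real N ^ 2) * ((real N * h)\<^sup>2 * (X + Y))"
    by (simp add: algebra_simps eval_nat_numeral)
  then have "S \<le> (real N * h)\<^sup>2 * (X + Y)" using False by simp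
  then have "h\<^sup>2 * S \<le> (real N * h)\<^sup>2 * (h\<^sup>2 * (X + Y))"
    using mult_left_mono[of S "(real N * h)\<^sup>2 * (X + Y)" "h\<^sup>2"] by (simp add: algebra_simps)
  moreover have "grid_norm2 h N f = sqrt (h\<^sup>2 * S)"
    by (simp add: grid_norm2_def grid_inner_def S_def power2_eq_square)
  moreover have "grad_norm2 h N f = sqrt (h\<^sup>2 * (X + Y))"
    by (simp add: grad_norm2_def X_def Y_def sum.distrib)
  ultimately show ?thesis
    using assms real_sqrt_le_mono[of "h\<^sup>2 * S" "(real N * h)\<^sup>2 * (h\<^sup>2 * (X + Y))"]
    by (simp add: real_sqrt_mult)
qed

subsection \<open>The inverse of the discrete Laplacian\<close>

lemma grid_inner_const_left: "grid_inner h N (\<lambda>i j. c) f = c * h\<^sup>2 * (\<Sum>i\<in>{1..int N}. \<Sum>j\<in>{1..int N}. f i j)"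
  by (simp add: grid_inner_def sum_distrib_left mult_ac)

lemma grid_inner_const_mean_zero: "mean_zero N f \<Longrightarrow> grid_inner h N (\<lambda>i j. c) f = 0"
  by (simp add: grid_inner_const_left mean_zero_def)

lemma grad_inner_const_left: "grad_inner h N (\<lambda>i j. c) f = 0"
  by (simp add: grad_inner_def Dx_def Dy_def grid_inner_def)

lemma mean_zero_iff: "h \<noteq> 0 \<Longrightarrow> mean_zero N f \<longleftrightarrow> grid_inner h N (\<lambda>i j. 1) f = 0"
  by (simp add: mean_zero_def grid_inner_const_left)

lemma mean_zero_lap:
  assumes "grid_per N f" "h \<noteq> 0"
  shows "mean_zero N (lap_h h f)"
  using assms grid_inner_lap[of N f "\<lambda>i j. 1" h]
  by (simp add: mean_zero_iff[OF assms(2)] grid_inner_commute grad_inner_commute[of h N f] grad_inner_const_left)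

lemma mean_zero_add: "mean_zero N f \<Longrightarrow> mean_zero N g \<Longrightarrow> mean_zero N (\<lambda>i j. f i j + g i j)"
  and mean_zero_diff: "mean_zero N f \<Longrightarrow> mean_zero N g \<Longrightarrow> mean_zero N (\<lambda>i j. f i j - g i j)"
  and mean_zero_scale: "mean_zero N f \<Longrightarrow> mean_zero N (\<lambda>i j. c * f i j)"
  by (simp_all add: mean_zero_def sum.distrib sum_subtractf sum_distrib_left[symmetric])

lemma grid_per_mod:
  assumes "grid_per N f"
  shows "f i j = f (1 + (i - 1) mod int N) (1 + (j - 1) mod int N)"
proof -
  have x: "f (a + int n * int N) b = f a b" for n a b
  proof (induction n)
    case (Suc n)
    have "f (a + int n * int N + int N) b = f (a + int n * int N) b" by (rule grid_per_x[OF assms])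
    then show ?case using Suc by (simp add: algebra_simps)
  qed simp
  have y: "f a (b + int n * int N) = f a b" for n a b
  proof (induction n)
    case (Suc n)
    have "f a (b + int n * int N + int N) = f a (b + int n * int N)" by (rule grid_per_y[OF assms])
    then show ?case using Suc by (simp add: algebra_simps)
  qed simp
  have x': "f (a + k * int N) b = f a b" for k a b
    using x[of a "nat k" b] x[of "a + k * int N" "nat (- k)" b] by (cases "k \<ge> 0") auto
  have y': "f a (b + k * int N) = f a b" for k a b
    using y[of a b "nat k"] y[of a "b + k * int N" "nat (- k)"] by (cases "k \<ge> 0") auto
  have "i = 1 + (i - 1) mod int N + ((i - 1) div int N) * int N"
    "j = 1 + (j - 1) mod int N + ((j - 1) div int N) * int N" by simp_all
  then show ?thesis using x' y' by metis
qed

lemma grid_point_le_norm: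
  assumes "grid_per N f" "N > 0" "h > 0"
  shows "h\<^sup>2 * (f i j)\<^sup>2 \<le> grid_inner h N f f"
proof -
  let ?a = "1 + (i - 1) mod int N" and ?b = "1 + (j - 1) mod int N"
  have "(i - 1) mod int N < int N" "(j - 1) mod int N < int N" "0 \<le> (i - 1) mod int N" "0 \<le> (j - 1) mod int N"
    using assms(2) by simp_all
  then have ab: "?a \<in> {1..int N}" "?b \<in> {1..int N}"
    unfolding atLeastAtMost_iff by linarith+
  have "(f i j)\<^sup>2 = f ?a ?b * f ?a ?b"
    using grid_per_mod[OF assms(1), of i j] by (simp add: power2_eq_square)
  also have "\<dots> \<le> (\<Sum>j\<in>{1..int N}. f ?a j * f ?a j)"
    by (rule member_le_sum) (use ab in auto)
  also have "\<dots> \<le> (\<Sum>i\<in>{1..int N}. \<Sum>j\<in>{1..int N}. f i j * f i j)"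
    by (rule member_le_sum[where f = "\<lambda>i. \<Sum>j\<in>{1..int N}. f i j * f i j"]) (use ab in \<open>auto intro: sum_nonneg\<close>)
  finally show ?thesis unfolding grid_inner_def by (intro mult_left_mono) auto
qed

lemma grid_norm_zero:
  assumes "grid_per N f" "N > 0" "h > 0" "grid_inner h N f f \<le> 0"
  shows "f i j = 0"
proof -
  have "h\<^sup>2 * (f i j)\<^sup>2 \<le> 0" using grid_point_le_norm[OF assms(1-3), of i j] assms(4) by simp
  then show ?thesis using assms(3) by (auto simp: mult_le_0_iff)
qed

text \<open>An inverse inequality: \<open>h\<close> times the Laplacian is a signed sum of four edge
  differences, whose square costs a factor 4, and every edge is counted by two cells, hence 8. This
  8 fixes the step size of the iteration that inverts the Laplacian.\<close>

lemma lap_norm_le_grad_norm: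
  assumes "grid_per N f" "h > 0"
  shows "h\<^sup>2 * grid_inner h N (lap_h h f) (lap_h h f) \<le> 8 * grad_inner h N f f"
proof -
  let ?X = "grid_inner h N (Dx h f) (Dx h f)" and ?Y = "grid_inner h N (Dy h f) (Dy h f)"
  let ?X' = "grid_inner h N (\<lambda>i j. Dx h f (i - 1) j) (\<lambda>i j. Dx h f (i - 1) j)"
  let ?Y' = "grid_inner h N (\<lambda>i j. Dy h f i (j - 1)) (\<lambda>i j. Dy h f i (j - 1))"
  have "(h * lap_h h f i j)\<^sup>2 \<le> 4 * ((Dx h f i j)\<^sup>2 + (Dx h f (i - 1) j)\<^sup>2 + (Dy h f i j)\<^sup>2 + (Dy h f i (j - 1))\<^sup>2)" for i j
  proof -
    have *: "(a - b + (c - d))\<^sup>2 \<le> 4 * (a\<^sup>2 + b\<^sup>2 + c\<^sup>2 + d\<^sup>2)" for a b c d :: real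
    proof -
      have "4 * (a\<^sup>2 + b\<^sup>2 + c\<^sup>2 + d\<^sup>2) - (a - b + (c - d))\<^sup>2 =
        (a + b)\<^sup>2 + (a - c)\<^sup>2 + (a + d)\<^sup>2 + (b + c)\<^sup>2 + (b - d)\<^sup>2 + (c + d)\<^sup>2"
        by (simp add: power2_eq_square algebra_simps)
      also have "\<dots> \<ge> 0" by simp
      finally show ?thesis by simp
    qed
    have "h * lap_h h f i j = Dx h f i j - Dx h f (i - 1) j + (Dy h f i j - Dy h f i (j - 1))"
      using assms by (simp add: lap_h_def grad_h_def div_h_def field_simps)
    then show ?thesis using * by simp
  qed
  then have "grid_inner h N (\<lambda>i j. h * lap_h h f i j) (\<lambda>i j. h * lap_h h f i j) \<le>
    h\<^sup>2 * (\<Sum>i\<in>{1..int N}. \<Sum>j\<in>{1..int N}. 4 * ((Dx h f i j)\<^sup>2 + (Dx h f (i - 1) j)\<^sup>2 + (Dy h f i j)\<^sup>2 + (Dy h f i (j - 1))\<^sup>2))"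
    unfolding grid_inner_def by (intro mult_left_mono sum_mono) (auto simp: power2_eq_square)
  also have "\<dots> = 4 * (?X + ?X' + ?Y + ?Y')"
    by (simp add: grid_inner_def power2_eq_square sum.distrib sum_distrib_left[symmetric] algebra_simps)
  also have "?X' = ?X"
    using grid_inner_shift_x[of N "\<lambda>i j. Dx h f (i - 1) j" "\<lambda>i j. Dx h f (i - 1) j" h]
      grid_per_shift_x[OF grid_per_Dx[OF assms(1)], of h "-1"] by simp
  also have "?Y' = ?Y"
    using grid_inner_shift_y[of N "\<lambda>i j. Dy h f i (j - 1)" "\<lambda>i j. Dy h f i (j - 1)" h]
      grid_per_shift_y[OF grid_per_Dy[OF assms(1)], of h "-1"] by simp
  finally show ?thesis
    by (simp add: grid_inner_scale_left grid_inner_scale_right grad_inner_def power2_eq_square)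
qed

text \<open>The difference is discretely harmonic, so its gradient vanishes by summation by parts,
  and Poincare makes a mean-zero function with vanishing gradient vanish.\<close>

lemma inv_lap_unique:
  assumes "grid_per N f" "mean_zero N f" "grid_per N g" "mean_zero N g" "N > 0" "h > 0"
    and "\<And>i j. lap_h h f i j = lap_h h g i j"
  shows "f = g"
proof -
  let ?d = "\<lambda>i j. f i j - g i j"
  have d: "grid_per N ?d" "mean_zero N ?d" using assms by (simp_all add: grid_per_diff mean_zero_diff)
  have "lap_h h ?d = (\<lambda>i j. 0)" using assms(7) by (simp add: lap_h_diff)
  then have "grad_inner h N ?d ?d = 0"
    using grid_inner_lap[OF d(1) d(1), of h] by (simp add: grid_inner_def)
  then have "grid_norm2 h N ?d \<le> 0"
    using Poincare_grid[OF d(2) assms(6)] by (simp add: grad_norm2_eq)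
  then have "grid_inner h N ?d ?d \<le> 0"
    using grid_norm2_sq[of h N ?d] grid_norm2_nonneg[of h N ?d] by simp
  then have "?d i j = 0" for i j using grid_norm_zero[OF d(1) assms(5,6)] by blast
  then show ?thesis by (simp add: fun_eq_iff)
qed

text \<open>The inverse is the Neumann series of the Richardson iteration \<open>I + (h\<^sup>2/8) \<Delta>\<^sub>h\<close>, which the
  Poincar\'e inequality makes a contraction on mean-zero functions.\<close>

lemma inv_lap_exists:
  assumes "grid_per N f" "mean_zero N f" "N > 0" "h > 0"
  shows "\<exists>u. grid_per N u \<and> mean_zero N u \<and> (\<forall>i j. - lap_h h u i j = f i j)"
proof -
  \<comment> \<open>With this step size the quadratic term of the iteration, \<open>s^2\<close>
    times the squared Laplacian, uses up just one of the two copies of \<open>s\<close> times the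
    Dirichlet energy; the other copy gives the contraction.\<close>
  define s where "s = h\<^sup>2 / 8"
  \<comment> \<open>The contraction factor of the squared norm: the Poincare constant turns the
    remaining energy into a fixed fraction of the norm.\<close>
  define q where "q = 1 - s / (real N * h)\<^sup>2"
  define G where "G = (\<lambda>(g :: grid_fun) i j. g i j + s * lap_h h g i j)"
  define d where "d = (\<lambda>k. (G ^^ k) (\<lambda>i j. s * f i j))"
  have s: "s > 0" using assms by (simp add: s_def)
  have "s / (real N * h)\<^sup>2 = 1 / (8 * (real N)\<^sup>2)" using assms by (simp add: s_def power_mult_distrib)
  moreover have "1 \<le> (real N)\<^sup>2" using assms by simp
  moreover have "1 / (8 * (real N)\<^sup>2) \<le> 1 / 8" using calculation(2) by (intro divide_left_mono) (use assms(3) in auto)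
  moreover have "0 < 1 / (8 * (real N)\<^sup>2)" using assms by simp
  ultimately have q: "0 < q" "q < 1" unfolding q_def by linarith+
  have d0: "d 0 = (\<lambda>i j. s * f i j)" by (simp add: d_def)
  have dS: "d (Suc k) = G (d k)" for k by (simp add: d_def)
  have per: "grid_per N (d k)" for k
    by (induction k) (simp_all add: d0 dS G_def grid_per_add grid_per_scale grid_per_lap assms)
  have mean: "mean_zero N (d k)" for k
  proof (induction k)
    case (Suc k)
    have "mean_zero N (lap_h h (d k))" using mean_zero_lap[OF per] assms(4) by simp
    then show ?case unfolding dS G_def by (intro mean_zero_add mean_zero_scale Suc)
  qed (simp add: d0 mean_zero_scale assms)
  have contr: "grid_inner h N (d (Suc k)) (d (Suc k)) \<le> q * grid_inner h N (d k) (d k)" for k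
  proof -
    let ?g = "d k" and ?E = "grad_inner h N (d k) (d k)"
    let ?l = "lap_h h (d k)"
    have 1: "grid_inner h N ?g ?l = - ?E" "grid_inner h N ?l ?g = - ?E"
      by (simp_all add: grid_inner_lap[OF per per] grid_inner_commute[of h N ?g ?l])
    have 2: "grid_inner h N (d (Suc k)) (d (Suc k)) = grid_inner h N ?g ?g - 2 * s * ?E + s * (s * grid_inner h N ?l ?l)"
      unfolding dS G_def grid_inner_add_left grid_inner_add_right grid_inner_scale_left
        grid_inner_scale_right 1 by (simp add: algebra_simps)
    have 3: "s * grid_inner h N ?l ?l \<le> ?E"
      using lap_norm_le_grad_norm[OF per assms(4), of k] by (simp add: s_def)
    have "grid_inner h N ?g ?g \<le> (real N * h)\<^sup>2 * ?E"
    proof -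
      have "(grid_norm2 h N ?g)\<^sup>2 \<le> (real N * h * grad_norm2 h N ?g)\<^sup>2"
        by (intro power_mono Poincare_grid mean assms(4) grid_norm2_nonneg)
      then show ?thesis by (simp add: power_mult_distrib grid_norm2_sq grad_norm2_sq)
    qed
    then have "grid_inner h N ?g ?g / (real N * h)\<^sup>2 \<le> ?E"
      using assms(3,4) by (simp add: field_simps)
    then have "s * (grid_inner h N ?g ?g / (real N * h)\<^sup>2) \<le> s * ?E"
      using s by (intro mult_left_mono) auto
    moreover have "s * (s * grid_inner h N ?l ?l) \<le> s * ?E" using 3 s by (intro mult_left_mono) auto
    moreover have "q * grid_inner h N ?g ?g = grid_inner h N ?g ?g - s * (grid_inner h N ?g ?g / (real N * h)\<^sup>2)"
      by (simp add: q_def algebra_simps)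
    ultimately show ?thesis unfolding 2 by linarith
  qed
  have geo: "grid_inner h N (d k) (d k) \<le> q ^ k * grid_inner h N (d 0) (d 0)" for k
  proof (induction k)
    case (Suc k)
    have "q * grid_inner h N (d k) (d k) \<le> q * (q ^ k * grid_inner h N (d 0) (d 0))"
      using Suc q by (intro mult_left_mono) auto
    then show ?case using contr[of k] by simp
  qed simp
  define B where "B = sqrt (grid_inner h N (d 0) (d 0)) / h"
  have bound: "\<bar>d k i j\<bar> \<le> B * sqrt q ^ k" for k i j
  proof -
    have "(h * \<bar>d k i j\<bar>)\<^sup>2 \<le> q ^ k * grid_inner h N (d 0) (d 0)"
      using grid_point_le_norm[OF per assms(3,4), of k i j] geo[of k] by (simp add: power_mult_distrib)
    then have "h * \<bar>d k i j\<bar> \<le> sqrt (q ^ k * grid_inner h N (d 0) (d 0))"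
      by (rule real_le_rsqrt)
    then have "h * \<bar>d k i j\<bar> \<le> sqrt q ^ k * sqrt (grid_inner h N (d 0) (d 0))"
      by (simp add: real_sqrt_mult real_sqrt_power)
    then show ?thesis using assms(4) by (simp add: B_def field_simps)
  qed
  have summ: "summable (\<lambda>k. d k i j)" for i j
  proof (rule summable_comparison_test)
    show "\<exists>n0. \<forall>n\<ge>n0. norm (d n i j) \<le> B * sqrt q ^ n" using bound by auto
    show "summable (\<lambda>k. B * sqrt q ^ k)" using q by (intro summable_mult summable_geometric) simp
  qed
  define u where "u = (\<lambda>i j. \<Sum>k. d k i j)"
  have "- lap_h h u i j = f i j" for i j
  proof -
    have "(\<lambda>k. lap_h h (d k) i j) sums lap_h h u i j"
      unfolding lap_h_explicit u_def
      by (intro sums_add sums_diff sums_divide sums_mult summable_sums summ)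
    then have 1: "(\<lambda>k. s * lap_h h (d k) i j) sums (s * lap_h h u i j)" by (rule sums_mult)
    \<comment> \<open>Consecutive terms of the series differ by \<open>s\<close> times a Laplacian,
      so the Laplacian of the sum telescopes to minus the first term, which is
      \<open>s * f\<close>.\<close>
    have "(\<lambda>k. d (Suc k) i j - d k i j) sums (0 - d 0 i j)"
      by (rule telescope_sums) (rule summable_LIMSEQ_zero[OF summ])
    then have "(\<lambda>k. s * lap_h h (d k) i j) sums (- d 0 i j)" by (simp add: dS G_def)
    from sums_unique2[OF 1 this] have "s * lap_h h u i j = s * (- f i j)" by (simp add: d0)
    then show ?thesis using s by (simp only: mult_cancel_left) auto
  qed
  moreover have "grid_per N u" using per by (simp add: grid_per_def u_def)
  moreover have "mean_zero N u"
  proof -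
    have "(\<lambda>k. \<Sum>i\<in>{1..int N}. \<Sum>j\<in>{1..int N}. d k i j) sums (\<Sum>i\<in>{1..int N}. \<Sum>j\<in>{1..int N}. u i j)"
      unfolding u_def by (intro sums_sum summable_sums summ)
    moreover have "(\<lambda>k. \<Sum>i\<in>{1..int N}. \<Sum>j\<in>{1..int N}. d k i j) = (\<lambda>k. 0)"
      using mean by (simp add: mean_zero_def)
    ultimately have "(\<lambda>k. 0) sums (\<Sum>i\<in>{1..int N}. \<Sum>j\<in>{1..int N}. u i j)" by simp
    from sums_unique2[OF this sums_zero] show ?thesis by (simp add: mean_zero_def)
  qed
  ultimately show ?thesis by blast
qed

text \<open>\<open>inv_neg_lap_h\<close> is a definite description: the Neumann series gives
  existence and the energy argument uniqueness. From here on only these three properties are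
  used.\<close>

lemma inv_neg_lap_spec:
  assumes "grid_per N f" "mean_zero N f" "N > 0" "h > 0"
  shows "grid_per N (inv_neg_lap_h h N f)" "mean_zero N (inv_neg_lap_h h N f)"
    "lap_h h (inv_neg_lap_h h N f) i j = - f i j"
proof -
  obtain u where u: "grid_per N u" "mean_zero N u" "\<forall>i j. - lap_h h u i j = f i j"
    using inv_lap_exists[OF assms] by blast
  have "\<exists>!u. grid_per N u \<and> mean_zero N u \<and> (\<forall>i j. - lap_h h u i j = f i j)"
  proof (rule ex1I[of _ u])
    fix v assume v: "grid_per N v \<and> mean_zero N v \<and> (\<forall>i j. - lap_h h v i j = f i j)"
    show "v = u"
      by (rule inv_lap_unique[OF _ _ _ _ assms(3,4)]) (use u v in \<open>auto simp: minus_equation_iff\<close>)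
  qed (use u in auto)
  from theI'[OF this] have *: "grid_per N (inv_neg_lap_h h N f) \<and> mean_zero N (inv_neg_lap_h h N f) \<and>
      (\<forall>i j. - lap_h h (inv_neg_lap_h h N f) i j = f i j)"
    unfolding inv_neg_lap_h_def .
  then show "grid_per N (inv_neg_lap_h h N f)" "mean_zero N (inv_neg_lap_h h N f)" by auto
  show "lap_h h (inv_neg_lap_h h N f) i j = - f i j" using * by (simp add: minus_equation_iff)
qed

lemma inv_neg_lap_add:
  assumes "grid_per N f" "mean_zero N f" "grid_per N g" "mean_zero N g" "N > 0" "h > 0"
  shows "inv_neg_lap_h h N (\<lambda>i j. f i j + g i j) =
    (\<lambda>i j. inv_neg_lap_h h N f i j + inv_neg_lap_h h N g i j)"
proof (rule inv_lap_unique[OF _ _ _ _ assms(5,6)])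
  note F = inv_neg_lap_spec[OF assms(1,2,5,6)] and G = inv_neg_lap_spec[OF assms(3-6)]
    and H = inv_neg_lap_spec[OF grid_per_add[OF assms(1,3)] mean_zero_add[OF assms(2,4)] assms(5,6)]
  show "grid_per N (inv_neg_lap_h h N (\<lambda>i j. f i j + g i j))"
    "mean_zero N (inv_neg_lap_h h N (\<lambda>i j. f i j + g i j))" by (fact H)+
  show "grid_per N (\<lambda>i j. inv_neg_lap_h h N f i j + inv_neg_lap_h h N g i j)"
    "mean_zero N (\<lambda>i j. inv_neg_lap_h h N f i j + inv_neg_lap_h h N g i j)"
    using F G by (auto intro: grid_per_add mean_zero_add)
  show "lap_h h (inv_neg_lap_h h N (\<lambda>i j. f i j + g i j)) i j =
    lap_h h (\<lambda>i j. inv_neg_lap_h h N f i j + inv_neg_lap_h h N g i j) i j" for i j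
    using F G H by (simp add: lap_h_add)
qed

text \<open>Write \<open>f\<close> as minus the Laplacian of its potential and sum by parts. The
  interpolation between the H^(-1) and the gradient norm, and the treatment of the time difference,
  are Cauchy-Schwarz applied to this identity.\<close>

lemma grid_inner_via_inverse:
  assumes "grid_per N f" "mean_zero N f" "grid_per N g" "N > 0" "h > 0"
  shows "grid_inner h N f g = grad_inner h N (inv_neg_lap_h h N f) g"
proof -
  note F = inv_neg_lap_spec[OF assms(1,2,4,5)]
  have "grid_inner h N f g = grid_inner h N (\<lambda>i j. - lap_h h (inv_neg_lap_h h N f) i j) g"
    by (rule grid_inner_cong) (simp_all add: F)
  also have "\<dots> = grad_inner h N (inv_neg_lap_h h N f) g"
    by (simp add: grid_inner_minus_left grid_inner_lap[OF F(1) assms(3)])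
  finally show ?thesis .
qed

text \<open>Turns the square root in \<open>norm_m1\<close> into one of a manifestly nonnegative
  quadratic form, namely the energy of the potential.\<close>

lemma norm_m1_eq:
  assumes "grid_per N f" "mean_zero N f" "N > 0" "h > 0"
  shows "norm_m1 h N f = grad_norm2 h N (inv_neg_lap_h h N f)"
  unfolding norm_m1_def grad_norm2_eq
  by (simp add: grid_inner_via_inverse[OF assms(1,2) inv_neg_lap_spec(1)[OF assms] assms(3,4)])

lemma grid_norm2_sq_interpolation:
  assumes "grid_per N f" "mean_zero N f" "N > 0" "h > 0"
  shows "(grid_norm2 h N f)\<^sup>2 \<le> norm_m1 h N f * grad_norm2 h N f"
  using grad_inner_Cauchy[of h N "inv_neg_lap_h h N f" f]
  by (simp add: grid_norm2_sq grid_inner_via_inverse[OF assms(1,2,1,3,4)] norm_m1_eq[OF assms])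

lemma grad_norm2_sq_interpolation:
  assumes "grid_per N f"
  shows "(grad_norm2 h N f)\<^sup>2 \<le> grid_norm2 h N f * grid_norm2 h N (lap_h h f)"
  using grid_inner_Cauchy[of h N "lap_h h f" f] grid_inner_lap[OF assms assms, of h]
  by (simp add: grad_norm2_sq mult.commute)

text \<open>Pair \<open>f\<close> with its own potential, apply Poincare to the potential, and
  cancel one factor of the norm.\<close>

lemma norm_m1_le:
  assumes "grid_per N f" "mean_zero N f" "N > 0" "h > 0"
  shows "norm_m1 h N f \<le> real N * h * grid_norm2 h N f"
proof -
  note F = inv_neg_lap_spec[OF assms]
  let ?u = "inv_neg_lap_h h N f"
  have "(norm_m1 h N f)\<^sup>2 = grid_inner h N f ?u"
    by (simp add: norm_m1_eq[OF assms] grad_norm2_sq grid_inner_via_inverse[OF assms(1,2) F(1) assms(3,4)])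
  also have "\<dots> \<le> grid_norm2 h N f * grid_norm2 h N ?u"
    using grid_inner_Cauchy[of h N f ?u] by simp
  also have "\<dots> \<le> grid_norm2 h N f * (real N * h * norm_m1 h N f)"
    using Poincare_grid[OF F(2) assms(4)]
    by (intro mult_left_mono) (simp_all add: norm_m1_eq[OF assms] grid_norm2_nonneg)
  finally have "norm_m1 h N f * norm_m1 h N f \<le> (real N * h * grid_norm2 h N f) * norm_m1 h N f"
    by (simp add: power2_eq_square mult_ac)
  moreover have "0 \<le> norm_m1 h N f" by (simp add: norm_m1_eq[OF assms] grad_norm2_nonneg)
  ultimately show ?thesis
    using grid_norm2_nonneg[of h N f] assms(4) by (cases "norm_m1 h N f = 0") auto
qed

lemma norm_m1_nonneg:
  assumes "grid_per N f" "mean_zero N f" "N > 0" "h > 0"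
  shows "0 \<le> norm_m1 h N f"
  by (simp add: norm_m1_eq[OF assms] grad_norm2_nonneg)

subsection \<open>Monotonicity of the implicit part of the scheme\<close>

text \<open>The bilinear form whose diagonal is the square of \<open>avg_grad_norm\<close> without
  the \<delta> term: an inner product of the four edge differences around a cell, halved because two
  edges represent each direction.\<close>

definition cell_prod :: "real \<Rightarrow> grid_fun \<Rightarrow> grid_fun \<Rightarrow> grid_fun" where
  "cell_prod h u v i j = (Dx h u i j * Dx h v i j + Dx h u (i - 1) j * Dx h v (i - 1) j
     + Dy h u i j * Dy h v i j + Dy h u i (j - 1) * Dy h v i (j - 1)) / 2"

lemma avg_grad_norm_sq: "(avg_grad_norm \<delta> h u i j)\<^sup>2 = cell_prod h u u i j + \<delta>\<^sup>2"
  by (simp add: avg_grad_norm_def cell_prod_def power2_eq_square)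

lemma avg_grad_norm_ge: "\<delta> > 0 \<Longrightarrow> \<delta> \<le> avg_grad_norm \<delta> h u i j"
  unfolding avg_grad_norm_def by (rule real_le_rsqrt) simp

lemma grid_per_avg_grad_norm: "grid_per N u \<Longrightarrow> grid_per N (avg_grad_norm \<delta> h u)"
  unfolding grid_per_def[of N "avg_grad_norm \<delta> h u"] avg_grad_norm_def
  by (simp add: grid_per_simps grid_per_Dx grid_per_Dy)

text \<open>Lagrange's identity for four components: the defect is a sum of six squares.\<close>

lemma cell_prod_Cauchy: "(cell_prod h u v i j)\<^sup>2 \<le> cell_prod h u u i j * cell_prod h v v i j"
proof -
  have "(a * a' + b * b' + c * c' + d * d')\<^sup>2 \<le> (a * a + b * b + c * c + d * d) * (a' * a' + b' * b' + c' * c' + d' * d')"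
    for a b c d a' b' c' d' :: real
  proof -
    have "(a * a + b * b + c * c + d * d) * (a' * a' + b' * b' + c' * c' + d' * d') - (a * a' + b * b' + c * c' + d * d')\<^sup>2 =
      (a * b' - b * a')\<^sup>2 + (a * c' - c * a')\<^sup>2 + (a * d' - d * a')\<^sup>2 + (b * c' - c * b')\<^sup>2 + (b * d' - d * b')\<^sup>2 + (c * d' - d * c')\<^sup>2"
      by (simp add: power2_eq_square algebra_simps)
    also have "\<dots> \<ge> 0" by simp
    finally show ?thesis by simp
  qed
  from this[of "Dx h u i j" "Dx h v i j" "Dx h u (i - 1) j" "Dx h v (i - 1) j" "Dy h u i j" "Dy h v i j"
      "Dy h u i (j - 1)" "Dy h v i (j - 1)"]
  show ?thesis by (simp add: cell_prod_def power_divide)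
qed

lemma cell_prod_self_nonneg: "0 \<le> cell_prod h u u i j"
  by (simp add: cell_prod_def)

text \<open>Averaging from cells to edges is adjoint to averaging from edges to cells. Hence the
  flux of the scheme, tested with \<open>v\<close>, sees products of gradients collected at cells,
  which is where \<open>avg_grad_norm\<close> lives.\<close>

lemma grid_inner_edge_avg:
  assumes "grid_per N g" "grid_per N u" "grid_per N v"
  shows "grid_inner h N (div_h h (edge_mult (edge_avg g) (grad_h h u))) v = - grid_inner h N g (cell_prod h u v)"
proof -
  have per: "grid_per N (fst (edge_mult (edge_avg g) (grad_h h u)))"
    "grid_per N (snd (edge_mult (edge_avg g) (grad_h h u)))"
    unfolding grid_per_def edge_mult_def edge_avg_def grad_h_def
    by (simp_all add: grid_per_simps[OF assms(1)] grid_per_simps[OF grid_per_Dx[OF assms(2)]]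
        grid_per_simps[OF grid_per_Dy[OF assms(2)]])
  let ?X = "\<lambda>i j. Dx h u i j * Dx h v i j" and ?Y = "\<lambda>i j. Dy h u i j * Dy h v i j"
  have X: "grid_per N ?X" "grid_per N ?Y" using assms by (simp_all add: grid_per_mult grid_per_Dx grid_per_Dy)
  have a: "grid_inner h N (fst (edge_mult (edge_avg g) (grad_h h u))) (Dx h v) =
    (grid_inner h N g ?X + grid_inner h N (\<lambda>i j. g (i + 1) j) ?X) / 2"
    "grid_inner h N (snd (edge_mult (edge_avg g) (grad_h h u))) (Dy h v) =
    (grid_inner h N g ?Y + grid_inner h N (\<lambda>i j. g i (j + 1)) ?Y) / 2"
    by (simp_all add: grid_inner_def edge_mult_def edge_avg_def grad_h_def algebra_simps
        sum.distrib sum_distrib_left sum_divide_distrib add_divide_distrib)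
  have b: "grid_inner h N (\<lambda>i j. g (i + 1) j) ?X = grid_inner h N g (\<lambda>i j. ?X (i - 1) j)"
    "grid_inner h N (\<lambda>i j. g i (j + 1)) ?Y = grid_inner h N g (\<lambda>i j. ?Y i (j - 1))"
    using grid_inner_backshift_x[OF X(1) assms(1), of h] grid_inner_backshift_y[OF X(2) assms(1), of h]
    by (simp_all add: grid_inner_commute)
  have c: "grid_inner h N g (cell_prod h u v) = (grid_inner h N g ?X + grid_inner h N g (\<lambda>i j. ?X (i - 1) j)) / 2
     + (grid_inner h N g ?Y + grid_inner h N g (\<lambda>i j. ?Y i (j - 1))) / 2"
    by (simp add: grid_inner_def cell_prod_def algebra_simps
        sum.distrib sum_distrib_left sum_divide_distrib add_divide_distrib)
  show ?thesis unfolding grid_inner_div[OF per assms(3)] a b c by (simp add: add_divide_distrib)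
qed

lemma grad_inner_cell_prod:
  assumes "grid_per N u" "grid_per N v"
  shows "grad_inner h N u v = grid_inner h N (\<lambda>i j. 1) (cell_prod h u v)"
proof -
  have "lap_h h u = div_h h (edge_mult (edge_avg (\<lambda>i j. 1)) (grad_h h u))"
    by (simp add: lap_h_def edge_mult_def edge_avg_def)
  then have "grid_inner h N (lap_h h u) v = - grid_inner h N (\<lambda>i j. 1) (cell_prod h u v)"
    using grid_inner_edge_avg[of N "\<lambda>i j. 1" u v h] assms by simp
  then show ?thesis using grid_inner_lap[OF assms, of h] by simp
qed

lemma mu_phi_h_inner:
  assumes "grid_per N f" "grid_per N u" "grid_per N \<rho>" "grid_per N v"
  shows "grid_inner h N (mu_phi_h \<alpha> \<epsilon> \<eta> \<delta> h f u \<rho>) v =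
    (1/\<epsilon>) * grid_inner h N (\<lambda>i j. (u i j - 1/2) ^ 3) v + (\<epsilon> + \<alpha> + \<alpha>/\<delta>) * grad_inner h N u v
    + \<eta>\<^sup>2 * grid_inner h N (lap_h h u) (lap_h h v)
    - \<alpha> * grid_inner h N (\<lambda>i j. \<rho> i j / avg_grad_norm \<delta> h u i j) (cell_prod h u v)
    - 1/(4*\<epsilon>) * grid_inner h N (\<lambda>i j. f i j - 1/2) v - \<alpha>/\<delta> * grad_inner h N f v"
proof -
  let ?g = "\<lambda>i j. \<rho> i j / avg_grad_norm \<delta> h u i j"
  have "grid_per N ?g" using assms by (simp add: grid_per_def[of _ ?g] grid_per_simps grid_per_avg_grad_norm)
  from grid_inner_edge_avg[OF this assms(2,4), of h]
  have 1: "grid_inner h N (div_h h (edge_mult (edge_avg ?g) (grad_h h u))) v = - grid_inner h N ?g (cell_prod h u v)" .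
  have "grid_inner h N (mu_phi_h \<alpha> \<epsilon> \<eta> \<delta> h f u \<rho>) v =
    (1/\<epsilon>) * grid_inner h N (\<lambda>i j. (u i j - 1/2) ^ 3) v - (\<epsilon> + \<alpha> + \<alpha>/\<delta>) * grid_inner h N (lap_h h u) v
    + \<eta>\<^sup>2 * grid_inner h N (lap_h h (lap_h h u)) v
    + \<alpha> * grid_inner h N (div_h h (edge_mult (edge_avg ?g) (grad_h h u))) v
    - 1/(4*\<epsilon>) * grid_inner h N (\<lambda>i j. f i j - 1/2) v + \<alpha>/\<delta> * grid_inner h N (lap_h h f) v"
    unfolding mu_phi_h_def
    by (simp only: grid_inner_add_left grid_inner_diff_left grid_inner_scale_left)
  then show ?thesis
    unfolding 1 grid_inner_lap_swap[OF grid_per_lap[OF assms(2)] assms(4)]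
    by (simp add: grid_inner_lap assms)
qed

lemma mu_rho_h_inner:
  assumes "grid_per N \<rho>" "grid_per N v"
  shows "grid_inner h N (mu_rho_h \<alpha> \<beta> \<xi> \<delta> h r u \<rho>) v =
    \<xi> * grad_inner h N \<rho> v + \<beta> * grid_inner h N (\<lambda>i j. ln (\<rho> i j) - ln (1 - \<rho> i j)) v
    + sqrt 2 * \<alpha> * grid_inner h N \<rho> v - \<alpha> * grid_inner h N (avg_grad_norm \<delta> h u) v
    - \<alpha> * (sqrt 2 - 1) * grid_inner h N r v"
proof -
  have "grid_inner h N (mu_rho_h \<alpha> \<beta> \<xi> \<delta> h r u \<rho>) v =
    - \<xi> * grid_inner h N (lap_h h \<rho>) v + \<beta> * grid_inner h N (\<lambda>i j. ln (\<rho> i j) - ln (1 - \<rho> i j)) v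
    + sqrt 2 * \<alpha> * grid_inner h N \<rho> v - \<alpha> * grid_inner h N (avg_grad_norm \<delta> h u) v
    - \<alpha> * (sqrt 2 - 1) * grid_inner h N r v"
    unfolding mu_rho_h_def
    by (simp only: grid_inner_add_left grid_inner_diff_left grid_inner_scale_left)
  then show ?thesis by (simp add: grid_inner_lap assms)
qed

text \<open>Here \<open>P = p\<^sub>1\<cdot>p\<^sub>1\<close>, \<open>Q = p\<^sub>2\<cdot>p\<^sub>2\<close>, \<open>R = p\<^sub>1\<cdot>p\<^sub>2\<close> for two gradients, so that \<open>E\<close> below is
  \<open>|p\<^sub>1 - p\<^sub>2|\<^sup>2\<close>. This is where the stabilising terms of the convex splitting are used.\<close>

lemma coupling_bound:
  fixes P Q R \<delta> s1 s2 \<rho> q :: real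
  assumes "0 \<le> P" "0 \<le> Q" "R\<^sup>2 \<le> P * Q" "\<delta> > 0" "\<delta> \<le> s1" "\<delta> \<le> s2" "s1\<^sup>2 = P + \<delta>\<^sup>2" "s2\<^sup>2 = Q + \<delta>\<^sup>2"
    and "0 \<le> \<rho>" "\<rho> \<le> 1"
  defines "E \<equiv> P - 2 * R + Q"
  shows "\<rho> * (P - R) / s1 - (\<rho> - q) * (R - Q) / s2 + (s1 - s2) * q \<le> q\<^sup>2 + (1 + 1/\<delta>) * E"
proof -
  have s: "s1 > 0" "s2 > 0" using assms by auto
  have "\<bar>R\<bar> \<le> (P + Q) / 2"
  proof (rule power2_le_imp_le)
    have "4 * (P * Q) + (P - Q)\<^sup>2 = (P + Q)\<^sup>2" by (simp add: power2_eq_square algebra_simps)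
    then have "4 * (P * Q) \<le> (P + Q)\<^sup>2" using zero_le_power2[of "P - Q"] by linarith
    then show "\<bar>R\<bar>\<^sup>2 \<le> ((P + Q) / 2)\<^sup>2" using assms(3) by (simp add: power_divide)
  qed (use assms in auto)
  then have "R \<le> (P + Q) / 2" by simp
  then have E: "0 \<le> E" unfolding E_def by (simp add: field_simps)
  \<comment> \<open>Cauchy-Schwarz for the two gradients extended by the common component \<delta>;
    their lengths are \<open>s1\<close> and \<open>s2\<close>.\<close>
  have R': "R + \<delta>\<^sup>2 \<le> s1 * s2"
  proof (rule power2_le_imp_le)
    have "(R + \<delta>\<^sup>2)\<^sup>2 = R\<^sup>2 + 2 * R * \<delta>\<^sup>2 + \<delta>\<^sup>2 * \<delta>\<^sup>2" by (simp add: power2_eq_square algebra_simps)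
    also have "2 * R * \<delta>\<^sup>2 \<le> (P + Q) * \<delta>\<^sup>2" using \<open>\<bar>R\<bar> \<le> (P + Q) / 2\<close> by (intro mult_right_mono) auto
    also have "R\<^sup>2 + (P + Q) * \<delta>\<^sup>2 + \<delta>\<^sup>2 * \<delta>\<^sup>2 \<le> P * Q + (P + Q) * \<delta>\<^sup>2 + \<delta>\<^sup>2 * \<delta>\<^sup>2" using assms(3) by simp
    also have "\<dots> = (s1 * s2)\<^sup>2" by (simp add: power_mult_distrib assms(7,8) algebra_simps)
    finally show "(R + \<delta>\<^sup>2)\<^sup>2 \<le> (s1 * s2)\<^sup>2" by simp
  qed (use s in simp)
  \<comment> \<open>The squared distance of the extended vectors, split into the squared difference
    of the lengths and the defect in Cauchy-Schwarz. Both parts are nonnegative, so \<open>E\<close>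
    bounds each of them.\<close>
  have E': "E = (s1 - s2)\<^sup>2 + 2 * (s1 * s2 - (R + \<delta>\<^sup>2))"
    using assms(7,8) by (simp add: E_def power2_diff)
  have "(P - R) / s1 - (R - Q) / s2 = (1/s1 + 1/s2) * (s1 * s2 - (R + \<delta>\<^sup>2))"
  proof -
    have P: "P - R = s1 * s1 - (R + \<delta>\<^sup>2)" "R - Q = (R + \<delta>\<^sup>2) - s2 * s2"
      using assms(7,8) by (simp_all add: power2_eq_square)
    show ?thesis unfolding P using s by (simp add: field_simps)
  qed
  also have "\<dots> \<le> (1/\<delta> + 1/\<delta>) * (E / 2)"
  proof (rule mult_mono)
    show "1/s1 + 1/s2 \<le> 1/\<delta> + 1/\<delta>"
      using assms(4-6) s by (intro add_mono divide_left_mono) auto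
    show "s1 * s2 - (R + \<delta>\<^sup>2) \<le> E / 2" using E' by simp
    show "0 \<le> s1 * s2 - (R + \<delta>\<^sup>2)" using R' by simp
  qed (use assms(4) in simp)
  finally have c1: "(P - R) / s1 - (R - Q) / s2 \<le> E / \<delta>" by simp
  have "\<rho> * ((P - R) / s1 - (R - Q) / s2) \<le> \<rho> * (E / \<delta>)" using c1 assms by (intro mult_left_mono) auto
  also have "\<dots> \<le> 1 * (E / \<delta>)" using assms E by (intro mult_right_mono) auto
  finally have c1': "\<rho> * ((P - R) / s1 - (R - Q) / s2) \<le> E / \<delta>" by simp
  \<comment> \<open>\<open>R - Q\<close> is the product of the difference of the gradients with the
    second gradient, whose length is at most \<open>s2\<close>.\<close>
  have c2: "\<bar>(R - Q) / s2\<bar> \<le> sqrt E"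
  proof (rule real_le_rsqrt)
    have "(R - Q)\<^sup>2 \<le> Q * E" using assms(3) by (simp add: E_def power2_eq_square algebra_simps)
    also have "\<dots> \<le> s2\<^sup>2 * E" using E assms(8) by (intro mult_right_mono) auto
    finally show "\<bar>(R - Q) / s2\<bar>\<^sup>2 \<le> E" using s by (simp add: power_divide field_simps)
  qed
  have c3: "\<bar>s1 - s2\<bar> \<le> sqrt E"
    by (rule real_le_rsqrt) (use E' R' in simp)
  have "q * ((R - Q) / s2 + (s1 - s2)) \<le> \<bar>q\<bar> * (2 * sqrt E)"
  proof -
    have "q * ((R - Q) / s2 + (s1 - s2)) \<le> \<bar>q\<bar> * \<bar>(R - Q) / s2 + (s1 - s2)\<bar>"
      by (metis abs_ge_self abs_mult)
    also have "\<dots> \<le> \<bar>q\<bar> * (2 * sqrt E)" by (intro mult_left_mono) (use c2 c3 in linarith, simp)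
    finally show ?thesis .
  qed
  also have "\<dots> \<le> q\<^sup>2 + E"
    using sum_squares_bound[of "\<bar>q\<bar>" "sqrt E"] E by simp
  finally have "\<rho> * ((P - R) / s1 - (R - Q) / s2) + q * ((R - Q) / s2 + (s1 - s2)) \<le> q\<^sup>2 + E + E / \<delta>"
    using c1' by linarith
  then show ?thesis by (simp add: algebra_simps diff_divide_distrib add_divide_distrib)
qed

text \<open>The cubic and the logarithm are monotone, so their contributions have a sign and are
  dropped. The coupling costs at most \<open>\<alpha>\<close> times the squared norm of
  \<open>d\<close> plus \<open>\<alpha> + \<alpha>/\<delta>\<close> times the squared gradient of
  \<open>e\<close>; the implicit coefficients \<open>sqrt 2 * \<alpha>\<close> and
  \<open>\<epsilon> + \<alpha> + \<alpha>/\<delta>\<close> cover this and still leave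
  \<open>\<epsilon>\<close>. The last three terms on the right cancel the explicit part, which is
  estimated separately.\<close>

lemma scheme_coercive:
  fixes \<alpha> \<beta> \<epsilon> \<eta> \<xi> \<delta> h :: real
  assumes par: "\<alpha> > 0" "\<beta> > 0" "\<epsilon> > 0" "\<delta> > 0"
    and per: "grid_per N p" "grid_per N f" "grid_per N p'" "grid_per N f'"
      "grid_per N q'" "grid_per N r'"
    and pos: "\<And>i j. 0 < q' i j \<and> q' i j < 1" "\<And>i j. 0 < r' i j \<and> r' i j < 1"
  defines "e \<equiv> \<lambda>i j. p' i j - f' i j" and "d \<equiv> \<lambda>i j. q' i j - r' i j"
  shows "\<epsilon> * grad_inner h N e e + \<eta>\<^sup>2 * grid_inner h N (lap_h h e) (lap_h h e) + \<xi> * grad_inner h N d d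
     \<le> grid_inner h N (mu_phi_h \<alpha> \<epsilon> \<eta> \<delta> h p p' q') e - grid_inner h N (mu_phi_h \<alpha> \<epsilon> \<eta> \<delta> h f f' r') e
       + grid_inner h N (mu_rho_h \<alpha> \<beta> \<xi> \<delta> h q p' q') d - grid_inner h N (mu_rho_h \<alpha> \<beta> \<xi> \<delta> h r f' r') d
       + 1/(4*\<epsilon>) * grid_inner h N (\<lambda>i j. p i j - f i j) e + \<alpha>/\<delta> * grad_inner h N (\<lambda>i j. p i j - f i j) e
       + \<alpha> * (sqrt 2 - 1) * grid_inner h N (\<lambda>i j. q i j - r i j) d"
proof -
  have pe: "grid_per N e" "grid_per N d" unfolding e_def d_def by (intro grid_per_diff per)+
  let ?s1 = "avg_grad_norm \<delta> h p'" and ?s2 = "avg_grad_norm \<delta> h f'"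
  \<comment> \<open>The coupling contributions of both potentials, collected so that they can be
    bounded together in each cell.\<close>
  define G where "G = grid_inner h N (\<lambda>i j. q' i j / ?s1 i j) (cell_prod h p' e)
     - grid_inner h N (\<lambda>i j. r' i j / ?s2 i j) (cell_prod h f' e) + grid_inner h N (\<lambda>i j. ?s1 i j - ?s2 i j) d"
  have "G \<le> grid_inner h N d d + (1 + 1/\<delta>) * grad_inner h N e e"
  proof -
    have pt: "q' i j / ?s1 i j * cell_prod h p' e i j - r' i j / ?s2 i j * cell_prod h f' e i j
       + (?s1 i j - ?s2 i j) * d i j \<le> d i j * d i j + (1 + 1/\<delta>) * cell_prod h e e i j" for i j
    proof -
      have "q' i j * (cell_prod h p' p' i j - cell_prod h p' f' i j) / ?s1 i j
        - (q' i j - d i j) * (cell_prod h p' f' i j - cell_prod h f' f' i j) / ?s2 i j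
        + (?s1 i j - ?s2 i j) * d i j \<le> (d i j)\<^sup>2
        + (1 + 1/\<delta>) * (cell_prod h p' p' i j - 2 * cell_prod h p' f' i j + cell_prod h f' f' i j)"
        by (rule coupling_bound)
          (use pos[of i j] par in \<open>auto simp: cell_prod_self_nonneg cell_prod_Cauchy avg_grad_norm_ge avg_grad_norm_sq\<close>)
      moreover have "cell_prod h p' e i j = cell_prod h p' p' i j - cell_prod h p' f' i j"
        "cell_prod h f' e i j = cell_prod h p' f' i j - cell_prod h f' f' i j"
        "cell_prod h e e i j = cell_prod h p' p' i j - 2 * cell_prod h p' f' i j + cell_prod h f' f' i j"
        unfolding e_def
        by (simp_all add: cell_prod_def Dx_diff Dy_diff algebra_simps diff_divide_distrib add_divide_distrib)
      ultimately show ?thesis by (simp add: d_def power2_eq_square)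
    qed
    have "G = h\<^sup>2 * (\<Sum>i\<in>{1..int N}. \<Sum>j\<in>{1..int N}. q' i j / ?s1 i j * cell_prod h p' e i j - r' i j / ?s2 i j * cell_prod h f' e i j
       + (?s1 i j - ?s2 i j) * d i j)"
      by (simp add: G_def grid_inner_def sum.distrib sum_subtractf distrib_left right_diff_distrib)
    also have "\<dots> \<le> h\<^sup>2 * (\<Sum>i\<in>{1..int N}. \<Sum>j\<in>{1..int N}. d i j * d i j + (1 + 1/\<delta>) * cell_prod h e e i j)"
      by (intro mult_left_mono sum_mono pt) auto
    also have "\<dots> = grid_inner h N d d + (1 + 1/\<delta>) * grad_inner h N e e"
      by (simp add: grad_inner_cell_prod pe grid_inner_def sum.distrib sum_distrib_left[symmetric] sum_divide_distrib[symmetric] algebra_simps)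
    finally show ?thesis .
  qed
  then have cG: "\<alpha> * G \<le> \<alpha> * grid_inner h N d d + (\<alpha> + \<alpha>/\<delta>) * grad_inner h N e e"
    using mult_left_mono[of G _ \<alpha>] par by (fastforce simp: algebra_simps)
  have c3: "0 \<le> grid_inner h N (\<lambda>i j. (p' i j - 1/2) ^ 3 - (f' i j - 1/2) ^ 3) e"
  proof -
    have "0 \<le> (x ^ 3 - y ^ 3) * (x - y)" for x y :: real
    proof -
      have eq: "(x ^ 3 - y ^ 3) * (x - y) = (x - y)\<^sup>2 * ((x + y)\<^sup>2 + x\<^sup>2 + y\<^sup>2) / 2"
        by (simp add: power2_eq_square power3_eq_cube algebra_simps)
      show ?thesis unfolding eq by simp
    qed
    from this[of "p' _ _ - 1/2" "f' _ _ - 1/2"] show ?thesis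
      by (auto simp: grid_inner_def e_def intro!: mult_nonneg_nonneg[OF zero_le_power2] sum_nonneg)
  qed
  have cl: "0 \<le> grid_inner h N (\<lambda>i j. (ln (q' i j) - ln (1 - q' i j)) - (ln (r' i j) - ln (1 - r' i j))) d"
  proof -
    have "0 \<le> ((ln x - ln (1 - x)) - (ln y - ln (1 - y))) * (x - y)"
      if "0 < x" "x < 1" "0 < y" "y < 1" for x y :: real
    proof (cases "x \<ge> y")
      case True
      then have "ln y \<le> ln x" "ln (1 - x) \<le> ln (1 - y)" using that by auto
      then show ?thesis using True by (intro mult_nonneg_nonneg) auto
    next
      case False
      then have "ln x \<le> ln y" "ln (1 - y) \<le> ln (1 - x)" using that by auto
      then show ?thesis using False by (intro mult_nonpos_nonpos) auto
    qed
    from this[of "q' _ _" "r' _ _"] show ?thesis using pos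
      by (auto simp: grid_inner_def d_def intro!: mult_nonneg_nonneg[OF zero_le_power2] sum_nonneg)
  qed
  have sq: "0 \<le> (sqrt 2 - 1) * \<alpha> * grid_inner h N d d"
    using par by (intro mult_nonneg_nonneg grid_inner_self_nonneg) auto
  have "grid_inner h N (mu_phi_h \<alpha> \<epsilon> \<eta> \<delta> h p p' q') e - grid_inner h N (mu_phi_h \<alpha> \<epsilon> \<eta> \<delta> h f f' r') e
       + grid_inner h N (mu_rho_h \<alpha> \<beta> \<xi> \<delta> h q p' q') d - grid_inner h N (mu_rho_h \<alpha> \<beta> \<xi> \<delta> h r f' r') d
       + 1/(4*\<epsilon>) * grid_inner h N (\<lambda>i j. p i j - f i j) e + \<alpha>/\<delta> * grad_inner h N (\<lambda>i j. p i j - f i j) e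
       + \<alpha> * (sqrt 2 - 1) * grid_inner h N (\<lambda>i j. q i j - r i j) d
     = (1/\<epsilon>) * grid_inner h N (\<lambda>i j. (p' i j - 1/2) ^ 3 - (f' i j - 1/2) ^ 3) e
       + (\<epsilon> + \<alpha> + \<alpha>/\<delta>) * grad_inner h N e e + \<eta>\<^sup>2 * grid_inner h N (lap_h h e) (lap_h h e)
       + \<xi> * grad_inner h N d d
       + \<beta> * grid_inner h N (\<lambda>i j. (ln (q' i j) - ln (1 - q' i j)) - (ln (r' i j) - ln (1 - r' i j))) d
       + sqrt 2 * \<alpha> * grid_inner h N d d - \<alpha> * G"
  proof -
    have e: "grad_inner h N e e = grad_inner h N p' e - grad_inner h N f' e"
      "grad_inner h N d d = grad_inner h N q' d - grad_inner h N r' d"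
      "grid_inner h N d d = grid_inner h N q' d - grid_inner h N r' d"
      "grid_inner h N (lap_h h e) (lap_h h e) = grid_inner h N (lap_h h p') (lap_h h e) - grid_inner h N (lap_h h f') (lap_h h e)"
      unfolding e_def d_def
      by (simp_all only: grad_inner_diff_left grid_inner_diff_left lap_h_diff)
    have "grid_inner h N (\<lambda>i j. p i j - f i j) e = grid_inner h N (\<lambda>i j. p i j - 1/2) e - grid_inner h N (\<lambda>i j. f i j - 1/2) e"
      by (simp add: grid_inner_diff_left)
    then show ?thesis
      unfolding mu_phi_h_inner[OF per(1,3,5) pe(1)] mu_phi_h_inner[OF per(2,4,6) pe(1)]
        mu_rho_h_inner[OF per(5) pe(2)] mu_rho_h_inner[OF per(6) pe(2)] G_def e
        grad_inner_diff_left grid_inner_diff_left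
      by (simp add: algebra_simps)
  qed
  moreover have "0 \<le> (1/\<epsilon>) * grid_inner h N (\<lambda>i j. (p' i j - 1/2) ^ 3 - (f' i j - 1/2) ^ 3) e"
    "0 \<le> \<beta> * grid_inner h N (\<lambda>i j. (ln (q' i j) - ln (1 - q' i j)) - (ln (r' i j) - ln (1 - r' i j))) d"
    using c3 cl par by simp_all
  moreover have "sqrt 2 * \<alpha> * grid_inner h N d d = (sqrt 2 - 1) * \<alpha> * grid_inner h N d d + \<alpha> * grid_inner h N d d"
    "(\<epsilon> + \<alpha> + \<alpha>/\<delta>) * grad_inner h N e e = \<epsilon> * grad_inner h N e e + (\<alpha> + \<alpha>/\<delta>) * grad_inner h N e e"
    by (simp_all add: algebra_simps)
  ultimately show ?thesis using cG sq by linarith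
qed

subsection \<open>The error inequality of one time step\<close>

definition err_low :: "real \<Rightarrow> nat \<Rightarrow> grid_fun \<Rightarrow> grid_fun \<Rightarrow> real" where
  "err_low h N e d = (norm_m1 h N e)\<^sup>2 + (norm_m1 h N d)\<^sup>2"

definition err_high :: "real \<Rightarrow> real \<Rightarrow> real \<Rightarrow> real \<Rightarrow> nat \<Rightarrow> grid_fun \<Rightarrow> grid_fun \<Rightarrow> real" where
  "err_high \<epsilon> \<eta> \<xi> h N e d = \<eta>\<^sup>2 * (grid_norm2 h N (lap_h h e))\<^sup>2 + \<epsilon> * (grad_norm2 h N e)\<^sup>2
     + \<xi> * (grad_norm2 h N d)\<^sup>2"

section \<open>Interpolation inequalities that absorb the explicit terms\<close>

lemma Young_weighted:
  fixes a b k :: real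
  assumes "k > 0"
  shows "a * b \<le> k * a\<^sup>2 + b\<^sup>2 / (4 * k)"
proof -
  have eq: "k * a\<^sup>2 + b\<^sup>2 / (4 * k) - a * b = (2 * k * a - b)\<^sup>2 / (4 * k)"
    using assms by (simp add: field_simps power2_eq_square)
  have "0 \<le> (2 * k * a - b)\<^sup>2 / (4 * k)" using assms by simp
  then show ?thesis using eq by linarith
qed

lemma half_squares: "\<bar>x\<bar> \<le> a * b \<Longrightarrow> x \<le> (a\<^sup>2 + b\<^sup>2) / 2" for a b x :: real
  using sum_squares_bound[of a b] by simp

text \<open>The weight \<open>k\<close> on the gradient can be made as small as the dissipation
  demands; the price is paid in the H^(-1) norm, which Gronwall can handle.\<close>

lemma grid_norm2_interpolate:
  assumes "grid_per N f" "mean_zero N f" "N > 0" "h > 0" "k > 0"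
  shows "(grid_norm2 h N f)\<^sup>2 \<le> k * (grad_norm2 h N f)\<^sup>2 + (norm_m1 h N f)\<^sup>2 / (4 * k)"
  using grid_norm2_sq_interpolation[OF assms(1-4)]
    Young_weighted[OF assms(5), of "grad_norm2 h N f" "norm_m1 h N f"] by (simp add: mult.commute)

lemma grad_norm2_interpolate:
  assumes "grid_per N f" "mean_zero N f" "N > 0" "h > 0" "k > 0"
  shows "(grad_norm2 h N f)\<^sup>2 \<le> 2 * k * (grid_norm2 h N (lap_h h f))\<^sup>2 + (norm_m1 h N f)\<^sup>2 / (16 * k\<^sup>2)"
proof -
  have "(grad_norm2 h N f)\<^sup>2 \<le> k * (grid_norm2 h N (lap_h h f))\<^sup>2 + (grid_norm2 h N f)\<^sup>2 / (4 * k)"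
    using grad_norm2_sq_interpolation[OF assms(1), of h]
      Young_weighted[OF assms(5), of "grid_norm2 h N (lap_h h f)" "grid_norm2 h N f"] by (simp add: mult.commute)
  \<comment> \<open>The weight \<open>2 * k\<close> makes exactly half of the gradient norm reappear
    on the right, where it is absorbed.\<close>
  also have "(grid_norm2 h N f)\<^sup>2 \<le> 2 * k * (grad_norm2 h N f)\<^sup>2 + (norm_m1 h N f)\<^sup>2 / (4 * (2 * k))"
    by (rule grid_norm2_interpolate) (use assms in auto)
  finally have "(grad_norm2 h N f)\<^sup>2 \<le> k * (grid_norm2 h N (lap_h h f))\<^sup>2 +
      (2 * k * (grad_norm2 h N f)\<^sup>2 + (norm_m1 h N f)\<^sup>2 / (4 * (2 * k))) / (4 * k)"
    using assms(5) by (simp add: divide_right_mono)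
  also have "\<dots> = k * (grid_norm2 h N (lap_h h f))\<^sup>2 + (grad_norm2 h N f)\<^sup>2 / 2 + (norm_m1 h N f)\<^sup>2 / (32 * k\<^sup>2)"
    using assms(5) by (simp add: field_simps power2_eq_square)
  finally show ?thesis by (simp add: field_simps)
qed

lemma explicit_part_bound:
  fixes \<alpha> \<epsilon> \<eta> \<xi> \<delta> :: real
  assumes par: "\<alpha> > 0" "\<epsilon> > 0" "\<eta> > 0" "\<xi> > 0" "\<delta> > 0"
  shows "\<exists>C\<ge>0. \<forall>N h e d e' d'. N > 0 \<longrightarrow> h > 0 \<longrightarrow>
     grid_per N e \<longrightarrow> grid_per N d \<longrightarrow> grid_per N e' \<longrightarrow> grid_per N d' \<longrightarrow>
     mean_zero N e \<longrightarrow> mean_zero N d \<longrightarrow> mean_zero N e' \<longrightarrow> mean_zero N d' \<longrightarrow>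
     1/(4*\<epsilon>) * grid_inner h N e e' + \<alpha>/\<delta> * grad_inner h N e e' + \<alpha> * (sqrt 2 - 1) * grid_inner h N d d'
     \<le> (err_high \<epsilon> \<eta> \<xi> h N e d + err_high \<epsilon> \<eta> \<xi> h N e' d') / 32 + C * (err_low h N e d + err_low h N e' d')"
proof -
  \<comment> \<open>The three weights are chosen so that, after multiplication with the coefficients
    of the explicit terms, \<open>1/32\<close> of each of the three dissipation terms is
    used.\<close>
  define k1 where "k1 = \<epsilon>\<^sup>2 / 4"
  define k2 where "k2 = \<eta>\<^sup>2 * \<delta> / (32 * \<alpha>)"
  define k3 where "k3 = \<xi> / (16 * \<alpha>)"
  have k: "k1 > 0" "k2 > 0" "k3 > 0" using par by (simp_all add: k1_def k2_def k3_def)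
  define C where "C = 1/(8*\<epsilon>) / (4 * k1) + \<alpha>/(2*\<delta>) / (16 * k2\<^sup>2) + (\<alpha>/2) / (4 * k3)"
  have C: "C \<ge> 0" using k par by (simp add: C_def)
  show ?thesis
  proof (intro exI[of _ C] conjI C allI impI)
    fix N h e d e' d'
    assume N: "N > 0" "h > (0::real)" and per: "grid_per N e" "grid_per N d" "grid_per N e'" "grid_per N d'"
      and mz: "mean_zero N e" "mean_zero N d" "mean_zero N e'" "mean_zero N d'"
    have single: "1/(8*\<epsilon>) * (grid_norm2 h N e)\<^sup>2 + \<alpha>/(2*\<delta>) * (grad_norm2 h N e)\<^sup>2 + \<alpha>/2 * (grid_norm2 h N d)\<^sup>2
        \<le> err_high \<epsilon> \<eta> \<xi> h N e d / 32 + C * err_low h N e d"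
      if per: "grid_per N e" "grid_per N d" and mz: "mean_zero N e" "mean_zero N d" for e d
    proof -
      have "1/(8*\<epsilon>) * (grid_norm2 h N e)\<^sup>2 \<le> 1/(8*\<epsilon>) * (k1 * (grad_norm2 h N e)\<^sup>2 + (norm_m1 h N e)\<^sup>2 / (4 * k1))"
        using grid_norm2_interpolate[OF per(1) mz(1) N k(1)] par by (intro mult_left_mono) auto
      also have "\<dots> = \<epsilon> * (grad_norm2 h N e)\<^sup>2 / 32 + 1/(8*\<epsilon>) / (4 * k1) * (norm_m1 h N e)\<^sup>2"
        using par by (simp add: k1_def field_simps power2_eq_square)
      finally have 1: "1/(8*\<epsilon>) * (grid_norm2 h N e)\<^sup>2 \<le> \<epsilon> * (grad_norm2 h N e)\<^sup>2 / 32 + 1/(8*\<epsilon>) / (4 * k1) * (norm_m1 h N e)\<^sup>2" .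
      have "\<alpha>/(2*\<delta>) * (grad_norm2 h N e)\<^sup>2 \<le> \<alpha>/(2*\<delta>) * (2 * k2 * (grid_norm2 h N (lap_h h e))\<^sup>2 + (norm_m1 h N e)\<^sup>2 / (16 * k2\<^sup>2))"
        using grad_norm2_interpolate[OF per(1) mz(1) N k(2)] par by (intro mult_left_mono) auto
      also have "\<dots> = \<eta>\<^sup>2 * (grid_norm2 h N (lap_h h e))\<^sup>2 / 32 + \<alpha>/(2*\<delta>) / (16 * k2\<^sup>2) * (norm_m1 h N e)\<^sup>2"
      proof -
        have "\<alpha>/(2*\<delta>) * (2 * k2) = \<eta>\<^sup>2 / 32" using par by (simp add: k2_def)
        then have "\<alpha>/(2*\<delta>) * (2 * k2 * (grid_norm2 h N (lap_h h e))\<^sup>2) = \<eta>\<^sup>2 / 32 * (grid_norm2 h N (lap_h h e))\<^sup>2"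
          by (simp only: mult.assoc[symmetric])
        then show ?thesis by (simp add: distrib_left)
      qed
      finally have 2: "\<alpha>/(2*\<delta>) * (grad_norm2 h N e)\<^sup>2 \<le> \<eta>\<^sup>2 * (grid_norm2 h N (lap_h h e))\<^sup>2 / 32 + \<alpha>/(2*\<delta>) / (16 * k2\<^sup>2) * (norm_m1 h N e)\<^sup>2" .
      have "\<alpha>/2 * (grid_norm2 h N d)\<^sup>2 \<le> \<alpha>/2 * (k3 * (grad_norm2 h N d)\<^sup>2 + (norm_m1 h N d)\<^sup>2 / (4 * k3))"
        using grid_norm2_interpolate[OF per(2) mz(2) N k(3)] par by (intro mult_left_mono) auto
      also have "\<dots> = \<xi> * (grad_norm2 h N d)\<^sup>2 / 32 + (\<alpha>/2) / (4 * k3) * (norm_m1 h N d)\<^sup>2"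
        using par by (simp add: k3_def field_simps)
      finally have 3: "\<alpha>/2 * (grid_norm2 h N d)\<^sup>2 \<le> \<xi> * (grad_norm2 h N d)\<^sup>2 / 32 + (\<alpha>/2) / (4 * k3) * (norm_m1 h N d)\<^sup>2" .
      have "0 \<le> (1/(8*\<epsilon>) / (4 * k1) + \<alpha>/(2*\<delta>) / (16 * k2\<^sup>2)) * (norm_m1 h N d)\<^sup>2" "0 \<le> (\<alpha>/2) / (4 * k3) * (norm_m1 h N e)\<^sup>2"
        using k par by simp_all
      then have "1/(8*\<epsilon>) / (4 * k1) * (norm_m1 h N e)\<^sup>2 + \<alpha>/(2*\<delta>) / (16 * k2\<^sup>2) * (norm_m1 h N e)\<^sup>2 + (\<alpha>/2) / (4 * k3) * (norm_m1 h N d)\<^sup>2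
         \<le> C * err_low h N e d"
        unfolding C_def err_low_def distrib_right distrib_left by linarith
      then show ?thesis using 1 2 3 unfolding err_high_def add_divide_distrib by linarith
    qed
    have b1: "1/(4*\<epsilon>) * grid_inner h N e e' \<le> 1/(4*\<epsilon>) * (((grid_norm2 h N e)\<^sup>2 + (grid_norm2 h N e')\<^sup>2) / 2)"
      using half_squares[OF grid_inner_Cauchy] par by (intro mult_left_mono) auto
    have b2: "\<alpha>/\<delta> * grad_inner h N e e' \<le> \<alpha>/\<delta> * (((grad_norm2 h N e)\<^sup>2 + (grad_norm2 h N e')\<^sup>2) / 2)"
      using half_squares[OF grad_inner_Cauchy] par by (intro mult_left_mono) auto
    have b3: "\<alpha> * (sqrt 2 - 1) * grid_inner h N d d' \<le> \<alpha> * (((grid_norm2 h N d)\<^sup>2 + (grid_norm2 h N d')\<^sup>2) / 2)"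
    proof -
      have "sqrt 2 \<le> 2" by (rule real_le_lsqrt) auto
      have "\<alpha> * (sqrt 2 - 1) * grid_inner h N d d' \<le> \<alpha> * (sqrt 2 - 1) * (((grid_norm2 h N d)\<^sup>2 + (grid_norm2 h N d')\<^sup>2) / 2)"
        using half_squares[OF grid_inner_Cauchy] par by (intro mult_left_mono) auto
      also have "\<dots> \<le> \<alpha> * 1 * (((grid_norm2 h N d)\<^sup>2 + (grid_norm2 h N d')\<^sup>2) / 2)"
        using \<open>sqrt 2 \<le> 2\<close> par by (intro mult_right_mono mult_left_mono) auto
      finally show ?thesis by simp
    qed
    have "1/(4*\<epsilon>) * grid_inner h N e e' + \<alpha>/\<delta> * grad_inner h N e e' + \<alpha> * (sqrt 2 - 1) * grid_inner h N d d'
       \<le> (1/(8*\<epsilon>) * (grid_norm2 h N e)\<^sup>2 + \<alpha>/(2*\<delta>) * (grad_norm2 h N e)\<^sup>2 + \<alpha>/2 * (grid_norm2 h N d)\<^sup>2)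
       + (1/(8*\<epsilon>) * (grid_norm2 h N e')\<^sup>2 + \<alpha>/(2*\<delta>) * (grad_norm2 h N e')\<^sup>2 + \<alpha>/2 * (grid_norm2 h N d')\<^sup>2)"
    proof -
      have "1/(4*\<epsilon>) * ((u + w) / 2) = 1/(8*\<epsilon>) * u + 1/(8*\<epsilon>) * w"
        "\<alpha>/\<delta> * ((u + w) / 2) = \<alpha>/(2*\<delta>) * u + \<alpha>/(2*\<delta>) * w"
        "\<alpha> * ((u + w) / 2) = \<alpha>/2 * u + \<alpha>/2 * w" for u w
        using par by (simp_all add: field_simps)
      then show ?thesis using b1 b2 b3 by smt
    qed
    also have "\<dots> \<le> (err_high \<epsilon> \<eta> \<xi> h N e d / 32 + C * err_low h N e d) + (err_high \<epsilon> \<eta> \<xi> h N e' d' / 32 + C * err_low h N e' d')"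
      by (intro add_mono single per mz)
    finally show "1/(4*\<epsilon>) * grid_inner h N e e' + \<alpha>/\<delta> * grad_inner h N e e' + \<alpha> * (sqrt 2 - 1) * grid_inner h N d d'
     \<le> (err_high \<epsilon> \<eta> \<xi> h N e d + err_high \<epsilon> \<eta> \<xi> h N e' d') / 32 + C * (err_low h N e d + err_low h N e' d')"
      by (simp add: algebra_simps add_divide_distrib)
  qed
qed

text \<open>In the H^(-1) inner product, twice the pairing of \<open>e\<close> with
  \<open>e'\<close> is at most the sum of their squared norms. This makes the backward difference in
  time a difference of squares.\<close>

lemma time_difference_bound:
  assumes per: "grid_per N e" "grid_per N e'" and mz: "mean_zero N e" "mean_zero N e'" and N: "N > 0" "h > 0"
  shows "((norm_m1 h N e')\<^sup>2 - (norm_m1 h N e)\<^sup>2) / 2 \<le> grid_inner h N (\<lambda>i j. e' i j - e i j) (inv_neg_lap_h h N e')"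
proof -
  let ?u = "inv_neg_lap_h h N e'" and ?v = "inv_neg_lap_h h N e"
  have u: "grid_per N ?u" using inv_neg_lap_spec[OF per(2) mz(2) N] by simp
  have "grid_inner h N e' ?u = (norm_m1 h N e')\<^sup>2"
    by (simp add: norm_m1_eq[OF per(2) mz(2) N] grad_norm2_sq grid_inner_via_inverse[OF per(2) mz(2) u N])
  moreover have "grid_inner h N e ?u \<le> ((norm_m1 h N e)\<^sup>2 + (norm_m1 h N e')\<^sup>2) / 2"
    unfolding grid_inner_via_inverse[OF per(1) mz(1) u N] norm_m1_eq[OF per(1) mz(1) N] norm_m1_eq[OF per(2) mz(2) N]
    by (rule half_squares[OF grad_inner_Cauchy])
  ultimately show ?thesis by (simp add: grid_inner_diff_left field_simps)
qed

text \<open>Testing with the potential of \<open>v\<close> cancels the outer Laplacian of the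
  scheme: what remains is the pairing of the chemical potential itself with
  \<open>v\<close>.\<close>

lemma scheme_weak_form:
  assumes step: "\<And>i j. (f' i j - f i j) / dt = M * lap_h h \<mu> i j" and "dt \<noteq> 0"
    and per: "grid_per N \<mu>" "grid_per N v" "mean_zero N v" "N > 0" "h > 0"
  shows "grid_inner h N (\<lambda>i j. f' i j - f i j) (inv_neg_lap_h h N v) = - dt * M * grid_inner h N \<mu> v"
proof -
  let ?u = "inv_neg_lap_h h N v"
  note U = inv_neg_lap_spec[OF per(2-5)]
  have "grid_inner h N (\<lambda>i j. f' i j - f i j) ?u = grid_inner h N (\<lambda>i j. (dt * M) * lap_h h \<mu> i j) ?u"
    using step \<open>dt \<noteq> 0\<close> by (intro grid_inner_cong) (auto simp: field_simps)
  also have "\<dots> = dt * M * grid_inner h N \<mu> (lap_h h ?u)"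
    by (simp add: grid_inner_scale_left grid_inner_lap_swap[OF per(1) U(1)])
  also have "grid_inner h N \<mu> (lap_h h ?u) = grid_inner h N \<mu> (\<lambda>i j. - v i j)"
    by (rule grid_inner_cong) (simp_all add: U)
  finally show ?thesis by (simp add: grid_inner_minus_right)
qed

lemma grid_per_mu_phi_h:
  assumes "grid_per N f" "grid_per N u" "grid_per N \<rho>"
  shows "grid_per N (mu_phi_h \<alpha> \<epsilon> \<eta> \<delta> h f u \<rho>)"
proof -
  let ?g = "\<lambda>i j. \<rho> i j / avg_grad_norm \<delta> h u i j"
  have g: "grid_per N ?g" using assms by (simp add: grid_per_def[of _ ?g] grid_per_simps grid_per_avg_grad_norm)
  have "grid_per N (div_h h (edge_mult (edge_avg ?g) (grad_h h u)))"
    by (rule grid_per_div; unfold grid_per_def edge_mult_def edge_avg_def grad_h_def)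
      (simp_all add: grid_per_simps[OF g] grid_per_simps[OF grid_per_Dx[OF assms(2)]]
        grid_per_simps[OF grid_per_Dy[OF assms(2)]])
  then show ?thesis
    unfolding grid_per_def[of _ "mu_phi_h \<alpha> \<epsilon> \<eta> \<delta> h f u \<rho>"] mu_phi_h_def
    using assms by (simp add: grid_per_simps grid_per_lap)
qed

lemma grid_per_mu_rho_h:
  assumes "grid_per N r" "grid_per N u" "grid_per N \<rho>"
  shows "grid_per N (mu_rho_h \<alpha> \<beta> \<xi> \<delta> h r u \<rho>)"
  unfolding grid_per_def[of _ "mu_rho_h \<alpha> \<beta> \<xi> \<delta> h r u \<rho>"] mu_rho_h_def
  using assms by (simp add: grid_per_simps grid_per_lap grid_per_avg_grad_norm)

text \<open>\<open>\<theta>\<close> is the truncation error per unit time, measured in a norm dual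
  to what the error equation controls. As the dissipation contains the Laplacian of the phase error,
  test functions may be charged with their Laplacian here; for the density only the gradient is
  available.\<close>

definition consistent_phi ::
  "real \<Rightarrow> real \<Rightarrow> real \<Rightarrow> real \<Rightarrow> real \<Rightarrow> real \<Rightarrow> nat \<Rightarrow> real \<Rightarrow> real \<Rightarrow> grid_fun \<Rightarrow> grid_fun \<Rightarrow> grid_fun \<Rightarrow> bool" where
  "consistent_phi \<alpha> \<epsilon> \<eta> \<delta> M h N dt \<theta> p p' q' \<longleftrightarrow>
     (\<forall>v. grid_per N v \<longrightarrow> mean_zero N v \<longrightarrow>
        \<bar>grid_inner h N (\<lambda>i j. p' i j - p i j) (inv_neg_lap_h h N v)
          + dt * M * grid_inner h N (mu_phi_h \<alpha> \<epsilon> \<eta> \<delta> h p p' q') v\<bar>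
        \<le> dt * \<theta> * (norm_m1 h N v + grad_norm2 h N v + grid_norm2 h N (lap_h h v)))"

definition consistent_rho ::
  "real \<Rightarrow> real \<Rightarrow> real \<Rightarrow> real \<Rightarrow> real \<Rightarrow> real \<Rightarrow> nat \<Rightarrow> real \<Rightarrow> real \<Rightarrow> grid_fun \<Rightarrow> grid_fun \<Rightarrow> grid_fun \<Rightarrow> bool" where
  "consistent_rho \<alpha> \<beta> \<xi> \<delta> M h N dt \<theta> q p' q' \<longleftrightarrow>
     (\<forall>v. grid_per N v \<longrightarrow> mean_zero N v \<longrightarrow>
        \<bar>grid_inner h N (\<lambda>i j. q' i j - q i j) (inv_neg_lap_h h N v)
          + dt * M * grid_inner h N (mu_rho_h \<alpha> \<beta> \<xi> \<delta> h q p' q') v\<bar>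
        \<le> dt * \<theta> * (norm_m1 h N v + grad_norm2 h N v))"

text \<open>The errors themselves serve as test functions. Coercivity produces the full dissipation
  at the new level, and the explicit terms and the truncation error take small multiples of the new
  and the old one. The weights \<open>3/2\<close> and \<open>1/2\<close> leave the new level ahead
  by a whole copy, which is what survives summation over the steps.\<close>

lemma step_estimate:
  fixes \<alpha> \<beta> \<epsilon> \<eta> \<xi> \<delta> M :: real
  assumes par: "\<alpha> > 0" "\<beta> > 0" "\<epsilon> > 0" "\<eta> > 0" "\<xi> > 0" "\<delta> > 0" "M > 0"
  shows "\<exists>C\<ge>0. \<forall>N h dt \<theta> p q f r p' q' f' r'.
     N > 0 \<longrightarrow> h > 0 \<longrightarrow> dt > 0 \<longrightarrow> \<theta> \<ge> 0 \<longrightarrow>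
     grid_per N p \<longrightarrow> grid_per N q \<longrightarrow> grid_per N f \<longrightarrow> grid_per N r \<longrightarrow> grid_per N p' \<longrightarrow> grid_per N q' \<longrightarrow>
     mean_zero N (\<lambda>i j. p i j - f i j) \<longrightarrow> mean_zero N (\<lambda>i j. q i j - r i j) \<longrightarrow>
     mean_zero N (\<lambda>i j. p' i j - f' i j) \<longrightarrow> mean_zero N (\<lambda>i j. q' i j - r' i j) \<longrightarrow>
     (\<forall>i j. 0 < q' i j \<and> q' i j < 1) \<longrightarrow>
     scheme_step \<alpha> \<beta> \<epsilon> \<eta> \<xi> \<delta> M h N dt f r f' r' \<longrightarrow>
     consistent_phi \<alpha> \<epsilon> \<eta> \<delta> M h N dt \<theta> p p' q' \<longrightarrow> consistent_rho \<alpha> \<beta> \<xi> \<delta> M h N dt \<theta> q p' q' \<longrightarrow>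
     err_low h N (\<lambda>i j. p' i j - f' i j) (\<lambda>i j. q' i j - r' i j)
       + 3/2 * (dt * M * err_high \<epsilon> \<eta> \<xi> h N (\<lambda>i j. p' i j - f' i j) (\<lambda>i j. q' i j - r' i j))
     \<le> err_low h N (\<lambda>i j. p i j - f i j) (\<lambda>i j. q i j - r i j)
       + 1/2 * (dt * M * err_high \<epsilon> \<eta> \<xi> h N (\<lambda>i j. p i j - f i j) (\<lambda>i j. q i j - r i j))
       + C * dt * (err_low h N (\<lambda>i j. p i j - f i j) (\<lambda>i j. q i j - r i j)
         + err_low h N (\<lambda>i j. p' i j - f' i j) (\<lambda>i j. q' i j - r' i j) + \<theta>\<^sup>2)"
proof -
  obtain K where K: "K \<ge> 0" and expl: "\<And>N h e d e' d'. N > 0 \<Longrightarrow> h > 0 \<Longrightarrow>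
     grid_per N e \<Longrightarrow> grid_per N d \<Longrightarrow> grid_per N e' \<Longrightarrow> grid_per N d' \<Longrightarrow>
     mean_zero N e \<Longrightarrow> mean_zero N d \<Longrightarrow> mean_zero N e' \<Longrightarrow> mean_zero N d' \<Longrightarrow>
     1/(4*\<epsilon>) * grid_inner h N e e' + \<alpha>/\<delta> * grad_inner h N e e' + \<alpha> * (sqrt 2 - 1) * grid_inner h N d d'
     \<le> (err_high \<epsilon> \<eta> \<xi> h N e d + err_high \<epsilon> \<eta> \<xi> h N e' d') / 32 + K * (err_low h N e d + err_low h N e' d')"
    using explicit_part_bound[OF par(1,3,4,5,6)] by meson
  \<comment> \<open>The coefficients of the squared truncation error in Young's inequality: 1 for
    each of the two H^(-1) norms, and \<open>8/(M*k)\<close> for a dissipation term with coefficient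
    \<open>k\<close>, of which \<open>1/32\<close> is given away.\<close>
  define K2 where "K2 = 2 + 8/(M*\<eta>\<^sup>2) + 8/(M*\<epsilon>) + 8/(M*\<xi>)"
  define C where "C = 2 * M * K + 2 + 2 * K2"
  have K2: "K2 \<ge> 0" using par by (simp add: K2_def)
  have C: "C \<ge> 0" using par K K2 by (simp add: C_def)
  show ?thesis
  proof (intro exI[of _ C] conjI C allI impI)
    fix N h dt \<theta> p q f r p' q' f' r'
    assume N: "N > 0" "h > (0::real)" and dt: "dt > (0::real)" and th: "\<theta> \<ge> (0::real)"
      and per: "grid_per N p" "grid_per N q" "grid_per N f" "grid_per N r" "grid_per N p'" "grid_per N q'"
      and mz: "mean_zero N (\<lambda>i j. p i j - f i j)" "mean_zero N (\<lambda>i j. q i j - r i j)"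
        "mean_zero N (\<lambda>i j. p' i j - f' i j)" "mean_zero N (\<lambda>i j. q' i j - r' i j)"
      and pos: "\<forall>i j. 0 < q' i j \<and> q' i j < 1"
      and step: "scheme_step \<alpha> \<beta> \<epsilon> \<eta> \<xi> \<delta> M h N dt f r f' r'"
      and cons: "consistent_phi \<alpha> \<epsilon> \<eta> \<delta> M h N dt \<theta> p p' q'" "consistent_rho \<alpha> \<beta> \<xi> \<delta> M h N dt \<theta> q p' q'"
    define e where "e = (\<lambda>i j. p i j - f i j)"
    define d where "d = (\<lambda>i j. q i j - r i j)"
    define e' where "e' = (\<lambda>i j. p' i j - f' i j)"
    define d' where "d' = (\<lambda>i j. q' i j - r' i j)"
    have st: "grid_per N f'" "grid_per N r'" "\<And>i j. 0 < r' i j \<and> r' i j < 1"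
      "\<And>i j. (f' i j - f i j) / dt = M * lap_h h (mu_phi_h \<alpha> \<epsilon> \<eta> \<delta> h f f' r') i j"
      "\<And>i j. (r' i j - r i j) / dt = M * lap_h h (mu_rho_h \<alpha> \<beta> \<xi> \<delta> h r f' r') i j"
      using step by (auto simp: scheme_step_def)
    have pe: "grid_per N e" "grid_per N d" "grid_per N e'" "grid_per N d'"
      unfolding e_def d_def e'_def d'_def by (intro grid_per_diff per st)+
    have me: "mean_zero N e" "mean_zero N d" "mean_zero N e'" "mean_zero N d'"
      using mz by (simp_all add: e_def d_def e'_def d'_def)
    let ?\<psi> = "inv_neg_lap_h h N e'" and ?\<chi> = "inv_neg_lap_h h N d'"
    define m1 where "m1 = grid_inner h N (mu_phi_h \<alpha> \<epsilon> \<eta> \<delta> h p p' q') e' - grid_inner h N (mu_phi_h \<alpha> \<epsilon> \<eta> \<delta> h f f' r') e'"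
    define m2 where "m2 = grid_inner h N (mu_rho_h \<alpha> \<beta> \<xi> \<delta> h q p' q') d' - grid_inner h N (mu_rho_h \<alpha> \<beta> \<xi> \<delta> h r f' r') d'"
    let ?a = "err_low h N e d" and ?a' = "err_low h N e' d'"
    let ?b = "err_high \<epsilon> \<eta> \<xi> h N e d" and ?b' = "err_high \<epsilon> \<eta> \<xi> h N e' d'"
    define x where "x = norm_m1 h N e'"
    define y where "y = norm_m1 h N d'"
    define g where "g = grad_norm2 h N e'"
    define l where "l = grid_norm2 h N (lap_h h e')"
    define s where "s = grad_norm2 h N d'"
    have nn: "0 \<le> g" "0 \<le> l" "0 \<le> s" by (simp_all add: g_def l_def s_def grad_norm2_nonneg grid_norm2_nonneg)
    have w1: "grid_inner h N (\<lambda>i j. f' i j - f i j) ?\<psi> = - dt * M * grid_inner h N (mu_phi_h \<alpha> \<epsilon> \<eta> \<delta> h f f' r') e'"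
      by (rule scheme_weak_form[OF st(4) _ grid_per_mu_phi_h[OF per(3) st(1,2)] pe(3) me(3) N]) (use dt in simp)
    have w2: "grid_inner h N (\<lambda>i j. r' i j - r i j) ?\<chi> = - dt * M * grid_inner h N (mu_rho_h \<alpha> \<beta> \<xi> \<delta> h r f' r') d'"
      by (rule scheme_weak_form[OF st(5) _ grid_per_mu_rho_h[OF per(4) st(1,2)] pe(4) me(4) N]) (use dt in simp)
    have c1: "grid_inner h N (\<lambda>i j. p' i j - p i j) ?\<psi> + dt * M * grid_inner h N (mu_phi_h \<alpha> \<epsilon> \<eta> \<delta> h p p' q') e'
        \<le> dt * \<theta> * (x + g + l)"
      using cons(1) pe(3) me(3) unfolding consistent_phi_def x_def g_def l_def by (meson abs_le_D1)
    have c2: "grid_inner h N (\<lambda>i j. q' i j - q i j) ?\<chi> + dt * M * grid_inner h N (mu_rho_h \<alpha> \<beta> \<xi> \<delta> h q p' q') d'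
        \<le> dt * \<theta> * (y + s)"
      using cons(2) pe(4) me(4) unfolding consistent_rho_def y_def s_def by (meson abs_le_D1)
    have s1: "grid_inner h N (\<lambda>i j. e' i j - e i j) ?\<psi> =
        grid_inner h N (\<lambda>i j. p' i j - p i j) ?\<psi> - grid_inner h N (\<lambda>i j. f' i j - f i j) ?\<psi>"
      unfolding grid_inner_diff_left[symmetric] by (rule grid_inner_cong) (simp_all add: e_def e'_def)
    have s2: "grid_inner h N (\<lambda>i j. d' i j - d i j) ?\<chi> =
        grid_inner h N (\<lambda>i j. q' i j - q i j) ?\<chi> - grid_inner h N (\<lambda>i j. r' i j - r i j) ?\<chi>"
      unfolding grid_inner_diff_left[symmetric] by (rule grid_inner_cong) (simp_all add: d_def d'_def)
    have i1: "(?a' - ?a) / 2 + dt * M * (m1 + m2) \<le> dt * \<theta> * (x + g + l) + dt * \<theta> * (y + s)"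
      using time_difference_bound[OF pe(1,3) me(1,3) N] time_difference_bound[OF pe(2,4) me(2,4) N] w1 w2 c1 c2 s1 s2
      by (simp add: err_low_def m1_def m2_def algebra_simps diff_divide_distrib add_divide_distrib)
    have "?b' \<le> m1 + m2 + (1/(4*\<epsilon>) * grid_inner h N e e' + \<alpha>/\<delta> * grad_inner h N e e' + \<alpha> * (sqrt 2 - 1) * grid_inner h N d d')"
      using scheme_coercive[OF par(1,2,3,6) per(1,3,5) st(1) per(6) st(2), where h = h and \<eta> = \<eta> and \<xi> = \<xi> and q = q and r = r] pos st(3)
      by (simp add: e_def[symmetric] d_def[symmetric] e'_def[symmetric] d'_def[symmetric] m1_def m2_def
          err_high_def grid_norm2_sq grad_norm2_sq)
    also have "\<dots> \<le> m1 + m2 + ((?b + ?b') / 32 + K * (?a + ?a'))"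
      by (intro add_left_mono expl N pe me)
    finally have "dt * M * (?b' - ((?b + ?b') / 32 + K * (?a + ?a'))) \<le> dt * M * (m1 + m2)"
      using dt par by (intro mult_left_mono) auto
    then have i2: "(?a' - ?a) / 2 + dt * M * ?b' \<le> dt * M * (?b + ?b') / 32 + dt * M * K * (?a + ?a')
        + dt * (\<theta> * (x + g + l + y + s))"
      using i1 by (simp add: algebra_simps)
    have "\<theta> * (x + g + l + y + s) \<le> ?a' + M * ?b' / 32 + K2 * \<theta>\<^sup>2"
    proof -
      have "\<theta> * x \<le> x\<^sup>2 + \<theta>\<^sup>2" "\<theta> * y \<le> y\<^sup>2 + \<theta>\<^sup>2"
        using Young_weighted[of 1 x \<theta>] Young_weighted[of 1 y \<theta>] zero_le_power2[of \<theta>]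
        unfolding mult.commute[of \<theta>] by linarith+
      moreover have "\<theta> * g \<le> M * \<epsilon> / 32 * g\<^sup>2 + 8/(M*\<epsilon>) * \<theta>\<^sup>2"
        using Young_weighted[of "M * \<epsilon> / 32" g \<theta>] par by (simp add: mult.commute)
      moreover have "\<theta> * l \<le> M * \<eta>\<^sup>2 / 32 * l\<^sup>2 + 8/(M*\<eta>\<^sup>2) * \<theta>\<^sup>2"
        using Young_weighted[of "M * \<eta>\<^sup>2 / 32" l \<theta>] par by (simp add: mult.commute)
      moreover have "\<theta> * s \<le> M * \<xi> / 32 * s\<^sup>2 + 8/(M*\<xi>) * \<theta>\<^sup>2"
        using Young_weighted[of "M * \<xi> / 32" s \<theta>] par by (simp add: mult.commute)
      ultimately have "\<theta> * x + \<theta> * g + \<theta> * l + \<theta> * y + \<theta> * s \<le>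
         x\<^sup>2 + y\<^sup>2 + (M * \<epsilon> / 32 * g\<^sup>2 + M * \<eta>\<^sup>2 / 32 * l\<^sup>2 + M * \<xi> / 32 * s\<^sup>2) + (2 * \<theta>\<^sup>2 + 8/(M*\<epsilon>) * \<theta>\<^sup>2 + 8/(M*\<eta>\<^sup>2) * \<theta>\<^sup>2 + 8/(M*\<xi>) * \<theta>\<^sup>2)"
        by linarith
      also have "2 * \<theta>\<^sup>2 + 8/(M*\<epsilon>) * \<theta>\<^sup>2 + 8/(M*\<eta>\<^sup>2) * \<theta>\<^sup>2 + 8/(M*\<xi>) * \<theta>\<^sup>2 = K2 * \<theta>\<^sup>2"
        by (simp add: K2_def algebra_simps)
      also have "M * \<epsilon> / 32 * g\<^sup>2 + M * \<eta>\<^sup>2 / 32 * l\<^sup>2 + M * \<xi> / 32 * s\<^sup>2 = M * ?b' / 32"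
        by (simp add: err_high_def g_def l_def s_def algebra_simps)
      finally show ?thesis by (simp add: err_low_def x_def y_def distrib_left)
    qed
    then have *: "dt * (\<theta> * (x + g + l + y + s)) \<le> dt * (?a' + M * ?b' / 32 + K2 * \<theta>\<^sup>2)"
      using dt by (intro mult_left_mono) auto
 \<comment> \<open>Twice the previous inequality. Of the dissipation, \<open>1/16\<close> of the old
   and \<open>1/8\<close> of the new level have been spent, well within what the claim
   concedes.\<close>
 have i3: "?a' + 2 * (dt * M * ?b') \<le> ?a + dt * M * ?b / 16 + dt * M * ?b' / 8 + 2 * (dt * M * K * (?a + ?a'))
       + 2 * (dt * ?a') + 2 * (dt * (K2 * \<theta>\<^sup>2))"
    proof -
      have "dt * (?a' + M * ?b' / 32 + K2 * \<theta>\<^sup>2) = dt * ?a' + dt * M * ?b' / 32 + dt * (K2 * \<theta>\<^sup>2)"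
        "dt * M * (?b + ?b') / 32 = dt * M * ?b / 32 + dt * M * ?b' / 32"
        by (simp_all add: algebra_simps add_divide_distrib)
      then show ?thesis using i2 * by (simp only: diff_divide_distrib mult.assoc[symmetric])
    qed
    have b0: "0 \<le> dt * M * ?b" "0 \<le> dt * M * ?b'" using dt par by (simp_all add: err_high_def)
    have a0: "0 \<le> ?a" "0 \<le> ?a'" by (simp_all add: err_low_def)
    have "C * dt * (?a + ?a' + \<theta>\<^sup>2) = 2 * (dt * M * K * (?a + ?a')) + 2 * (dt * ?a') + 2 * (dt * (K2 * \<theta>\<^sup>2))
       + (2 * M * K * dt * \<theta>\<^sup>2 + 2 * dt * ?a + 2 * dt * \<theta>\<^sup>2 + 2 * K2 * dt * (?a + ?a'))"
      by (simp add: C_def algebra_simps)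
    moreover have "0 \<le> 2 * M * K * dt * \<theta>\<^sup>2 + 2 * dt * ?a + 2 * dt * \<theta>\<^sup>2 + 2 * K2 * dt * (?a + ?a')"
      using dt par K K2 a0 by simp
    ultimately have "?a' + 3/2 * (dt * M * ?b') \<le> ?a + 1/2 * (dt * M * ?b) + C * dt * (?a + ?a' + \<theta>\<^sup>2)"
      using i3 b0 by linarith
    then show "err_low h N (\<lambda>i j. p' i j - f' i j) (\<lambda>i j. q' i j - r' i j)
       + 3/2 * (dt * M * err_high \<epsilon> \<eta> \<xi> h N (\<lambda>i j. p' i j - f' i j) (\<lambda>i j. q' i j - r' i j))
     \<le> err_low h N (\<lambda>i j. p i j - f i j) (\<lambda>i j. q i j - r i j)
       + 1/2 * (dt * M * err_high \<epsilon> \<eta> \<xi> h N (\<lambda>i j. p i j - f i j) (\<lambda>i j. q i j - r i j))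
       + C * dt * (err_low h N (\<lambda>i j. p i j - f i j) (\<lambda>i j. q i j - r i j)
         + err_low h N (\<lambda>i j. p' i j - f' i j) (\<lambda>i j. q' i j - r' i j) + \<theta>\<^sup>2)"
      unfolding e_def d_def e'_def d'_def .
  qed
qed

text \<open>The new error occurs on both sides, and half of the old dissipation on the right; the
  induction is run for \<open>X\<close>, which contains these together with the accumulated
  dissipation. The restriction \<open>C * dt \<le> 1/2\<close> pays for the implicit occurrence and
  is the only smallness condition of the whole proof.\<close>

lemma discrete_Gronwall:
  fixes a b \<theta> :: "nat \<Rightarrow> real"
  assumes step: "\<And>n. n < m \<Longrightarrow> a (Suc n) + 3/2 * b (Suc n) \<le> a n + 1/2 * b n + C * dt * (a n + a (Suc n) + \<theta> n)"
    and nn: "\<And>n. 0 \<le> a n" "\<And>n. 0 \<le> b n" "\<And>n. 0 \<le> \<theta> n" "0 \<le> C" "0 < dt" "C * dt \<le> 1/2"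
  shows "n \<le> m \<Longrightarrow> a n + (\<Sum>k=1..n. b k) \<le> exp (4 * C * dt * real n) * (a 0 + b 0 + 2 * C * dt * (\<Sum>k<n. \<theta> k))"
proof -
  define X where "X = (\<lambda>n. a n + 1/2 * b n + (\<Sum>k=1..n. b k))"
  define E where "E = exp (4 * C * dt)"
  have E: "E \<ge> 1" using nn by (simp add: E_def)
  have "X n \<le> E ^ n * (a 0 + b 0 + 2 * C * dt * (\<Sum>k<n. \<theta> k))" if "n \<le> m" for n
    using that
  proof (induction n)
    case 0
    show ?case using nn(2)[of 0] by (simp add: X_def)
  next
    case (Suc n)
    let ?z = "C * dt"
    have z: "0 \<le> ?z" "?z \<le> 1/2" using nn by auto
    have 1: "X (Suc n) \<le> X n + ?z * (a n + a (Suc n) + \<theta> n)"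
      using step[of n] Suc.prems by (simp add: X_def algebra_simps)
    have 2: "a n \<le> X n" "a (Suc n) \<le> X (Suc n)" using nn by (simp_all add: X_def sum_nonneg)
    have "?z * (a n + a (Suc n) + \<theta> n) \<le> ?z * (X n + X (Suc n) + \<theta> n)"
      using 2 z by (intro mult_left_mono) auto
    then have 3: "(1 - ?z) * X (Suc n) \<le> (1 + ?z) * X n + ?z * \<theta> n"
      using 1 by (simp add: algebra_simps)
    have X0: "0 \<le> X n" using 2(1) nn(1)[of n] by linarith
    \<comment> \<open>Below \<open>1/2\<close>, dividing by \<open>1 - z\<close> costs at most the
      factor \<open>exp (4 * z)\<close>: already the product of \<open>1 - z\<close> and
      \<open>1 + 4 * z\<close> exceeds \<open>1 + z\<close>, with surplus
      \<open>z * (2 - 4 * z)\<close>.\<close>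
    have r1: "1 + ?z \<le> (1 - ?z) * E"
    proof -
      have "1 + 4 * ?z \<le> E" using exp_ge_add_one_self[of "4 * ?z"] by (simp add: E_def mult.assoc)
      then have "(1 - ?z) * (1 + 4 * ?z) \<le> (1 - ?z) * E" using z by (intro mult_left_mono) auto
      moreover have "1 + ?z \<le> (1 - ?z) * (1 + 4 * ?z)"
      proof -
        have "0 \<le> ?z * (2 - 4 * ?z)" by (rule mult_nonneg_nonneg) (use z in auto)
        then show ?thesis by (simp add: algebra_simps)
      qed
      ultimately show ?thesis by linarith
    qed
    have r2: "?z \<le> (1 - ?z) * (2 * ?z)"
    proof -
      have "0 \<le> ?z * (1 - 2 * ?z)" by (rule mult_nonneg_nonneg) (use z in auto)
      then show ?thesis by (simp add: algebra_simps)
    qed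
    have "(1 - ?z) * X (Suc n) \<le> (1 - ?z) * (E * X n + 2 * ?z * \<theta> n)"
      using 3 mult_right_mono[OF r1 X0] mult_right_mono[OF r2 nn(3)[of n]] by (simp add: algebra_simps)
    then have 4: "X (Suc n) \<le> E * X n + 2 * ?z * \<theta> n" using z by (simp add: mult_le_cancel_left)
    have "E * X n \<le> E * (E ^ n * (a 0 + b 0 + 2 * C * dt * (\<Sum>k<n. \<theta> k)))"
      using Suc E by (intro mult_left_mono) auto
    moreover have "1 * (2 * ?z * \<theta> n) \<le> E ^ Suc n * (2 * ?z * \<theta> n)"
      using E z nn(3) by (intro mult_right_mono one_le_power) auto
    ultimately have "X (Suc n) \<le> E * (E ^ n * (a 0 + b 0 + 2 * C * dt * (\<Sum>k<n. \<theta> k))) + E ^ Suc n * (2 * ?z * \<theta> n)"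
      using 4 by linarith
    also have "\<dots> = E ^ Suc n * (a 0 + b 0 + 2 * C * dt * (\<Sum>k<Suc n. \<theta> k))"
      by (simp add: algebra_simps)
    finally show ?case .
  qed
  moreover have "E ^ n = exp (4 * C * dt * real n)" for n by (simp add: E_def exp_of_nat_mult[symmetric] mult_ac)
  moreover have "a n + (\<Sum>k=1..n. b k) \<le> X n" for n using nn(2)[of n] by (simp add: X_def)
  ultimately show "n \<le> m \<Longrightarrow> a n + (\<Sum>k=1..n. b k) \<le> exp (4 * C * dt * real n) * (a 0 + b 0 + 2 * C * dt * (\<Sum>k<n. \<theta> k))"
    by (metis order_trans)
qed

subsection \<open>Smooth test functions in time\<close>

definition smooth_real :: "(real \<Rightarrow> real) \<Rightarrow> bool" where
  "smooth_real f \<longleftrightarrow> (\<forall>k t. (deriv ^^ k) f differentiable (at t))"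

text \<open>A class of differentiable functions that is closed under differentiation consists of
  smooth functions. This spares formulas for higher derivatives of sums and of bump
  functions.\<close>

lemma smooth_real_coinduct:
  assumes "f \<in> S" and "\<And>g t. g \<in> S \<Longrightarrow> g differentiable (at t)" and "\<And>g. g \<in> S \<Longrightarrow> deriv g \<in> S"
  shows "smooth_real f"
proof -
  have "(deriv ^^ k) f \<in> S" for k by (induction k) (use assms in auto)
  then show ?thesis using assms(2) by (auto simp: smooth_real_def)
qed

lemma smooth_real_deriv: "smooth_real f \<Longrightarrow> smooth_real (deriv f)"
  unfolding smooth_real_def by (metis comp_apply funpow_Suc_right)

lemma smooth_real_differentiable: "smooth_real f \<Longrightarrow> f differentiable (at t)"
  unfolding smooth_real_def by (metis funpow_0)

lemma smooth_real_has_deriv: "smooth_real f \<Longrightarrow> (f has_real_derivative deriv f t) (at t)"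
  by (simp add: smooth_real_differentiable DERIV_deriv_iff_real_differentiable)

text \<open>Differentiation shifts the sequence of derivatives by one. In this way the successive
  primitives of the bump inherit its smoothness.\<close>

lemma smooth_realI:
  assumes "\<And>t. (f has_real_derivative g t) (at t)" "smooth_real g"
  shows "smooth_real f"
proof -
  have "deriv f = g" using assms(1) by (intro ext DERIV_imp_deriv) auto
  have "(deriv ^^ k) f differentiable (at t)" for k t
  proof (cases k)
    case 0
    then show ?thesis using assms(1) by (auto simp: real_differentiable_def)
  next
    case (Suc m)
    then have "(deriv ^^ k) f = (deriv ^^ m) g" by (simp add: funpow_swap1 \<open>deriv f = g\<close>)
    then show ?thesis using assms(2) by (simp add: smooth_real_def)
  qed
  then show ?thesis by (simp add: smooth_real_def)
qed

lemma smooth_real_add: "smooth_real f \<Longrightarrow> smooth_real g \<Longrightarrow> smooth_real (\<lambda>t. f t + g t)"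
proof (rule smooth_real_coinduct[where S = "{\<lambda>t. f t + g t | f g. smooth_real f \<and> smooth_real g}"])
  fix u assume "u \<in> {\<lambda>t. f t + g t | f g. smooth_real f \<and> smooth_real g}"
  then obtain f g where u: "u = (\<lambda>t. f t + g t)" "smooth_real f" "smooth_real g" by auto
  have D: "(u has_real_derivative deriv f t + deriv g t) (at t)" for t
    unfolding u by (intro DERIV_add smooth_real_has_deriv u)
  then show "u differentiable (at t)" for t by (auto simp: real_differentiable_def)
  have "deriv u = (\<lambda>t. deriv f t + deriv g t)" using D by (intro ext DERIV_imp_deriv)
  then show "deriv u \<in> {\<lambda>t. f t + g t | f g. smooth_real f \<and> smooth_real g}"
    using u smooth_real_deriv by blast
qed auto

lemma smooth_real_affine: "smooth_real f \<Longrightarrow> smooth_real (\<lambda>t. c * f (t - a))"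
proof (rule smooth_real_coinduct[where S = "{\<lambda>t. c * f (t - a) | f. smooth_real f}"])
  fix u assume "u \<in> {\<lambda>t. c * f (t - a) | f. smooth_real f}"
  then obtain f where u: "u = (\<lambda>t. c * f (t - a))" "smooth_real f" by auto
  have D: "(u has_real_derivative c * deriv f (t - a)) (at t)" for t
    unfolding u using DERIV_shift[of f "deriv f (t - a)" t "- a"] smooth_real_has_deriv[OF u(2), of "t - a"]
    by (intro DERIV_cmult) simp
  then show "u differentiable (at t)" for t by (auto simp: real_differentiable_def)
  have "deriv u = (\<lambda>t. c * deriv f (t - a))" using D by (intro ext DERIV_imp_deriv)
  then show "deriv u \<in> {\<lambda>t. c * f (t - a) | f. smooth_real f}"
    using u smooth_real_deriv by blast
qed auto

section \<open>A smooth bump function with compact support\<close>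

definition flat_exp :: "real poly \<Rightarrow> real \<Rightarrow> real" where
  "flat_exp p x = (if x > 0 then poly p (1 / x) * exp (- (1 / x)) else 0)"

lemma poly_div_exp_tendsto_0: "((\<lambda>y. poly p y * exp (- y)) \<longlongrightarrow> 0) at_top" for p :: "real poly"
proof -
  have "((\<lambda>y. \<Sum>i\<le>degree p. coeff p i * (y ^ i / exp y)) \<longlongrightarrow> (\<Sum>i\<le>degree p. coeff p i * 0)) at_top"
    by (intro tendsto_sum tendsto_mult tendsto_const tendsto_power_div_exp_0)
  moreover have "(\<Sum>i\<le>degree p. coeff p i * (y ^ i / exp y)) = poly p y * exp (- y)" for y
    by (simp add: poly_altdef sum_distrib_right exp_minus divide_inverse mult.assoc)
  ultimately show ?thesis by simp
qed

lemma flat_exp_tendsto_0: "(flat_exp p \<longlongrightarrow> 0) (at 0)"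
proof (rule filterlim_split_at)
  have "((\<lambda>x. 0) \<longlongrightarrow> (0::real)) (at_left 0)" by simp
  moreover have "eventually (\<lambda>x. 0 = flat_exp p x) (at_left 0)"
    by (auto simp: flat_exp_def eventually_at_filter)
  ultimately show "(flat_exp p \<longlongrightarrow> 0) (at_left 0)" by (rule Lim_transform_eventually)
next
  have "((\<lambda>x. poly p (inverse x) * exp (- inverse x)) \<longlongrightarrow> 0) (at_right 0)"
    by (rule filterlim_compose[OF poly_div_exp_tendsto_0 filterlim_inverse_at_top_right])
  moreover have "eventually (\<lambda>x. poly p (inverse x) * exp (- inverse x) = flat_exp p x) (at_right 0)"
    by (auto simp: flat_exp_def eventually_at_filter inverse_eq_divide)
  ultimately show "(flat_exp p \<longlongrightarrow> 0) (at_right 0)" by (rule Lim_transform_eventually)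
qed

text \<open>With \<open>y = 1/x\<close>, the derivative of \<open>p(y) * exp(-y)\<close> is
  \<open>y^2 * (p - p')(y) * exp(-y)\<close>, which has the same form with another polynomial. The
  family is thus closed under differentiation, at 0 as well.\<close>

lemma flat_exp_has_derivative:
  "(flat_exp p has_real_derivative flat_exp ([:0, 0, 1:] * (p - pderiv p)) x) (at x)"
proof -
  consider "x < 0" | "x = 0" | "x > 0" by linarith
  then show ?thesis
  proof cases
    case 1
    have "((\<lambda>x. 0) has_real_derivative 0) (at x)" by simp
    then show ?thesis
      by (rule has_field_derivative_transform_within_open[where S = "{..<0}", THEN DERIV_cong])
        (use 1 in \<open>auto simp: flat_exp_def\<close>)
  next
    case 2
    \<comment> \<open>The difference quotient at 0 is again a member of the family, with the
      polynomial multiplied by its variable, and every member tends to 0 there.\<close>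
    have "((\<lambda>y. (flat_exp p y - flat_exp p 0) / (y - 0)) \<longlongrightarrow> 0) (at 0)"
    proof (rule Lim_transform_eventually[OF flat_exp_tendsto_0[of "[:0, 1:] * p"]])
      show "eventually (\<lambda>y. flat_exp ([:0, 1:] * p) y = (flat_exp p y - flat_exp p 0) / (y - 0)) (at 0)"
        by (auto simp: flat_exp_def eventually_at_filter field_simps)
    qed
    then show ?thesis using 2 by (simp add: has_field_derivative_iff flat_exp_def)
  next
    case 3
    have "((\<lambda>x. poly p (1 / x) * exp (- (1 / x))) has_real_derivative
        poly p (1 / x) * (exp (- (1 / x)) * (1 / x\<^sup>2)) + (poly (pderiv p) (1 / x) * (- (1 / x\<^sup>2))) * exp (- (1 / x))) (at x)"
    proof (intro DERIV_mult')
      have i: "((\<lambda>x. 1 / x) has_real_derivative - (1 / x\<^sup>2)) (at x)"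
        using 3 by (auto intro!: derivative_eq_intros simp: power2_eq_square)
      show "((\<lambda>x. poly p (1 / x)) has_real_derivative poly (pderiv p) (1 / x) * - (1 / x\<^sup>2)) (at x)"
        by (rule DERIV_chain2[OF poly_DERIV i])
      show "((\<lambda>x. exp (- (1 / x))) has_real_derivative exp (- (1 / x)) * (1 / x\<^sup>2)) (at x)"
        by (rule DERIV_chain2[OF DERIV_exp, THEN DERIV_cong]) (use DERIV_minus[OF i] in auto)
    qed
    then show ?thesis
      by (rule has_field_derivative_transform_within_open[where S = "{0<..}", THEN DERIV_cong])
        (use 3 in \<open>auto simp: flat_exp_def algebra_simps power2_eq_square\<close>)
  qed
qed

text \<open>Single products would not be closed under differentiation, since the product rule gives
  two of them; hence the closure under addition. All members vanish outside the interval from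
  \<open>-r\<close> to \<open>r\<close>.\<close>

inductive_set bump_functions :: "real \<Rightarrow> (real \<Rightarrow> real) set" for r where
  prod: "(\<lambda>t. flat_exp p (t + r) * flat_exp q (r - t)) \<in> bump_functions r"
| add: "f \<in> bump_functions r \<Longrightarrow> g \<in> bump_functions r \<Longrightarrow> (\<lambda>t. f t + g t) \<in> bump_functions r"

lemma bump_functions_deriv:
  "f \<in> bump_functions r \<Longrightarrow> \<exists>g\<in>bump_functions r. \<forall>t. (f has_real_derivative g t) (at t)"
proof (induction rule: bump_functions.induct)
  case (prod p q)
  let ?d = "\<lambda>p. [:0, 0, 1:] * (p - pderiv p)"
  have "((\<lambda>t. flat_exp p (t + r) * flat_exp q (r - t)) has_real_derivative
     flat_exp (?d p) (t + r) * flat_exp q (r - t) + flat_exp p (t + r) * flat_exp (- ?d q) (r - t)) (at t)" for t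
  proof -
    have 1: "((\<lambda>t. flat_exp p (t + r)) has_real_derivative flat_exp (?d p) (t + r) * 1) (at t)"
      by (rule DERIV_chain2[OF flat_exp_has_derivative]) (auto intro!: derivative_eq_intros)
    have 2: "((\<lambda>t. flat_exp q (r - t)) has_real_derivative flat_exp (?d q) (r - t) * (- 1)) (at t)"
      by (rule DERIV_chain2[OF flat_exp_has_derivative]) (auto intro!: derivative_eq_intros)
    have "flat_exp (- p) x = - flat_exp p x" for p x by (simp add: flat_exp_def)
    then have "flat_exp (- ?d q) (r - t) = flat_exp (?d q) (r - t) * (- 1)" by (simp only: mult_minus1_right)
    then show ?thesis using DERIV_mult'[OF 1 2] by (simp add: add.commute)
  qed
  then show ?case
    by (intro bexI[of _ "\<lambda>t. flat_exp (?d p) (t + r) * flat_exp q (r - t) + flat_exp p (t + r) * flat_exp (- ?d q) (r - t)"])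
      (auto intro!: bump_functions.intros)
next
  case (add f g)
  then obtain f' g' where fg: "f' \<in> bump_functions r" "g' \<in> bump_functions r"
    "\<And>t. (f has_real_derivative f' t) (at t)" "\<And>t. (g has_real_derivative g' t) (at t)" by blast
  have "((\<lambda>t. f t + g t) has_real_derivative f' t + g' t) (at t)" for t by (intro DERIV_add fg)
  then show ?case using fg by (intro bexI[of _ "\<lambda>t. f' t + g' t"]) (auto intro: bump_functions.add)
qed

lemma smooth_bump: "smooth_real (\<lambda>t. flat_exp 1 (t + r) * flat_exp 1 (r - t))"
proof (rule smooth_real_coinduct[of _ "bump_functions r"])
  fix g assume "g \<in> bump_functions r"
  from bump_functions_deriv[OF this] obtain g' where g': "g' \<in> bump_functions r" "\<And>t. (g has_real_derivative g' t) (at t)"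
    by blast
  then show "g differentiable (at t)" for t by (auto simp: real_differentiable_def)
  have "deriv g = g'" using g' by (intro ext DERIV_imp_deriv)
  then show "deriv g \<in> bump_functions r" using g' by simp
qed (rule bump_functions.prod)

section \<open>Mollification and difference quotients in time\<close>

lemma real_antiderivative:
  fixes f :: "real \<Rightarrow> real"
  assumes "\<And>x. isCont f x"
  shows "\<exists>F. \<forall>x. (F has_real_derivative f x) (at x)"
  using einterval_antiderivative[of "-\<infinity>" "\<infinity>" f] assms
  by (auto simp: has_real_derivative_iff_has_vector_derivative)

lemma zero_deriv_imp_const:
  fixes F f :: "real \<Rightarrow> real"
  assumes "\<And>x. (F has_real_derivative f x) (at x)" "\<And>x. x \<in> {a<..<b} \<Longrightarrow> f x = c" "a \<le> b"
  shows "F b - F a = c * (b - a)"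
proof (cases "a = b")
  case False
  then obtain z where "a < z" "z < b" "F b - F a = (b - a) * f z"
    using MVT2[of a b F f] assms(1,3) by auto
  then show ?thesis using assms(2) by simp
qed simp

text \<open>\<open>\<eta>\<close> is the bump normalised to mass 1, \<open>H\<close> a smoothed step
  and \<open>J\<close> a smoothed positive part. Two primitives are needed because second weak
  derivatives will be tested: \<open>J\<close> supplies the test function and \<open>\<eta>\<close>
  its second derivative.\<close>

lemma mollifier_exists:
  fixes r :: real
  assumes r: "r > 0"
  shows "\<exists>\<eta> H J. smooth_real \<eta> \<and> (\<forall>x. (H has_real_derivative \<eta> x) (at x)) \<and> (\<forall>x. (J has_real_derivative H x) (at x)) \<and>
    (\<forall>x. 0 \<le> \<eta> x) \<and> (\<forall>x. \<bar>x\<bar> \<ge> r \<longrightarrow> \<eta> x = 0) \<and> (\<forall>x. 0 \<le> H x \<and> H x \<le> 1) \<and>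
    (\<forall>x \<le> - r. H x = 0) \<and> (\<forall>x \<ge> r. H x = 1) \<and> (\<forall>x \<le> - r. J x = 0) \<and> (\<exists>c. \<forall>x \<ge> r. J x = x + c)"
proof -
  define b where "b = (\<lambda>t. flat_exp 1 (t + r) * flat_exp 1 (r - t))"
  have sb: "smooth_real b" unfolding b_def by (rule smooth_bump)
  have b0: "b x \<ge> 0" for x by (simp add: b_def flat_exp_def)
  have bz: "b x = 0" if "\<bar>x\<bar> \<ge> r" for x using that by (auto simp: b_def flat_exp_def)
  have bp: "b x > 0" if "- r < x" "x < r" for x using that by (simp add: b_def flat_exp_def)
  have "isCont b x" for x using smooth_real_has_deriv[OF sb] DERIV_isCont by blast
  then obtain B where B: "\<And>x. (B has_real_derivative b x) (at x)" using real_antiderivative by blast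
  define m where "m = B r - B (- r)"
  have m: "m > 0"
  proof -
    obtain z where "- r < z" "z < r" "B r - B (- r) = (r - (- r)) * b z"
      using MVT2[of "- r" r B b] B r by auto
    then show ?thesis using bp r by (simp add: m_def)
  qed
  define \<eta> where "\<eta> = (\<lambda>x. b x / m)"
  define H where "H = (\<lambda>x. (B x - B (- r)) / m)"
  have s\<eta>: "smooth_real \<eta>" using smooth_real_affine[OF sb, of "1/m" 0] by (simp add: \<eta>_def)
  have H': "(H has_real_derivative \<eta> x) (at x)" for x
    unfolding H_def \<eta>_def using DERIV_cdivide[OF DERIV_diff[OF B DERIV_const[of "B (- r)"]], of m x] by simp
  have \<eta>: "\<eta> x \<ge> 0" "\<bar>x\<bar> \<ge> r \<Longrightarrow> \<eta> x = 0" for x using b0 m bz by (simp_all add: \<eta>_def)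
  have H0: "H x = 0" if "x \<le> - r" for x
  proof -
    have "H (- r) - H x = 0 * (- r - x)" by (rule zero_deriv_imp_const[OF H']) (use that \<eta>(2) in auto)
    then show ?thesis by (simp add: H_def)
  qed
  have Hr: "H r = 1" using m by (simp add: H_def m_def)
  have H1: "H x = 1" if "x \<ge> r" for x
  proof -
    have "H x - H r = 0 * (x - r)" by (rule zero_deriv_imp_const[OF H']) (use that r \<eta>(2) in auto)
    then show ?thesis using Hr by simp
  qed
  have mono: "H x \<le> H y" if "x \<le> y" for x y
    by (rule DERIV_nonneg_imp_nondecreasing[OF that]) (use H' \<eta>(1) in blast)
  have H01: "0 \<le> H x" "H x \<le> 1" for x
    using mono[of x "max x r"] H1[of "max x r"] mono[of "min x (- r)" x] H0[of "min x (- r)"] by simp_all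
  have "isCont H x" for x using H' DERIV_isCont by blast
  then obtain J0 where J0: "\<And>x. (J0 has_real_derivative H x) (at x)" using real_antiderivative by blast
  define J where "J = (\<lambda>x. J0 x - J0 (- r))"
  have J': "(J has_real_derivative H x) (at x)" for x
    unfolding J_def using DERIV_diff[OF J0 DERIV_const[of "J0 (- r)"], of x] by simp
  have Jz: "J x = 0" if "x \<le> - r" for x
  proof -
    have "J (- r) - J x = 0 * (- r - x)" by (rule zero_deriv_imp_const[OF J']) (use that H0 in auto)
    then show ?thesis by (simp add: J_def)
  qed
  have "J x = x + (J r - r)" if "x \<ge> r" for x
  proof -
    have "J x - J r = 1 * (x - r)" by (rule zero_deriv_imp_const[OF J']) (use that H1 in auto)
    then show ?thesis by simp
  qed
  then have "\<exists>c. \<forall>x\<ge>r. J x = x + c" by blast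
  then show ?thesis
    using s\<eta> H' J' \<eta> H01 H0 H1 Jz by (intro exI[of _ \<eta>] exI[of _ H] exI[of _ J]) auto
qed

lemma integrable_continuous_open_interval:
  fixes f :: "real \<Rightarrow> real"
  assumes "continuous_on {0..T} f"
  shows "integrable (lebesgue_on {0<..<T}) f"
proof -
  have "set_integrable lebesgue {0..T} f"
    using continuous_imp_integrable_real[OF assms] by (simp add: integrable_restrict_space set_integrable_def)
  then have "set_integrable lebesgue {0<..<T} f" by (rule set_integrable_subset) auto
  then show ?thesis by (simp add: integrable_restrict_space set_integrable_def)
qed

text \<open>The translated kernel has mass 1 and lives within \<open>r\<close> of \<open>a\<close>,
  so the integral is an average of values of \<open>u\<close> near \<open>a\<close>; the bounds on
  \<open>a\<close> keep the whole mass inside the time interval.\<close>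

lemma mollified_value:
  fixes u \<eta> H :: "real \<Rightarrow> real"
  assumes u: "continuous_on {0..T} u"
    and H: "\<And>x. (H has_real_derivative \<eta> x) (at x)" and \<eta>: "\<And>x. isCont \<eta> x" "\<And>x. 0 \<le> \<eta> x" "\<And>x. \<bar>x\<bar> \<ge> r \<Longrightarrow> \<eta> x = 0"
    and Hb: "\<And>x. x \<le> - r \<Longrightarrow> H x = 0" "\<And>x. x \<ge> r \<Longrightarrow> H x = 1"
    and a: "r \<le> a" "a \<le> T - r" "0 \<le> T"
    and osc: "\<And>t. t \<in> {0..T} \<Longrightarrow> \<bar>t - a\<bar> < r \<Longrightarrow> \<bar>u t - u a\<bar> \<le> e"
  shows "integrable (lebesgue_on {0<..<T}) (\<lambda>t. u t * \<eta> (t - a))"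
    "\<bar>(LINT t|lebesgue_on {0<..<T}. u t * \<eta> (t - a)) - u a\<bar> \<le> e"
proof -
  have c\<eta>: "continuous_on {0..T} (\<lambda>t. \<eta> (t - a))"
    by (intro continuous_at_imp_continuous_on ballI isCont_o2[OF _ \<eta>(1)]) auto
  have c: "continuous_on {0..T} (\<lambda>t. u t * \<eta> (t - a))" by (intro continuous_on_mult u c\<eta>)
  show i: "integrable (lebesgue_on {0<..<T}) (\<lambda>t. u t * \<eta> (t - a))" by (rule integrable_continuous_open_interval[OF c])
  have "(LINT t|lebesgue_on {0<..<T}. u t * \<eta> (t - a)) = integral {0..T} (\<lambda>t. u t * \<eta> (t - a))"
    using lebesgue_integral_eq_integral[OF i] by (simp add: integral_open_interval_real)
  moreover have one: "((\<lambda>t. \<eta> (t - a)) has_integral 1) {0..T}"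
  proof -
    have "((\<lambda>t. \<eta> (t - a)) has_integral (H (T - a) - H (0 - a))) {0..T}"
    proof (rule fundamental_theorem_of_calculus[OF a(3)])
      fix x
      have "((\<lambda>t. H (t - a)) has_real_derivative \<eta> (x - a)) (at x)"
        using DERIV_shift[of H "\<eta> (x - a)" x "- a"] H by simp
      then show "((\<lambda>t. H (t - a)) has_vector_derivative \<eta> (x - a)) (at x within {0..T})"
        by (simp add: has_real_derivative_iff_has_vector_derivative has_vector_derivative_at_within)
    qed
    then show ?thesis using Hb a by simp
  qed
  have "norm (integral {0..T} (\<lambda>t. (u t - u a) * \<eta> (t - a))) \<le> integral {0..T} (\<lambda>t. e * \<eta> (t - a))"
  proof (rule integral_norm_bound_integral)
    show "(\<lambda>t. (u t - u a) * \<eta> (t - a)) integrable_on {0..T}"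
      by (intro integrable_continuous_real continuous_intros u c\<eta>)
    show "(\<lambda>t. e * \<eta> (t - a)) integrable_on {0..T}"
      by (intro integrable_continuous_real continuous_intros c\<eta>)
    fix t assume t: "t \<in> {0..T}"
    show "norm ((u t - u a) * \<eta> (t - a)) \<le> e * \<eta> (t - a)"
    proof (cases "\<bar>t - a\<bar> < r")
      case True
      then show ?thesis using osc[of t] t \<eta>(2)[of "t - a"] by (simp add: abs_mult mult_right_mono)
    next
      case False
      then show ?thesis using \<eta>(3)[of "t - a"] by simp
    qed
  qed
  moreover have "integral {0..T} (\<lambda>t. e * \<eta> (t - a)) = e" using integral_unique[OF one] by (simp only: integral_mult_right)
  moreover have "integral {0..T} (\<lambda>t. (u t - u a) * \<eta> (t - a)) = integral {0..T} (\<lambda>t. u t * \<eta> (t - a)) - u a"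
  proof -
    have "integral {0..T} (\<lambda>t. u t * \<eta> (t - a) - u a * \<eta> (t - a)) =
        integral {0..T} (\<lambda>t. u t * \<eta> (t - a)) - integral {0..T} (\<lambda>t. u a * \<eta> (t - a))"
      by (intro integral_diff integrable_continuous_real continuous_intros u c\<eta> c)
    then show ?thesis using integral_unique[OF one] by (simp add: left_diff_distrib)
  qed
  ultimately show "\<bar>(LINT t|lebesgue_on {0<..<T}. u t * \<eta> (t - a)) - u a\<bar> \<le> e" by (simp only: real_norm_def)
qed

lemma integrable_indicator_mult:
  fixes f :: "real \<Rightarrow> real"
  assumes "integrable (lebesgue_on S) f"
  shows "integrable (lebesgue_on S) (\<lambda>t. indicator {a..b} t * f t)"
proof (rule Bochner_Integration.integrable_bound[OF assms])
  have "(indicator {a..b} :: real \<Rightarrow> real) \<in> borel_measurable (lebesgue_on S)"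
    by (intro measurable_restrict_space1 borel_measurable_indicator) simp
  then show "(\<lambda>t. indicator {a..b} t * f t) \<in> borel_measurable (lebesgue_on S)"
    using assms by (intro borel_measurable_times) auto
qed (auto simp: indicator_def)

text \<open>The test function is \<open>comb J\<close>. Its second derivative
  \<open>comb \<eta>\<close> reproduces, up to sign and mollification, the difference of the two
  quotients, while \<open>comb J\<close> itself takes values in \<open>[-1, 1]\<close> and vanishes
  outside \<open>{t1..t2}\<close>. Two integrations by parts then leave an integral of
  \<open>w\<close> over that interval.\<close>

lemma second_difference_bound:
  fixes u v w \<sigma> :: "real \<Rightarrow> real"
  assumes u: "continuous_on {0..T} u"
    and uv: "\<And>\<theta>. time_test_function T \<theta> \<Longrightarrow>
      (LINT t|lebesgue_on {0<..<T}. u t * deriv \<theta> t) = - (LINT t|lebesgue_on {0<..<T}. v t * \<theta> t)"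
    and vw: "\<And>\<theta>. time_test_function T \<theta> \<Longrightarrow>
      (LINT t|lebesgue_on {0<..<T}. v t * deriv \<theta> t) = - (LINT t|lebesgue_on {0<..<T}. w t * \<theta> t)"
    and \<sigma>: "integrable (lebesgue_on {0<..<T}) \<sigma>" "AE t in lebesgue_on {0<..<T}. \<bar>w t\<bar> \<le> \<sigma> t"
    and ord: "0 \<le> t1" "t1 < a" "a < s" "s < s'" "s' < b" "b < t2" "t2 \<le> T"
  shows "\<bar>(u b - u a) / (b - a) - (u s' - u s) / (s' - s)\<bar>
    \<le> (LINT t|lebesgue_on {0<..<T}. indicator {t1..t2} t * \<sigma> t)" (is "_ \<le> ?S")
proof (rule field_le_epsilon)
  let ?M = "lebesgue_on {0<..<T}"
  fix e0 :: real assume e0: "e0 > 0"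
  \<comment> \<open>The total weight of the four point evaluations, each of which is recovered only
    up to \<open>e\<close>.\<close>
  define A where "A = 2 / (b - a) + 2 / (s' - s)"
  have A: "A > 0" using ord unfolding A_def by (intro add_pos_pos divide_pos_pos) auto
  define e where "e = e0 / A"
  have e: "e > 0" using e0 A by (simp add: e_def)
  have "uniformly_continuous_on {0..T} u" by (rule compact_uniformly_continuous[OF u]) simp
  then obtain k where k: "k > 0" "\<And>x y. x \<in> {0..T} \<Longrightarrow> y \<in> {0..T} \<Longrightarrow> \<bar>y - x\<bar> < k \<Longrightarrow> \<bar>u y - u x\<bar> < e"
    using e unfolding uniformly_continuous_on_def dist_real_def by blast
  \<comment> \<open>Small enough for the uniform continuity of \<open>u\<close>, and for the
    mollified kernel to stay inside the interval from \<open>t1\<close> to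
    \<open>t2\<close>.\<close>
  define r where "r = min k (min ((a - t1) / 2) ((t2 - b) / 2))"
  have r: "r > 0" "r \<le> k" "r \<le> (a - t1) / 2" "r \<le> (t2 - b) / 2"
  proof -
    show "r > 0" using k(1) ord unfolding r_def by simp
    show "r \<le> k" unfolding r_def by (rule min.cobounded1)
    show "r \<le> (a - t1) / 2" "r \<le> (t2 - b) / 2" unfolding r_def by linarith+
  qed
  obtain \<eta> H J where s\<eta>: "smooth_real \<eta>" and H': "\<And>x. (H has_real_derivative \<eta> x) (at x)"
    and J': "\<And>x. (J has_real_derivative H x) (at x)" and \<eta>: "\<And>x. 0 \<le> \<eta> x" "\<And>x. \<bar>x\<bar> \<ge> r \<Longrightarrow> \<eta> x = 0"
    and H01: "\<And>x. 0 \<le> H x \<and> H x \<le> 1" and H0: "\<And>x. x \<le> - r \<Longrightarrow> H x = 0" and H1: "\<And>x. x \<ge> r \<Longrightarrow> H x = 1"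
    and J0: "\<And>x. x \<le> - r \<Longrightarrow> J x = 0" and J1: "\<exists>c. \<forall>x \<ge> r. J x = x + c"
    using mollifier_exists[OF r(1)] by metis
  have c\<eta>: "isCont \<eta> x" for x using smooth_real_has_deriv[OF s\<eta>] DERIV_isCont by blast
  have sH: "smooth_real H" by (rule smooth_realI[OF H' s\<eta>])
  have sJ: "smooth_real J" by (rule smooth_realI[OF J' sH])
  define comb where "comb = (\<lambda>(g :: real \<Rightarrow> real) t. (g (t - a) - g (t - b)) / (b - a) - (g (t - s) - g (t - s')) / (s' - s))"
  have comb_smooth: "smooth_real (comb g)" if "smooth_real g" for g
  proof -
    have "smooth_real (\<lambda>t. (1/(b-a) * g (t - a) + (- 1/(b-a)) * g (t - b)) + ((- 1/(s'-s)) * g (t - s) + 1/(s'-s) * g (t - s')))"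
      by (intro smooth_real_add smooth_real_affine that)
    also have "(\<lambda>t. (1/(b-a) * g (t - a) + (- 1/(b-a)) * g (t - b)) + ((- 1/(s'-s)) * g (t - s) + 1/(s'-s) * g (t - s'))) = comb g"
      by (simp add: comb_def fun_eq_iff diff_divide_distrib)
    finally show ?thesis .
  qed
  have comb_deriv: "deriv (comb g) = comb g'" if "\<And>x. (g has_real_derivative g' x) (at x)" for g g'
  proof (intro ext DERIV_imp_deriv)
    fix t
    have sh: "((\<lambda>t. g (t - x)) has_real_derivative g' (t - x)) (at t)" for x
      using DERIV_shift[of g "g' (t - x)" t "- x"] that by simp
    show "(comb g has_real_derivative comb g' t) (at t)"
      unfolding comb_def by (intro DERIV_diff DERIV_cdivide sh)
  qed
  have dJ: "deriv (comb J) = comb H" and dH: "deriv (comb H) = comb \<eta>"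
    by (rule comb_deriv, fact J', rule comb_deriv, fact H')
  obtain c where c: "\<And>x. x \<ge> r \<Longrightarrow> J x = x + c" using J1 by blast
  have low: "comb g t = 0" if "\<And>x. x \<le> - r \<Longrightarrow> g x = 0" "t \<le> a - r" for g t
    using that ord by (simp add: comb_def)
  \<comment> \<open>To the right of the support \<open>J\<close> is affine with slope 1, so both
    quotients equal 1 and cancel.\<close>
  have hiJ: "comb J t = 0" if "t \<ge> b + r" for t
    using that ord c[of "t - a"] c[of "t - b"] c[of "t - s"] c[of "t - s'"] by (simp add: comb_def)
  have hiH: "comb H t = 0" if "t \<ge> b + r" for t
    using that ord H1[of "t - a"] H1[of "t - b"] H1[of "t - s"] H1[of "t - s'"] by (simp add: comb_def)
  have in1: "0 < a - r" "b + r < T" "t1 \<le> a - r" "b + r \<le> t2"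
    using r ord by (simp_all add: field_simps)
  have test: "time_test_function T g"
    if "smooth_real g" "\<And>t. t \<le> a - r \<Longrightarrow> g t = 0" "\<And>t. t \<ge> b + r \<Longrightarrow> g t = 0" for g
  proof -
    have "\<forall>t. t \<notin> {a - r..b + r} \<longrightarrow> g t = 0" using that(2,3) by force
    moreover have "0 < a - r" "b + r < T" using in1 by auto
    ultimately show ?thesis using that(1) unfolding time_test_function_def smooth_real_def by blast
  qed
  have testJ: "time_test_function T (comb J)" and testH: "time_test_function T (comb H)"
    using test[OF comb_smooth[OF sJ] low[OF J0] hiJ] test[OF comb_smooth[OF sH] low[OF H0] hiH] by auto
  have J_lip: "0 \<le> (J y - J x) / (y - x) \<and> (J y - J x) / (y - x) \<le> 1" if xy: "x < y" for x y
  proof -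
    obtain z where "J y - J x = (y - x) * H z" using MVT2[OF xy, of J H] J' by auto
    then show ?thesis using H01[of z] xy by simp
  qed
  \<comment> \<open>The slope of \<open>J\<close> lies between 0 and 1, so this is a difference of
    two numbers in \<open>[0, 1]\<close>.\<close>
  have combJ: "\<bar>comb J t\<bar> \<le> 1" for t
  proof -
    have "(J (t - a) - J (t - b)) / (b - a) = (J (t - a) - J (t - b)) / ((t - a) - (t - b))"
      "(J (t - s) - J (t - s')) / (s' - s) = (J (t - s) - J (t - s')) / ((t - s) - (t - s'))" by simp_all
    then show ?thesis using J_lip[of "t - b" "t - a"] J_lip[of "t - s'" "t - s"] ord
      unfolding comb_def by (smt (verit))
  qed
  have key: "(LINT t|?M. u t * comb \<eta> t) = (LINT t|?M. w t * comb J t)"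
    using uv[OF testH] vw[OF testJ] by (simp add: dJ dH)
  have "\<bar>LINT t|?M. w t * comb J t\<bar> \<le> (LINT t|?M. \<bar>w t * comb J t\<bar>)"
    by (rule integral_abs_bound)
  also have "\<dots> \<le> ?S"
  proof (rule integral_mono_AE')
    show "integrable ?M (\<lambda>t. indicator {t1..t2} t * \<sigma> t)"
      by (rule integrable_indicator_mult[OF \<sigma>(1)])
    show "AE t in ?M. \<bar>w t * comb J t\<bar> \<le> indicator {t1..t2} t * \<sigma> t"
      using \<sigma>(2)
    proof eventually_elim
      case (elim t)
      show ?case
      proof (cases "t \<in> {t1..t2}")
        case True
        have "\<bar>w t\<bar> * \<bar>comb J t\<bar> \<le> \<sigma> t * 1" by (rule mult_mono) (use elim combJ in auto)
        then show ?thesis using True by (simp add: abs_mult)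
      next
        case False
        then have "comb J t = 0" using low[of J t] hiJ[of t] J0 in1 by force
        then show ?thesis using False by simp
      qed
    qed
    show "AE t in ?M. 0 \<le> indicator {t1..t2} t * \<sigma> t"
      using \<sigma>(2) by eventually_elim (auto simp: indicator_def)
  qed
  finally have bound: "\<bar>LINT t|?M. u t * comb \<eta> t\<bar> \<le> ?S" by (simp add: key)
  have val: "integrable ?M (\<lambda>t. u t * \<eta> (t - x))" "\<bar>(LINT t|?M. u t * \<eta> (t - x)) - u x\<bar> \<le> e"
    if "r \<le> x" "x \<le> T - r" for x
  proof -
    have osc: "\<bar>u t - u x\<bar> \<le> e" if "t \<in> {0..T}" "\<bar>t - x\<bar> < r" for t
      using k(2)[of x t] that \<open>r \<le> x\<close> \<open>x \<le> T - r\<close> r by auto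
    show "integrable ?M (\<lambda>t. u t * \<eta> (t - x))" "\<bar>(LINT t|?M. u t * \<eta> (t - x)) - u x\<bar> \<le> e"
      using mollified_value[OF u H' c\<eta> \<eta> H0 H1 that _ osc] ord by auto
  qed
  define V where "V = (\<lambda>x. LINT t|?M. u t * \<eta> (t - x))"
  have pts: "r \<le> a" "a \<le> T - r" "r \<le> b" "b \<le> T - r" "r \<le> s" "s \<le> T - r" "r \<le> s'" "s' \<le> T - r"
    using in1 ord by auto
  have "(LINT t|?M. u t * comb \<eta> t) =
    (LINT t|?M. (u t * \<eta> (t - a) - u t * \<eta> (t - b)) / (b - a) - (u t * \<eta> (t - s) - u t * \<eta> (t - s')) / (s' - s))"
    by (simp add: comb_def right_diff_distrib)
  also have "\<dots> = (V a - V b) / (b - a) - (V s - V s') / (s' - s)"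
    unfolding V_def
    by (simp add: Bochner_Integration.integral_diff integrable_diff integrable_divide val(1) pts)
  finally have V: "\<bar>(V a - V b) / (b - a) - (V s - V s') / (s' - s)\<bar> \<le> ?S" using bound by simp
  have app: "\<bar>(V x - V y) / l - (u x - u y) / l\<bar> \<le> e * (2 / l)"
    if "r \<le> x" "x \<le> T - r" "r \<le> y" "y \<le> T - r" "l > 0" for x y l
  proof -
    have "\<bar>(V x - V y) - (u x - u y)\<bar> \<le> 2 * e" using val(2)[of x] val(2)[of y] that unfolding V_def by linarith
    then have "\<bar>(V x - V y) - (u x - u y)\<bar> / l \<le> 2 * e / l" using that by (intro divide_right_mono) auto
    then show ?thesis using that by (simp add: diff_divide_distrib[symmetric] mult.commute abs_divide)
  qed
  have "\<bar>(u a - u b) / (b - a) - (u s - u s') / (s' - s)\<bar> \<le> ?S + e * (2 / (b - a)) + e * (2 / (s' - s))"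
    using V app[of a b "b - a"] app[of s s' "s' - s"] pts ord by linarith
  also have "\<dots> = ?S + e * A" by (simp add: A_def distrib_left add.assoc)
  also have "e * A = e0" using A by (simp add: e_def)
  also have "\<bar>(u a - u b) / (b - a) - (u s - u s') / (s' - s)\<bar> = \<bar>(u b - u a) / (b - a) - (u s' - u s) / (s' - s)\<bar>"
  proof -
    have "(u a - u b) / (b - a) - (u s - u s') / (s' - s) = - ((u b - u a) / (b - a) - (u s' - u s) / (s' - s))"
      by (simp add: diff_divide_distrib)
    then show ?thesis by (simp only: abs_minus_cancel)
  qed
  finally show "\<bar>(u b - u a) / (b - a) - (u s' - u s) / (s' - s)\<bar> \<le> ?S + e0" .
qed

text \<open>Shrinking the inner interval to the point \<open>s\<close> replaces its quotient by the
  classical derivative. The outer points are pushed to \<open>t1\<close> and \<open>t2\<close> only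
  afterwards, by continuity, because the test functions need room inside the interval.\<close>

lemma derivative_vs_difference_quotient:
  fixes u v w \<sigma> :: "real \<Rightarrow> real"
  assumes u: "continuous_on {0..T} u"
    and uv: "\<And>\<theta>. time_test_function T \<theta> \<Longrightarrow>
      (LINT t|lebesgue_on {0<..<T}. u t * deriv \<theta> t) = - (LINT t|lebesgue_on {0<..<T}. v t * \<theta> t)"
    and vw: "\<And>\<theta>. time_test_function T \<theta> \<Longrightarrow>
      (LINT t|lebesgue_on {0<..<T}. v t * deriv \<theta> t) = - (LINT t|lebesgue_on {0<..<T}. w t * \<theta> t)"
    and \<sigma>: "integrable (lebesgue_on {0<..<T}) \<sigma>" "AE t in lebesgue_on {0<..<T}. \<bar>w t\<bar> \<le> \<sigma> t"
    and ord: "0 \<le> t1" "t1 < s" "s < t2" "t2 \<le> T"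
    and d: "(u has_real_derivative d) (at s)"
  shows "\<bar>u t2 - u t1 - (t2 - t1) * d\<bar>
    \<le> (t2 - t1) * (LINT t|lebesgue_on {0<..<T}. indicator {t1..t2} t * \<sigma> t)" (is "_ \<le> _ * ?S")
proof -
  define S where "S = ?S"
  have 1: "\<bar>(u b - u a) / (b - a) - d\<bar> \<le> S" if ab: "t1 < a" "a < s" "s < b" "b < t2" for a b
  proof -
    have q: "((\<lambda>s'. (u s' - u s) / (s' - s)) \<longlongrightarrow> d) (at_right s)"
      using has_field_derivative_at_within[OF d, of "{s<..}"] by (simp only: has_field_derivative_iff)
    have lim: "((\<lambda>s'. \<bar>(u b - u a) / (b - a) - (u s' - u s) / (s' - s)\<bar>) \<longlongrightarrow> \<bar>(u b - u a) / (b - a) - d\<bar>) (at_right s)"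
      by (rule tendsto_rabs[OF tendsto_diff[OF tendsto_const q]])
    have "\<bar>(u b - u a) / (b - a) - (u s' - u s) / (s' - s)\<bar> \<le> S" if "s < s'" "s' < b" for s'
      unfolding S_def
      by (rule second_difference_bound[where u = u and v = v and w = w, OF u _ _ \<sigma> ord(1) ab(1,2) that ab(4) ord(4)])
        (fact uv, fact vw)
    then have "eventually (\<lambda>s'. \<bar>(u b - u a) / (b - a) - (u s' - u s) / (s' - s)\<bar> \<le> S) (at_right s)"
      using eventually_at_right_real[OF ab(3)] by (auto elim: eventually_mono)
    then show ?thesis by (rule tendsto_upperbound[OF lim]) simp
  qed
  define A where "A = (\<lambda>n. t1 + (s - t1) / real (n + 2))"
  define B where "B = (\<lambda>n. t2 - (t2 - s) / real (n + 2))"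
  have n0: "(\<lambda>n. c / real (n + 2)) \<longlonglongrightarrow> 0" for c
    using LIMSEQ_ignore_initial_segment[OF lim_const_over_n[of c], of 2] by simp
  have AB: "A \<longlonglongrightarrow> t1" "B \<longlonglongrightarrow> t2"
    using tendsto_add[OF tendsto_const[of t1] n0[of "s - t1"]] tendsto_diff[OF tendsto_const[of t2] n0[of "t2 - s"]]
    unfolding A_def B_def by simp_all
  have in_AB: "t1 < A n \<and> A n < s \<and> s < B n \<and> B n < t2" for n
  proof -
    have "0 < c / real (n + 2) \<and> c / real (n + 2) < c" if "c > 0" for c
      using that by (simp add: divide_less_eq)
    from this[of "s - t1"] this[of "t2 - s"] show ?thesis using ord unfolding A_def B_def by simp
  qed
  have uAB: "(\<lambda>n. u (A n)) \<longlonglongrightarrow> u t1" "(\<lambda>n. u (B n)) \<longlonglongrightarrow> u t2"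
  proof -
    have "A n \<in> {0..T}" "B n \<in> {0..T}" for n using in_AB[of n] ord by auto
    then show "(\<lambda>n. u (A n)) \<longlonglongrightarrow> u t1" "(\<lambda>n. u (B n)) \<longlonglongrightarrow> u t2"
      using continuous_on_tendsto_compose[OF u AB(1)] continuous_on_tendsto_compose[OF u AB(2)] ord by auto
  qed
  have "(\<lambda>n. \<bar>(u (B n) - u (A n)) / (B n - A n) - d\<bar>) \<longlonglongrightarrow> \<bar>(u t2 - u t1) / (t2 - t1) - d\<bar>"
    by (intro tendsto_rabs tendsto_diff tendsto_divide tendsto_const uAB AB) (use ord in simp)
  then have "\<bar>(u t2 - u t1) / (t2 - t1) - d\<bar> \<le> S"
    by (rule LIMSEQ_le_const2) (use 1 in_AB in blast)
  then have "(t2 - t1) * \<bar>(u t2 - u t1) / (t2 - t1) - d\<bar> \<le> (t2 - t1) * S"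
    using ord by (intro mult_left_mono) auto
  moreover have "(t2 - t1) * \<bar>(u t2 - u t1) / (t2 - t1) - d\<bar> = \<bar>(t2 - t1) * ((u t2 - u t1) / (t2 - t1) - d)\<bar>"
    using ord by (simp add: abs_mult)
  moreover have "(t2 - t1) * ((u t2 - u t1) / (t2 - t1) - d) = u t2 - u t1 - (t2 - t1) * d"
  proof -
    have "(t2 - t1) * ((u t2 - u t1) / (t2 - t1)) = u t2 - u t1" using ord by simp
    then show ?thesis by (simp only: right_diff_distrib)
  qed
  ultimately show ?thesis by (simp add: S_def)
qed

subsection \<open>Fourier partial sums in one variable\<close>

definition fmode :: "real \<Rightarrow> int \<Rightarrow> real \<Rightarrow> complex" where
  "fmode L k x = cis (2 * pi * of_int k * x / L)"

definition fcoef :: "real \<Rightarrow> (real \<Rightarrow> complex) \<Rightarrow> int \<Rightarrow> complex" where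
  "fcoef L f k = integral {0..L} (\<lambda>x. f x * cnj (fmode L k x)) / of_real L"

definition fsum :: "real \<Rightarrow> nat \<Rightarrow> (real \<Rightarrow> complex) \<Rightarrow> real \<Rightarrow> complex" where
  "fsum L K f x = (\<Sum>k\<in>{- int K..int K}. fcoef L f k * fmode L k x)"

lemma norm_fmode [simp]: "norm (fmode L k x) = 1"
  by (simp add: fmode_def)

lemma fmode_add: "fmode L (k + l) x = fmode L k x * fmode L l x"
  by (simp add: fmode_def cis_mult add_divide_distrib algebra_simps)

lemma fmode_mult_cnj: "fmode L k x * cnj (fmode L k x) = 1"
  by (simp add: fmode_def cis_cnj cis_mult)

lemma fmode_0 [simp]: "fmode L 0 x = 1"
  by (simp add: fmode_def)

lemma continuous_fmode [continuous_intros]: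
  "continuous_on S f \<Longrightarrow> continuous_on S (\<lambda>x. fmode L k (f x))"
  unfolding fmode_def by (cases "L = 0") (auto intro!: continuous_intros)

lemma fmode_shift_argument: "fmode L k (x + y) = fmode L k x * fmode L k y"
  by (simp add: fmode_def cis_mult add_divide_distrib algebra_simps)

lemma fmode_period: "L \<noteq> 0 \<Longrightarrow> fmode L k (x + L) = fmode L k x"
  using cis_multiple_2pi[of "of_int k"] by (simp add: fmode_shift_argument) (simp add: fmode_def)

lemma fmode_has_vector_derivative:
  "(fmode L k has_vector_derivative (\<i> * of_real (2 * pi * of_int k / L)) * fmode L k x) (at x within S)"
proof -
  define c where "c = \<i> * of_real (2 * pi * of_int k / L)"
  have "((\<lambda>z. exp (c * z)) has_field_derivative exp (c * of_real x) * c) (at (of_real x))"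
    by (auto intro!: derivative_eq_intros)
  then have "((\<lambda>x. exp (c * of_real x)) has_vector_derivative exp (c * of_real x) * c) (at x within S)"
    by (rule has_vector_derivative_real_field)
  moreover have "fmode L k = (\<lambda>x. exp (c * of_real x))"
    by (simp add: fmode_def fun_eq_iff cis_conv_exp c_def mult_ac)
  ultimately show ?thesis by (simp add: c_def mult.commute)
qed

text \<open>As a function of the shift, the integral is a difference of two values of a primitive,
  and its derivative vanishes by periodicity.\<close>

lemma integral_periodic_shift:
  fixes G :: "real \<Rightarrow> complex"
  assumes G: "continuous_on UNIV G" "\<And>x. G (x + L) = G x" and L: "L \<ge> 0"
  shows "integral {0..L} (\<lambda>y. G (y + a)) = integral {0..L} G"
proof -
  have "isCont G x" for x using G(1) by (simp add: continuous_on_eq_continuous_at)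
  then obtain F where F: "\<And>x. (F has_vector_derivative G x) (at x)"
    using einterval_antiderivative[of "-\<infinity>" "\<infinity>" G] by auto
  have sh: "((\<lambda>y. F (y + b)) has_vector_derivative G (y + b)) (at y within S)" for y b S
  proof -
    have "((\<lambda>y. y + b) has_vector_derivative 1) (at y within S)"
      unfolding has_real_derivative_iff_has_vector_derivative[symmetric] by (auto intro!: derivative_eq_intros)
    from vector_diff_chain_within[OF this has_vector_derivative_at_within[OF F]]
    show ?thesis by (simp add: o_def)
  qed
  have int: "integral {0..L} (\<lambda>y. G (y + b)) = F (L + b) - F (0 + b)" for b
    by (rule integral_unique, rule fundamental_theorem_of_calculus[OF L]) (rule sh)
  have *: "((\<lambda>b. F (b + L) - F (b + 0)) has_vector_derivative (G (b + L) - G (b + 0))) (at b within UNIV)" for b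
    by (intro has_vector_derivative_diff sh)
  have "((\<lambda>b. F (b + L) - F (b + 0)) has_vector_derivative 0) (at b within UNIV)" for b
    using *[of b] unfolding G(2) add_0_right diff_self .
  then have "F (a + L) - F (a + 0) = F (0 + L) - F (0 + 0)"
    using has_vector_derivative_zero_constant[OF convex_UNIV, of "\<lambda>b. F (b + L) - F (b + 0)"] by (metis UNIV_I)
  then show ?thesis using int[of a] int[of 0] by (simp add: add.commute)
qed

lemma norm_fcoef_le:
  assumes "continuous_on {0..L} f" "L > 0" "\<And>x. x \<in> {0..L} \<Longrightarrow> norm (f x) \<le> B"
  shows "norm (fcoef L f k) \<le> B"
proof -
  have "norm (integral {0..L} (\<lambda>x. f x * cnj (fmode L k x))) \<le> B * (L - 0)"
    by (rule integral_bound) (use assms in \<open>auto intro!: continuous_intros simp: norm_mult\<close>)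
  then show ?thesis using assms(2) by (simp add: fcoef_def norm_divide field_simps)
qed

lemma fcoef_by_parts:
  assumes L: "L > 0" and D: "\<And>x. (f has_vector_derivative f' x) (at x)" and c: "continuous_on UNIV f'"
    and per: "f L = f 0"
  shows "fcoef L f' k = (\<i> * of_real (2 * pi * of_int k / L)) * fcoef L f k"
proof -
  let ?w = "\<i> * of_real (2 * pi * of_int k / L)"
  have m: "(\<lambda>x. cnj (fmode L k x)) = fmode L (- k)"
    by (simp add: fmode_def fun_eq_iff cis_cnj)
  have cf: "continuous_on UNIV f"
    using D by (intro continuous_at_imp_continuous_on ballI) (metis has_vector_derivative_continuous)
  have "((\<lambda>x. f x * fmode L (- k) x) has_vector_derivative
      (f x * ((\<i> * of_real (2 * pi * of_int (- k) / L)) * fmode L (- k) x) + f' x * fmode L (- k) x)) (at x within S)" for x S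
    by (rule has_vector_derivative_mult[OF has_vector_derivative_at_within[OF D] fmode_has_vector_derivative])
  then have "((\<lambda>x. f x * ((\<i> * of_real (2 * pi * of_int (- k) / L)) * fmode L (- k) x) + f' x * fmode L (- k) x) has_integral
      (f L * fmode L (- k) L - f 0 * fmode L (- k) 0)) {0..L}"
    using L by (intro fundamental_theorem_of_calculus) auto
  moreover have "fmode L (- k) L = fmode L (- k) 0" using fmode_period[of L "-k" 0] L by simp
  ultimately have h1: "((\<lambda>x. f' x * fmode L (- k) x - ?w * (f x * fmode L (- k) x)) has_integral 0) {0..L}"
    by (simp add: per algebra_simps)
  have i: "(\<lambda>x. f x * fmode L (- k) x) integrable_on {0..L}" "(\<lambda>x. f' x * fmode L (- k) x) integrable_on {0..L}"
    by (intro integrable_continuous_real continuous_intros continuous_on_subset[OF cf] continuous_on_subset[OF c] subset_UNIV)+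
  have h2: "((\<lambda>x. f' x * fmode L (- k) x - ?w * (f x * fmode L (- k) x)) has_integral
     (integral {0..L} (\<lambda>x. f' x * fmode L (- k) x) - ?w * integral {0..L} (\<lambda>x. f x * fmode L (- k) x))) {0..L}"
    by (intro has_integral_diff has_integral_mult_right integrable_integral i)
  from has_integral_unique[OF h1 h2]
  have "integral {0..L} (\<lambda>x. f' x * fmode L (- k) x) = ?w * integral {0..L} (\<lambda>x. f x * fmode L (- k) x)"
    by simp
  then show ?thesis by (simp add: fcoef_def fun_cong[OF m] del: of_real_divide)
qed

text \<open>The derivative of a constant is 0, so integration by parts forces every coefficient with
  \<open>k \<noteq> 0\<close> to vanish.\<close>

lemma fcoef_const:
  assumes "L > 0"
  shows "fcoef L (\<lambda>x. c) k = (if k = 0 then c else 0)"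
proof (cases "k = 0")
  case True
  then show ?thesis using assms by (simp add: fcoef_def scaleR_conv_of_real)
next
  case False
  have "fcoef L (\<lambda>x. 0) k = (\<i> * of_real (2 * pi * of_int k / L)) * fcoef L (\<lambda>x. c) k"
    by (rule fcoef_by_parts) (use assms in auto)
  then show ?thesis using False assms by (simp add: fcoef_def[of L "\<lambda>x. 0"])
qed

lemma fcoef_diff:
  assumes "continuous_on {0..L} f" "continuous_on {0..L} g"
  shows "fcoef L (\<lambda>x. f x - g x) k = fcoef L f k - fcoef L g k"
proof -
  have "integral {0..L} (\<lambda>x. f x * cnj (fmode L k x) - g x * cnj (fmode L k x)) =
     integral {0..L} (\<lambda>x. f x * cnj (fmode L k x)) - integral {0..L} (\<lambda>x. g x * cnj (fmode L k x))"
    by (intro integral_diff integrable_continuous_real continuous_intros assms)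
  then show ?thesis by (simp add: fcoef_def left_diff_distrib diff_divide_distrib)
qed

text \<open>This index shift is what makes partial sums telescope in the convergence proof.\<close>

lemma fcoef_mult_mode:
  "fcoef L (\<lambda>x. c * (f x * fmode L 1 x)) k = c * fcoef L f (k - 1)"
proof -
  have "fmode L 1 x * cnj (fmode L k x) = cnj (fmode L (k - 1) x)" for x
  proof -
    have "fmode L 1 x * cnj (fmode L k x) = cnj (fmode L (k - 1) x) * (fmode L 1 x * cnj (fmode L 1 x))"
      using fmode_add[of L "k - 1" 1 x] by simp
    then show ?thesis by (simp only: fmode_mult_cnj mult_1_right)
  qed
  then have "(\<lambda>x. c * (f x * fmode L 1 x) * cnj (fmode L k x)) = (\<lambda>x. c * (f x * cnj (fmode L (k - 1) x)))"
    by (simp add: mult.assoc)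
  then show ?thesis by (simp add: fcoef_def)
qed

text \<open>A shift by half a wavelength changes the sign of the mode. Averaging the original and
  the shifted integral leaves differences of \<open>g\<close> at distance
  \<open>L / (2 * \<bar>k\<bar>)\<close>, which uniform continuity makes small.\<close>

lemma Riemann_Lebesgue_periodic:
  assumes L: "L > 0" and g: "continuous_on UNIV g" "\<And>x. g (x + L) = g x" and e: "e > 0"
  shows "\<exists>m>0. \<forall>k. real_of_int \<bar>k\<bar> \<ge> m \<longrightarrow> norm (fcoef L g k) \<le> e"
proof -
  \<comment> \<open>Two periods, since the shifted argument leaves \<open>{0..L}\<close>.\<close>
  have "uniformly_continuous_on {0..2 * L} g"
    by (rule compact_uniformly_continuous[OF continuous_on_subset[OF g(1)]]) auto
  then obtain d where d: "d > 0" "\<And>x y. x \<in> {0..2 * L} \<Longrightarrow> y \<in> {0..2 * L} \<Longrightarrow> \<bar>y - x\<bar> < d \<Longrightarrow> norm (g y - g x) < e"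
    using e unfolding uniformly_continuous_on_def dist_norm real_norm_def by meson
  show ?thesis
  proof (intro exI[of _ "max 1 (L / d)"] conjI allI impI)
    fix k :: int assume "real_of_int \<bar>k\<bar> \<ge> max 1 (L / d)"
    then have k: "\<bar>real_of_int k\<bar> \<ge> 1" "\<bar>real_of_int k\<bar> \<ge> L / d" by auto
    define a where "a = L / (2 * \<bar>real_of_int k\<bar>)"
    have "a * (2 * \<bar>real_of_int k\<bar>) = L" using k by (simp add: a_def)
    have "L \<le> \<bar>real_of_int k\<bar> * d" using k(2) d(1) by (simp add: field_simps)
    then have "L < 2 * \<bar>real_of_int k\<bar> * d" using L by linarith
    then have a: "a > 0" "a < d" "a \<le> L" using k L by (auto simp: a_def field_simps)
    have "2 * pi * real_of_int k * a / L = pi \<or> 2 * pi * real_of_int k * a / L = - pi"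
      using k L by (cases "k > 0") (auto simp: a_def)
    then have ma: "fmode L k a = - 1" unfolding fmode_def using cis_inverse[of pi] by (auto simp del: cis_inverse)
    let ?G = "\<lambda>x. g x * cnj (fmode L k x)"
    have cG: "continuous_on UNIV ?G" by (intro continuous_intros g)
    have ca: "continuous_on UNIV (\<lambda>y. g (y + a))"
      by (rule continuous_on_compose2[OF g(1)]) (auto intro!: continuous_intros)
    have "integral {0..L} ?G = integral {0..L} (\<lambda>y. ?G (y + a))"
      by (rule integral_periodic_shift[symmetric, OF cG]) (use g L fmode_period in auto)
    also have "(\<lambda>y. ?G (y + a)) = (\<lambda>y. - (g (y + a) * cnj (fmode L k y)))"
      by (simp add: fmode_shift_argument ma)
    finally have 1: "integral {0..L} ?G = - integral {0..L} (\<lambda>y. g (y + a) * cnj (fmode L k y))" by simp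
    have "integral {0..L} (\<lambda>y. g y * cnj (fmode L k y) - g (y + a) * cnj (fmode L k y)) =
      integral {0..L} ?G - integral {0..L} (\<lambda>y. g (y + a) * cnj (fmode L k y))"
      by (intro integral_diff integrable_continuous_real continuous_intros continuous_on_subset[OF g(1)]
          continuous_on_subset[OF ca]) auto
    then have 2: "2 * integral {0..L} ?G = integral {0..L} (\<lambda>y. (g y - g (y + a)) * cnj (fmode L k y))"
      using 1 by (simp add: left_diff_distrib)
    have "norm (integral {0..L} (\<lambda>y. (g y - g (y + a)) * cnj (fmode L k y))) \<le> e * (L - 0)"
    proof (rule integral_bound)
      show "continuous_on {0..L} (\<lambda>y. (g y - g (y + a)) * cnj (fmode L k y))"
        by (intro continuous_intros continuous_on_subset[OF g(1)] continuous_on_subset[OF ca]) auto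
      fix y assume "y \<in> {0..L}"
      then show "norm ((g y - g (y + a)) * cnj (fmode L k y)) \<le> e"
        using d(2)[of "y + a" y] a L by (simp add: norm_mult less_imp_le)
    qed (use L in simp)
    then have "2 * norm (integral {0..L} ?G) \<le> e * L"
      unfolding 2[symmetric] by (simp add: norm_mult)
    then have "norm (integral {0..L} ?G) / L \<le> e / 2" using L by (simp add: field_simps)
    moreover have "norm (fcoef L g k) = norm (integral {0..L} ?G) / L" using L by (simp add: fcoef_def norm_divide)
    ultimately show "norm (fcoef L g k) \<le> e" using e by linarith
  qed auto
qed

lemma periodic_int_shift:
  assumes "\<And>x. f (x + L) = f (x::real)"
  shows "f (x + of_int m * L) = f x"
proof -
  have nat: "f (y + real n * L) = f y" for n y
  proof (induction n)
    case (Suc n)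
    have "y + real (Suc n) * L = (y + real n * L) + L" by (simp add: algebra_simps)
    then show ?case using assms Suc by metis
  qed simp
  show ?thesis
  proof (cases "m \<ge> 0")
    case True
    then show ?thesis using nat[of x "nat m"] by simp
  next
    case False
    then show ?thesis using nat[of "x + of_int m * L" "nat (- m)"] by simp
  qed
qed

lemma vector_derivative_quotient:
  fixes f :: "real \<Rightarrow> complex"
  assumes "(f has_vector_derivative d) (at y)"
  shows "((\<lambda>z. (f z - f y) / of_real (z - y)) \<longlongrightarrow> d) (at y)"
proof -
  have "((\<lambda>z. (1 / norm (z - y)) *\<^sub>R (f z - (f y + (z - y) *\<^sub>R d))) \<longlongrightarrow> 0) (at y)"
    using assms unfolding has_vector_derivative_def has_derivative_within by blast
  then have 1: "((\<lambda>z. norm ((1 / norm (z - y)) *\<^sub>R (f z - (f y + (z - y) *\<^sub>R d)))) \<longlongrightarrow> 0) (at y)"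
    by (rule tendsto_norm_zero)
  have "eventually (\<lambda>z. norm ((1 / norm (z - y)) *\<^sub>R (f z - (f y + (z - y) *\<^sub>R d)))
      = norm ((f z - f y) / of_real (z - y) - d)) (at y)"
  proof -
    have "norm ((1 / norm (z - y)) *\<^sub>R (f z - (f y + (z - y) *\<^sub>R d))) = norm ((f z - f y) / of_real (z - y) - d)"
      if "z \<noteq> y" for z
    proof -
      have "(f z - f y) / of_real (z - y) - d = (f z - (f y + (z - y) *\<^sub>R d)) / of_real (z - y)"
        using that by (simp add: diff_divide_distrib add_divide_distrib scaleR_conv_of_real del: of_real_diff)
      then show ?thesis by (simp only: norm_divide norm_of_real norm_scaleR) simp
    qed
    then show ?thesis by (auto simp: eventually_at_filter)
  qed
  from Lim_transform_eventually[OF 1 this]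
  have "((\<lambda>z. (f z - f y) / of_real (z - y) - d) \<longlongrightarrow> 0) (at y)" by (rule tendsto_norm_zero_cancel)
  then show ?thesis by (simp add: LIM_zero_iff)
qed

text \<open>Chernoff's proof: \<open>f - f x = (e\<^sub>1(\<cdot> - x) - 1) g\<close> with \<open>g\<close> continuous, so the partial sums of \<open>f - f x\<close> at \<open>x\<close>
  telescope to two Fourier coefficients of \<open>g\<close>.\<close>

lemma fsum_converges:
  assumes L: "L > 0" and D: "\<And>x. (f has_vector_derivative f' x) (at x)"
    and per: "\<And>x. f (x + L) = f x" "\<And>x. f' (x + L) = f' x"
  shows "(\<lambda>M. fsum L M f x) \<longlonglongrightarrow> f x"
proof -
  define w where "w = (\<lambda>y. fmode L 1 y * cnj (fmode L 1 x))"
  define v where "v = \<i> * of_real (2 * pi / L)"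
  have v: "v \<noteq> 0" using L by (simp add: v_def)
  \<comment> \<open>Where the denominator vanishes, \<open>g\<close> gets the quotient of the
    derivatives, which is the limit there. These points are the translates of \<open>x\<close> by
    periods, so one value serves for all of them.\<close>
  define g where "g = (\<lambda>y. if w y = 1 then f' x / v else (f y - f x) / (w y - 1))"
  have cf: "continuous_on UNIV f"
    using D by (intro continuous_at_imp_continuous_on ballI) (metis has_vector_derivative_continuous)
  have cw: "continuous_on UNIV w" unfolding w_def by (intro continuous_intros)
  have Dw: "(w has_vector_derivative v * w y) (at y)" for y
    using has_vector_derivative_mult_left[OF fmode_has_vector_derivative[of L 1 y UNIV], of "cnj (fmode L 1 x)"]
    by (simp add: w_def v_def mult_ac)
  have wper: "w (y + L) = w y" for y using L by (simp add: w_def fmode_period)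
  have gper: "g (y + L) = g y" for y by (simp add: g_def wper per)
  have wx: "w x = 1" by (simp add: w_def fmode_mult_cnj)
  have w1: "f y = f x" "f' y = f' x" if "w y = 1" for y
  proof -
    have "fmode L 1 (y - x) = 1"
      using that fmode_shift_argument[of L 1 "y - x" x] by (simp add: w_def fmode_mult_cnj mult.assoc)
    then have "cos (2 * pi * (y - x) / L) = 1" by (simp add: fmode_def complex_eq_iff)
    then obtain m :: int where "2 * pi * (y - x) / L = of_int m * 2 * pi" using cos_one_2pi_int by blast
    then have "(2 * pi) * (y - x) = (2 * pi) * (of_int m * L)" using L by (simp add: field_simps)
    then have "y - x = of_int m * L" by (simp only: mult_cancel_left) simp
    then have "y = x + of_int m * L" by simp
    then show "f y = f x" "f' y = f' x" using periodic_int_shift[of f L] periodic_int_shift[of f' L] per by auto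
  qed
  have cg: "isCont g y" for y
  proof (cases "w y = 1")
    case False
    have "isCont (\<lambda>y. (f y - f x) / (w y - 1)) y"
      using cf cw False by (intro continuous_intros) (auto simp: continuous_on_eq_continuous_at)
    moreover have "eventually (\<lambda>z. g z = (f z - f x) / (w z - 1)) (nhds y)"
    proof -
      have "open {z. w z \<noteq> 1}" by (intro open_Collect_neq cw continuous_on_const)
      from eventually_nhds_in_open[OF this, of y] have "eventually (\<lambda>z. w z \<noteq> 1) (nhds y)"
        using False by simp
      then show ?thesis by eventually_elim (simp add: g_def)
    qed
    ultimately show ?thesis using isCont_cong by fast
  next
    case True
    have lf: "((\<lambda>z. (f z - f y) / of_real (z - y)) \<longlongrightarrow> f' y) (at y)"
      by (rule vector_derivative_quotient[OF D])
    have lw: "((\<lambda>z. (w z - w y) / of_real (z - y)) \<longlongrightarrow> v * w y) (at y)"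
      by (rule vector_derivative_quotient[OF Dw])
    have lim: "((\<lambda>z. ((f z - f y) / of_real (z - y)) / ((w z - w y) / of_real (z - y))) \<longlongrightarrow> f' y / (v * w y)) (at y)"
      by (rule tendsto_divide[OF lf lw]) (use v True in simp)
    have "eventually (\<lambda>z. (w z - w y) / of_real (z - y) \<noteq> 0) (at y)"
      by (rule tendsto_imp_eventually_ne[OF lw]) (use v True in simp)
    moreover have "eventually (\<lambda>z. z \<noteq> y) (at y)" by (simp add: eventually_at_filter)
    ultimately have "eventually (\<lambda>z. ((f z - f y) / of_real (z - y)) / ((w z - w y) / of_real (z - y)) = g z) (at y)"
      by eventually_elim (use True w1[OF True] in \<open>auto simp: g_def\<close>)
    from Lim_transform_eventually[OF lim this] show ?thesis
      using True w1[OF True] by (simp add: isCont_def g_def)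
  qed
  then have gc: "continuous_on UNIV g" by (simp add: continuous_at_imp_continuous_on)
  have fg: "f y - f x = cnj (fmode L 1 x) * (g y * fmode L 1 y) - g y" for y
  proof (cases "w y = 1")
    case True
    then show ?thesis using w1[OF True] by (simp add: w_def mult_ac)
  next
    case False
    then have "f y - f x = g y * (w y - 1)" by (simp add: g_def)
    then show ?thesis by (simp add: w_def algebra_simps)
  qed
  have coef: "fcoef L f k * fmode L k x = (if k = 0 then f x else 0)
     + (fcoef L g (k - 1) * fmode L (k - 1) x - fcoef L g k * fmode L k x)" for k
  proof -
    have s: "continuous_on {0..L} f" "continuous_on {0..L} g"
      using continuous_on_subset[OF cf] continuous_on_subset[OF gc] by auto
    have "fcoef L f k - (if k = 0 then f x else 0) = fcoef L (\<lambda>y. f y - f x) k"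
      using L by (subst fcoef_diff) (auto intro: s simp: fcoef_const)
    also have "\<dots> = fcoef L (\<lambda>y. cnj (fmode L 1 x) * (g y * fmode L 1 y) - g y) k" by (simp only: fg)
    also have "\<dots> = fcoef L (\<lambda>y. cnj (fmode L 1 x) * (g y * fmode L 1 y)) k - fcoef L g k"
      by (rule fcoef_diff) (intro continuous_intros s)+
    also have "\<dots> = cnj (fmode L 1 x) * fcoef L g (k - 1) - fcoef L g k" by (simp only: fcoef_mult_mode)
    finally have 1: "fcoef L f k = (if k = 0 then f x else 0) + (cnj (fmode L 1 x) * fcoef L g (k - 1) - fcoef L g k)"
      by (simp add: algebra_simps)
    have "cnj (fmode L 1 x) * fmode L k x = fmode L (k - 1) x * (fmode L 1 x * cnj (fmode L 1 x))"
      using fmode_add[of L "k - 1" 1 x] by simp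
    then have "cnj (fmode L 1 x) * fmode L k x = fmode L (k - 1) x" by (simp only: fmode_mult_cnj mult_1_right)
    then have 2: "cnj (fmode L 1 x) * fcoef L g (k - 1) * fmode L k x = fcoef L g (k - 1) * fmode L (k - 1) x"
      by (metis mult.assoc mult.commute)
    have 3: "(if k = 0 then f x else 0) * fmode L k x = (if k = 0 then f x else 0)" by simp
    show ?thesis unfolding 1 distrib_right left_diff_distrib 2 3 ..
  qed
  have tele: "(\<Sum>k\<in>{- int M..int M}. F (k - 1) - F k) = F (- int M - 1) - F (int M)" for F :: "int \<Rightarrow> complex" and M
  proof (induction M)
    case (Suc M)
    have "{- int (Suc M)..int (Suc M)} = insert (- int (Suc M)) (insert (int (Suc M)) {- int M..int M})" by auto
    then have *: "(\<Sum>k\<in>{- int (Suc M)..int (Suc M)}. F (k - 1) - F k) = (F (- int (Suc M) - 1) - F (- int (Suc M)))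
       + ((F (int (Suc M) - 1) - F (int (Suc M))) + (\<Sum>k\<in>{- int M..int M}. F (k - 1) - F k))" by simp
    have f: "F (int (Suc M) - 1) = F (int M)" "F (- int M - 1) = F (- int (Suc M))"
      by (rule arg_cong[where f = F], simp)+
    show ?case unfolding * Suc f by simp
  qed simp
  \<comment> \<open>Only two coefficients of \<open>g\<close> survive, at the indices
    \<open>- M - 1\<close> and \<open>M\<close>; both tend to 0 by Riemann-Lebesgue.\<close>
  have err: "fsum L M f x - f x = fcoef L g (- int M - 1) * fmode L (- int M - 1) x - fcoef L g (int M) * fmode L (int M) x" for M
  proof -
    have "fsum L M f x = (\<Sum>k\<in>{- int M..int M}. if k = 0 then f x else 0) +
      (\<Sum>k\<in>{- int M..int M}. fcoef L g (k - 1) * fmode L (k - 1) x - fcoef L g k * fmode L k x)"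
      unfolding fsum_def by (simp only: coef sum.distrib)
    then show ?thesis by (simp add: tele[of "\<lambda>k. fcoef L g k * fmode L k x"])
  qed
  show ?thesis
  proof (rule LIMSEQ_I)
    fix e :: real assume "e > 0"
    then obtain m where m: "m > 0" "\<And>k. real_of_int \<bar>k\<bar> \<ge> m \<Longrightarrow> norm (fcoef L g k) \<le> e / 3"
      using Riemann_Lebesgue_periodic[OF L gc gper, of "e / 3"] by (metis divide_pos_pos zero_less_numeral)
    have "norm (fsum L M f x - f x) < e" if "M \<ge> nat \<lceil>m\<rceil>" for M
    proof -
      have "real M \<ge> m" using that by linarith
      then have "norm (fcoef L g (- int M - 1)) \<le> e / 3" "norm (fcoef L g (int M)) \<le> e / 3" using m(2) by auto
      then have "norm (fsum L M f x - f x) \<le> e / 3 + e / 3"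
        unfolding err by (intro order_trans[OF norm_triangle_ineq4] add_mono) (simp_all add: norm_mult)
      then show ?thesis using \<open>e > 0\<close> by simp
    qed
    then show "\<exists>no. \<forall>n\<ge>no. norm (fsum L n f x - f x) < e" by blast
  qed
qed

lemma sum_inverse_squares_le: "(\<Sum>k\<in>{1..M}. 1 / (real k)\<^sup>2) \<le> 2"
proof -
  have "(\<Sum>k\<in>{1..M}. 1 / (real k)\<^sup>2) \<le> 2 - 1 / real M" if "M \<ge> 1" for M
    using that
  proof (induction M rule: dec_induct)
    case (step n)
    have "1 / (real (Suc n))\<^sup>2 \<le> 1 / (real n * real (Suc n))"
      using step(1) by (intro divide_left_mono) (auto simp: power2_eq_square)
    also have "\<dots> = 1 / real n - 1 / real (Suc n)" using step(1) by (simp add: field_simps)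
    finally show ?case using step by simp
  qed simp
  moreover have "0 \<le> 1 / real M" by simp
  ultimately have "M \<ge> 1 \<Longrightarrow> ?thesis" by (smt (verit))
  then show ?thesis by (cases "M \<ge> 1") simp_all
qed

text \<open>Integrating by parts \<open>r\<close> times gives coefficients that decay like the power
  \<open>-r\<close> of the frequency. Two powers are spent on a summable series, the others are
  bounded at the first omitted index \<open>K + 1\<close>. The 4 is 2 for the two signs of the
  frequency times 2 for the sum of the inverse squares.\<close>

lemma fsum_error:
  assumes L: "L > 0" and r: "r \<ge> 2"
    and D: "\<And>j x. j < r \<Longrightarrow> (D j has_vector_derivative D (Suc j) x) (at x)"
    and c: "continuous_on UNIV (D r)" and per: "\<And>j x. j \<le> r \<Longrightarrow> D j (x + L) = D j x"
    and B: "\<And>x. norm (D r x) \<le> B"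
  shows "norm (fsum L K (D 0) x - D 0 x) \<le> 4 * (L / (2 * pi)) ^ r * B / real (K + 1) ^ (r - 2)"
proof -
  define A where "A = (L / (2 * pi)) ^ r * B"
  have B0: "0 \<le> B" using B[of 0] norm_ge_zero[of "D r 0"] by linarith
  have A: "A \<ge> 0" using L B0 by (simp add: A_def)
  have cont: "continuous_on UNIV (D j)" if "j \<le> r" for j
  proof (cases "j = r")
    case False
    then show ?thesis using D[of j] that
      by (intro continuous_at_imp_continuous_on ballI) (auto intro: has_vector_derivative_continuous)
  qed (use c in simp)
  have coef: "norm (fcoef L (D 0) k) \<le> A / real_of_int \<bar>k\<bar> ^ r" if k: "k \<noteq> 0" for k
  proof -
    define w where "w = 2 * pi * real_of_int \<bar>k\<bar> / L"
    have w: "w > 0" using k L by (simp add: w_def)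
    have "norm (fcoef L (D j) k) = w ^ j * norm (fcoef L (D 0) k)" if "j \<le> r" for j
      using that
    proof (induction j)
      case (Suc j)
      have "fcoef L (D (Suc j)) k = (\<i> * of_real (2 * pi * of_int k / L)) * fcoef L (D j) k"
        by (rule fcoef_by_parts[OF L]) (use D cont per[of j 0] Suc.prems in auto)
      then have "norm (fcoef L (D (Suc j)) k) = norm (of_real (2 * pi * of_int k / L) :: complex) * norm (fcoef L (D j) k)"
        by (simp only: norm_mult norm_ii mult_1_left)
      also have "norm (of_real (2 * pi * of_int k / L) :: complex) = w"
        using L by (simp only: norm_of_real) (simp add: w_def abs_mult abs_divide)
      finally show ?case using Suc by simp
    qed simp
    from this[of r] have "w ^ r * norm (fcoef L (D 0) k) \<le> B"
      using norm_fcoef_le[of L "D r" B k] B L continuous_on_subset[OF c] by auto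
    then have "norm (fcoef L (D 0) k) \<le> B / w ^ r" using w by (simp add: field_simps)
    also have "\<dots> = A / real_of_int \<bar>k\<bar> ^ r" using L k by (simp add: A_def w_def power_mult_distrib power_divide)
    finally show ?thesis .
  qed
  define R where "R = real (K + 1) ^ (r - 2)"
  have R: "R > 0" by (simp add: R_def)
  \<comment> \<open>The comparison is with a longer partial sum, by induction on its length;
    pointwise convergence is used only at the end, when \<open>M\<close> tends to infinity.\<close>
  have partial: "norm (fsum L M (D 0) x - fsum L K (D 0) x) \<le> 2 * (A / R) * (\<Sum>k\<in>{K+1..M}. 1 / (real k)\<^sup>2)"
    if "K \<le> M" for M
    using that
  proof (induction M rule: dec_induct)
    case (step M)
    have "{- int (Suc M)..int (Suc M)} = insert (- int (Suc M)) (insert (int (Suc M)) {- int M..int M})" by auto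
    then have eq: "fsum L (Suc M) (D 0) x = fcoef L (D 0) (- int (Suc M)) * fmode L (- int (Suc M)) x
        + (fcoef L (D 0) (int (Suc M)) * fmode L (int (Suc M)) x + fsum L M (D 0) x)"
      by (simp add: fsum_def)
    have tail: "A / real (Suc M) ^ r \<le> A / R * (1 / (real (Suc M))\<^sup>2)"
    proof -
      have "real (Suc M) ^ r = real (Suc M) ^ (r - 2) * (real (Suc M))\<^sup>2"
        using r by (metis power_add le_add_diff_inverse2)
      moreover have "R \<le> real (Suc M) ^ (r - 2)" unfolding R_def using step(1) by (intro power_mono) auto
      ultimately have "R * (real (Suc M))\<^sup>2 \<le> real (Suc M) ^ r" by (simp add: mult_right_mono del: of_nat_Suc)
      then have "A / real (Suc M) ^ r \<le> A / (R * (real (Suc M))\<^sup>2)"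
        using A R by (intro divide_left_mono) (auto simp del: of_nat_Suc)
      then show ?thesis by simp
    qed
    have "norm (fsum L (Suc M) (D 0) x - fsum L K (D 0) x) \<le>
       norm (fcoef L (D 0) (- int (Suc M))) + norm (fcoef L (D 0) (int (Suc M))) + norm (fsum L M (D 0) x - fsum L K (D 0) x)"
    proof -
      have "fsum L (Suc M) (D 0) x - fsum L K (D 0) x = fcoef L (D 0) (- int (Suc M)) * fmode L (- int (Suc M)) x
        + fcoef L (D 0) (int (Suc M)) * fmode L (int (Suc M)) x + (fsum L M (D 0) x - fsum L K (D 0) x)"
        unfolding eq by simp
      then show ?thesis
        using norm_triangle_ineq[of "fcoef L (D 0) (- int (Suc M)) * fmode L (- int (Suc M)) x
            + fcoef L (D 0) (int (Suc M)) * fmode L (int (Suc M)) x" "fsum L M (D 0) x - fsum L K (D 0) x"]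
          norm_triangle_ineq[of "fcoef L (D 0) (- int (Suc M)) * fmode L (- int (Suc M)) x"
            "fcoef L (D 0) (int (Suc M)) * fmode L (int (Suc M)) x"]
        by (simp only: norm_mult norm_fmode mult_1_right)
    qed
    also have "\<dots> \<le> A / real (Suc M) ^ r + A / real (Suc M) ^ r + 2 * (A / R) * (\<Sum>k\<in>{K+1..M}. 1 / (real k)\<^sup>2)"
      using coef[of "- int (Suc M)"] coef[of "int (Suc M)"] step(3)
      by (intro add_mono) (simp_all del: of_nat_Suc)
    also have "\<dots> \<le> 2 * (A / R) * ((\<Sum>k\<in>{K+1..M}. 1 / (real k)\<^sup>2) + 1 / (real (Suc M))\<^sup>2)"
      using tail by (simp only: distrib_left)
    also have "(\<Sum>k\<in>{K+1..M}. 1 / (real k)\<^sup>2) + 1 / (real (Suc M))\<^sup>2 = (\<Sum>k\<in>{K+1..Suc M}. 1 / (real k)\<^sup>2)"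
      using step(1) by simp
    finally show ?case .
  qed simp
  have "norm (fsum L M (D 0) x - fsum L K (D 0) x) \<le> 4 * (A / R)" if "K \<le> M" for M
  proof -
    have "(\<Sum>k\<in>{K+1..M}. 1 / (real k)\<^sup>2) \<le> (\<Sum>k\<in>{1..M}. 1 / (real k)\<^sup>2)" by (rule sum_mono2) auto
    then have "(\<Sum>k\<in>{K+1..M}. 1 / (real k)\<^sup>2) \<le> 2" using sum_inverse_squares_le[of M] by linarith
    then have "2 * (A / R) * (\<Sum>k\<in>{K+1..M}. 1 / (real k)\<^sup>2) \<le> 2 * (A / R) * 2"
      using A R by (intro mult_left_mono) auto
    then show ?thesis using partial[OF that] by simp
  qed
  then have ev: "\<exists>N. \<forall>M\<ge>N. norm (fsum L M (D 0) x - fsum L K (D 0) x) \<le> 4 * (A / R)" by blast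
  have "(\<lambda>M. fsum L M (D 0) x) \<longlonglongrightarrow> D 0 x"
    by (rule fsum_converges[OF L, where f' = "D 1"]) (use D[of 0] per[of 0] per[of 1] r in auto)
  then have "(\<lambda>M. norm (fsum L M (D 0) x - fsum L K (D 0) x)) \<longlonglongrightarrow> norm (D 0 x - fsum L K (D 0) x)"
    by (intro tendsto_intros)
  from LIMSEQ_le_const2[OF this ev] show ?thesis
    by (simp add: norm_minus_commute A_def R_def)
qed

subsection \<open>The two-dimensional projection\<close>

lemma fourier_mode_eq: "fourier_mode L k l (x, y) = fmode L k x * fmode L l y"
  by (simp add: fourier_mode_def fmode_def cis_mult add_divide_distrib distrib_left mult.assoc)

lemma fcoef_sum:
  assumes "finite I" "\<And>i. i \<in> I \<Longrightarrow> continuous_on {0..L} (F i)"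
  shows "fcoef L (\<lambda>x. \<Sum>i\<in>I. F i x) k = (\<Sum>i\<in>I. fcoef L (F i) k)"
proof -
  have "integral {0..L} (\<lambda>x. \<Sum>i\<in>I. F i x * cnj (fmode L k x)) = (\<Sum>i\<in>I. integral {0..L} (\<lambda>x. F i x * cnj (fmode L k x)))"
    by (intro Henstock_Kurzweil_Integration.integral_sum integrable_continuous_real continuous_intros assms)
  then show ?thesis by (simp add: fcoef_def sum_distrib_right sum_divide_distrib)
qed

lemma fcoef_cmult: "fcoef L (\<lambda>x. f x * c) k = fcoef L f k * c"
proof -
  have "(\<lambda>x. f x * c * cnj (fmode L k x)) = (\<lambda>x. (f x * cnj (fmode L k x)) * c)" by (simp add: mult_ac)
  then show ?thesis by (simp add: fcoef_def)
qed

lemma continuous_slice_fcoef: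
  fixes u :: "real \<times> real \<Rightarrow> real"
  assumes "continuous_on UNIV u"
  shows "continuous_on S (\<lambda>x. fcoef L (\<lambda>y. of_real (u (x, y))) l)"
proof (cases "L = 0")
  case False
  have "continuous_on UNIV (\<lambda>x. integral (cbox 0 L) (\<lambda>y. of_real (u (x, y)) * cnj (fmode L l y)))"
  proof (rule integral_continuous_on_param)
    have "continuous_on (UNIV \<times> cbox 0 L) (\<lambda>z. of_real (u z) * cnj (fmode L l (snd z)))"
      by (intro continuous_intros continuous_on_subset[OF assms subset_UNIV])
    then show "continuous_on (UNIV \<times> cbox 0 L) (\<lambda>(x, y). of_real (u (x, y)) * cnj (fmode L l y))"
      by (simp add: case_prod_beta)
  qed
  then have "continuous_on S (\<lambda>x. integral {0..L} (\<lambda>y. of_real (u (x, y)) * cnj (fmode L l y)))"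
    unfolding cbox_interval by (rule continuous_on_subset) simp
  then show ?thesis unfolding fcoef_def using False by (intro continuous_on_divide continuous_on_const) simp_all
qed (simp add: fcoef_def)

lemma fourier_coeff_eq:
  fixes u :: "real \<times> real \<Rightarrow> real"
  assumes u: "continuous_on UNIV u"
  shows "fourier_coeff L u k l = fcoef L (\<lambda>x. fcoef L (\<lambda>y. of_real (u (x, y))) l) k"
proof -
  have "continuous_on (cbox (0, 0) (L, L)) (\<lambda>z. of_real (u z) * cnj (fourier_mode L k l z))"
  proof -
    have "fourier_mode L k l = (\<lambda>z. fmode L k (fst z) * fmode L l (snd z))"
      by (simp add: fun_eq_iff fourier_mode_eq)
    then show ?thesis by (simp only:) (intro continuous_intros continuous_on_subset[OF u subset_UNIV])
  qed
  from integral_prod_continuous[OF this]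
  have "integral (cbox (0, 0) (L, L)) (\<lambda>z. of_real (u z) * cnj (fourier_mode L k l z)) =
    integral {0..L} (\<lambda>x. integral {0..L} (\<lambda>y. (of_real (u (x, y)) * cnj (fmode L l y)) * cnj (fmode L k x)))"
    by (simp add: cbox_interval fourier_mode_eq mult_ac)
  then show ?thesis by (simp add: fourier_coeff_def fcoef_def power2_eq_square)
qed

lemma continuous_slice:
  assumes "continuous_on UNIV u"
  shows "continuous_on S (\<lambda>y. of_real (u (x, y)) :: complex)" "continuous_on S (\<lambda>x. of_real (u (x, y)) :: complex)"
  by (intro continuous_on_of_real continuous_on_compose2[OF assms] continuous_on_Pair continuous_on_const
      continuous_on_id subset_UNIV)+

lemma continuous_slice_fsum:
  fixes u :: "real \<times> real \<Rightarrow> real"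
  assumes "continuous_on UNIV u"
  shows "continuous_on S (\<lambda>x. fsum L K (\<lambda>y. of_real (u (x, y))) y)"
  unfolding fsum_def by (intro continuous_intros continuous_slice_fcoef assms)

text \<open>Fubini: the two-dimensional projection is the one-dimensional one applied in
  \<open>y\<close> and then in \<open>x\<close>. Its error estimates are derived from one
  variable.\<close>

lemma fourier_proj_eq:
  fixes u :: "real \<times> real \<Rightarrow> real"
  assumes u: "continuous_on UNIV u"
  shows "fourier_proj L K u (x, y) = Re (fsum L K (\<lambda>x'. fsum L K (\<lambda>y'. of_real (u (x', y'))) y) x)"
proof -
  have "fcoef L (\<lambda>x'. fsum L K (\<lambda>y'. of_real (u (x', y'))) y) k =
    (\<Sum>l\<in>{- int K..int K}. fourier_coeff L u k l * fmode L l y)" for k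
    unfolding fsum_def
    by (subst fcoef_sum)
      (simp_all add: fcoef_cmult fourier_coeff_eq[OF u] continuous_on_mult_right continuous_slice_fcoef[OF u])
  then have "fsum L K (\<lambda>x'. fsum L K (\<lambda>y'. of_real (u (x', y'))) y) x =
    (\<Sum>k\<in>{- int K..int K}. \<Sum>l\<in>{- int K..int K}. fourier_coeff L u k l * fourier_mode L k l (x, y))"
    unfolding fsum_def[of L K "\<lambda>x'. fsum L K (\<lambda>y'. of_real (u (x', y'))) y"]
    by (simp add: fourier_mode_eq sum_distrib_left mult_ac)
  then show ?thesis by (simp only: fourier_proj_def)
qed

lemma fsum_diff:
  assumes "continuous_on {0..L} f" "continuous_on {0..L} g"
  shows "fsum L K (\<lambda>x. f x - g x) x = fsum L K f x - fsum L K g x"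
  by (simp add: fsum_def fcoef_diff[OF assms] left_diff_distrib sum_subtractf)

lemma norm_fsum_le:
  assumes "continuous_on {0..L} f" "L > 0" "\<And>x. x \<in> {0..L} \<Longrightarrow> norm (f x) \<le> B"
  shows "norm (fsum L K f x) \<le> real (2 * K + 1) * B"
proof -
  have "norm (fsum L K f x) \<le> (\<Sum>k\<in>{- int K..int K}. norm (fcoef L f k * fmode L k x))"
    unfolding fsum_def by (rule norm_sum)
  also have "\<dots> \<le> (\<Sum>k\<in>{- int K..int K}. B)"
    by (intro sum_mono) (simp only: norm_mult norm_fmode mult_1_right norm_fcoef_le[OF assms])
  also have "\<dots> = real (2 * K + 1) * B" by simp
  finally show ?thesis .
qed

text \<open>A crude bound whose factor grows with \<open>K\<close>. It serves only to pass, for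
  fixed \<open>K\<close>, from an arbitrary time to a good one nearby, where the closeness in time
  beats the factor.\<close>

lemma fourier_proj_diff_le:
  fixes u v :: "real \<times> real \<Rightarrow> real"
  assumes u: "continuous_on UNIV u" and v: "continuous_on UNIV v" and L: "L > 0"
    and B: "\<And>z. \<bar>u z - v z\<bar> \<le> B"
  shows "\<bar>fourier_proj L K u z - fourier_proj L K v z\<bar> \<le> (real (2 * K + 1))\<^sup>2 * B"
proof -
  obtain x y where z: "z = (x, y)" by (cases z)
  let ?s = "\<lambda>u x'. fsum L K (\<lambda>y'. of_real (u (x', y'))) y"
  have 1: "norm (?s u x' - ?s v x') \<le> real (2 * K + 1) * B" for x'
  proof -
    have "?s u x' - ?s v x' = fsum L K (\<lambda>y'. of_real (u (x', y')) - of_real (v (x', y'))) y"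
      by (rule fsum_diff[symmetric]; rule continuous_slice; fact)
    also have "norm \<dots> \<le> real (2 * K + 1) * B"
    proof (rule norm_fsum_le[OF _ L])
      show "norm (complex_of_real (u (x', y')) - of_real (v (x', y'))) \<le> B" for y'
        by (simp only: of_real_diff[symmetric] norm_of_real B)
    qed (intro continuous_on_diff continuous_slice u v)
    finally show ?thesis .
  qed
  have "fourier_proj L K u z - fourier_proj L K v z = Re (fsum L K (\<lambda>x'. ?s u x' - ?s v x') x)"
    unfolding z fourier_proj_eq[OF u] fourier_proj_eq[OF v]
    by (subst fsum_diff) (simp_all add: continuous_slice_fsum u v)
  also have "\<bar>\<dots>\<bar> \<le> norm (fsum L K (\<lambda>x'. ?s u x' - ?s v x') x)" by (rule abs_Re_le_cmod)
  also have "\<dots> \<le> real (2 * K + 1) * (real (2 * K + 1) * B)"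
    by (rule norm_fsum_le) (simp_all add: continuous_on_diff continuous_slice_fsum u v L 1[simplified])
  finally show ?thesis by (simp add: power2_eq_square mult.assoc)
qed

text \<open>The sequence \<open>D\<close> holds the successive derivatives along a line, so that
  they can be supplied by iterated partial derivatives without identifying iterated one-variable
  derivatives.\<close>

definition slice_smooth :: "real \<Rightarrow> nat \<Rightarrow> real \<Rightarrow> (real \<Rightarrow> real) \<Rightarrow> bool" where
  "slice_smooth L r B f \<longleftrightarrow> (\<exists>D. D 0 = f \<and> (\<forall>j<r. \<forall>x. (D j has_real_derivative D (Suc j) x) (at x)) \<and>
     continuous_on UNIV (D r) \<and> (\<forall>j\<le>r. \<forall>x. D j (x + L) = D j x) \<and> (\<forall>x. \<bar>D r x\<bar> \<le> B))"

lemma fsum_error_slice: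
  assumes "L > 0" "r \<ge> 2" "slice_smooth L r B f"
  shows "norm (fsum L K (\<lambda>x. of_real (f x)) x - of_real (f x)) \<le> 4 * (L / (2 * pi)) ^ r * B / real (K + 1) ^ (r - 2)"
proof -
  obtain D where D: "D 0 = f" "\<And>j x. j < r \<Longrightarrow> (D j has_real_derivative D (Suc j) x) (at x)"
    "continuous_on UNIV (D r)" "\<And>j x. j \<le> r \<Longrightarrow> D j (x + L) = D j x" "\<And>x. \<bar>D r x\<bar> \<le> B"
    using assms(3) unfolding slice_smooth_def by auto
  have "norm (fsum L K (\<lambda>x. of_real (D 0 x)) x - of_real (D 0 x)) \<le> 4 * (L / (2 * pi)) ^ r * B / real (K + 1) ^ (r - 2)"
  proof (rule fsum_error[where D = "\<lambda>j x. of_real (D j x)"])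
    show "((\<lambda>x. complex_of_real (D j x)) has_vector_derivative of_real (D (Suc j) x)) (at x)" if "j < r" for j x
      using D(2)[OF that] by (intro has_vector_derivative_of_real)
    show "continuous_on UNIV (\<lambda>x. complex_of_real (D r x))" by (intro continuous_intros D(3))
  qed (use assms D in auto)
  then show ?thesis by (simp add: D(1))
qed

text \<open>The projection in \<open>y\<close> has the one-dimensional error; applying the
  projection in \<open>x\<close> to that error costs a factor \<open>2 * K + 1\<close>. The rate is
  one power worse than in one variable, which the regularity of the data can afford.\<close>

lemma fourier_proj_error:
  fixes u :: "real \<times> real \<Rightarrow> real"
  assumes u: "continuous_on UNIV u" and L: "L > 0" and r: "r \<ge> 2"
    and sx: "\<And>y. slice_smooth L r B (\<lambda>x. u (x, y))" and sy: "\<And>x. slice_smooth L r B (\<lambda>y. u (x, y))"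
  shows "\<bar>fourier_proj L K u z - u z\<bar> \<le> 16 * (L / (2 * pi)) ^ r * B * real (K + 1) / real (K + 1) ^ (r - 2)"
proof -
  obtain x y where z: "z = (x, y)" by (cases z)
  define E where "E = 4 * (L / (2 * pi)) ^ r * B / real (K + 1) ^ (r - 2)"
  let ?s = "\<lambda>x'. fsum L K (\<lambda>y'. of_real (u (x', y'))) y"
  have e: "norm (?s x' - of_real (u (x', y))) \<le> E" for x'
    unfolding E_def by (rule fsum_error_slice[OF L r sy])
  have e2: "norm (fsum L K (\<lambda>x'. of_real (u (x', y))) x - of_real (u (x, y))) \<le> E"
    unfolding E_def by (rule fsum_error_slice[OF L r sx])
  have E0: "0 \<le> E" using e[of 0] norm_ge_zero order_trans by blast
  have d: "fsum L K (\<lambda>x'. ?s x' - of_real (u (x', y))) x = fsum L K ?s x - fsum L K (\<lambda>x'. of_real (u (x', y))) x"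
    by (intro fsum_diff continuous_slice_fsum continuous_slice u)
  have "fsum L K ?s x - of_real (u (x, y)) = fsum L K (\<lambda>x'. ?s x' - of_real (u (x', y))) x
      + (fsum L K (\<lambda>x'. of_real (u (x', y))) x - of_real (u (x, y)))"
    unfolding d by simp
  also have "norm \<dots> \<le> real (2 * K + 1) * E + E"
    by (intro norm_triangle_mono norm_fsum_le[OF _ L] continuous_on_diff continuous_slice_fsum continuous_slice u e
        e2)
  finally have n: "norm (fsum L K ?s x - of_real (u (x, y))) \<le> real (2 * K + 1) * E + E" .
  have "\<bar>fourier_proj L K u z - u z\<bar> = \<bar>Re (fsum L K ?s x - of_real (u (x, y)))\<bar>"
    by (simp add: z fourier_proj_eq[OF u])
  also have "\<dots> \<le> real (2 * K + 1) * E + E" using abs_Re_le_cmod n order_trans by blast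
  also have "\<dots> \<le> 4 * real (K + 1) * E" using E0 by (simp add: algebra_simps)
  also have "\<dots> = 16 * (L / (2 * pi)) ^ r * B * real (K + 1) / real (K + 1) ^ (r - 2)"
  proof -
    have "4 * n * (4 * X * B / R) = 16 * X * B * n / R" for n X R :: real by simp
    then show ?thesis unfolding E_def .
  qed
  finally show ?thesis .
qed

text \<open>A geometric sum over the powers of an \<open>N\<close>-th root of unity; the root
  differs from 1 because \<open>k\<close> is nonzero and smaller than \<open>N\<close> in
  modulus.\<close>

lemma fmode_grid_sum:
  assumes "L > 0" "k \<noteq> 0" "\<bar>k\<bar> \<le> int K"
  defines "N \<equiv> 2 * K + 1"
  shows "(\<Sum>i\<in>{1..int N}. fmode L k ((of_int i - 1/2) * (L / real N))) = 0"
proof -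
  define q where "q = cis (2 * pi * of_int k / real N)"
  have N: "N > 0" by (simp add: N_def)
  have "fmode L k ((of_int i - 1/2) * (L / real N)) = cis (- (pi * of_int k / real N)) * cis (2 * pi * of_int k / real N * of_int i)" for i
  proof -
    have "2 * pi * of_int k * ((of_int i - 1/2) * (L / real N)) / L = - (pi * of_int k / real N) + 2 * pi * of_int k / real N * of_int i"
      using assms(1) N by (simp add: field_simps)
    then show ?thesis unfolding fmode_def cis_mult by (rule arg_cong)
  qed
  moreover have "(\<Sum>i\<in>{1..int N}. cis (2 * pi * of_int k / real N * of_int i)) = (\<Sum>i<N. q ^ Suc i)"
  proof (rule sum.reindex_bij_witness[where i = "\<lambda>i. int i + 1" and j = "\<lambda>i. nat (i - 1)"])
    fix i assume "i \<in> {1..int N}"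
    then have i: "real (Suc (nat (i - 1))) = of_int i" by auto
    show "q ^ Suc (nat (i - 1)) = cis (2 * pi * of_int k / real N * of_int i)"
    proof -
      have "q ^ Suc (nat (i - 1)) = cis (real (Suc (nat (i - 1))) * (2 * pi * of_int k / real N))"
        unfolding q_def by (rule Complex.DeMoivre)
      then show ?thesis unfolding i by (simp only: mult.commute)
    qed
  qed auto
  moreover have "(\<Sum>i<N. q ^ Suc i) = 0"
  proof -
    have qN: "q ^ N = 1"
      using N cis_multiple_2pi[of "of_int k"] unfolding q_def Complex.DeMoivre by simp
    have "q \<noteq> 1"
    proof
      assume "q = 1"
      then have "cos (2 * pi * of_int k / real N) = 1" by (simp add: q_def complex_eq_iff)
      then obtain m :: int where m: "2 * pi * of_int k / real N = of_int m * 2 * pi" using cos_one_2pi_int by blast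
      then have "(2 * pi) * real_of_int k = (2 * pi) * (of_int m * real N)" using N by (simp add: field_simps)
      then have "real_of_int k = of_int (m * int N)" by (simp only: mult_cancel_left) simp
      then have k: "k = m * int N" by (simp only: of_int_eq_iff)
      then have "m \<noteq> 0" using assms(2) by auto
      then have "int N \<le> \<bar>k\<bar>" unfolding k abs_mult using mult_right_mono[of 1 "\<bar>m\<bar>" "int N"] by simp
      then show False using assms(3) by (simp add: N_def)
    qed
    then show ?thesis using qN by (simp add: sum_distrib_left[symmetric] geometric_sum)
  qed
  ultimately show ?thesis by (simp add: sum_distrib_left[symmetric])
qed

text \<open>The midpoint rule with \<open>2 * K + 1\<close> points per direction integrates
  trigonometric polynomials of degree up to \<open>K\<close> exactly. The projected data therefore
  carry exactly the mass of the exact solution.\<close>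

lemma grid_mean_fourier_proj:
  fixes u :: "real \<times> real \<Rightarrow> real" and K :: nat
  assumes u: "continuous_on UNIV u" and L: "L > 0"
  defines "N \<equiv> 2 * K + 1"
  shows "(\<Sum>i\<in>{1..int N}. \<Sum>j\<in>{1..int N}. grid_interp (L / real N) (fourier_proj L K u) i j) =
    (real N)\<^sup>2 * Re (fourier_coeff L u 0 0)"
proof -
  let ?I = "{1..int N}" and ?J = "{- int K..int K}"
  let ?p = "\<lambda>i. (of_int i - 1/2) * (L / real N)"
  have s: "(\<Sum>i\<in>?I. fmode L k (?p i)) = (if k = 0 then of_nat N else 0)" if "k \<in> ?J" for k
    using fmode_grid_sum[OF L, of k K] that unfolding N_def by auto
  have "(\<Sum>i\<in>?I. \<Sum>j\<in>?I. \<Sum>k\<in>?J. \<Sum>l\<in>?J. fourier_coeff L u k l * fourier_mode L k l (?p i, ?p j)) =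
    (\<Sum>k\<in>?J. \<Sum>l\<in>?J. fourier_coeff L u k l * ((\<Sum>i\<in>?I. fmode L k (?p i)) * (\<Sum>j\<in>?I. fmode L l (?p j))))"
  proof -
    have "(\<Sum>i\<in>?I. \<Sum>j\<in>?I. \<Sum>k\<in>?J. \<Sum>l\<in>?J. F i j k l) = (\<Sum>k\<in>?J. \<Sum>l\<in>?J. \<Sum>i\<in>?I. \<Sum>j\<in>?I. F i j k l)"
      for F :: "int \<Rightarrow> int \<Rightarrow> int \<Rightarrow> int \<Rightarrow> complex"
    proof -
      have "(\<Sum>i\<in>?I. \<Sum>j\<in>?I. \<Sum>k\<in>?J. \<Sum>l\<in>?J. F i j k l) = (\<Sum>i\<in>?I. \<Sum>k\<in>?J. \<Sum>l\<in>?J. \<Sum>j\<in>?I. F i j k l)"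
      proof (rule sum.cong[OF refl])
        fix i
        have "(\<Sum>j\<in>?I. \<Sum>k\<in>?J. \<Sum>l\<in>?J. F i j k l) = (\<Sum>k\<in>?J. \<Sum>j\<in>?I. \<Sum>l\<in>?J. F i j k l)" by (rule sum.swap)
        also have "\<dots> = (\<Sum>k\<in>?J. \<Sum>l\<in>?J. \<Sum>j\<in>?I. F i j k l)" by (intro sum.cong refl sum.swap)
        finally show "(\<Sum>j\<in>?I. \<Sum>k\<in>?J. \<Sum>l\<in>?J. F i j k l) = (\<Sum>k\<in>?J. \<Sum>l\<in>?J. \<Sum>j\<in>?I. F i j k l)" .
      qed
      also have "\<dots> = (\<Sum>k\<in>?J. \<Sum>i\<in>?I. \<Sum>l\<in>?J. \<Sum>j\<in>?I. F i j k l)" by (rule sum.swap)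
      also have "\<dots> = (\<Sum>k\<in>?J. \<Sum>l\<in>?J. \<Sum>i\<in>?I. \<Sum>j\<in>?I. F i j k l)" by (intro sum.cong refl sum.swap)
      finally show ?thesis .
    qed
    moreover have "c * ((\<Sum>i\<in>?I. a i) * (\<Sum>j\<in>?I. b j)) = (\<Sum>i\<in>?I. \<Sum>j\<in>?I. c * (a i * b j))"
      for c :: complex and a b by (subst sum_product) (simp only: sum_distrib_left)
    ultimately show ?thesis by (simp only: fourier_mode_eq)
  qed
  also have "\<dots> = (\<Sum>k\<in>?J. \<Sum>l\<in>?J. if k = 0 then (if l = 0 then fourier_coeff L u k l * (of_nat N)\<^sup>2 else 0) else 0)"
    by (intro sum.cong refl) (simp only: s, simp add: power2_eq_square)
  also have "\<dots> = fourier_coeff L u 0 0 * (of_nat N)\<^sup>2"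
  proof -
    have "(\<Sum>l\<in>?J. if k = 0 then (if l = 0 then fourier_coeff L u k l * (of_nat N)\<^sup>2 else 0) else 0) =
      (if k = 0 then fourier_coeff L u 0 0 * (of_nat N)\<^sup>2 else 0)" for k by simp
    then show ?thesis by simp
  qed
  finally have "(\<Sum>i\<in>?I. \<Sum>j\<in>?I. \<Sum>k\<in>?J. \<Sum>l\<in>?J. fourier_coeff L u k l * fourier_mode L k l (?p i, ?p j)) =
    of_real ((real N)\<^sup>2) * fourier_coeff L u 0 0" by (simp add: mult.commute)
  from arg_cong[OF this, of Re] show ?thesis
    by (simp add: grid_interp_def fourier_proj_def Re_sum del: of_real_power)
qed

subsection \<open>Bounded differentiable functions of two variables\<close>

text \<open>One bound for all mixed partial derivatives up to order \<open>k\<close>. It mentions no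
  supremum, whose finiteness would have to be shown first, and it is preserved by sums and products
  with explicit constants.\<close>

primrec Cb :: "nat \<Rightarrow> real \<Rightarrow> (real \<times> real \<Rightarrow> real) \<Rightarrow> bool" where
  "Cb 0 B u \<longleftrightarrow> continuous_on UNIV u \<and> (\<forall>z. \<bar>u z\<bar> \<le> B)"
| "Cb (Suc k) B u \<longleftrightarrow> continuous_on UNIV u \<and> (\<forall>z. \<bar>u z\<bar> \<le> B) \<and> partially_differentiable u \<and>
     Cb k B (pdx u) \<and> Cb k B (pdy u)"

lemma Cb_Suc: "Cb (Suc k) B u \<longleftrightarrow> continuous_on UNIV u \<and> (\<forall>z. \<bar>u z\<bar> \<le> B) \<and>
    partially_differentiable u \<and> Cb k B (pdx u) \<and> Cb k B (pdy u)"
  by (rule Cb.simps(2))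

declare Cb.simps(2) [simp del]

lemma Cb_continuous: "Cb k B u \<Longrightarrow> continuous_on UNIV u"
  by (cases k) (simp_all add: Cb_Suc)

lemma Cb_bound: "Cb k B u \<Longrightarrow> \<bar>u z\<bar> \<le> B"
  by (cases k) (simp_all add: Cb_Suc del: split_paired_All)

lemma Cb_Suc_D: "Cb (Suc k) B u \<Longrightarrow> Cb k B u"
proof (induction k arbitrary: u)
  case 0
  then show ?case unfolding Cb_Suc Cb.simps(1) by blast
next
  case (Suc k)
  have "Cb (Suc k) B (pdx u)" "Cb (Suc k) B (pdy u)" using Suc.prems unfolding Cb_Suc[of "Suc k"] by blast+
  then have "Cb k B (pdx u)" "Cb k B (pdy u)" by (auto intro: Suc.IH)
  then show ?case using Suc.prems unfolding Cb_Suc[of "Suc k"] unfolding Cb_Suc[of k] by blast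
qed

lemma Cb_Suc_parts:
  assumes "Cb (Suc k) B u"
  shows "partially_differentiable u" "Cb k B (pdx u)" "Cb k B (pdy u)"
  using assms unfolding Cb_Suc by blast+

lemma Cb_le: "Cb k B u \<Longrightarrow> k' \<le> k \<Longrightarrow> Cb k' B u"
proof (induction k)
  case (Suc k)
  then show ?case using Cb_Suc_D[OF Suc.prems(1)] by (cases "k' = Suc k") auto
qed simp

lemma Cb_mono: "Cb k B u \<Longrightarrow> B \<le> B' \<Longrightarrow> Cb k B' u"
proof (induction k arbitrary: u)
  case 0
  then show ?case using order_trans by (simp only: Cb.simps) blast
next
  case (Suc k)
  then show ?case using order_trans unfolding Cb_Suc by blast
qed

lemma pdx_has_derivative:
  "partially_differentiable u \<Longrightarrow> ((\<lambda>s. u (s, y)) has_real_derivative pdx u (x, y)) (at x)"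
  and pdy_has_derivative:
  "partially_differentiable u \<Longrightarrow> ((\<lambda>s. u (x, s)) has_real_derivative pdy u (x, y)) (at y)"
  unfolding partially_differentiable_def pdx_def pdy_def
  by (simp_all add: DERIV_deriv_iff_real_differentiable)

lemma Cb_SucI:
  assumes "continuous_on UNIV u" "\<And>z. \<bar>u z\<bar> \<le> B"
    and dx: "\<And>x y. ((\<lambda>s. u (s, y)) has_real_derivative a (x, y)) (at x)"
    and dy: "\<And>x y. ((\<lambda>s. u (x, s)) has_real_derivative b (x, y)) (at y)"
    and "Cb k B a" "Cb k B b"
  shows "Cb (Suc k) B u" "pdx u = a" "pdy u = b"
proof -
  show a: "pdx u = a" unfolding pdx_def using DERIV_imp_deriv[OF dx] by auto
  show b: "pdy u = b" unfolding pdy_def using DERIV_imp_deriv[OF dy] by auto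
  have "partially_differentiable u"
    unfolding partially_differentiable_def real_differentiable_def using dx dy by blast
  then show "Cb (Suc k) B u" unfolding Cb_Suc a b using assms by blast
qed

lemma Cb_const: "\<bar>c\<bar> \<le> B \<Longrightarrow> Cb k B (\<lambda>z. c)"
proof (induction k arbitrary: c)
  case (Suc k)
  have "Cb k B (\<lambda>z. 0)" using Suc by auto
  then show ?case using Suc.prems by (intro Cb_SucI[where a = "\<lambda>z. 0" and b = "\<lambda>z. 0"]) auto
qed simp

lemma Cb_add: "Cb k B u \<Longrightarrow> Cb k B' v \<Longrightarrow> Cb k (B + B') (\<lambda>z. u z + v z)"
proof (induction k arbitrary: u v)
  case 0
  have "\<bar>u z + v z\<bar> \<le> B + B'" for z
    using Cb_bound[OF 0(1), of z] Cb_bound[OF 0(2), of z] by linarith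
  then show ?case using continuous_on_add[OF Cb_continuous[OF 0(1)] Cb_continuous[OF 0(2)]] by simp
next
  case (Suc k)
  show ?case
  proof (rule Cb_SucI)
    show "Cb k (B + B') (\<lambda>z. pdx u z + pdx v z)" "Cb k (B + B') (\<lambda>z. pdy u z + pdy v z)"
      by (intro Suc.IH Cb_Suc_parts[OF Suc.prems(1)] Cb_Suc_parts[OF Suc.prems(2)])+
    show "\<bar>u z + v z\<bar> \<le> B + B'" for z
      using Cb_bound[OF Suc.prems(1), of z] Cb_bound[OF Suc.prems(2), of z] by linarith
    show "continuous_on UNIV (\<lambda>z. u z + v z)"
      by (rule continuous_on_add[OF Cb_continuous[OF Suc.prems(1)] Cb_continuous[OF Suc.prems(2)]])
    show "((\<lambda>s. u (s, y) + v (s, y)) has_real_derivative pdx u (x, y) + pdx v (x, y)) (at x)"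
      "((\<lambda>s. u (x, s) + v (x, s)) has_real_derivative pdy u (x, y) + pdy v (x, y)) (at y)" for x y
      by (intro DERIV_add pdx_has_derivative pdy_has_derivative Cb_Suc_parts(1)[OF Suc.prems(1)]
          Cb_Suc_parts(1)[OF Suc.prems(2)])+
  qed
qed

text \<open>The Leibniz rule doubles the number of terms with each order, hence
  \<open>2 ^ k\<close>.\<close>

lemma Cb_mult: "Cb k B u \<Longrightarrow> Cb k B' v \<Longrightarrow> Cb k (2 ^ k * B * B') (\<lambda>z. u z * v z)"
proof (induction k arbitrary: u v)
  case 0
  have "0 \<le> B" using Cb_bound[OF 0(1), of 0] by linarith
  then have "\<bar>u z * v z\<bar> \<le> B * B'" for z
    unfolding abs_mult by (intro mult_mono Cb_bound[OF 0(1)] Cb_bound[OF 0(2)]) auto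
  then show ?case using continuous_on_mult[OF Cb_continuous[OF 0(1)] Cb_continuous[OF 0(2)]] by simp
next
  case (Suc k)
  have B: "0 \<le> B" "0 \<le> B'"
    using Cb_bound[OF Suc.prems(1), of 0] Cb_bound[OF Suc.prems(2), of 0] by linarith+
  have e: "2 ^ k * B * B' + 2 ^ k * B * B' = 2 ^ Suc k * B * B'" by simp
  note p = Suc.prems(1)[THEN Cb_Suc_D] Suc.prems(2)[THEN Cb_Suc_D]
  show ?case
  proof (rule Cb_SucI)
    show "Cb k (2 ^ Suc k * B * B') (\<lambda>z. pdx u z * v z + u z * pdx v z)"
      "Cb k (2 ^ Suc k * B * B') (\<lambda>z. pdy u z * v z + u z * pdy v z)"
      unfolding e[symmetric]
      by (intro Cb_add Suc.IH p Cb_Suc_parts[OF Suc.prems(1)] Cb_Suc_parts[OF Suc.prems(2)])+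
    show "\<bar>u z * v z\<bar> \<le> 2 ^ Suc k * B * B'" for z
    proof -
      have "\<bar>u z * v z\<bar> \<le> B * B'"
        unfolding abs_mult using B Cb_bound[OF Suc.prems(1)] Cb_bound[OF Suc.prems(2)] by (intro mult_mono) auto
      also have "\<dots> \<le> 2 ^ Suc k * (B * B')"
        using B mult_right_mono[of 1 "2 ^ Suc k" "B * B'"] one_le_power[of "2::real" "Suc k"] by simp
      finally show ?thesis by (simp only: mult.assoc)
    qed
    show "continuous_on UNIV (\<lambda>z. u z * v z)"
      by (rule continuous_on_mult[OF Cb_continuous[OF Suc.prems(1)] Cb_continuous[OF Suc.prems(2)]])
    show "((\<lambda>s. u (s, y) * v (s, y)) has_real_derivative pdx u (x, y) * v (x, y) + u (x, y) * pdx v (x, y)) (at x)"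
      "((\<lambda>s. u (x, s) * v (x, s)) has_real_derivative pdy u (x, y) * v (x, y) + u (x, y) * pdy v (x, y)) (at y)" for x y
      using DERIV_mult[OF pdx_has_derivative[where x = x and y = y, OF Cb_Suc_parts(1)[OF Suc.prems(1)]]
          pdx_has_derivative[where x = x and y = y, OF Cb_Suc_parts(1)[OF Suc.prems(2)]]]
        DERIV_mult[OF pdy_has_derivative[where x = x and y = y, OF Cb_Suc_parts(1)[OF Suc.prems(1)]]
          pdy_has_derivative[where x = x and y = y, OF Cb_Suc_parts(1)[OF Suc.prems(2)]]]
      by (simp_all add: mult.commute)
  qed
qed

text \<open>Regularity uniform over a set of times. Hiding the bound behind a quantifier lets the
  potentials be treated by closure rules, without carrying constants through nonlinear
  expressions.\<close>

definition Cfam :: "nat \<Rightarrow> 'a set \<Rightarrow> ('a \<Rightarrow> real \<times> real \<Rightarrow> real) \<Rightarrow> bool" where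
  "Cfam k S U \<longleftrightarrow> (\<exists>B. \<forall>t\<in>S. Cb k B (U t))"

lemma Cfam_le: "Cfam k S U \<Longrightarrow> k' \<le> k \<Longrightarrow> Cfam k' S U"
  unfolding Cfam_def using Cb_le by blast

lemma Cfam_add: "Cfam k S U \<Longrightarrow> Cfam k S V \<Longrightarrow> Cfam k S (\<lambda>t z. U t z + V t z)"
proof -
  assume "Cfam k S U" "Cfam k S V"
  then obtain B1 B2 where "\<And>t. t \<in> S \<Longrightarrow> Cb k B1 (U t)" "\<And>t. t \<in> S \<Longrightarrow> Cb k B2 (V t)"
    unfolding Cfam_def by blast
  then show ?thesis unfolding Cfam_def by (intro exI[of _ "B1 + B2"] ballI Cb_add)
qed

lemma Cfam_mult: "Cfam k S U \<Longrightarrow> Cfam k S V \<Longrightarrow> Cfam k S (\<lambda>t z. U t z * V t z)"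
proof -
  assume "Cfam k S U" "Cfam k S V"
  then obtain B1 B2 where "\<And>t. t \<in> S \<Longrightarrow> Cb k B1 (U t)" "\<And>t. t \<in> S \<Longrightarrow> Cb k B2 (V t)"
    unfolding Cfam_def by blast
  then show ?thesis unfolding Cfam_def by (intro exI[of _ "2 ^ k * B1 * B2"] ballI Cb_mult)
qed

lemma Cfam_const: "Cfam k S (\<lambda>t z. c)"
  unfolding Cfam_def using Cb_const[of c "\<bar>c\<bar>" k] by blast

lemma Cfam_cmult: "Cfam k S U \<Longrightarrow> Cfam k S (\<lambda>t z. c * U t z)"
  by (rule Cfam_mult[OF Cfam_const])

lemma Cfam_diff: "Cfam k S U \<Longrightarrow> Cfam k S V \<Longrightarrow> Cfam k S (\<lambda>t z. U t z - V t z)"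
  using Cfam_add[OF _ Cfam_cmult[of k S V "-1"], of U] by simp

lemma Cfam_power: "Cfam k S U \<Longrightarrow> Cfam k S (\<lambda>t z. U t z ^ n)"
  by (induction n) (simp_all add: Cfam_const Cfam_mult)

lemma Cfam_cong: "Cfam k S U \<Longrightarrow> (\<And>t. t \<in> S \<Longrightarrow> U t = V t) \<Longrightarrow> Cfam k S V"
  unfolding Cfam_def by auto

lemma Cfam_pdx: "Cfam (Suc k) S U \<Longrightarrow> Cfam k S (\<lambda>t. pdx (U t))"
  and Cfam_pdy: "Cfam (Suc k) S U \<Longrightarrow> Cfam k S (\<lambda>t. pdy (U t))"
  unfolding Cfam_def using Cb_Suc_parts by blast+

lemma Cfam_SucI:
  assumes U: "Cfam 0 S U" and A: "Cfam k S A" and B: "Cfam k S B"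
    and dx: "\<And>t x y. t \<in> S \<Longrightarrow> ((\<lambda>s. U t (s, y)) has_real_derivative A t (x, y)) (at x)"
    and dy: "\<And>t x y. t \<in> S \<Longrightarrow> ((\<lambda>s. U t (x, s)) has_real_derivative B t (x, y)) (at y)"
  shows "Cfam (Suc k) S U"
proof -
  obtain b1 b2 b3 where b: "\<And>t. t \<in> S \<Longrightarrow> Cb 0 b1 (U t)" "\<And>t. t \<in> S \<Longrightarrow> Cb k b2 (A t)" "\<And>t. t \<in> S \<Longrightarrow> Cb k b3 (B t)"
    using U A B unfolding Cfam_def by blast
  define b0 where "b0 = max b1 (max b2 b3)"
  have "Cb (Suc k) b0 (U t)" if t: "t \<in> S" for t
  proof (rule Cb_SucI)
    show "continuous_on UNIV (U t)" by (rule Cb_continuous[OF b(1)[OF t]])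
    show "\<bar>U t z\<bar> \<le> b0" for z using Cb_bound[OF b(1)[OF t], of z] by (simp add: b0_def)
    show "Cb k b0 (A t)" by (rule Cb_mono[OF b(2)[OF t]]) (simp add: b0_def)
    show "Cb k b0 (B t)" by (rule Cb_mono[OF b(3)[OF t]]) (simp add: b0_def)
  qed (use dx dy t in auto)
  then show ?thesis unfolding Cfam_def by blast
qed

lemma Cfam_partial:
  assumes "Cfam (Suc k) S U" "t \<in> S"
  shows "((\<lambda>s. U t (s, y)) has_real_derivative pdx (U t) (x, y)) (at x)"
    "((\<lambda>s. U t (x, s)) has_real_derivative pdy (U t) (x, y)) (at y)"
proof -
  obtain B where "Cb (Suc k) B (U t)" using assms unfolding Cfam_def by blast
  note pd = Cb_Suc_parts(1)[OF this]
  show "((\<lambda>s. U t (s, y)) has_real_derivative pdx (U t) (x, y)) (at x)" by (rule pdx_has_derivative[OF pd])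
  show "((\<lambda>s. U t (x, s)) has_real_derivative pdy (U t) (x, y)) (at y)" by (rule pdy_has_derivative[OF pd])
qed

text \<open>The partial derivatives are minus the cube of the function times an expression in
  \<open>P\<close>, \<open>Q\<close> and their derivatives. They need the function itself only at
  order \<open>k\<close>, so the induction closes; the \<delta> term keeps the root away from
  0.\<close>

lemma Cfam_rsqrt:
  assumes "\<delta> > 0"
  shows "Cfam k S P \<Longrightarrow> Cfam k S Q \<Longrightarrow> Cfam k S (\<lambda>t z. 1 / sqrt ((P t z)\<^sup>2 + (Q t z)\<^sup>2 + \<delta>\<^sup>2))"
proof (induction k)
  case 0
  have pos: "0 < a\<^sup>2 + b\<^sup>2 + \<delta>\<^sup>2" for a b using assms by (simp add: add_nonneg_pos)
  have "Cb 0 (1/\<delta>) (\<lambda>z. 1 / sqrt ((P t z)\<^sup>2 + (Q t z)\<^sup>2 + \<delta>\<^sup>2))" if t: "t \<in> S" for t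
  proof -
    have c: "continuous_on UNIV (P t)" "continuous_on UNIV (Q t)" using 0 t unfolding Cfam_def by (blast intro: Cb_continuous)+
    have "\<bar>1 / sqrt (a\<^sup>2 + b\<^sup>2 + \<delta>\<^sup>2)\<bar> \<le> 1/\<delta>" for a b
    proof -
      have "\<delta> \<le> sqrt (a\<^sup>2 + b\<^sup>2 + \<delta>\<^sup>2)" by (rule real_le_rsqrt) simp
      then show ?thesis using assms by (simp add: frac_le)
    qed
    moreover have "sqrt (a\<^sup>2 + b\<^sup>2 + \<delta>\<^sup>2) \<noteq> 0" for a b using pos[of a b] by simp
    then have "continuous_on UNIV (\<lambda>z. 1 / sqrt ((P t z)\<^sup>2 + (Q t z)\<^sup>2 + \<delta>\<^sup>2))"
      by (intro continuous_intros c) blast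
    ultimately show ?thesis by simp
  qed
  then show ?case unfolding Cfam_def by blast
next
  case (Suc k)
  let ?w = "\<lambda>t z. 1 / sqrt ((P t z)\<^sup>2 + (Q t z)\<^sup>2 + \<delta>\<^sup>2)"
  have PQ: "Cfam k S P" "Cfam k S Q" by (rule Cfam_le[OF Suc.prems(1)], simp, rule Cfam_le[OF Suc.prems(2)], simp)
  have IH: "Cfam k S ?w" by (rule Suc.IH[OF PQ])
  have W0: "Cfam 0 S ?w" by (rule Cfam_le[OF IH]) simp
  have D: "((\<lambda>s. 1 / sqrt ((p s)\<^sup>2 + (q s)\<^sup>2 + \<delta>\<^sup>2)) has_real_derivative
      (-1) * ((1 / sqrt ((p x)\<^sup>2 + (q x)\<^sup>2 + \<delta>\<^sup>2)) ^ 3 * (p x * p' + q x * q'))) (at x)"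
    if "(p has_real_derivative p') (at x)" "(q has_real_derivative q') (at x)" for p q p' q' x
  proof -
    define X where "X = (p x)\<^sup>2 + (q x)\<^sup>2 + \<delta>\<^sup>2"
    have X: "X > 0" using assms by (simp add: X_def add_nonneg_pos)
    have 1: "((\<lambda>s. (p s)\<^sup>2 + (q s)\<^sup>2 + \<delta>\<^sup>2) has_real_derivative (2 * (p x * p' + q x * q'))) (at x)"
      using that by (auto intro!: derivative_eq_intros simp: algebra_simps)
    have 2: "((\<lambda>s. sqrt ((p s)\<^sup>2 + (q s)\<^sup>2 + \<delta>\<^sup>2)) has_real_derivative (inverse (sqrt X) / 2) * (2 * (p x * p' + q x * q'))) (at x)"
      unfolding X_def by (rule DERIV_chain2[OF DERIV_real_sqrt 1]) (use X in \<open>simp add: X_def\<close>)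
    have 3: "((\<lambda>s. inverse (sqrt ((p s)\<^sup>2 + (q s)\<^sup>2 + \<delta>\<^sup>2))) has_real_derivative
      - (inverse (sqrt X) * ((inverse (sqrt X) / 2) * (2 * (p x * p' + q x * q'))) * inverse (sqrt X))) (at x)"
      using DERIV_inverse'[OF 2] X by (simp add: X_def)
    have "- (inverse Y * ((inverse Y / 2) * (2 * k)) * inverse Y) = (-1) * ((1 / Y) ^ 3 * k)" for Y k :: real
      by (cases "Y = 0") (simp_all add: field_simps power3_eq_cube)
    note 4 = DERIV_cong[OF 3 this]
    have "(\<lambda>s. inverse (sqrt ((p s)\<^sup>2 + (q s)\<^sup>2 + \<delta>\<^sup>2))) = (\<lambda>s. 1 / sqrt ((p s)\<^sup>2 + (q s)\<^sup>2 + \<delta>\<^sup>2))"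
      by (simp add: inverse_eq_divide)
    then show ?thesis using 4 unfolding X_def by metis
  qed
  show ?case
  proof (rule Cfam_SucI[OF W0])
    show "Cfam k S (\<lambda>t z. (-1) * (?w t z ^ 3 * (P t z * pdx (P t) z + Q t z * pdx (Q t) z)))"
      "Cfam k S (\<lambda>t z. (-1) * (?w t z ^ 3 * (P t z * pdy (P t) z + Q t z * pdy (Q t) z)))"
      by (intro Cfam_cmult Cfam_mult Cfam_add Cfam_power IH PQ Cfam_pdx Cfam_pdy Suc.prems)+
  qed (intro D Cfam_partial[OF Suc.prems(1)] Cfam_partial[OF Suc.prems(2)]; assumption)+
qed

lemma Cfam_inverse:
  assumes "c > 0" "\<And>t z. t \<in> S \<Longrightarrow> c \<le> V t z"
  shows "Cfam k S V \<Longrightarrow> Cfam k S (\<lambda>t z. 1 / V t z)"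
proof (induction k)
  case 0
  have "Cb 0 (1/c) (\<lambda>z. 1 / V t z)" if t: "t \<in> S" for t
  proof -
    have "continuous_on UNIV (V t)" using 0 t unfolding Cfam_def by (blast intro: Cb_continuous)+
    moreover have "V t z > 0" "V t z \<noteq> 0" for z using assms(1) assms(2)[OF t, of z] by linarith+
    ultimately show ?thesis using assms(1) assms(2)[OF t]
      by (auto intro!: continuous_on_divide continuous_on_const simp: frac_le abs_of_pos)
  qed
  then show ?case unfolding Cfam_def by blast
next
  case (Suc k)
  have V: "Cfam k S V" by (rule Cfam_le[OF Suc.prems]) simp
  have IH: "Cfam k S (\<lambda>t z. 1 / V t z)" by (rule Suc.IH[OF V])
  have W0: "Cfam 0 S (\<lambda>t z. 1 / V t z)" by (rule Cfam_le[OF IH]) simp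
  have D: "((\<lambda>s. 1 / v s) has_real_derivative (-1) * ((1 / v x) ^ 2 * v')) (at x)"
    if "(v has_real_derivative v') (at x)" "v x \<noteq> 0" for v v' x
    using that by (auto intro!: derivative_eq_intros simp: power2_eq_square)
  have nz: "V t z \<noteq> 0" if "t \<in> S" for t z using assms(1) assms(2)[OF that, of z] by linarith
  show ?case
  proof (rule Cfam_SucI[OF W0])
    show "Cfam k S (\<lambda>t z. (-1) * ((1 / V t z) ^ 2 * pdx (V t) z))"
      "Cfam k S (\<lambda>t z. (-1) * ((1 / V t z) ^ 2 * pdy (V t) z))"
      by (intro Cfam_cmult Cfam_mult Cfam_power IH Cfam_pdx Cfam_pdy Suc.prems)+
  qed (intro D nz Cfam_partial[OF Suc.prems]; assumption)+
qed

text \<open>The derivative is \<open>1 / V\<close> times that of \<open>V\<close>, which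
  \<open>Cfam_inverse\<close> covers. At order 0 the bounds \<open>c\<close> and 1 confine the
  logarithm between \<open>ln c\<close> and 0.\<close>

lemma Cfam_ln:
  assumes "c > 0" "\<And>t z. t \<in> S \<Longrightarrow> c \<le> V t z" "\<And>t z. t \<in> S \<Longrightarrow> V t z \<le> 1" "Cfam k S V"
  shows "Cfam k S (\<lambda>t z. ln (V t z))"
proof -
  have W0: "Cfam 0 S (\<lambda>t z. ln (V t z))"
  proof -
    have "Cb 0 (- ln c) (\<lambda>z. ln (V t z))" if t: "t \<in> S" for t
    proof -
      have "continuous_on UNIV (V t)" using assms(4) t unfolding Cfam_def by (blast intro: Cb_continuous)
      moreover have V: "V t z > 0" "V t z \<noteq> 0" for z using assms(1) assms(2)[OF t, of z] by linarith+
      moreover have "ln c \<le> ln (V t z)" "ln (V t z) \<le> 0" for z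
        using assms(1) assms(2)[OF t, of z] assms(3)[OF t, of z] V[of z] by (simp_all add: ln_le_zero_iff)
      ultimately show ?thesis by (auto intro!: continuous_on_ln)
    qed
    then show ?thesis unfolding Cfam_def by blast
  qed
  show ?thesis
  proof (cases k)
    case 0
    then show ?thesis using W0 by simp
  next
    case (Suc m)
    have V: "Cfam (Suc m) S V" "Cfam m S V" using assms(4) Suc Cfam_le[of k S V m] by auto
    have D: "((\<lambda>s. ln (v s)) has_real_derivative (1 / v x) * v') (at x)"
      if "(v has_real_derivative v') (at x)" "v x > 0" for v v' x
      using that by (auto intro!: derivative_eq_intros simp: divide_inverse mult.commute)
    have pos: "V t z > 0" if "t \<in> S" for t z using assms(1) assms(2)[OF that, of z] by linarith
    show ?thesis unfolding Suc
    proof (rule Cfam_SucI[OF W0])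
      show "Cfam m S (\<lambda>t z. (1 / V t z) * pdx (V t) z)" "Cfam m S (\<lambda>t z. (1 / V t z) * pdy (V t) z)"
        by (intro Cfam_mult Cfam_inverse[OF assms(1,2)] Cfam_pdx Cfam_pdy V; assumption)+
    qed (intro D pos Cfam_partial[OF V(1)]; assumption)+
  qed
qed

text \<open>\<open>sup_norm\<close> is a supremum of reals and means nothing for an unbounded
  function; periodicity reduces boundedness to continuity on a compact cell.\<close>

lemma C_per_bounded:
  assumes "C_per L u" "L > 0"
  shows "\<bar>u z\<bar> \<le> sup_norm u"
proof -
  have cont: "continuous_on UNIV u" and p: "\<And>x y. u (x + L, y) = u (x, y)" "\<And>x y. u (x, y + L) = u (x, y)"
    using assms by (auto simp: C_per_def)
  have "compact (u ` cbox (0, 0) (L, L))"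
    by (intro compact_continuous_image continuous_on_subset[OF cont subset_UNIV] compact_cbox)
  then obtain b where b: "\<And>z. z \<in> cbox (0, 0) (L, L) \<Longrightarrow> norm (u z) \<le> b"
    using compact_imp_bounded bounded_iff by (metis imageI)
  have "\<bar>u z\<bar> \<le> b" for z
  proof -
    obtain x y where z: "z = (x, y)" by (cases z)
    define m where "m = \<lfloor>x / L\<rfloor>"
    define n where "n = \<lfloor>y / L\<rfloor>"
    have "0 \<le> x - of_int m * L" "x - of_int m * L \<le> L" "0 \<le> y - of_int n * L" "y - of_int n * L \<le> L"
      using floor_divide_lower[OF assms(2), of x] floor_divide_upper[OF assms(2), of x]
        floor_divide_lower[OF assms(2), of y] floor_divide_upper[OF assms(2), of y]
      by (auto simp: m_def n_def algebra_simps)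
    then have "\<bar>u (x - of_int m * L, y - of_int n * L)\<bar> \<le> b" using b by (auto simp: cbox_Pair_iff)
    moreover have "u (x - of_int m * L + of_int m * L, y - of_int n * L) = u (x - of_int m * L, y - of_int n * L)"
      by (rule periodic_int_shift[where f = "\<lambda>x. u (x, y - of_int n * L)"]) (rule p)
    moreover have "u (x, y - of_int n * L + of_int n * L) = u (x, y - of_int n * L)"
      by (rule periodic_int_shift[where f = "\<lambda>y. u (x, y)"]) (rule p)
    ultimately show ?thesis by (simp add: z)
  qed
  then have "bdd_above (range (\<lambda>z. \<bar>u z\<bar>))" by (auto simp: bdd_above_def)
  then show ?thesis unfolding sup_norm_def by (intro cSUP_upper) auto
qed

lemma Ck_per_imp_Cb:
  assumes "L > 0"
  shows "Ck_per L k u \<Longrightarrow> Ck_norm k u \<le> B \<Longrightarrow> Cb k B u"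
proof (induction k arbitrary: u)
  case 0
  then have "C_per L u" "sup_norm u \<le> B" by simp_all
  then have "\<bar>u z\<bar> \<le> B" for z using C_per_bounded[of L u z] assms by linarith
  then show ?case using \<open>C_per L u\<close> by (simp add: C_per_def)
next
  case (Suc k)
  have "C_per L u" using Suc by simp
  moreover have "sup_norm u \<le> B" "Ck_norm k (pdx u) \<le> B" "Ck_norm k (pdy u) \<le> B" using Suc.prems(2) by simp_all
  ultimately have "\<bar>u z\<bar> \<le> B" for z using C_per_bounded[of L u z] assms by linarith
  moreover have "Cb k B (pdx u)" "Cb k B (pdy u)"
    using Suc.IH Suc.prems(1) \<open>Ck_norm k (pdx u) \<le> B\<close> \<open>Ck_norm k (pdy u) \<le> B\<close> by simp_all
  ultimately show ?case using Suc.prems(1) \<open>C_per L u\<close> by (simp add: C_per_def Cb_Suc)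
qed

subsection \<open>Central differences\<close>

lemma Cb_iterated:
  assumes "Cb k B u"
  shows "m \<le> k \<Longrightarrow> Cb (k - m) B ((pdx ^^ m) u)" "m \<le> k \<Longrightarrow> Cb (k - m) B ((pdy ^^ m) u)"
proof (induction m)
  case (Suc m)
  { case 1
    then have "Cb (Suc (k - Suc m)) B ((pdx ^^ m) u)" using Suc.IH(1) by (simp add: Suc_diff_Suc)
    then show ?case using Cb_Suc_parts(2) by simp }
  { case 2
    then have "Cb (Suc (k - Suc m)) B ((pdy ^^ m) u)" using Suc.IH(2) by (simp add: Suc_diff_Suc)
    then show ?case using Cb_Suc_parts(3) by simp }
qed (use assms in auto)

lemma Cb_slices:
  assumes "Cb k B u" "m < k"
  shows "((\<lambda>s. (pdx ^^ m) u (s, y)) has_real_derivative (pdx ^^ Suc m) u (x, y)) (at x)"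
    "((\<lambda>s. (pdy ^^ m) u (x, s)) has_real_derivative (pdy ^^ Suc m) u (x, y)) (at y)"
proof -
  have "Cb (Suc (k - Suc m)) B ((pdx ^^ m) u)" "Cb (Suc (k - Suc m)) B ((pdy ^^ m) u)"
    using Cb_iterated[OF assms(1), of m] assms(2) by (simp_all add: Suc_diff_Suc)
  then show "((\<lambda>s. (pdx ^^ m) u (s, y)) has_real_derivative (pdx ^^ Suc m) u (x, y)) (at x)"
    "((\<lambda>s. (pdy ^^ m) u (x, s)) has_real_derivative (pdy ^^ Suc m) u (x, y)) (at y)"
    using pdx_has_derivative[OF Cb_Suc_parts(1)] pdy_has_derivative[OF Cb_Suc_parts(1)] by simp_all
qed

lemma Taylor_bound:
  fixes D :: "nat \<Rightarrow> real \<Rightarrow> real"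
  assumes D: "\<And>m x. m < n \<Longrightarrow> (D m has_real_derivative D (Suc m) x) (at x)" and B: "\<And>x. \<bar>D n x\<bar> \<le> B"
  shows "\<bar>D 0 (c + x) - (\<Sum>m<n. D m c / fact m * x ^ m)\<bar> \<le> B / fact n * \<bar>x\<bar> ^ n"
proof -
  have "\<exists>t. \<bar>t\<bar> \<le> \<bar>x\<bar> \<and> D 0 (c + x) = (\<Sum>m<n. D m (c + 0) / fact m * x ^ m) + D n (c + t) / fact n * x ^ n"
  proof (rule Maclaurin_bi_le[where f = "\<lambda>x. D 0 (c + x)" and diff = "\<lambda>m x. D m (c + x)"])
    show "\<forall>m t. m < n \<and> \<bar>t\<bar> \<le> \<bar>x\<bar> \<longrightarrow> ((\<lambda>x. D m (c + x)) has_real_derivative D (Suc m) (c + t)) (at t)"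
    proof (intro allI impI)
      fix m t assume "m < n \<and> \<bar>t\<bar> \<le> \<bar>x\<bar>"
      then show "((\<lambda>x. D m (c + x)) has_real_derivative D (Suc m) (c + t)) (at t)"
        using DERIV_shift[of "D m" "D (Suc m) (c + t)" t c] D[of m "t + c"] by (simp add: add.commute)
    qed
  qed simp
  then obtain t where "D 0 (c + x) = (\<Sum>m<n. D m (c + 0) / fact m * x ^ m) + D n (c + t) / fact n * x ^ n" by blast
  then have "D 0 (c + x) - (\<Sum>m<n. D m c / fact m * x ^ m) = D n (c + t) / fact n * x ^ n" by simp
  then show ?thesis using B[of "c + t"] by (simp add: abs_mult power_abs divide_right_mono mult_right_mono)
qed

text \<open>All four formulas come from one Taylor estimate, with \<open>n\<close> the order of the
  derivative that bounds the remainder. Numerical factors below 1 are rounded up.\<close>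

lemma central_differences:
  fixes D :: "nat \<Rightarrow> real \<Rightarrow> real"
  assumes D: "\<And>m x. m < n \<Longrightarrow> (D m has_real_derivative D (Suc m) x) (at x)" and B: "\<And>x. \<bar>D n x\<bar> \<le> B"
    and h: "h > 0"
  shows "n = 4 \<Longrightarrow> \<bar>(D 0 (c + h) - 2 * D 0 c + D 0 (c - h)) / h\<^sup>2 - D 2 c\<bar> \<le> B * h\<^sup>2"
    "n = 3 \<Longrightarrow> \<bar>(D 0 (c + h / 2) - D 0 (c - h / 2)) / h - D 1 c\<bar> \<le> B * h\<^sup>2"
    "n = 2 \<Longrightarrow> \<bar>(D 0 (c + h / 2) + D 0 (c - h / 2)) / 2 - D 0 c\<bar> \<le> B * h\<^sup>2"
    "n = 1 \<Longrightarrow> \<bar>D 0 (c + h) - D 0 c\<bar> \<le> B * h"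
proof -
  have B0: "0 \<le> B" using B[of 0] by linarith
  note T = Taylor_bound[of n D B, OF D B]
  show "\<bar>(D 0 (c + h) - 2 * D 0 c + D 0 (c - h)) / h\<^sup>2 - D 2 c\<bar> \<le> B * h\<^sup>2" if n: "n = 4"
  proof -
    have "\<bar>D 0 (c + h) - (D 0 c + D 1 c * h + D 2 c / 2 * h\<^sup>2 + D 3 c / 6 * h ^ 3)\<bar> \<le> B / 24 * h ^ 4"
      "\<bar>D 0 (c - h) - (D 0 c - D 1 c * h + D 2 c / 2 * h\<^sup>2 - D 3 c / 6 * h ^ 3)\<bar> \<le> B / 24 * h ^ 4"
      using T[of c h] T[of c "- h"] h n by (simp_all add: eval_nat_numeral fact_numeral algebra_simps)
    then have "\<bar>D 0 (c + h) - 2 * D 0 c + D 0 (c - h) - D 2 c * h\<^sup>2\<bar> \<le> B / 12 * h ^ 4" by linarith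
    then have "\<bar>D 0 (c + h) - 2 * D 0 c + D 0 (c - h) - D 2 c * h\<^sup>2\<bar> / h\<^sup>2 \<le> B / 12 * h ^ 4 / h\<^sup>2"
      by (intro divide_right_mono) auto
    also have "B / 12 * h ^ 4 / h\<^sup>2 = B / 12 * h\<^sup>2" using h by (simp add: eval_nat_numeral)
    also have "\<dots> \<le> B * h\<^sup>2" using B0 by (intro mult_right_mono) auto
    also have "\<bar>D 0 (c + h) - 2 * D 0 c + D 0 (c - h) - D 2 c * h\<^sup>2\<bar> / h\<^sup>2 =
        \<bar>(D 0 (c + h) - 2 * D 0 c + D 0 (c - h) - D 2 c * h\<^sup>2) / h\<^sup>2\<bar>" by (simp add: abs_divide)
    also have "(D 0 (c + h) - 2 * D 0 c + D 0 (c - h) - D 2 c * h\<^sup>2) / h\<^sup>2 = (D 0 (c + h) - 2 * D 0 c + D 0 (c - h)) / h\<^sup>2 - D 2 c"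
      using h by (simp add: diff_divide_distrib)
    finally show ?thesis .
  qed
  show "\<bar>(D 0 (c + h / 2) - D 0 (c - h / 2)) / h - D 1 c\<bar> \<le> B * h\<^sup>2" if n: "n = 3"
  proof -
    define k where "k = h / 2"
    have k: "k > 0" "h = 2 * k" using h by (auto simp: k_def)
    have "\<bar>D 0 (c + k) - (D 0 c + D 1 c * k + D 2 c / 2 * k\<^sup>2)\<bar> \<le> B / 6 * k ^ 3"
      "\<bar>D 0 (c - k) - (D 0 c - D 1 c * k + D 2 c / 2 * k\<^sup>2)\<bar> \<le> B / 6 * k ^ 3"
      using T[of c k] T[of c "- k"] k n by (simp_all add: eval_nat_numeral fact_numeral algebra_simps)
    then have "\<bar>D 0 (c + k) - D 0 (c - k) - D 1 c * h\<bar> \<le> B / 3 * k ^ 3" unfolding k(2) by linarith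
    then have "\<bar>D 0 (c + k) - D 0 (c - k) - D 1 c * h\<bar> / h \<le> B / 3 * k ^ 3 / h"
      using h by (intro divide_right_mono) auto
    also have "B / 3 * k ^ 3 / h = B / 6 * k\<^sup>2" using k by (simp add: eval_nat_numeral)
    also have "\<dots> \<le> B * h\<^sup>2"
    proof -
      have "B / 6 * k\<^sup>2 \<le> B * (4 * k\<^sup>2)" using B0 by simp
      then show ?thesis by (simp add: k(2) power_mult_distrib)
    qed
    also have "\<bar>D 0 (c + k) - D 0 (c - k) - D 1 c * h\<bar> / h = \<bar>(D 0 (c + k) - D 0 (c - k) - D 1 c * h) / h\<bar>"
      using h by (simp add: abs_divide)
    also have "(D 0 (c + k) - D 0 (c - k) - D 1 c * h) / h = (D 0 (c + k) - D 0 (c - k)) / h - D 1 c"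
      using h by (simp add: diff_divide_distrib)
    finally show ?thesis by (simp add: k_def)
  qed
  show "\<bar>(D 0 (c + h / 2) + D 0 (c - h / 2)) / 2 - D 0 c\<bar> \<le> B * h\<^sup>2" if n: "n = 2"
  proof -
    have "\<bar>D 0 (c + h / 2) - (D 0 c + D 1 c * (h / 2))\<bar> \<le> B / 2 * (h / 2)\<^sup>2"
      "\<bar>D 0 (c - h / 2) - (D 0 c - D 1 c * (h / 2))\<bar> \<le> B / 2 * (h / 2)\<^sup>2"
      using T[of c "h / 2"] T[of c "- (h / 2)"] h n by (simp_all add: eval_nat_numeral fact_numeral algebra_simps)
    then have "\<bar>D 0 (c + h / 2) + D 0 (c - h / 2) - 2 * D 0 c\<bar> \<le> 2 * (B / 2 * (h / 2)\<^sup>2)" by linarith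
    also have "2 * (B / 2 * (h / 2)\<^sup>2) \<le> 2 * (B * h\<^sup>2)" using B0 by (simp add: power_divide)
    finally have "\<bar>(D 0 (c + h / 2) + D 0 (c - h / 2) - 2 * D 0 c) / 2\<bar> \<le> B * h\<^sup>2" by (simp add: abs_divide)
    then show ?thesis by (simp add: diff_divide_distrib)
  qed
  show "\<bar>D 0 (c + h) - D 0 c\<bar> \<le> B * h" if n: "n = 1" using T[of c h] h n by simp
qed

lemma Cb_central_x:
  assumes "Cb n B u" "h > 0"
  shows "n = 4 \<Longrightarrow> \<bar>(u (x + h, y) - 2 * u (x, y) + u (x - h, y)) / h\<^sup>2 - pdx (pdx u) (x, y)\<bar> \<le> B * h\<^sup>2"
    "n = 3 \<Longrightarrow> \<bar>(u (x + h / 2, y) - u (x - h / 2, y)) / h - pdx u (x, y)\<bar> \<le> B * h\<^sup>2"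
    "n = 2 \<Longrightarrow> \<bar>(u (x + h / 2, y) + u (x - h / 2, y)) / 2 - u (x, y)\<bar> \<le> B * h\<^sup>2"
    "n = 1 \<Longrightarrow> \<bar>u (x + h, y) - u (x, y)\<bar> \<le> B * h"
proof -
  have b: "\<bar>(pdx ^^ n) u (s, y)\<bar> \<le> B" for s by (rule Cb_bound[OF Cb_iterated(1)[OF assms(1) order_refl]])
  note C = central_differences[of n "\<lambda>m s. (pdx ^^ m) u (s, y)" B h x, OF Cb_slices(1)[OF assms(1)] b assms(2)]
  show "n = 4 \<Longrightarrow> \<bar>(u (x + h, y) - 2 * u (x, y) + u (x - h, y)) / h\<^sup>2 - pdx (pdx u) (x, y)\<bar> \<le> B * h\<^sup>2"
    using C(1) by (simp add: numeral_2_eq_2)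
  show "n = 3 \<Longrightarrow> \<bar>(u (x + h / 2, y) - u (x - h / 2, y)) / h - pdx u (x, y)\<bar> \<le> B * h\<^sup>2"
    using C(2) by simp
  show "n = 2 \<Longrightarrow> \<bar>(u (x + h / 2, y) + u (x - h / 2, y)) / 2 - u (x, y)\<bar> \<le> B * h\<^sup>2"
    using C(3) by simp
  show "n = 1 \<Longrightarrow> \<bar>u (x + h, y) - u (x, y)\<bar> \<le> B * h"
    using C(4) by simp
qed

lemma Cb_central_y:
  assumes "Cb n B u" "h > 0"
  shows "n = 4 \<Longrightarrow> \<bar>(u (x, y + h) - 2 * u (x, y) + u (x, y - h)) / h\<^sup>2 - pdy (pdy u) (x, y)\<bar> \<le> B * h\<^sup>2"
    "n = 3 \<Longrightarrow> \<bar>(u (x, y + h / 2) - u (x, y - h / 2)) / h - pdy u (x, y)\<bar> \<le> B * h\<^sup>2"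
    "n = 2 \<Longrightarrow> \<bar>(u (x, y + h / 2) + u (x, y - h / 2)) / 2 - u (x, y)\<bar> \<le> B * h\<^sup>2"
    "n = 1 \<Longrightarrow> \<bar>u (x, y + h) - u (x, y)\<bar> \<le> B * h"
proof -
  have b: "\<bar>(pdy ^^ n) u (x, s)\<bar> \<le> B" for s by (rule Cb_bound[OF Cb_iterated(2)[OF assms(1) order_refl]])
  note C = central_differences[of n "\<lambda>m s. (pdy ^^ m) u (x, s)" B h y, OF Cb_slices(2)[OF assms(1)] b assms(2)]
  show "n = 4 \<Longrightarrow> \<bar>(u (x, y + h) - 2 * u (x, y) + u (x, y - h)) / h\<^sup>2 - pdy (pdy u) (x, y)\<bar> \<le> B * h\<^sup>2"
    using C(1) by (simp add: numeral_2_eq_2)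
  show "n = 3 \<Longrightarrow> \<bar>(u (x, y + h / 2) - u (x, y - h / 2)) / h - pdy u (x, y)\<bar> \<le> B * h\<^sup>2"
    using C(2) by simp
  show "n = 2 \<Longrightarrow> \<bar>(u (x, y + h / 2) + u (x, y - h / 2)) / 2 - u (x, y)\<bar> \<le> B * h\<^sup>2"
    using C(3) by simp
  show "n = 1 \<Longrightarrow> \<bar>u (x, y + h) - u (x, y)\<bar> \<le> B * h"
    using C(4) by simp
qed

text \<open>At the midpoint of an edge a one-step difference is a central difference and therefore
  second-order accurate; comparing it with the derivative at a cell would lose one order.\<close>

definition edge_x :: "real \<Rightarrow> (real \<times> real \<Rightarrow> real) \<Rightarrow> grid_fun" where
  "edge_x h F i j = F (of_int i * h, (of_int j - 1/2) * h)"

definition edge_y :: "real \<Rightarrow> (real \<times> real \<Rightarrow> real) \<Rightarrow> grid_fun" where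
  "edge_y h F i j = F ((of_int i - 1/2) * h, of_int j * h)"

lemma cell_coordinate:
  fixes h :: real
  shows "(of_int (i + 1) - 1/2) * h = (of_int i - 1/2) * h + h" "(of_int (i - 1) - 1/2) * h = (of_int i - 1/2) * h - h"
    "of_int i * h = (of_int i - 1/2) * h + h / 2" "of_int (i - 1) * h = (of_int i - 1/2) * h - h / 2"
    "(of_int (i + 1) - 1/2) * h = of_int i * h + h / 2" "(of_int i - 1/2) * h = of_int i * h - h / 2"
  by (simp_all add: algebra_simps)

lemma lap_h_consistent:
  assumes "Cb 4 B g" "h > 0"
  shows "\<bar>lap_h h (grid_interp h g) i j - grid_interp h (laplacian g) i j\<bar> \<le> 2 * B * h\<^sup>2"
  using Cb_central_x(1)[OF assms refl, of "(of_int i - 1/2) * h" "(of_int j - 1/2) * h"]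
    Cb_central_y(1)[OF assms refl, of "(of_int i - 1/2) * h" "(of_int j - 1/2) * h"]
  unfolding lap_h_explicit grid_interp_def laplacian_def cell_coordinate(1,2) by linarith

lemma div_h_consistent:
  assumes "Cb 3 B F" "Cb 3 B G" "h > 0"
  shows "\<bar>div_h h (edge_x h F, edge_y h G) i j - grid_interp h (divergence F G) i j\<bar> \<le> 2 * B * h\<^sup>2"
  using Cb_central_x(2)[OF assms(1,3) refl, of "(of_int i - 1/2) * h" "(of_int j - 1/2) * h"]
    Cb_central_y(2)[OF assms(2,3) refl, of "(of_int i - 1/2) * h" "(of_int j - 1/2) * h"]
  unfolding div_h_def grid_interp_def divergence_def edge_x_def edge_y_def fst_conv snd_conv
    cell_coordinate(3)[where i = i] cell_coordinate(3)[where i = j]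
    cell_coordinate(4)[where i = i] cell_coordinate(4)[where i = j] by linarith

lemma Dx_consistent:
  assumes "Cb 3 B u" "h > 0"
  shows "\<bar>Dx h (grid_interp h u) i j - edge_x h (pdx u) i j\<bar> \<le> B * h\<^sup>2"
    "\<bar>Dy h (grid_interp h u) i j - edge_y h (pdy u) i j\<bar> \<le> B * h\<^sup>2"
  using Cb_central_x(2)[OF assms refl, of "of_int i * h" "(of_int j - 1/2) * h"]
    Cb_central_y(2)[OF assms refl, of "(of_int i - 1/2) * h" "of_int j * h"]
  unfolding Dx_def Dy_def grid_interp_def edge_x_def edge_y_def cell_coordinate(5)
  by (simp_all only: cell_coordinate(6)[symmetric])

lemma Dx_bounded:
  assumes "Cb 1 B u" "h > 0"
  shows "\<bar>Dx h (grid_interp h u) i j\<bar> \<le> B" "\<bar>Dy h (grid_interp h u) i j\<bar> \<le> B"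
  using Cb_central_x(4)[OF assms refl, of "(of_int i - 1/2) * h" "(of_int j - 1/2) * h"]
    Cb_central_y(4)[OF assms refl, of "(of_int i - 1/2) * h" "(of_int j - 1/2) * h"] assms(2)
  unfolding Dx_def Dy_def grid_interp_def cell_coordinate(1) by (simp_all add: abs_divide divide_le_eq)

lemma edge_avg_consistent:
  assumes "Cb 2 B g" "h > 0"
  shows "\<bar>(grid_interp h g i j + grid_interp h g (i + 1) j) / 2 - edge_x h g i j\<bar> \<le> B * h\<^sup>2"
    "\<bar>(grid_interp h g i j + grid_interp h g i (j + 1)) / 2 - edge_y h g i j\<bar> \<le> B * h\<^sup>2"
proof -
  have c: "(of_int k + 1 - 1/2) * h = of_int k * h + h / 2" for k :: int by (simp add: algebra_simps)
  show "\<bar>(grid_interp h g i j + grid_interp h g (i + 1) j) / 2 - edge_x h g i j\<bar> \<le> B * h\<^sup>2"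
    "\<bar>(grid_interp h g i j + grid_interp h g i (j + 1)) / 2 - edge_y h g i j\<bar> \<le> B * h\<^sup>2"
    using Cb_central_x(3)[OF assms refl, of "of_int i * h" "(of_int j - 1/2) * h"]
      Cb_central_y(3)[OF assms refl, of "(of_int i - 1/2) * h" "of_int j * h"]
    unfolding grid_interp_def edge_x_def edge_y_def cell_coordinate(5)
    by (simp_all only: cell_coordinate(6)[symmetric] add.commute)
qed

lemma abs_mult_diff_le:
  fixes a b a' b' :: real
  assumes "\<bar>a - a'\<bar> \<le> p" "\<bar>b - b'\<bar> \<le> q" "\<bar>a'\<bar> \<le> A" "\<bar>b\<bar> \<le> B"
  shows "\<bar>a * b - a' * b'\<bar> \<le> p * B + A * q"
proof -
  have "a * b - a' * b' = (a - a') * b + a' * (b - b')" by (simp add: algebra_simps)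
  also have "\<bar>\<dots>\<bar> \<le> \<bar>a - a'\<bar> * \<bar>b\<bar> + \<bar>a'\<bar> * \<bar>b - b'\<bar>" unfolding abs_mult[symmetric] by (rule abs_triangle_ineq)
  also have "\<dots> \<le> p * B + A * q"
    by (intro add_mono mult_mono assms) (use assms in linarith)+
  finally show ?thesis .
qed

lemma reg_grad_norm_ge: "\<delta> > 0 \<Longrightarrow> \<delta> \<le> reg_grad_norm \<delta> u z"
  unfolding reg_grad_norm_def by (rule real_le_rsqrt) simp

text \<open>The squares are compared first: edge differences with derivatives at the edges, then
  averages over opposite edges with the value at the cell. Dividing by the sum of the two roots,
  which is at least \<open>2 * \<delta>\<close>, gives the roots.\<close>

lemma avg_grad_norm_consistent:
  assumes u: "Cb 3 B u" and sq: "Cb 2 B (\<lambda>z. (pdx u z)\<^sup>2)" "Cb 2 B (\<lambda>z. (pdy u z)\<^sup>2)" and "h > 0" "\<delta> > 0"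
  shows "\<bar>avg_grad_norm \<delta> h (grid_interp h u) i j - grid_interp h (reg_grad_norm \<delta> u) i j\<bar> \<le> (2 * B\<^sup>2 + B) / \<delta> * h\<^sup>2"
proof -
  let ?P = "grid_interp h u"
  let ?S = "avg_grad_norm \<delta> h ?P i j" and ?s = "grid_interp h (reg_grad_norm \<delta> u) i j"
  have u2: "Cb 2 B (pdx u)" "Cb 2 B (pdy u)" using u Cb_Suc_parts[of 2 B u] by (simp_all add: numeral_3_eq_3 numeral_2_eq_2)
  have bnd: "\<bar>edge_x h (pdx u) i j\<bar> \<le> B" "\<bar>edge_y h (pdy u) i j\<bar> \<le> B" for i j
    unfolding edge_x_def edge_y_def by (rule Cb_bound[OF u2(1)], rule Cb_bound[OF u2(2)])
  have u1: "Cb 1 B u" by (rule Cb_le[OF u]) simp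
  have dx: "\<bar>(Dx h ?P i j)\<^sup>2 - (edge_x h (pdx u) i j)\<^sup>2\<bar> \<le> 2 * B\<^sup>2 * h\<^sup>2" for i j
    using abs_mult_diff_le[OF Dx_consistent(1)[OF u assms(4), of i j] Dx_consistent(1)[OF u assms(4), of i j]
        bnd(1) Dx_bounded(1)[OF u1 assms(4)]] by (simp add: power2_eq_square mult_ac)
  have dy: "\<bar>(Dy h ?P i j)\<^sup>2 - (edge_y h (pdy u) i j)\<^sup>2\<bar> \<le> 2 * B\<^sup>2 * h\<^sup>2" for i j
    using abs_mult_diff_le[OF Dx_consistent(2)[OF u assms(4), of i j] Dx_consistent(2)[OF u assms(4), of i j]
        bnd(2) Dx_bounded(2)[OF u1 assms(4)]] by (simp add: power2_eq_square mult_ac)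
  have ax: "\<bar>((edge_x h (pdx u) i j)\<^sup>2 + (edge_x h (pdx u) (i - 1) j)\<^sup>2) / 2 - (grid_interp h (pdx u) i j)\<^sup>2\<bar> \<le> B * h\<^sup>2"
    using Cb_central_x(3)[OF sq(1) assms(4) refl, of "(of_int i - 1/2) * h" "(of_int j - 1/2) * h"]
    unfolding edge_x_def grid_interp_def cell_coordinate(3)[where i = i] cell_coordinate(4)[where i = i] .
  have ay: "\<bar>((edge_y h (pdy u) i j)\<^sup>2 + (edge_y h (pdy u) i (j - 1))\<^sup>2) / 2 - (grid_interp h (pdy u) i j)\<^sup>2\<bar> \<le> B * h\<^sup>2"
    using Cb_central_y(3)[OF sq(2) assms(4) refl, of "(of_int i - 1/2) * h" "(of_int j - 1/2) * h"]
    unfolding edge_y_def grid_interp_def cell_coordinate(3)[where i = j] cell_coordinate(4)[where i = j] .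
  have S2: "?S\<^sup>2 = ((Dx h ?P i j)\<^sup>2 + (Dx h ?P (i - 1) j)\<^sup>2 + (Dy h ?P i j)\<^sup>2 + (Dy h ?P i (j - 1))\<^sup>2) / 2 + \<delta>\<^sup>2"
    by (simp add: avg_grad_norm_def)
  have s2: "?s\<^sup>2 = (grid_interp h (pdx u) i j)\<^sup>2 + (grid_interp h (pdy u) i j)\<^sup>2 + \<delta>\<^sup>2"
    by (simp add: grid_interp_def reg_grad_norm_def)
  have "\<bar>?S\<^sup>2 - ?s\<^sup>2\<bar> \<le> 4 * (B\<^sup>2 * h\<^sup>2) + 2 * (B * h\<^sup>2)"
    unfolding S2 s2 using dx[of i j] dx[of "i - 1" j] dy[of i j] dy[of i "j - 1"] ax ay
    unfolding mult.assoc add_divide_distrib abs_le_iff by - (elim conjE, intro conjI; linarith)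
  moreover have "?S\<^sup>2 - ?s\<^sup>2 = (?S - ?s) * (?S + ?s)" by (simp add: power2_eq_square algebra_simps)
  moreover have g: "\<delta> \<le> ?S" "\<delta> \<le> ?s"
    using avg_grad_norm_ge[OF assms(5)] reg_grad_norm_ge[OF assms(5)] by (simp_all add: grid_interp_def)
  ultimately have "\<bar>?S - ?s\<bar> * (?S + ?s) \<le> 4 * (B\<^sup>2 * h\<^sup>2) + 2 * (B * h\<^sup>2)"
    using assms(5) by (simp add: abs_mult)
  moreover have "\<bar>?S - ?s\<bar> * (2 * \<delta>) \<le> \<bar>?S - ?s\<bar> * (?S + ?s)" using g by (intro mult_left_mono) auto
  ultimately have "\<bar>?S - ?s\<bar> * (2 * \<delta>) \<le> (2 * B\<^sup>2 + B) * h\<^sup>2 * 2" by (simp add: algebra_simps)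
  then show ?thesis using assms(5) by (simp add: field_simps)
qed

lemma grid_inner_sup_le:
  assumes "\<And>i j. \<bar>r i j\<bar> \<le> R" "h > 0"
  shows "\<bar>grid_inner h N r v\<bar> \<le> R * (real N * h) * grid_norm2 h N v"
proof -
  have R: "0 \<le> R" using assms(1)[of 0 0] by linarith
  have "grid_inner h N r r \<le> grid_inner h N (\<lambda>i j. R) (\<lambda>i j. R)"
  proof (rule grid_inner_mono)
    fix i j
    have "\<bar>r i j\<bar> * \<bar>r i j\<bar> \<le> R * R" by (intro mult_mono assms R) simp
    then show "r i j * r i j \<le> R * R" by simp
  qed
  also have "\<dots> = (R * (real N * h))\<^sup>2" by (simp add: grid_inner_def power2_eq_square)
  finally have "grid_norm2 h N r \<le> R * (real N * h)"
    unfolding grid_norm2_def using R assms(2) by (intro real_le_lsqrt) auto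
  then have "grid_norm2 h N r * grid_norm2 h N v \<le> R * (real N * h) * grid_norm2 h N v"
    by (intro mult_right_mono grid_norm2_nonneg)
  then show ?thesis using grid_inner_Cauchy[of h N r v] by linarith
qed

lemma grid_norm2_Dx_le: "grid_norm2 h N (Dx h v) \<le> grad_norm2 h N v" "grid_norm2 h N (Dy h v) \<le> grad_norm2 h N v"
  unfolding grid_norm2_def grad_norm2_eq grad_inner_def
  by (simp_all add: grid_inner_self_nonneg)

text \<open>Written around \<open>1/2\<close>, where the derivative splits into the cubic that the
  scheme treats implicitly and the linear term that it treats explicitly.\<close>

lemma deriv_double_well: "deriv double_well s = (s - 1/2) ^ 3 - (s - 1/2) / 4"
proof (rule DERIV_imp_deriv)
  have "(double_well has_real_derivative (1/2) * s * (1 - s) * (1 - 2 * s)) (at s)"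
    unfolding double_well_def
    by (auto intro!: derivative_eq_intros simp: power2_eq_square algebra_simps)
  also have "(1/2) * s * (1 - s) * (1 - 2 * s) = (s - 1/2) ^ 3 - (s - 1/2) / 4"
    by (simp add: power3_eq_cube field_simps)
  finally show "(double_well has_real_derivative (s - 1/2) ^ 3 - (s - 1/2) / 4) (at s)" .
qed

lemma deriv_mixing_entropy:
  assumes "0 < s" "s < 1"
  shows "deriv mixing_entropy s = ln s - ln (1 - s)"
proof (rule DERIV_imp_deriv)
  show "(mixing_entropy has_real_derivative ln s - ln (1 - s)) (at s)"
    unfolding mixing_entropy_def using assms by (auto intro!: derivative_eq_intros)
qed

lemma cube_diff_le:
  fixes x y :: real
  assumes "\<bar>x\<bar> \<le> A" "\<bar>y\<bar> \<le> A"
  shows "\<bar>x ^ 3 - y ^ 3\<bar> \<le> 3 * A\<^sup>2 * \<bar>x - y\<bar>"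
proof -
  have A: "0 \<le> A" using assms by linarith
  have "\<bar>x * x\<bar> \<le> A * A" "\<bar>x * y\<bar> \<le> A * A" "\<bar>y * y\<bar> \<le> A * A"
    unfolding abs_mult by (intro mult_mono assms A abs_ge_zero)+
  then have "\<bar>x * x + x * y + y * y\<bar> \<le> 3 * A\<^sup>2" unfolding power2_eq_square by linarith
  then have "\<bar>x - y\<bar> * \<bar>x * x + x * y + y * y\<bar> \<le> \<bar>x - y\<bar> * (3 * A\<^sup>2)" by (intro mult_left_mono) auto
  moreover have "x ^ 3 - y ^ 3 = (x - y) * (x * x + x * y + y * y)" by (simp add: power3_eq_cube algebra_simps)
  ultimately show ?thesis by (simp add: abs_mult mult.commute)
qed

lemma Dx_minus_const: "Dx h (\<lambda>i j. u i j - c) = Dx h u" "Dy h (\<lambda>i j. u i j - c) = Dy h u"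
  by (simp_all add: Dx_def Dy_def fun_eq_iff)

lemma lap_h_minus_const: "lap_h h (\<lambda>i j. u i j - c) = lap_h h u"
  by (simp add: lap_h_def grad_h_def Dx_minus_const)

lemma avg_grad_norm_minus_const: "avg_grad_norm \<delta> h (\<lambda>i j. u i j - c) = avg_grad_norm \<delta> h u"
  by (simp add: avg_grad_norm_def Dx_minus_const fun_eq_iff)

subsection \<open>Consistency of the discrete chemical potentials\<close>

lemma divide_diff_le:
  fixes r p S s :: real
  assumes "\<bar>r - p\<bar> \<le> \<kappa>" "\<bar>S - s\<bar> \<le> \<kappa>'" "\<bar>p\<bar> \<le> 1" "\<delta> \<le> S" "\<delta> \<le> s" "\<delta> > 0"
  shows "\<bar>r / S - p / s\<bar> \<le> \<kappa> / \<delta> + \<kappa>' / \<delta>\<^sup>2"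
proof -
  have S: "S > 0" "s > 0" using assms by auto
  have "r / S - p / s = (r - p) / S + p * (s - S) / (S * s)" using S by (simp add: field_simps)
  also have "\<bar>\<dots>\<bar> \<le> \<bar>(r - p) / S\<bar> + \<bar>p * (s - S) / (S * s)\<bar>" by (rule abs_triangle_ineq)
  also have "\<bar>(r - p) / S\<bar> \<le> \<kappa> / \<delta>"
    using assms S by (simp add: abs_divide frac_le)
  also have "\<bar>p * (s - S) / (S * s)\<bar> \<le> \<kappa>' / \<delta>\<^sup>2"
  proof -
    have "\<bar>p\<bar> * \<bar>s - S\<bar> \<le> 1 * \<kappa>'" by (rule mult_mono) (use assms in auto)
    moreover have "\<delta> * \<delta> \<le> S * s" using assms by (intro mult_mono) auto
    ultimately have "(\<bar>p\<bar> * \<bar>s - S\<bar>) / (S * s) \<le> (1 * \<kappa>') / (\<delta> * \<delta>)"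
      using assms S by (intro frac_le) auto
    then show ?thesis using S by (simp add: abs_divide abs_mult power2_eq_square)
  qed
  finally show ?thesis by simp
qed

lemma average_diff_le:
  fixes a b a' b' e R S T :: real
  assumes "\<bar>a - a'\<bar> \<le> R" "\<bar>b - b'\<bar> \<le> R" "\<bar>(a' + b') / 2 - e\<bar> \<le> S" "S \<le> T"
  shows "\<bar>(a + b) / 2 - e\<bar> \<le> R + T"
  using assms unfolding add_divide_distrib by linarith

text \<open>Consistency in the weak sense only: part of the differences is moved onto
  \<open>v\<close>, namely one Laplacian of the biharmonic term, the divergence of the perturbed
  flux and the Laplacian of the explicit term. \<open>\<kappa>\<close> is the common size of all
  perturbations, those of the mesh and those from comparing different times; \<open>c\<close> is the
  mass correction of the reference.\<close>

lemma mu_phi_h_consistent: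
  fixes \<alpha> \<epsilon> \<eta> \<delta> B L K0 :: real
  assumes par: "\<alpha> > 0" "\<epsilon> > 0" "\<eta> > 0" "\<delta> > 0" "B \<ge> 0" "L > 0" "K0 \<ge> 0"
  shows "\<exists>C\<ge>0. \<forall>N h \<kappa> u \<psi> f c \<rho> v. N > 0 \<longrightarrow> h > 0 \<longrightarrow> real N * h = L \<longrightarrow> h\<^sup>2 \<le> \<kappa> \<longrightarrow> \<kappa> \<le> K0 \<longrightarrow>
    Cb 4 B u \<longrightarrow> Cb 4 B (laplacian u) \<longrightarrow> Cb 2 B (\<lambda>z. (pdx u z)\<^sup>2) \<longrightarrow> Cb 2 B (\<lambda>z. (pdy u z)\<^sup>2) \<longrightarrow>
    Cb 2 B (\<lambda>z. \<psi> z / reg_grad_norm \<delta> u z) \<longrightarrow>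
    Cb 3 B (\<lambda>z. \<psi> z * pdx u z / reg_grad_norm \<delta> u z) \<longrightarrow> Cb 3 B (\<lambda>z. \<psi> z * pdy u z / reg_grad_norm \<delta> u z) \<longrightarrow>
    (\<forall>z. \<bar>\<psi> z\<bar> \<le> 1) \<longrightarrow>
    grid_per N (grid_interp h u) \<longrightarrow> grid_per N f \<longrightarrow> grid_per N \<rho> \<longrightarrow> grid_per N v \<longrightarrow>
    grid_per N (edge_x h (\<lambda>z. \<psi> z * pdx u z / reg_grad_norm \<delta> u z)) \<longrightarrow>
    grid_per N (edge_y h (\<lambda>z. \<psi> z * pdy u z / reg_grad_norm \<delta> u z)) \<longrightarrow>
    grid_per N (grid_interp h (laplacian u)) \<longrightarrow>
    \<bar>c\<bar> \<le> \<kappa> \<longrightarrow> (\<forall>i j. \<bar>f i j - (grid_interp h u i j - c)\<bar> \<le> \<kappa>) \<longrightarrow>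
    (\<forall>i j. \<bar>\<rho> i j - grid_interp h \<psi> i j\<bar> \<le> \<kappa>) \<longrightarrow>
    \<bar>grid_inner h N (grid_interp h (mu_phi \<alpha> \<epsilon> \<eta> \<delta> u \<psi>)) v
      - grid_inner h N (mu_phi_h \<alpha> \<epsilon> \<eta> \<delta> h f (\<lambda>i j. grid_interp h u i j - c) \<rho>) v\<bar>
    \<le> C * \<kappa> * (grid_norm2 h N v + grad_norm2 h N v + grid_norm2 h N (lap_h h v))"
proof -
  \<comment> \<open>Bounds the arguments of the cubic and hence its Lipschitz constant; this is what
    the ceiling \<open>K0\<close> for \<open>\<kappa>\<close> is for.\<close>
  define A where "A = B + K0 + 1/2"
  \<comment> \<open>Constants for the regularised norm, for the density divided by it, and for the
    flux, each built on the one before.\<close>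
  define Cs where "Cs = (2 * B\<^sup>2 + B) / \<delta>"
  define Cq where "Cq = 1 / \<delta> + Cs / \<delta>\<^sup>2"
  define Cf where "Cf = (Cq + B) * B + B * B"
  define C1 where "C1 = 3 * A\<^sup>2 / \<epsilon> + 2 / (4 * \<epsilon>) + (\<epsilon> + \<alpha>) * (2 * B) + \<eta>\<^sup>2 * (2 * B) + \<alpha> * (2 * B)"
  define C where "C = L * (C1 + \<alpha> * (2 * Cf) + \<eta>\<^sup>2 * (2 * B) + \<alpha> / \<delta>)"
  have nn: "0 \<le> Cs" "0 \<le> Cq" "0 \<le> Cf" "0 \<le> C1" using par by (simp_all add: Cs_def Cq_def Cf_def C1_def)
  have C: "C \<ge> 0" using par nn by (simp add: C_def)
  show ?thesis
  proof (intro exI[of _ C] conjI C allI impI)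
    fix N h \<kappa> u \<psi> f c \<rho> v
    assume N: "N > 0" and h: "h > (0::real)" and NL: "real N * h = L" and \<kappa>: "h\<^sup>2 \<le> \<kappa>" "\<kappa> \<le> K0"
      and u: "Cb 4 B u" and lu: "Cb 4 B (laplacian u)" and sq: "Cb 2 B (\<lambda>z. (pdx u z)\<^sup>2)" "Cb 2 B (\<lambda>z. (pdy u z)\<^sup>2)"
      and gq: "Cb 2 B (\<lambda>z. \<psi> z / reg_grad_norm \<delta> u z)"
      and F: "Cb 3 B (\<lambda>z. \<psi> z * pdx u z / reg_grad_norm \<delta> u z)"
      and G: "Cb 3 B (\<lambda>z. \<psi> z * pdy u z / reg_grad_norm \<delta> u z)" and \<psi>: "\<forall>z. \<bar>\<psi> z\<bar> \<le> 1"
      and per: "grid_per N (grid_interp h u)" "grid_per N f" "grid_per N \<rho>" "grid_per N v"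
      and perF: "grid_per N (edge_x h (\<lambda>z. \<psi> z * pdx u z / reg_grad_norm \<delta> u z))"
        "grid_per N (edge_y h (\<lambda>z. \<psi> z * pdy u z / reg_grad_norm \<delta> u z))"
      and perl: "grid_per N (grid_interp h (laplacian u))"
      and c: "\<bar>c\<bar> \<le> \<kappa>" and f: "\<forall>i j. \<bar>f i j - (grid_interp h u i j - c)\<bar> \<le> \<kappa>"
      and \<rho>: "\<forall>i j. \<bar>\<rho> i j - grid_interp h \<psi> i j\<bar> \<le> \<kappa>"
    let ?P = "grid_interp h u"
    define w where "w = (\<lambda>i j. ?P i j - c)"
    define n where "n = grid_norm2 h N v"
    define g where "g = grad_norm2 h N v"
    define l where "l = grid_norm2 h N (lap_h h v)"
    have ngl: "0 \<le> n" "0 \<le> g" "0 \<le> l" by (simp_all add: n_def g_def l_def grid_norm2_nonneg grad_norm2_nonneg)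
    have \<kappa>0: "0 \<le> \<kappa>" using \<kappa>(1) zero_le_power2[of h] by linarith
    have BK: "B * h\<^sup>2 \<le> B * \<kappa>" using \<kappa>(1) par by (intro mult_left_mono) auto
    have pw: "grid_per N w" unfolding w_def by (intro grid_per_diff per(1) grid_per_const)
    let ?F = "\<lambda>z. \<psi> z * pdx u z / reg_grad_norm \<delta> u z" and ?G = "\<lambda>z. \<psi> z * pdy u z / reg_grad_norm \<delta> u z"
    let ?q = "\<lambda>z. \<psi> z / reg_grad_norm \<delta> u z" and ?Q = "\<lambda>i j. \<rho> i j / avg_grad_norm \<delta> h w i j"
    let ?H = "edge_mult (edge_avg ?Q) (grad_h h w)"
    have sup: "\<bar>grid_inner h N r x\<bar> \<le> R * L * grid_norm2 h N x" if "\<And>i j. \<bar>r i j\<bar> \<le> R" for r R x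
      using grid_inner_sup_le[of r R h N x, OF that h] NL by simp
    have mu: "grid_interp h (mu_phi \<alpha> \<epsilon> \<eta> \<delta> u \<psi>) i j =
        (1/\<epsilon>) * (?P i j - 1/2) ^ 3 - 1/(4*\<epsilon>) * (?P i j - 1/2)
        - (\<epsilon> + \<alpha>) * grid_interp h (laplacian u) i j + \<eta>\<^sup>2 * grid_interp h (laplacian (laplacian u)) i j
        + \<alpha> * grid_interp h (divergence ?F ?G) i j" for i j
      by (simp add: grid_interp_def mu_phi_def deriv_double_well diff_divide_distrib)
    have muI: "grid_inner h N (grid_interp h (mu_phi \<alpha> \<epsilon> \<eta> \<delta> u \<psi>)) v =
        (1/\<epsilon>) * grid_inner h N (\<lambda>i j. (?P i j - 1/2) ^ 3) v - 1/(4*\<epsilon>) * grid_inner h N (\<lambda>i j. ?P i j - 1/2) v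
        - (\<epsilon> + \<alpha>) * grid_inner h N (grid_interp h (laplacian u)) v
        + \<eta>\<^sup>2 * grid_inner h N (grid_interp h (laplacian (laplacian u))) v
        + \<alpha> * grid_inner h N (grid_interp h (divergence ?F ?G)) v"
      unfolding grid_inner_add_left[symmetric] grid_inner_diff_left[symmetric] grid_inner_scale_left[symmetric]
      by (rule grid_inner_cong) (simp_all only: mu)
    have pQ: "grid_per N ?Q"
      using per(3) grid_per_avg_grad_norm[OF pw] by (simp add: grid_per_def)
    have muH: "grid_inner h N (mu_phi_h \<alpha> \<epsilon> \<eta> \<delta> h f w \<rho>) v =
      (1/\<epsilon>) * grid_inner h N (\<lambda>i j. (w i j - 1/2) ^ 3) v - (\<epsilon> + \<alpha> + \<alpha>/\<delta>) * grid_inner h N (lap_h h w) v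
      + \<eta>\<^sup>2 * grid_inner h N (lap_h h w) (lap_h h v) + \<alpha> * grid_inner h N (div_h h ?H) v
      - 1/(4*\<epsilon>) * grid_inner h N (\<lambda>i j. f i j - 1/2) v + \<alpha>/\<delta> * grid_inner h N (lap_h h f) v"
      using mu_phi_h_inner[OF per(2) pw per(3,4), of h \<alpha> \<epsilon> \<eta> \<delta>] grid_inner_edge_avg[OF pQ pw per(4), of h]
        grid_inner_lap[OF pw per(4), of h] grid_inner_lap[OF per(2,4), of h] by simp
    have lw: "lap_h h w = lap_h h ?P" unfolding w_def by (rule lap_h_minus_const)
    have D1: "\<bar>grid_inner h N (\<lambda>i j. (?P i j - 1/2) ^ 3 - (w i j - 1/2) ^ 3) v\<bar> \<le> (3 * A\<^sup>2 * \<kappa>) * L * n"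
      unfolding n_def
    proof (rule sup)
      fix i j
      have b: "\<bar>?P i j\<bar> \<le> B" unfolding grid_interp_def by (rule Cb_bound[OF u])
      have "\<bar>(?P i j - 1/2) ^ 3 - (w i j - 1/2) ^ 3\<bar> \<le> 3 * A\<^sup>2 * \<bar>(?P i j - 1/2) - (w i j - 1/2)\<bar>"
        by (rule cube_diff_le) (use b c \<kappa> par in \<open>auto simp: A_def w_def\<close>)
      also have "\<dots> \<le> 3 * A\<^sup>2 * \<kappa>" using c by (intro mult_left_mono) (auto simp: w_def)
      finally show "\<bar>(?P i j - 1/2) ^ 3 - (w i j - 1/2) ^ 3\<bar> \<le> 3 * A\<^sup>2 * \<kappa>" .
    qed
    have D2: "\<bar>grid_inner h N (\<lambda>i j. (?P i j - 1/2) - (f i j - 1/2)) v\<bar> \<le> (2 * \<kappa>) * L * n"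
      unfolding n_def
    proof (rule sup)
      fix i j
      have "\<bar>f i j - (?P i j - c)\<bar> \<le> \<kappa>" using f by blast
      then show "\<bar>(?P i j - 1/2) - (f i j - 1/2)\<bar> \<le> 2 * \<kappa>" using c by linarith
    qed
    have lapc: "\<bar>lap_h h (grid_interp h k) i j - grid_interp h (laplacian k) i j\<bar> \<le> 2 * B * \<kappa>" if "Cb 4 B k" for k i j
      using lap_h_consistent[OF that h, of i j] BK by linarith
    have D3: "\<bar>grid_inner h N (\<lambda>i j. lap_h h ?P i j - grid_interp h (laplacian u) i j) v\<bar> \<le> (2 * B * \<kappa>) * L * n"
      unfolding n_def by (rule sup) (rule lapc[OF u])
    have D4: "\<bar>grid_inner h N (\<lambda>i j. lap_h h (grid_interp h (laplacian u)) i j - grid_interp h (laplacian (laplacian u)) i j) v\<bar> \<le> (2 * B * \<kappa>) * L * n"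
      unfolding n_def by (rule sup) (rule lapc[OF lu])
    have D5: "\<bar>grid_inner h N (\<lambda>i j. lap_h h ?P i j - grid_interp h (laplacian u) i j) (lap_h h v)\<bar> \<le> (2 * B * \<kappa>) * L * l"
      unfolding l_def by (rule sup) (rule lapc[OF u])
    have D6: "\<bar>grid_inner h N (\<lambda>i j. div_h h (edge_x h ?F, edge_y h ?G) i j - grid_interp h (divergence ?F ?G) i j) v\<bar> \<le> (2 * B * \<kappa>) * L * n"
      unfolding n_def
    proof (rule sup)
      fix i j
      show "\<bar>div_h h (edge_x h ?F, edge_y h ?G) i j - grid_interp h (divergence ?F ?G) i j\<bar> \<le> 2 * B * \<kappa>"
        using div_h_consistent[OF F G h, of i j] BK by linarith
    qed
    have u3: "Cb 3 B u" and u1: "Cb 1 B u" by (rule Cb_le[OF u], simp)+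
    have Q: "\<bar>?Q i j - grid_interp h ?q i j\<bar> \<le> Cq * \<kappa>" for i j
    proof -
      have S: "\<bar>avg_grad_norm \<delta> h w i j - grid_interp h (reg_grad_norm \<delta> u) i j\<bar> \<le> Cs * \<kappa>"
      proof -
        have "Cs * h\<^sup>2 \<le> Cs * \<kappa>" using nn \<kappa> by (intro mult_left_mono) auto
        then show ?thesis using avg_grad_norm_consistent[OF u3 sq h par(4), of i j]
          unfolding w_def avg_grad_norm_minus_const Cs_def by linarith
      qed
      have "\<bar>?Q i j - grid_interp h \<psi> i j / grid_interp h (reg_grad_norm \<delta> u) i j\<bar> \<le> \<kappa> / \<delta> + (Cs * \<kappa>) / \<delta>\<^sup>2"
        by (rule divide_diff_le[OF _ S])
          (use \<rho> \<psi> par(4) avg_grad_norm_ge[OF par(4)] reg_grad_norm_ge[OF par(4)] in \<open>simp_all add: grid_interp_def\<close>)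
      also have "\<kappa> / \<delta> + (Cs * \<kappa>) / \<delta>\<^sup>2 = Cq * \<kappa>" by (simp add: Cq_def algebra_simps)
      finally show ?thesis by (simp add: grid_interp_def)
    qed
    have qb: "\<bar>?q z\<bar> \<le> B" for z by (rule Cb_bound[OF gq])
    have dxw: "Dx h w = Dx h ?P" "Dy h w = Dy h ?P" unfolding w_def by (rule Dx_minus_const)+
    have flx: "\<bar>fst ?H i j - edge_x h ?F i j\<bar> \<le> Cf * \<kappa>" for i j
    proof -
      have 1: "\<bar>(?Q i j + ?Q (i + 1) j) / 2 - edge_x h ?q i j\<bar> \<le> (Cq + B) * \<kappa>"
        unfolding distrib_right by (rule average_diff_le[OF Q Q edge_avg_consistent(1)[OF gq h] BK])
      have 2: "\<bar>Dx h ?P i j - edge_x h (pdx u) i j\<bar> \<le> B * \<kappa>" using Dx_consistent(1)[OF u3 h, of i j] BK by linarith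
      have 3: "\<bar>edge_x h ?q i j\<bar> \<le> B" unfolding edge_x_def by (rule qb)
      have fh: "fst ?H i j = (?Q i j + ?Q (i + 1) j) / 2 * Dx h ?P i j" "edge_x h ?F i j = edge_x h ?q i j * edge_x h (pdx u) i j"
        by (simp_all add: edge_mult_def edge_avg_def grad_h_def dxw edge_x_def)
      have "(Cq + B) * \<kappa> * B + B * (B * \<kappa>) = Cf * \<kappa>" by (simp add: Cf_def algebra_simps)
      then show ?thesis using abs_mult_diff_le[OF 1 2 3 Dx_bounded(1)[OF u1 h]] unfolding fh by simp
    qed
    have fly: "\<bar>snd ?H i j - edge_y h ?G i j\<bar> \<le> Cf * \<kappa>" for i j
    proof -
      have 1: "\<bar>(?Q i j + ?Q i (j + 1)) / 2 - edge_y h ?q i j\<bar> \<le> (Cq + B) * \<kappa>"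
        unfolding distrib_right by (rule average_diff_le[OF Q Q edge_avg_consistent(2)[OF gq h] BK])
      have 2: "\<bar>Dy h ?P i j - edge_y h (pdy u) i j\<bar> \<le> B * \<kappa>" using Dx_consistent(2)[OF u3 h, of i j] BK by linarith
      have 3: "\<bar>edge_y h ?q i j\<bar> \<le> B" unfolding edge_y_def by (rule qb)
      have fh: "snd ?H i j = (?Q i j + ?Q i (j + 1)) / 2 * Dy h ?P i j" "edge_y h ?G i j = edge_y h ?q i j * edge_y h (pdy u) i j"
        by (simp_all add: edge_mult_def edge_avg_def grad_h_def dxw edge_y_def)
      have "(Cq + B) * \<kappa> * B + B * (B * \<kappa>) = Cf * \<kappa>" by (simp add: Cf_def algebra_simps)
      then show ?thesis using abs_mult_diff_le[OF 1 2 3 Dx_bounded(2)[OF u1 h]] unfolding fh by simp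
    qed
    have pH: "grid_per N (fst ?H)" "grid_per N (snd ?H)"
      unfolding grid_per_def edge_mult_def edge_avg_def grad_h_def
      by (simp_all add: grid_per_simps[OF per(3)] grid_per_simps[OF grid_per_avg_grad_norm[OF pw]]
          grid_per_simps[OF grid_per_Dx[OF pw]] grid_per_simps[OF grid_per_Dy[OF pw]])
    have D7: "\<bar>grid_inner h N (div_h h ?H) v - grid_inner h N (div_h h (edge_x h ?F, edge_y h ?G)) v\<bar> \<le> (2 * Cf * \<kappa>) * L * g"
    proof -
      have e: "grid_inner h N (div_h h ?H) v - grid_inner h N (div_h h (edge_x h ?F, edge_y h ?G)) v =
        - (grid_inner h N (\<lambda>i j. fst ?H i j - edge_x h ?F i j) (Dx h v) + grid_inner h N (\<lambda>i j. snd ?H i j - edge_y h ?G i j) (Dy h v))"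
        using grid_inner_div[OF pH per(4), of h] grid_inner_div[of N "(edge_x h ?F, edge_y h ?G)" v h] perF per(4)
        by (simp add: grid_inner_diff_left)
      have x: "\<bar>grid_inner h N (\<lambda>i j. fst ?H i j - edge_x h ?F i j) (Dx h v)\<bar> \<le> Cf * \<kappa> * L * g"
      proof -
        have "Cf * \<kappa> * L * grid_norm2 h N (Dx h v) \<le> Cf * \<kappa> * L * g"
          unfolding g_def using nn \<kappa>0 par by (intro mult_left_mono grid_norm2_Dx_le) auto
        then show ?thesis using sup[of "\<lambda>i j. fst ?H i j - edge_x h ?F i j" "Cf * \<kappa>" "Dx h v", OF flx] by linarith
      qed
      have y: "\<bar>grid_inner h N (\<lambda>i j. snd ?H i j - edge_y h ?G i j) (Dy h v)\<bar> \<le> Cf * \<kappa> * L * g"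
      proof -
        have "Cf * \<kappa> * L * grid_norm2 h N (Dy h v) \<le> Cf * \<kappa> * L * g"
          unfolding g_def using nn \<kappa>0 par by (intro mult_left_mono grid_norm2_Dx_le) auto
        then show ?thesis using sup[of "\<lambda>i j. snd ?H i j - edge_y h ?G i j" "Cf * \<kappa>" "Dy h v", OF fly] by linarith
      qed
      show ?thesis unfolding e using x y by (simp add: abs_le_iff)
    qed
    have D8: "\<bar>grid_inner h N (lap_h h f) v - grid_inner h N (lap_h h w) v\<bar> \<le> \<kappa> * L * l"
    proof -
      have "grid_inner h N (lap_h h f) v - grid_inner h N (lap_h h w) v = grid_inner h N (\<lambda>i j. f i j - w i j) (lap_h h v)"
        by (simp add: grid_inner_lap_swap[OF per(2,4)] grid_inner_lap_swap[OF pw per(4)] grid_inner_diff_left)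
      moreover have "\<bar>grid_inner h N (\<lambda>i j. f i j - w i j) (lap_h h v)\<bar> \<le> \<kappa> * L * l"
        unfolding l_def by (rule sup) (use f in \<open>simp add: w_def\<close>)
      ultimately show ?thesis by simp
    qed
    have swp: "grid_inner h N (lap_h h (grid_interp h (laplacian u))) v = grid_inner h N (grid_interp h (laplacian u)) (lap_h h v)"
      by (rule grid_inner_lap_swap[OF perl per(4)])
    \<comment> \<open>The biharmonic error is split in two: one discrete Laplacian is compared on
      the smooth function \<open>laplacian u\<close>, the other only after one Laplacian has been
      moved onto \<open>v\<close>.\<close>
    have split: "grid_inner h N (grid_interp h (mu_phi \<alpha> \<epsilon> \<eta> \<delta> u \<psi>)) v - grid_inner h N (mu_phi_h \<alpha> \<epsilon> \<eta> \<delta> h f w \<rho>) v =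
      (1/\<epsilon>) * grid_inner h N (\<lambda>i j. (?P i j - 1/2) ^ 3 - (w i j - 1/2) ^ 3) v
      - 1/(4*\<epsilon>) * grid_inner h N (\<lambda>i j. (?P i j - 1/2) - (f i j - 1/2)) v
      + (\<epsilon> + \<alpha>) * grid_inner h N (\<lambda>i j. lap_h h ?P i j - grid_interp h (laplacian u) i j) v
      - \<eta>\<^sup>2 * grid_inner h N (\<lambda>i j. lap_h h (grid_interp h (laplacian u)) i j - grid_interp h (laplacian (laplacian u)) i j) v
      - \<eta>\<^sup>2 * grid_inner h N (\<lambda>i j. lap_h h ?P i j - grid_interp h (laplacian u) i j) (lap_h h v)
      - \<alpha> * grid_inner h N (\<lambda>i j. div_h h (edge_x h ?F, edge_y h ?G) i j - grid_interp h (divergence ?F ?G) i j) v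
      - \<alpha> * (grid_inner h N (div_h h ?H) v - grid_inner h N (div_h h (edge_x h ?F, edge_y h ?G)) v)
      - \<alpha>/\<delta> * (grid_inner h N (lap_h h f) v - grid_inner h N (lap_h h w) v)"
      unfolding muI muH lw grid_inner_diff_left swp by (simp add: algebra_simps)
    have sc: "\<bar>k * x\<bar> \<le> k * X" if "0 \<le> k" "\<bar>x\<bar> \<le> X" for k x X :: real
      using that by (simp add: abs_mult mult_left_mono)
    have "\<bar>grid_inner h N (grid_interp h (mu_phi \<alpha> \<epsilon> \<eta> \<delta> u \<psi>)) v - grid_inner h N (mu_phi_h \<alpha> \<epsilon> \<eta> \<delta> h f w \<rho>) v\<bar> \<le>
      (1/\<epsilon>) * ((3 * A\<^sup>2 * \<kappa>) * L * n) + 1/(4*\<epsilon>) * ((2 * \<kappa>) * L * n) + (\<epsilon> + \<alpha>) * ((2 * B * \<kappa>) * L * n)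
      + \<eta>\<^sup>2 * ((2 * B * \<kappa>) * L * n) + \<eta>\<^sup>2 * ((2 * B * \<kappa>) * L * l) + \<alpha> * ((2 * B * \<kappa>) * L * n)
      + \<alpha> * ((2 * Cf * \<kappa>) * L * g) + \<alpha>/\<delta> * (\<kappa> * L * l)"
    proof -
      have tri: "\<bar>a - b + c - d - e - f - g - h\<bar> \<le> a' + b' + c' + d' + e' + f' + g' + h'"
        if "\<bar>a\<bar> \<le> a'" "\<bar>b\<bar> \<le> b'" "\<bar>c\<bar> \<le> c'" "\<bar>d\<bar> \<le> d'" "\<bar>e\<bar> \<le> e'" "\<bar>f\<bar> \<le> f'" "\<bar>g\<bar> \<le> g'" "\<bar>h\<bar> \<le> h'"
        for a b c d e f g h a' b' c' d' e' f' g' h' :: real using that unfolding abs_le_iff by - (elim conjE, intro conjI; linarith)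
      show ?thesis unfolding split
        by (rule tri; rule sc; (rule D1 D2 D3 D4 D5 D6 D7 D8)?) (use par in simp_all)
    qed
    also have "\<dots> = \<kappa> * (L * (C1 * n + \<alpha> * (2 * Cf) * g + (\<eta>\<^sup>2 * (2 * B) + \<alpha> / \<delta>) * l))"
      by (simp add: C1_def algebra_simps add_divide_distrib)
    also have "\<dots> \<le> \<kappa> * (C * (n + g + l))"
    proof (rule mult_left_mono[OF _ \<kappa>0])
      have "C1 * n + \<alpha> * (2 * Cf) * g + (\<eta>\<^sup>2 * (2 * B) + \<alpha> / \<delta>) * l \<le>
        (C1 + \<alpha> * (2 * Cf) + \<eta>\<^sup>2 * (2 * B) + \<alpha> / \<delta>) * n + (C1 + \<alpha> * (2 * Cf) + \<eta>\<^sup>2 * (2 * B) + \<alpha> / \<delta>) * g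
        + (C1 + \<alpha> * (2 * Cf) + \<eta>\<^sup>2 * (2 * B) + \<alpha> / \<delta>) * l"
        by (intro add_mono mult_right_mono ngl) (use nn par in simp_all)
      then have "L * (C1 * n + \<alpha> * (2 * Cf) * g + (\<eta>\<^sup>2 * (2 * B) + \<alpha> / \<delta>) * l) \<le>
        L * ((C1 + \<alpha> * (2 * Cf) + \<eta>\<^sup>2 * (2 * B) + \<alpha> / \<delta>) * (n + g + l))"
        using par by (intro mult_left_mono) (simp_all add: distrib_left)
      then show "L * (C1 * n + \<alpha> * (2 * Cf) * g + (\<eta>\<^sup>2 * (2 * B) + \<alpha> / \<delta>) * l) \<le> C * (n + g + l)"
        by (simp only: C_def mult.assoc)
    qed
    finally show "\<bar>grid_inner h N (grid_interp h (mu_phi \<alpha> \<epsilon> \<eta> \<delta> u \<psi>)) v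
      - grid_inner h N (mu_phi_h \<alpha> \<epsilon> \<eta> \<delta> h f (\<lambda>i j. grid_interp h u i j - c) \<rho>) v\<bar>
      \<le> C * \<kappa> * (grid_norm2 h N v + grad_norm2 h N v + grid_norm2 h N (lap_h h v))"
      unfolding w_def n_def g_def l_def by (simp only: mult_ac)
  qed
qed

lemma ln_diff_le:
  fixes x y c :: real
  assumes "c > 0" "c \<le> x" "c \<le> y"
  shows "\<bar>ln x - ln y\<bar> \<le> \<bar>x - y\<bar> / c"
proof -
  have *: "ln x - ln y \<le> \<bar>x - y\<bar> / c" if "c \<le> x" "c \<le> y" for x y
  proof -
    have "ln x - ln y = ln (x / y)" using that assms by (simp add: ln_div)
    also have "\<dots> \<le> x / y - 1" using that assms by (intro ln_le_minus_one) auto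
    also have "\<dots> = (x - y) / y" using that assms by (simp add: field_simps)
    also have "\<dots> \<le> \<bar>x - y\<bar> / y" using that assms by (intro divide_right_mono) auto
    also have "\<dots> \<le> \<bar>x - y\<bar> / c" using that assms by (intro divide_left_mono) auto
    finally show ?thesis .
  qed
  show ?thesis using *[of x y] *[of y x] assms by (simp add: abs_le_iff abs_minus_commute)
qed

text \<open>A pointwise comparison is enough here: the only difference operators are one Laplacian
  and the regularised norm, and both are compared in the hypotheses. The margin \<open>c0\<close>
  makes the logarithms Lipschitz.\<close>

lemma mu_rho_h_consistent:
  fixes \<alpha> \<beta> \<xi> \<delta> c0 :: real
  assumes par: "\<alpha> > 0" "\<beta> > 0" "\<xi> > 0" "c0 > 0"
    and c: "c0 \<le> \<psi> (p, q)" "\<psi> (p, q) \<le> 1 - c0" "c0 \<le> \<rho> i j" "\<rho> i j \<le> 1 - c0"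
    and pq: "p = (of_int i - 1/2) * h" "q = (of_int j - 1/2) * h"
    and d: "\<bar>\<rho> i j - \<psi> (p, q)\<bar> \<le> \<kappa>" "\<bar>r i j - \<rho> i j\<bar> \<le> \<kappa>"
      "\<bar>lap_h h \<rho> i j - laplacian \<psi> (p, q)\<bar> \<le> \<kappa>" "\<bar>avg_grad_norm \<delta> h w i j - reg_grad_norm \<delta> u (p, q)\<bar> \<le> \<kappa>"
  shows "\<bar>grid_interp h (mu_rho \<alpha> \<beta> \<xi> \<delta> u \<psi>) i j - mu_rho_h \<alpha> \<beta> \<xi> \<delta> h r w \<rho> i j\<bar> \<le>
    (3 * \<alpha> + \<xi> + 2 * \<beta> / c0) * \<kappa>"
proof -
  have "\<bar>ln (\<psi> (p, q)) - ln (\<rho> i j)\<bar> \<le> \<bar>\<psi> (p, q) - \<rho> i j\<bar> / c0"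
    "\<bar>ln (1 - \<rho> i j) - ln (1 - \<psi> (p, q))\<bar> \<le> \<bar>(1 - \<rho> i j) - (1 - \<psi> (p, q))\<bar> / c0"
    by (rule ln_diff_le; use par c in simp)+
  moreover have "\<bar>\<psi> (p, q) - \<rho> i j\<bar> / c0 \<le> \<kappa> / c0" "\<bar>(1 - \<rho> i j) - (1 - \<psi> (p, q))\<bar> / c0 \<le> \<kappa> / c0"
    using d(1) par by (auto intro!: divide_right_mono)
  ultimately have "\<bar>ln (\<psi> (p, q)) - ln (1 - \<psi> (p, q)) - (ln (\<rho> i j) - ln (1 - \<rho> i j))\<bar> \<le> 2 * (\<kappa> / c0)"
    unfolding abs_le_iff by - (elim conjE, intro conjI; linarith)
  note L = mult_left_mono[OF this, of \<beta>]
  have s2: "sqrt 2 \<le> 2" "1 \<le> sqrt 2" by (rule real_le_lsqrt; simp) simp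
  have k0: "0 \<le> \<kappa>" using d(1) by linarith
  have sc: "\<bar>k * x\<bar> \<le> k * X" if "0 \<le> k" "\<bar>x\<bar> \<le> X" for k x X :: real
    using that by (simp add: abs_mult mult_left_mono)
  \<comment> \<open>The implicit and the explicit density term of the splitting differ from a single
    \<open>\<rho>\<close> by \<open>sqrt 2 - 1\<close> times an increment in time, hence by at most
    \<open>\<kappa>\<close>.\<close>
  have r: "\<bar>(\<psi> (p, q) - \<rho> i j) + (sqrt 2 - 1) * (r i j - \<rho> i j)\<bar> \<le> 2 * \<kappa>"
  proof -
    have "\<bar>(sqrt 2 - 1) * (r i j - \<rho> i j)\<bar> \<le> (sqrt 2 - 1) * \<kappa>" by (rule sc) (use s2 d in auto)
    also have "\<dots> \<le> 1 * \<kappa>" using s2 k0 by (intro mult_right_mono) auto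
    finally show ?thesis using d(1) by linarith
  qed
  have eq: "grid_interp h (mu_rho \<alpha> \<beta> \<xi> \<delta> u \<psi>) i j - mu_rho_h \<alpha> \<beta> \<xi> \<delta> h r w \<rho> i j =
    \<alpha> * ((\<psi> (p, q) - \<rho> i j) + (sqrt 2 - 1) * (r i j - \<rho> i j))
    + \<alpha> * (avg_grad_norm \<delta> h w i j - reg_grad_norm \<delta> u (p, q))
    + \<xi> * (lap_h h \<rho> i j - laplacian \<psi> (p, q))
    + \<beta> * (ln (\<psi> (p, q)) - ln (1 - \<psi> (p, q)) - (ln (\<rho> i j) - ln (1 - \<rho> i j)))"
  proof -
    have dm: "deriv mixing_entropy (\<psi> (p, q)) = ln (\<psi> (p, q)) - ln (1 - \<psi> (p, q))"
      by (rule deriv_mixing_entropy) (use c par in auto)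
    show ?thesis
      unfolding grid_interp_def pq[symmetric] mu_rho_def mu_rho_h_def dm by (simp add: algebra_simps)
  qed
  have "\<bar>grid_interp h (mu_rho \<alpha> \<beta> \<xi> \<delta> u \<psi>) i j - mu_rho_h \<alpha> \<beta> \<xi> \<delta> h r w \<rho> i j\<bar> \<le>
    \<alpha> * (2 * \<kappa>) + \<alpha> * \<kappa> + \<xi> * \<kappa> + \<beta> * (2 * (\<kappa> / c0))"
    unfolding eq
    by (intro order_trans[OF abs_triangle_ineq] add_mono sc r d \<open>\<bar>ln (\<psi> (p, q)) - ln (1 - \<psi> (p, q)) - (ln (\<rho> i j) - ln (1 - \<rho> i j))\<bar> \<le> 2 * (\<kappa> / c0)\<close>)
      (use par in auto)
  also have "\<dots> = (3 * \<alpha> + \<xi> + 2 * \<beta> / c0) * \<kappa>" by (simp add: algebra_simps)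
  finally show ?thesis .
qed

subsection \<open>One component of the exact solution\<close>

text \<open>Periodicity separated from continuity: it passes to \<open>pdx\<close>,
  \<open>pdy\<close> and pointwise nonlinear expressions without any differentiability.\<close>

definition xy_periodic :: "real \<Rightarrow> (real \<times> real \<Rightarrow> real) \<Rightarrow> bool" where
  "xy_periodic L u \<longleftrightarrow> (\<forall>x y. u (x + L, y) = u (x, y) \<and> u (x, y + L) = u (x, y))"

lemma C_per_xy_periodic: "C_per L u \<Longrightarrow> xy_periodic L u"
  by (simp add: C_per_def xy_periodic_def)

lemma xy_periodic_pd:
  assumes "xy_periodic L u"
  shows "xy_periodic L (pdx u)" "xy_periodic L (pdy u)"
proof -
  have sh: "deriv f (x + L) = deriv (\<lambda>s. f (s + L)) x" for f :: "real \<Rightarrow> real" and x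
    by (simp only: deriv_def DERIV_shift)
  show "xy_periodic L (pdx u)" "xy_periodic L (pdy u)"
    using assms unfolding xy_periodic_def pdx_def pdy_def by (simp_all add: sh)
qed

lemma mesh_tendsto_0: "(\<lambda>K. L / real (2 * K + 1)) \<longlonglongrightarrow> 0"
proof -
  have "(\<lambda>n. L / real n) \<longlonglongrightarrow> 0" by (rule lim_const_over_n)
  then show ?thesis by (rule LIMSEQ_subseq_LIMSEQ[unfolded o_def]) (auto simp: strict_mono_def)
qed

lemma xy_periodic_iterated:
  assumes "xy_periodic L u"
  shows "xy_periodic L ((pdx ^^ m) u)" "xy_periodic L ((pdy ^^ m) u)"
  by (induction m) (simp_all add: assms xy_periodic_pd)

lemma slice_smooth_Cb:
  assumes "xy_periodic L u" "Cb r B u"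
  shows "slice_smooth L r B (\<lambda>x. u (x, y))" "slice_smooth L r B (\<lambda>y. u (x, y))"
proof -
  have c: "continuous_on UNIV ((pdx ^^ r) u)" "continuous_on UNIV ((pdy ^^ r) u)"
    by (rule Cb_continuous[OF Cb_iterated(1)[OF assms(2) order_refl]])
      (rule Cb_continuous[OF Cb_iterated(2)[OF assms(2) order_refl]])
  have cx: "continuous_on UNIV (\<lambda>s. (pdx ^^ r) u (s, y))"
    by (rule continuous_on_compose2[OF c(1)]) (auto intro!: continuous_on_Pair continuous_on_const continuous_on_id)
  have cy: "continuous_on UNIV (\<lambda>s. (pdy ^^ r) u (x, s))"
    by (rule continuous_on_compose2[OF c(2)]) (auto intro!: continuous_on_Pair continuous_on_const continuous_on_id)
  have px: "(pdx ^^ j) u (s + L, y) = (pdx ^^ j) u (s, y)" for j s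
    using xy_periodic_iterated(1)[OF assms(1), of j] by (simp add: xy_periodic_def)
  have py: "(pdy ^^ j) u (x, s + L) = (pdy ^^ j) u (x, s)" for j s
    using xy_periodic_iterated(2)[OF assms(1), of j] by (simp add: xy_periodic_def)
  show "slice_smooth L r B (\<lambda>x. u (x, y))"
    unfolding slice_smooth_def
    by (rule exI[of _ "\<lambda>j s. (pdx ^^ j) u (s, y)"])
      (use cx px Cb_slices(1)[OF assms(2)] Cb_bound[OF Cb_iterated(1)[OF assms(2) order_refl]] in simp)
  show "slice_smooth L r B (\<lambda>y. u (x, y))"
    unfolding slice_smooth_def
    by (rule exI[of _ "\<lambda>j s. (pdy ^^ j) u (x, s)"])
      (use cy py Cb_slices(2)[OF assms(2)] Cb_bound[OF Cb_iterated(2)[OF assms(2) order_refl]] in simp)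
qed

lemma grid_per_interp:
  assumes "xy_periodic L u" "real N * h = L"
  shows "grid_per N (grid_interp h u)" "grid_per N (edge_x h u)" "grid_per N (edge_y h u)"
proof -
  have e: "(of_int (i + int N) - 1/2) * h = (of_int i - 1/2) * h + L" "of_int (i + int N) * h = of_int i * h + L" for i
    using assms(2) by (simp_all add: algebra_simps)
  show "grid_per N (grid_interp h u)" "grid_per N (edge_x h u)" "grid_per N (edge_y h u)"
    using assms(1) unfolding grid_per_def grid_interp_def edge_x_def edge_y_def e xy_periodic_def by simp_all
qed

section \<open>Grid means and integrals over time steps\<close>

definition gmean :: "nat \<Rightarrow> grid_fun \<Rightarrow> real" where
  "gmean N f = (\<Sum>i\<in>{1..int N}. \<Sum>j\<in>{1..int N}. f i j) / (real N)\<^sup>2"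

lemma gmean_diff: "gmean N (\<lambda>i j. f i j - g i j) = gmean N f - gmean N g"
  by (simp add: gmean_def sum_subtractf diff_divide_distrib)

lemma gmean_scale: "gmean N (\<lambda>i j. c * f i j) = c * gmean N f"
  by (simp add: gmean_def sum_distrib_left)

lemma gmean_const: "N > 0 \<Longrightarrow> gmean N (\<lambda>i j. c) = c"
  by (simp add: gmean_def power2_eq_square)

lemma gmean_add: "gmean N (\<lambda>i j. f i j + g i j) = gmean N f + gmean N g"
  by (simp add: gmean_def sum.distrib add_divide_distrib)

lemma mean_zero_gmean: "N > 0 \<Longrightarrow> mean_zero N f \<longleftrightarrow> gmean N f = 0"
  by (simp add: mean_zero_def gmean_def)

lemma gmean_mono: "(\<And>i j. f i j \<le> g i j) \<Longrightarrow> gmean N f \<le> gmean N g"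
  unfolding gmean_def by (intro divide_right_mono sum_mono) auto

lemma gmean_bound:
  assumes "N > 0" "\<And>i j. \<bar>f i j\<bar> \<le> B"
  shows "\<bar>gmean N f\<bar> \<le> B"
proof -
  have "gmean N f \<le> gmean N (\<lambda>i j. B)" "gmean N (\<lambda>i j. - B) \<le> gmean N f"
    by (intro gmean_mono; use assms(2) abs_le_iff in \<open>simp add: abs_le_iff\<close>; metis minus_le_iff)+
  then show ?thesis using assms(1) by (simp add: gmean_const abs_le_iff)
qed

text \<open>The closed step intervals meet at their end points, so a given time belongs to at most
  two of them.\<close>

lemma sum_indicators_le_2:
  fixes t dt :: real
  assumes "dt > 0"
  shows "(\<Sum>n<m. indicator {real n * dt..real (Suc n) * dt} t) \<le> (2 :: real)"
proof -
  define k where "k = \<lfloor>t / dt\<rfloor>"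
  have "(\<Sum>n<m. indicator {real n * dt..real (Suc n) * dt} t) =
    (\<Sum>n\<in>{n. n < m \<and> t \<in> {real n * dt..real (Suc n) * dt}}. (1 :: real))"
    by (simp add: indicator_def sum.If_cases Int_def lessThan_def conj_commute)
  also have "\<dots> = real (card {n. n < m \<and> t \<in> {real n * dt..real (Suc n) * dt}})" by simp
  also have "\<dots> \<le> real (card {nat k, nat (k - 1)})"
  proof -
    have "{n. n < m \<and> t \<in> {real n * dt..real (Suc n) * dt}} \<subseteq> {nat k, nat (k - 1)}"
    proof
      fix n assume "n \<in> {n. n < m \<and> t \<in> {real n * dt..real (Suc n) * dt}}"
      then have "real n \<le> t / dt" "t / dt \<le> real (Suc n)" using assms by (auto simp: field_simps)
      then have "int n \<le> k" "k \<le> int n + 1" unfolding k_def by linarith+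
      then show "n \<in> {nat k, nat (k - 1)}" by auto
    qed
    then show ?thesis by (intro of_nat_mono card_mono) auto
  qed
  also have "card {nat k, nat (k - 1)} \<le> 2" by (simp add: card_insert_if)
  finally show ?thesis by simp
qed

definition window :: "real \<Rightarrow> (real \<Rightarrow> real) \<Rightarrow> real \<Rightarrow> real \<Rightarrow> real" where
  "window T f a b = (LINT t|lebesgue_on {0<..<T}. indicator {a..b} t * f t)"

lemma window_sum_le:
  assumes f: "integrable (lebesgue_on {0<..<T}) f" "\<And>t. 0 \<le> f t" and "dt > 0"
  shows "(\<Sum>n<m. window T f (real n * dt) (real (Suc n) * dt)) \<le> 2 * (LINT t|lebesgue_on {0<..<T}. f t)"
proof -
  have "(\<Sum>n<m. window T f (real n * dt) (real (Suc n) * dt)) =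
    (LINT t|lebesgue_on {0<..<T}. (\<Sum>n<m. indicator {real n * dt..real (Suc n) * dt} t * f t))"
    unfolding window_def by (rule Bochner_Integration.integral_sum[symmetric]) (rule integrable_indicator_mult[OF f(1)])
  also have "\<dots> \<le> (LINT t|lebesgue_on {0<..<T}. 2 * f t)"
  proof (rule integral_mono)
    show "integrable (lebesgue_on {0<..<T}) (\<lambda>t. \<Sum>n<m. indicator {real n * dt..real (Suc n) * dt} t * f t)"
      by (intro Bochner_Integration.integrable_sum integrable_indicator_mult f(1))
    show "integrable (lebesgue_on {0<..<T}) (\<lambda>t. 2 * f t)" using f(1) by simp
    fix t
    show "(\<Sum>n<m. indicator {real n * dt..real (Suc n) * dt} t * f t) \<le> 2 * f t"
      unfolding sum_distrib_right[symmetric] by (intro mult_right_mono sum_indicators_le_2 assms(3) f(2))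
  qed
  finally show ?thesis by simp
qed

lemma window_nonneg: "(\<And>t. 0 \<le> f t) \<Longrightarrow> 0 \<le> window T f a b"
  unfolding window_def by (intro integral_nonneg_AE) (simp add: indicator_def)

text \<open>Cauchy-Schwarz in time. The factor \<open>b - a\<close> gained here is what turns the
  squared truncation errors of all steps into \<open>dt^2\<close> times a fixed integral.\<close>

lemma window_sq_le:
  assumes f: "integrable (lebesgue_on {0<..<T}) f" "integrable (lebesgue_on {0<..<T}) (\<lambda>t. (f t)\<^sup>2)"
    and "a \<le> b"
  shows "(window T f a b)\<^sup>2 \<le> (b - a) * window T (\<lambda>t. (f t)\<^sup>2) a b"
proof -
  let ?M = "lebesgue_on {0<..<T}"
  have i1: "integrable ?M (\<lambda>t. 1 :: real)" by (rule integrable_continuous_open_interval) simp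
  define c where "c = window T (\<lambda>t. 1) a b"
  have c: "c \<le> b - a" "0 \<le> c"
  proof -
    have "c = measure ?M ({a..b} \<inter> {0<..<T})"
      by (simp add: c_def window_def space_restrict_space Int_commute)
    also have "\<dots> = measure lebesgue ({a..b} \<inter> {0<..<T})"
      by (rule measure_restrict_space) auto
    also have "\<dots> \<le> measure lebesgue {a..b}"
      by (rule measure_mono_fmeasurable) auto
    finally show "c \<le> b - a" using \<open>a \<le> b\<close> by simp
    show "0 \<le> c" unfolding c_def by (rule window_nonneg) simp
  qed
  have "0 \<le> window T (\<lambda>t. (f t)\<^sup>2) a b + 2 * x * window T f a b + x\<^sup>2 * c" for x
  proof -
    have "0 \<le> (LINT t|?M. indicator {a..b} t * (f t + x)\<^sup>2)"
      by (intro integral_nonneg_AE) (simp add: indicator_def)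
    also have "\<dots> = (LINT t|?M. (indicator {a..b} t * (f t)\<^sup>2 + (2 * x) * (indicator {a..b} t * f t)) + x\<^sup>2 * (indicator {a..b} t * 1))"
      by (rule Bochner_Integration.integral_cong) (simp_all add: power2_sum algebra_simps)
    also have "\<dots> = window T (\<lambda>t. (f t)\<^sup>2) a b + 2 * x * window T f a b + x\<^sup>2 * c"
      unfolding window_def c_def
      using integrable_indicator_mult[OF f(2), of a b] integrable_indicator_mult[OF f(1), of a b]
        integrable_indicator_mult[OF i1, of a b]
      by (simp only: Bochner_Integration.integral_add Bochner_Integration.integral_mult_right
          Bochner_Integration.integrable_add integrable_mult_right)
    finally show ?thesis .
  qed
  then have "\<bar>window T f a b\<bar> \<le> sqrt (window T (\<lambda>t. (f t)\<^sup>2) a b) * sqrt c"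
    by (rule discriminant_bound) (use c window_nonneg[of "\<lambda>t. (f t)\<^sup>2"] in auto)
  then have "\<bar>window T f a b\<bar>\<^sup>2 \<le> (sqrt (window T (\<lambda>t. (f t)\<^sup>2) a b) * sqrt c)\<^sup>2"
    by (intro power_mono) auto
  also have "\<dots> = window T (\<lambda>t. (f t)\<^sup>2) a b * c"
    using c window_nonneg[of "\<lambda>t. (f t)\<^sup>2" T a b] by (simp add: power_mult_distrib)
  also have "\<dots> \<le> window T (\<lambda>t. (f t)\<^sup>2) a b * (b - a)"
    using c by (intro mult_left_mono window_nonneg) auto
  finally show ?thesis by (simp add: mult.commute)
qed

text \<open>\<open>\<sigma>\<close> is the sup norm of the second weak derivative, so one function
  serves all points \<open>z\<close>. The absolute value is taken because the supremum is arbitrary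
  at the exceptional times at which \<open>w t\<close> fails to be continuous and periodic.\<close>

lemma H2_time_difference:
  assumes "H2_C_per T L U" "L > 0" "T > 0"
  shows "\<exists>\<sigma>. integrable (lebesgue_on {0<..<T}) \<sigma> \<and> integrable (lebesgue_on {0<..<T}) (\<lambda>t. (\<sigma> t)\<^sup>2) \<and> (\<forall>t. 0 \<le> \<sigma> t) \<and>
    (\<forall>t1 s t2 z d. 0 \<le> t1 \<longrightarrow> t1 < s \<longrightarrow> s < t2 \<longrightarrow> t2 \<le> T \<longrightarrow> ((\<lambda>t. U t z) has_real_derivative d) (at s) \<longrightarrow>
      \<bar>U t2 z - U t1 z - (t2 - t1) * d\<bar> \<le> (t2 - t1) * window T \<sigma> t1 t2)"
proof -
  let ?M = "lebesgue_on {0<..<T}"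
  obtain v w where w: "L2_C_per T L w" and uv: "weak_time_derivative T U v" and vw: "weak_time_derivative T v w"
    using assms(1) unfolding H2_C_per_def by blast
  have cont: "continuous_on ({0..T} \<times> UNIV) (\<lambda>(t, z). U t z)" using assms(1) unfolding H2_C_per_def by blast
  define \<sigma> where "\<sigma> = (\<lambda>t. \<bar>sup_norm (w t)\<bar>)"
  have sq: "integrable ?M (\<lambda>t. (\<sigma> t)\<^sup>2)" using w by (simp add: L2_C_per_def \<sigma>_def)
  \<comment> \<open>What is given is integrability of the square; measurability of the function
    itself is recovered through the root.\<close>
  have "(\<lambda>t. sqrt ((\<sigma> t)\<^sup>2)) \<in> borel_measurable ?M" 
    by (rule measurable_compose[OF borel_measurable_integrable[OF sq]
          borel_measurable_continuous_onI[OF continuous_on_real_sqrt[OF continuous_on_id]]])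
  then have meas: "\<sigma> \<in> borel_measurable ?M" by (simp add: \<sigma>_def)
  have one: "integrable ?M (\<lambda>t. 1 + (\<sigma> t)\<^sup>2)"
    by (intro Bochner_Integration.integrable_add sq integrable_continuous_open_interval) simp
  have int: "integrable ?M \<sigma>"
  proof (rule Bochner_Integration.integrable_bound[OF one meas])
    have "norm (\<sigma> t) \<le> norm (1 + (\<sigma> t)\<^sup>2)" for t
    proof -
      have "2 * \<bar>\<sigma> t\<bar> * 1 \<le> \<bar>\<sigma> t\<bar>\<^sup>2 + 1\<^sup>2" by (rule sum_squares_bound)
      then show ?thesis by (simp add: abs_of_nonneg)
    qed
    then show "AE t in ?M. norm (\<sigma> t) \<le> norm (1 + (\<sigma> t)\<^sup>2)" by simp
  qed
  have "\<bar>U t2 z - U t1 z - (t2 - t1) * d\<bar> \<le> (t2 - t1) * window T \<sigma> t1 t2"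
    if "0 \<le> t1" "t1 < s" "s < t2" "t2 \<le> T" "((\<lambda>t. U t z) has_real_derivative d) (at s)" for t1 s t2 z d
    unfolding window_def
  proof (rule derivative_vs_difference_quotient[where u = "\<lambda>t. U t z" and v = "\<lambda>t. v t z" and w = "\<lambda>t. w t z" and s = s])
    show "continuous_on {0..T} (\<lambda>t. U t z)"
    proof -
      have "continuous_on {0..T} (\<lambda>t. (t, z))" by (intro continuous_on_Pair continuous_on_id continuous_on_const)
      moreover have "(\<lambda>t. (t, z)) ` {0..T} \<subseteq> {0..T} \<times> UNIV" by auto
      ultimately show ?thesis using continuous_on_compose2[OF cont, of "{0..T}" "\<lambda>t. (t, z)"] by (simp only: prod.case)
    qed
    show "(LINT t|?M. U t z * deriv \<theta> t) = - (LINT t|?M. v t z * \<theta> t)"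
      "(LINT t|?M. v t z * deriv \<theta> t) = - (LINT t|?M. w t z * \<theta> t)" if "time_test_function T \<theta>" for \<theta>
      using uv vw that unfolding weak_time_derivative_def by blast+
    have "AE t in ?M. C_per L (w t)" using w by (simp add: L2_C_per_def)
    then show "AE t in ?M. \<bar>w t z\<bar> \<le> \<sigma> t"
    proof eventually_elim
      case (elim t)
      then show ?case using C_per_bounded[of L "w t" z] assms(2) unfolding \<sigma>_def by linarith
    qed
  qed (use that int in auto)
  then show ?thesis using int sq by (intro exI[of _ \<sigma>]) (auto simp: \<sigma>_def)
qed

text \<open>The set \<open>S\<close> consists of good times: the equation and the spatial regularity hold there.\<close>

locale diffusion_component =
  fixes T L M :: real and r :: nat and U \<mu> :: "real \<Rightarrow> real \<times> real \<Rightarrow> real" and S :: "real set"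
  assumes pos: "T > 0" "L > 0" "M > 0" and r: "r \<ge> 6"
    and H2: "H2_C_per T L U"
    and S: "S \<subseteq> {0<..<T}" "\<And>a b. 0 \<le> a \<Longrightarrow> a < b \<Longrightarrow> b \<le> T \<Longrightarrow> \<exists>s\<in>S. a < s \<and> s < b"
    and fam: "Cfam r S U" "Cfam 4 S \<mu>" and per_mu: "\<And>s. s \<in> S \<Longrightarrow> xy_periodic L (\<mu> s)"
    and eqn: "\<And>s z. s \<in> S \<Longrightarrow> ((\<lambda>t. U t z) has_real_derivative M * laplacian (\<mu> s) z) (at s)"
begin

section \<open>Consequences of the equation at good times\<close>

abbreviation mass :: real where "mass \<equiv> Re (fourier_coeff L (U 0) 0 0)"

lemma C_per_U: "t \<in> {0..T} \<Longrightarrow> C_per L (U t)"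
  using H2 by (simp add: H2_C_per_def)

lemma cont_U: "t \<in> {0..T} \<Longrightarrow> continuous_on UNIV (U t)"
  using C_per_U by (simp add: C_per_def)

lemma per_U: "t \<in> {0..T} \<Longrightarrow> xy_periodic L (U t)"
  by (rule C_per_xy_periodic[OF C_per_U])

lemma S_in: "s \<in> S \<Longrightarrow> s \<in> {0..T}"
  using S(1) by auto

definition sigma :: "real \<Rightarrow> real" where
  "sigma = (SOME \<sigma>. integrable (lebesgue_on {0<..<T}) \<sigma> \<and> integrable (lebesgue_on {0<..<T}) (\<lambda>t. (\<sigma> t)\<^sup>2) \<and> (\<forall>t. 0 \<le> \<sigma> t) \<and>
    (\<forall>t1 s t2 z d. 0 \<le> t1 \<longrightarrow> t1 < s \<longrightarrow> s < t2 \<longrightarrow> t2 \<le> T \<longrightarrow> ((\<lambda>t. U t z) has_real_derivative d) (at s) \<longrightarrow>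
      \<bar>U t2 z - U t1 z - (t2 - t1) * d\<bar> \<le> (t2 - t1) * window T \<sigma> t1 t2))"

lemma sigma: "integrable (lebesgue_on {0<..<T}) sigma" "integrable (lebesgue_on {0<..<T}) (\<lambda>t. (sigma t)\<^sup>2)" "0 \<le> sigma t"
  and time_difference: "0 \<le> t1 \<Longrightarrow> t1 < s \<Longrightarrow> s < t2 \<Longrightarrow> t2 \<le> T \<Longrightarrow> s \<in> S \<Longrightarrow>
    \<bar>U t2 z - U t1 z - (t2 - t1) * (M * laplacian (\<mu> s) z)\<bar> \<le> (t2 - t1) * window T sigma t1 t2"
proof -
  note X = someI_ex[OF H2_time_difference[OF H2 pos(2,1)], folded sigma_def]
  show "integrable (lebesgue_on {0<..<T}) sigma" "integrable (lebesgue_on {0<..<T}) (\<lambda>t. (sigma t)\<^sup>2)" "0 \<le> sigma t"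
    using X by blast+
  show "\<bar>U t2 z - U t1 z - (t2 - t1) * (M * laplacian (\<mu> s) z)\<bar> \<le> (t2 - t1) * window T sigma t1 t2"
    if "0 \<le> t1" "t1 < s" "s < t2" "t2 \<le> T" "s \<in> S"
    using X that eqn[OF that(5), of z] by blast
qed

abbreviation \<omega> :: "real \<Rightarrow> real \<Rightarrow> real" where "\<omega> a b \<equiv> window T sigma a b"

lemma \<omega>_nonneg: "0 \<le> \<omega> a b"
  by (rule window_nonneg) (rule sigma)

lemma \<omega>_le: "\<omega> a b \<le> (LINT t|lebesgue_on {0<..<T}. sigma t)"
  unfolding window_def
  by (rule integral_mono[OF integrable_indicator_mult[OF sigma(1)] sigma(1)]) (simp add: indicator_def sigma(3))

lemma lap_mu_bounded: "\<exists>B\<ge>0. \<forall>s\<in>S. Cb 4 B (\<mu> s) \<and> (\<forall>z. \<bar>laplacian (\<mu> s) z\<bar> \<le> 2 * B)"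
proof -
  obtain B where B: "\<And>s. s \<in> S \<Longrightarrow> Cb 4 B (\<mu> s)" using fam(2) unfolding Cfam_def by blast
  obtain s0 where "s0 \<in> S" using S(2)[of 0 T] pos by auto
  then have "0 \<le> B" using Cb_bound[OF B, of s0 0] by linarith
  moreover have "\<bar>laplacian (\<mu> s) z\<bar> \<le> 2 * B" if "s \<in> S" for s z
    using Cb_bound[OF Cb_iterated(1)[OF B[OF that], of 2], of z] Cb_bound[OF Cb_iterated(2)[OF B[OF that], of 2], of z]
    by (simp add: laplacian_def numeral_2_eq_2)
  ultimately show ?thesis using B by blast
qed

text \<open>Compare with the equation at a good time between the two times: the Laplacian of the
  potential is bounded uniformly over good times, and the remainder is controlled by the full
  integral of \<open>sigma\<close>.\<close>

lemma time_Lipschitz: "\<exists>C\<ge>0. \<forall>t1\<in>{0..T}. \<forall>t2\<in>{0..T}. \<forall>z. \<bar>U t2 z - U t1 z\<bar> \<le> C * \<bar>t2 - t1\<bar>"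
proof -
  obtain B where B: "B \<ge> 0" "\<And>s z. s \<in> S \<Longrightarrow> \<bar>laplacian (\<mu> s) z\<bar> \<le> 2 * B" using lap_mu_bounded by blast
  define I where "I = (LINT t|lebesgue_on {0<..<T}. sigma t)"
  have I: "0 \<le> I" unfolding I_def by (intro integral_nonneg_AE) (simp add: sigma(3))
  define C where "C = M * (2 * B) + I"
  have lt: "\<bar>U t2 z - U t1 z\<bar> \<le> C * (t2 - t1)" if t: "0 \<le> t1" "t1 < t2" "t2 \<le> T" for t1 t2 z
  proof -
    obtain s where s: "s \<in> S" "t1 < s" "s < t2" using S(2)[OF t] by blast
    have "\<bar>U t2 z - U t1 z - (t2 - t1) * (M * laplacian (\<mu> s) z)\<bar> \<le> (t2 - t1) * \<omega> t1 t2"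
      by (rule time_difference) (use s t in auto)
    also have "\<dots> \<le> (t2 - t1) * I" unfolding I_def using t \<omega>_le by (intro mult_left_mono) auto
    finally have 1: "\<bar>U t2 z - U t1 z - (t2 - t1) * (M * laplacian (\<mu> s) z)\<bar> \<le> (t2 - t1) * I" .
    have 2: "\<bar>(t2 - t1) * (M * laplacian (\<mu> s) z)\<bar> \<le> (t2 - t1) * (M * (2 * B))"
      unfolding abs_mult using t pos B(2)[OF s(1), of z] by (intro mult_mono) auto
    have "(t2 - t1) * (M * (2 * B)) + (t2 - t1) * I = C * (t2 - t1)" by (simp add: C_def algebra_simps)
    then show ?thesis using 1 2 by linarith
  qed
  have "\<bar>U t2 z - U t1 z\<bar> \<le> C * \<bar>t2 - t1\<bar>" if "t1 \<in> {0..T}" "t2 \<in> {0..T}" for t1 t2 z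
    using lt[of t1 t2 z] lt[of t2 t1 z] that by (cases t1 t2 rule: linorder_cases) (auto simp: abs_minus_commute)
  moreover have "C \<ge> 0" using B I pos by (simp add: C_def)
  ultimately show ?thesis by blast
qed

lemma good_time_near:
  assumes "t \<in> {0..T}" "e > 0"
  shows "\<exists>s\<in>S. \<bar>t - s\<bar> < e"
proof (cases "t < T")
  case True
  then obtain s where "s \<in> S" "t < s" "s < min T (t + e)" using S(2)[of t "min T (t + e)"] assms by auto
  then show ?thesis by (intro bexI[of _ s]) auto
next
  case False
  then obtain s where "s \<in> S" "max 0 (T - e) < s" "s < T" using S(2)[of "max 0 (T - e)" T] assms pos by auto
  then show ?thesis using False assms by (intro bexI[of _ s]) auto
qed

text \<open>Smoothness in space is available at good times only. For fixed \<open>K\<close> a good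
  time is taken so close that the crude bound for the projection makes the discrepancy smaller than
  any \<open>e\<close>, and the estimate passes to all times.\<close>

lemma proj_error: "\<exists>C\<ge>0. \<forall>t\<in>{0..T}. \<forall>K z. \<bar>fourier_proj L K (U t) z - U t z\<bar> \<le> C * (L / real (2 * K + 1)) ^ (r - 3)"
proof -
  obtain C0 where C0: "C0 \<ge> 0" "\<And>t1 t2 z. t1 \<in> {0..T} \<Longrightarrow> t2 \<in> {0..T} \<Longrightarrow> \<bar>U t2 z - U t1 z\<bar> \<le> C0 * \<bar>t2 - t1\<bar>"
    using time_Lipschitz by blast
  obtain B0 where B0: "\<And>s. s \<in> S \<Longrightarrow> Cb r B0 (U s)" using fam(1) unfolding Cfam_def by blast
  define B where "B = max B0 0"
  have B: "B \<ge> 0" "\<And>s. s \<in> S \<Longrightarrow> Cb r B (U s)"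
    by (simp add: B_def, rule Cb_mono[OF B0], assumption, simp add: B_def)
  \<comment> \<open>The last factor converts the degree into the mesh width, using that
    \<open>K + 1\<close> is at least half of \<open>2 * K + 1\<close>.\<close>
  define C where "C = 16 * (L / (2 * pi)) ^ r * B * (2 / L) ^ (r - 3)"
  have "\<bar>fourier_proj L K (U t) z - U t z\<bar> \<le> C * (L / real (2 * K + 1)) ^ (r - 3)" if t: "t \<in> {0..T}" for t K z
  proof (rule field_le_epsilon)
    fix e :: real assume e: "e > 0"
    define n where "n = real (2 * K + 1)"
    \<comment> \<open>The distance to the good time counts \<open>n^2\<close> times through the
      projection and once through the function itself; the final 1 keeps the divisor
      positive.\<close>
    define D where "D = C0 * (1 + n\<^sup>2) + 1"
    have D: "D > 0" using C0 by (simp add: D_def add_nonneg_pos)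
    obtain s where s: "s \<in> S" "\<bar>t - s\<bar> < e / D" using good_time_near[OF t, of "e / D"] e D by auto
    note sT = S_in[OF s(1)]
    have 1: "\<bar>fourier_proj L K (U s) z - U s z\<bar> \<le> 16 * (L / (2 * pi)) ^ r * B * real (K + 1) / real (K + 1) ^ (r - 2)"
      by (rule fourier_proj_error[OF cont_U[OF sT] pos(2)])
        (use r slice_smooth_Cb[OF per_U[OF sT] B(2)[OF s(1)]] in auto)
    have "real (K + 1) / real (K + 1) ^ (r - 2) = 1 / real (K + 1) ^ (r - 3)"
    proof -
      have "r - 2 = Suc (r - 3)" using r by simp
      then show ?thesis by (simp del: of_nat_Suc of_nat_add)
    qed
    also have "\<dots> \<le> 1 / (n / 2) ^ (r - 3)"
    proof (rule divide_left_mono)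
      show "(n / 2) ^ (r - 3) \<le> real (K + 1) ^ (r - 3)" by (rule power_mono) (simp_all add: n_def)
      show "0 < real (K + 1) ^ (r - 3) * (n / 2) ^ (r - 3)" by (intro mult_pos_pos zero_less_power) (simp_all add: n_def)
    qed simp
    also have "\<dots> = (2 / L) ^ (r - 3) * (L / n) ^ (r - 3)"
    proof -
      have "(2 / L) * (L / n) = 1 / (n / 2)" using pos by simp
      then have "((2 / L) * (L / n)) ^ (r - 3) = 1 / (n / 2) ^ (r - 3)" by (simp only: power_one_over)
      then show ?thesis by (simp only: power_mult_distrib)
    qed
    finally have 2: "real (K + 1) / real (K + 1) ^ (r - 2) \<le> (2 / L) ^ (r - 3) * (L / n) ^ (r - 3)" .
    have "16 * (L / (2 * pi)) ^ r * B * (real (K + 1) / real (K + 1) ^ (r - 2)) \<le>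
      16 * (L / (2 * pi)) ^ r * B * ((2 / L) ^ (r - 3) * (L / n) ^ (r - 3))"
      using B pos by (intro mult_left_mono 2) auto
    then have 3: "\<bar>fourier_proj L K (U s) z - U s z\<bar> \<le> C * (L / n) ^ (r - 3)"
      using 1 by (simp add: C_def mult.assoc)
    have d: "\<bar>U t z - U s z\<bar> \<le> C0 * \<bar>t - s\<bar>" for z using C0(2)[OF sT t] by (simp add: abs_minus_commute)
    have 4: "\<bar>fourier_proj L K (U t) z - fourier_proj L K (U s) z\<bar> \<le> n\<^sup>2 * (C0 * \<bar>t - s\<bar>)"
      unfolding n_def by (rule fourier_proj_diff_le[OF cont_U[OF t] cont_U[OF sT] pos(2) d])
    have "n\<^sup>2 * (C0 * \<bar>t - s\<bar>) + C0 * \<bar>t - s\<bar> \<le> e"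
    proof -
      have "n\<^sup>2 * (C0 * \<bar>t - s\<bar>) + C0 * \<bar>t - s\<bar> = (C0 * (1 + n\<^sup>2)) * \<bar>t - s\<bar>" by (simp add: algebra_simps)
      also have "\<dots> \<le> D * \<bar>t - s\<bar>" by (intro mult_right_mono) (auto simp: D_def)
      also have "\<dots> \<le> D * (e / D)" using s D by (intro mult_left_mono) auto
      finally show ?thesis using D by simp
    qed
    then show "\<bar>fourier_proj L K (U t) z - U t z\<bar> \<le> C * (L / real (2 * K + 1)) ^ (r - 3) + e"
      using 3 4 d[of z] unfolding n_def by linarith
  qed
  moreover have "C \<ge> 0" using B pos by (simp add: C_def)
  ultimately show ?thesis by blast
qed

lemma gmean_proj:
  assumes "t \<in> {0..T}"
  shows "gmean (2 * K + 1) (grid_interp (L / real (2 * K + 1)) (fourier_proj L K (U t))) = Re (fourier_coeff L (U t) 0 0)"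
  using grid_mean_fourier_proj[OF cont_U[OF assms] pos(2), of K] by (simp add: gmean_def)

lemma gmean_error:
  "\<exists>C\<ge>0. \<forall>t\<in>{0..T}. \<forall>K. \<bar>gmean (2 * K + 1) (grid_interp (L / real (2 * K + 1)) (U t)) - Re (fourier_coeff L (U t) 0 0)\<bar>
    \<le> C * (L / real (2 * K + 1)) ^ (r - 3)"
proof -
  obtain C where C: "C \<ge> 0" "\<And>t K z. t \<in> {0..T} \<Longrightarrow> \<bar>fourier_proj L K (U t) z - U t z\<bar> \<le> C * (L / real (2 * K + 1)) ^ (r - 3)"
    using proj_error by blast
  have "\<bar>gmean (2 * K + 1) (grid_interp (L / real (2 * K + 1)) (U t)) - Re (fourier_coeff L (U t) 0 0)\<bar>
    \<le> C * (L / real (2 * K + 1)) ^ (r - 3)" if t: "t \<in> {0..T}" for t K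
    unfolding gmean_proj[OF t, of K, symmetric] gmean_diff[symmetric]
    by (rule gmean_bound) (simp, simp only: grid_interp_def, subst abs_minus_commute, rule C(2)[OF t])
  then show ?thesis using C(1) by blast
qed

text \<open>The mass is not differentiated. On each grid the discrete Laplacian has mean zero, so
  over a time interval the grid mean changes only by the time truncation error and by terms that
  vanish with the mesh. Each truncation error carries the length of its interval as a factor, so
  refining a partition of the time interval makes the total change vanish.\<close>

lemma mass_conserved:
  assumes "t \<in> {0..T}"
  shows "Re (fourier_coeff L (U t) 0 0) = mass"
proof -
  define m where "m = (\<lambda>t. Re (fourier_coeff L (U t) 0 0))"
  obtain C where C: "C \<ge> 0" "\<And>t K. t \<in> {0..T} \<Longrightarrow> \<bar>gmean (2 * K + 1) (grid_interp (L / real (2 * K + 1)) (U t)) - m t\<bar>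
    \<le> C * (L / real (2 * K + 1)) ^ (r - 3)"
    using gmean_error unfolding m_def by blast
  obtain B where B: "B \<ge> 0" "\<And>s. s \<in> S \<Longrightarrow> Cb 4 B (\<mu> s)" using lap_mu_bounded by blast
  have step: "\<bar>m t2 - m t1\<bar> \<le> (t2 - t1) * \<omega> t1 t2" if t: "0 \<le> t1" "t1 < t2" "t2 \<le> T" for t1 t2
  proof -
    obtain s where s: "s \<in> S" "t1 < s" "s < t2" using S(2)[OF t] by blast
    have "\<bar>m t2 - m t1\<bar> \<le> (t2 - t1) * \<omega> t1 t2 + ((t2 - t1) * (M * (2 * B * (L / real (2 * K + 1))\<^sup>2)) + 2 * (C * (L / real (2 * K + 1)) ^ (r - 3)))" for K
    proof -
      define N where "N = 2 * K + 1"
      define h where "h = L / real N"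
      have N: "N > 0" "h > 0" "real N * h = L" using pos by (simp_all add: N_def h_def)
      let ?P = "\<lambda>u. grid_interp h u"
      have "gmean N (\<lambda>i j. lap_h h (?P (\<mu> s)) i j) = 0"
        using mean_zero_lap[OF grid_per_interp(1)[OF per_mu[OF s(1)] N(3)], of h] N mean_zero_gmean[OF N(1)] by simp
      moreover have "\<bar>gmean N (\<lambda>i j. lap_h h (?P (\<mu> s)) i j - ?P (laplacian (\<mu> s)) i j)\<bar> \<le> 2 * B * h\<^sup>2"
        by (rule gmean_bound[OF N(1)]) (rule lap_h_consistent[OF B(2)[OF s(1)] N(2)])
      ultimately have g1: "\<bar>gmean N (?P (laplacian (\<mu> s)))\<bar> \<le> 2 * B * h\<^sup>2" by (simp add: gmean_diff)
      have "\<bar>gmean N (\<lambda>i j. (?P (U t2) i j - ?P (U t1) i j) - ((t2 - t1) * M) * ?P (laplacian (\<mu> s)) i j)\<bar> \<le> (t2 - t1) * \<omega> t1 t2"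
        by (rule gmean_bound[OF N(1)])
          (use time_difference[OF t(1) s(2,3) t(3) s(1)] in \<open>simp only: grid_interp_def mult.assoc\<close>)
      then have g2: "\<bar>gmean N (?P (U t2)) - gmean N (?P (U t1)) - ((t2 - t1) * M) * gmean N (?P (laplacian (\<mu> s)))\<bar> \<le> (t2 - t1) * \<omega> t1 t2"
        by (simp only: gmean_diff gmean_scale)
      have g3: "\<bar>((t2 - t1) * M) * gmean N (?P (laplacian (\<mu> s)))\<bar> \<le> ((t2 - t1) * M) * (2 * B * h\<^sup>2)"
        unfolding abs_mult[of "(t2 - t1) * M"] using t pos g1 by (intro mult_mono) auto
      have "t1 \<in> {0..T}" "t2 \<in> {0..T}" using t by auto
      then have "\<bar>gmean N (?P (U t1)) - m t1\<bar> \<le> C * h ^ (r - 3)" "\<bar>gmean N (?P (U t2)) - m t2\<bar> \<le> C * h ^ (r - 3)"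
        using C(2) unfolding h_def N_def by blast+
      then show ?thesis using g2 g3 unfolding h_def N_def mult.assoc by linarith
    qed
    moreover have "(\<lambda>K. (t2 - t1) * \<omega> t1 t2 + ((t2 - t1) * (M * (2 * B * (L / real (2 * K + 1))\<^sup>2)) + 2 * (C * (L / real (2 * K + 1)) ^ (r - 3))))
      \<longlonglongrightarrow> (t2 - t1) * \<omega> t1 t2 + ((t2 - t1) * (M * (2 * B * 0\<^sup>2)) + 2 * (C * 0 ^ (r - 3)))"
      by (intro tendsto_intros mesh_tendsto_0)
    ultimately have "\<bar>m t2 - m t1\<bar> \<le> (t2 - t1) * \<omega> t1 t2 + ((t2 - t1) * (M * (2 * B * 0\<^sup>2)) + 2 * (C * 0 ^ (r - 3)))"
      by (intro LIMSEQ_le_const) auto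
    then show ?thesis using r by (simp add: power_0_left)
  qed
  have "\<bar>m t - m 0\<bar> \<le> (t * (2 * (LINT t|lebesgue_on {0<..<T}. sigma t))) / real n" if n: "n > 0" for n
  proof (cases "t = 0")
    case False
    define dt where "dt = t / real n"
    have dt: "dt > 0" "real n * dt = t" using False assms n by (simp_all add: dt_def)
    have "\<bar>m (real k * dt) - m 0\<bar> \<le> dt * (\<Sum>j<k. \<omega> (real j * dt) (real (Suc j) * dt))" if "k \<le> n" for k
      using that
    proof (induction k)
      case (Suc k)
      have "real (Suc k) * dt \<le> real n * dt" using Suc.prems dt by (intro mult_right_mono) auto
      then have le: "real (Suc k) * dt \<le> T" using dt assms by simp
      have e: "real (Suc k) * dt - real k * dt = dt" by (simp add: algebra_simps)
      have "\<bar>m (real (Suc k) * dt) - m (real k * dt)\<bar> \<le> (real (Suc k) * dt - real k * dt) * \<omega> (real k * dt) (real (Suc k) * dt)"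
        by (rule step) (use dt le in auto)
      then have "\<bar>m (real (Suc k) * dt) - m (real k * dt)\<bar> \<le> dt * \<omega> (real k * dt) (real (Suc k) * dt)" unfolding e .
      then show ?case using Suc by (simp add: distrib_left)
    qed simp
    from this[of n] have "\<bar>m t - m 0\<bar> \<le> dt * (\<Sum>j<n. \<omega> (real j * dt) (real (Suc j) * dt))" using dt by simp
    also have "\<dots> \<le> dt * (2 * (LINT t|lebesgue_on {0<..<T}. sigma t))"
      using dt by (intro mult_left_mono window_sum_le sigma) auto
    finally show ?thesis by (simp add: dt_def)
  qed simp
  moreover have "(\<lambda>n. (t * (2 * (LINT t|lebesgue_on {0<..<T}. sigma t))) / real n) \<longlonglongrightarrow> 0" by (rule lim_const_over_n)
  ultimately have "\<bar>m t - m 0\<bar> \<le> 0" by (intro LIMSEQ_le_const) (auto intro!: exI[of _ 1])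
  then show ?thesis by (simp add: m_def)
qed

lemma \<omega>_square_sum:
  "\<exists>C\<ge>0. \<forall>dt>0. \<forall>m. (\<Sum>n<m. dt * (\<omega> (real n * dt) (real (Suc n) * dt))\<^sup>2) \<le> C * dt\<^sup>2"
proof -
  define I where "I = 2 * (LINT t|lebesgue_on {0<..<T}. (sigma t)\<^sup>2)"
  have "(\<Sum>n<m. dt * (\<omega> (real n * dt) (real (Suc n) * dt))\<^sup>2) \<le> I * dt\<^sup>2" if dt: "dt > 0" for dt m
  proof -
    have "(\<Sum>n<m. dt * (\<omega> (real n * dt) (real (Suc n) * dt))\<^sup>2) \<le>
      (\<Sum>n<m. dt * (dt * window T (\<lambda>t. (sigma t)\<^sup>2) (real n * dt) (real (Suc n) * dt)))"
    proof (intro sum_mono mult_left_mono)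
      fix n
      have "real (Suc n) * dt - real n * dt = dt" by (simp add: algebra_simps)
      then show "(\<omega> (real n * dt) (real (Suc n) * dt))\<^sup>2 \<le> dt * window T (\<lambda>t. (sigma t)\<^sup>2) (real n * dt) (real (Suc n) * dt)"
        using window_sq_le[OF sigma(1,2), of "real n * dt" "real (Suc n) * dt"] dt by simp
    qed (use dt in simp)
    also have "\<dots> = dt\<^sup>2 * (\<Sum>n<m. window T (\<lambda>t. (sigma t)\<^sup>2) (real n * dt) (real (Suc n) * dt))"
      by (simp add: sum_distrib_left power2_eq_square mult.assoc)
    also have "\<dots> \<le> dt\<^sup>2 * I" unfolding I_def by (intro mult_left_mono window_sum_le sigma dt) auto
    finally show ?thesis by (simp add: mult.commute)
  qed
  moreover have "I \<ge> 0" unfolding I_def by (simp add: integral_nonneg_AE)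
  ultimately show ?thesis by blast
qed

end

context diffusion_component
begin

text \<open>The test function enters through \<open>(-\<Delta>\<^sub>h)\<^sup>-\<^sup>1 v\<close>, so only the chemical potential itself remains.\<close>

lemma weak_time_step:
  "\<exists>C\<ge>0. \<forall>N h t1 s t2 v. N > 0 \<longrightarrow> h > 0 \<longrightarrow> real N * h = L \<longrightarrow> 0 \<le> t1 \<longrightarrow> t1 < s \<longrightarrow> s < t2 \<longrightarrow> t2 \<le> T \<longrightarrow> s \<in> S \<longrightarrow>
     grid_per N v \<longrightarrow> mean_zero N v \<longrightarrow>
     \<bar>grid_inner h N (\<lambda>i j. grid_interp h (U t2) i j - grid_interp h (U t1) i j) (inv_neg_lap_h h N v)
       + (t2 - t1) * M * grid_inner h N (grid_interp h (\<mu> s)) v\<bar>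
     \<le> (t2 - t1) * (C * (\<omega> t1 t2 + h\<^sup>2)) * norm_m1 h N v"
proof -
  obtain B where B: "B \<ge> 0" "\<And>s. s \<in> S \<Longrightarrow> Cb 4 B (\<mu> s)" using lap_mu_bounded by blast
  define C where "C = (1 + M * (2 * B)) * L * L"
  have "\<bar>grid_inner h N (\<lambda>i j. grid_interp h (U t2) i j - grid_interp h (U t1) i j) (inv_neg_lap_h h N v)
       + (t2 - t1) * M * grid_inner h N (grid_interp h (\<mu> s)) v\<bar>
     \<le> (t2 - t1) * (C * (\<omega> t1 t2 + h\<^sup>2)) * norm_m1 h N v"
    if N: "N > 0" "h > 0" "real N * h = L" and t: "0 \<le> t1" "t1 < s" "s < t2" "t2 \<le> T" "s \<in> S"
      and v: "grid_per N v" "mean_zero N v" for N h t1 s t2 v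
  proof -
    let ?\<psi> = "inv_neg_lap_h h N v" and ?P = "\<lambda>u. grid_interp h u"
    note \<psi> = inv_neg_lap_spec[OF v N(1,2)]
    have pm: "grid_per N (?P (\<mu> s))" by (rule grid_per_interp(1)[OF per_mu[OF t(5)] N(3)])
    have "grid_inner h N (lap_h h (?P (\<mu> s))) ?\<psi> = grid_inner h N (?P (\<mu> s)) (lap_h h ?\<psi>)"
      by (rule grid_inner_lap_swap[OF pm \<psi>(1)])
    also have "\<dots> = grid_inner h N (?P (\<mu> s)) (\<lambda>i j. - v i j)" by (rule grid_inner_cong) (simp_all add: \<psi>(3))
    finally have lp: "grid_inner h N (lap_h h (?P (\<mu> s))) ?\<psi> = - grid_inner h N (?P (\<mu> s)) v"
      by (simp add: grid_inner_minus_right)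
    let ?R = "\<lambda>i j. (?P (U t2) i j - ?P (U t1) i j) - ((t2 - t1) * M) * lap_h h (?P (\<mu> s)) i j"
    have R: "\<bar>?R i j\<bar> \<le> (t2 - t1) * \<omega> t1 t2 + ((t2 - t1) * M) * (2 * B * h\<^sup>2)" for i j
    proof -
      have 1: "\<bar>?P (U t2) i j - ?P (U t1) i j - (t2 - t1) * M * ?P (laplacian (\<mu> s)) i j\<bar> \<le> (t2 - t1) * \<omega> t1 t2"
        using time_difference[OF t(1-4) t(5)] by (simp only: grid_interp_def mult.assoc)
      have "\<bar>(t2 - t1) * M * (lap_h h (?P (\<mu> s)) i j - ?P (laplacian (\<mu> s)) i j)\<bar> \<le> ((t2 - t1) * M) * (2 * B * h\<^sup>2)"
        unfolding abs_mult[of "(t2 - t1) * M"]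
        using lap_h_consistent[OF B(2)[OF t(5)] N(2), of i j] t pos by (intro mult_mono) auto
      then show ?thesis using 1 unfolding right_diff_distrib by linarith
    qed
    have w0: "0 \<le> \<omega> t1 t2" by (rule \<omega>_nonneg)
    have eq: "grid_inner h N (\<lambda>i j. ?P (U t2) i j - ?P (U t1) i j) ?\<psi> + (t2 - t1) * M * grid_inner h N (?P (\<mu> s)) v = grid_inner h N ?R ?\<psi>"
      by (simp only: grid_inner_diff_left grid_inner_scale_left lp mult_minus_right diff_minus_eq_add)
    have "\<bar>grid_inner h N (\<lambda>i j. ?P (U t2) i j - ?P (U t1) i j) ?\<psi> + (t2 - t1) * M * grid_inner h N (?P (\<mu> s)) v\<bar>
      \<le> ((t2 - t1) * \<omega> t1 t2 + ((t2 - t1) * M) * (2 * B * h\<^sup>2)) * (real N * h) * grid_norm2 h N ?\<psi>"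
      unfolding eq by (rule grid_inner_sup_le[where r = ?R, OF _ N(2)]) (rule R)
    \<comment> \<open>Poincare for the potential of \<open>v\<close>, whose gradient norm is the
      H^(-1) norm of \<open>v\<close>.\<close>
    also have "\<dots> \<le> ((t2 - t1) * \<omega> t1 t2 + ((t2 - t1) * M) * (2 * B * h\<^sup>2)) * L * (L * norm_m1 h N v)"
      using Poincare_grid[OF \<psi>(2) N(2)] t pos B w0 unfolding N(3) norm_m1_eq[OF v N(1,2)]
      by (intro mult_left_mono) auto
    also have "\<dots> = (t2 - t1) * ((\<omega> t1 t2 + M * (2 * B) * h\<^sup>2) * L * L) * norm_m1 h N v"
      by (simp add: algebra_simps)
    also have "\<dots> \<le> (t2 - t1) * (C * (\<omega> t1 t2 + h\<^sup>2)) * norm_m1 h N v"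
    proof (intro mult_right_mono mult_left_mono norm_m1_nonneg v N)
      have "\<omega> t1 t2 + M * (2 * B) * h\<^sup>2 \<le> (1 + M * (2 * B)) * (\<omega> t1 t2 + h\<^sup>2)"
        using w0 B pos by (simp add: algebra_simps)
      then have "(\<omega> t1 t2 + M * (2 * B) * h\<^sup>2) * (L * L) \<le> (1 + M * (2 * B)) * (\<omega> t1 t2 + h\<^sup>2) * (L * L)"
        using pos by (intro mult_right_mono) auto
      then show "(\<omega> t1 t2 + M * (2 * B) * h\<^sup>2) * L * L \<le> C * (\<omega> t1 t2 + h\<^sup>2)" by (simp only: C_def mult_ac)
    qed (use t in auto)
    finally show ?thesis .
  qed
  moreover have "C \<ge> 0" using pos B by (simp add: C_def)
  ultimately show ?thesis by blast
qed

end

subsection \<open>Regularity of the chemical potentials\<close>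

lemma Cfam_laplacian:
  assumes "Cfam (Suc (Suc k)) S U"
  shows "Cfam k S (\<lambda>s. laplacian (U s))"
proof -
  have "Cfam k S (\<lambda>s z. pdx (pdx (U s)) z + pdy (pdy (U s)) z)"
    by (rule Cfam_add[OF Cfam_pdx[OF Cfam_pdx[OF assms]] Cfam_pdy[OF Cfam_pdy[OF assms]]])
  then show ?thesis by (rule Cfam_cong) (rule ext, rule laplacian_def[symmetric])
qed

lemma Cfam_divide_reg_grad_norm:
  assumes "\<delta> > 0" "Cfam k S W" "Cfam (Suc k) S U"
  shows "Cfam k S (\<lambda>s z. W s z / reg_grad_norm \<delta> (U s) z)"
proof -
  have "Cfam k S (\<lambda>s z. W s z * (1 / sqrt ((pdx (U s) z)\<^sup>2 + (pdy (U s) z)\<^sup>2 + \<delta>\<^sup>2)))"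
    by (rule Cfam_mult[OF assms(2) Cfam_rsqrt[OF assms(1) Cfam_pdx[OF assms(3)] Cfam_pdy[OF assms(3)]]])
  then show ?thesis by (simp only: reg_grad_norm_def times_divide_eq_right mult_1_right)
qed

text \<open>The root is written as its square divided by itself, so that the result on reciprocal
  roots covers it.\<close>

lemma Cfam_reg_grad_norm:
  assumes "\<delta> > 0" "Cfam (Suc k) S U"
  shows "Cfam k S (\<lambda>s. reg_grad_norm \<delta> (U s))"
proof -
  have "Cfam k S (\<lambda>s z. ((pdx (U s) z)\<^sup>2 + (pdy (U s) z)\<^sup>2 + \<delta>\<^sup>2) / reg_grad_norm \<delta> (U s) z)"
    by (rule Cfam_divide_reg_grad_norm[OF assms(1) _ assms(2)])
      (rule Cfam_add[OF Cfam_add[OF Cfam_power[OF Cfam_pdx[OF assms(2)]] Cfam_power[OF Cfam_pdy[OF assms(2)]]] Cfam_const])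
  then show ?thesis by (rule Cfam_cong) (rule ext, simp add: reg_grad_norm_def real_div_sqrt)
qed

lemma Cfam_flux:
  assumes "\<delta> > 0" "Cfam (Suc k) S U" "Cfam k S V"
  shows "Cfam k S (\<lambda>s z. V s z * pdx (U s) z / reg_grad_norm \<delta> (U s) z)"
    "Cfam k S (\<lambda>s z. V s z * pdy (U s) z / reg_grad_norm \<delta> (U s) z)"
  by (rule Cfam_divide_reg_grad_norm[OF assms(1) Cfam_mult[OF assms(3) Cfam_pdx[OF assms(2)]] assms(2)],
      rule Cfam_divide_reg_grad_norm[OF assms(1) Cfam_mult[OF assms(3) Cfam_pdy[OF assms(2)]] assms(2)])

text \<open>The bookkeeping behind the exponents 8 and 6: the biharmonic term takes four derivatives
  of the phase field and leaves the four that second-order accuracy of a discrete Laplacian of the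
  potential requires; the flux term needs five derivatives of the density.\<close>

lemma Cfam_mu_phi:
  assumes "\<delta> > 0" and U: "Cfam 8 S U" and V: "Cfam 6 S V"
  shows "Cfam 4 S (\<lambda>s. mu_phi \<alpha> \<epsilon> \<eta> \<delta> (U s) (V s))"
proof -
  have U': "Cfam (Suc 5) S U" "Cfam 4 S U" "Cfam (Suc (Suc 4)) S U" "Cfam (Suc (Suc (Suc (Suc 4)))) S U" and V': "Cfam 5 S V"
    by (rule Cfam_le[OF U], simp)+ (rule Cfam_le[OF V], simp)
  have five: "(5 :: nat) = Suc 4" by simp
  note F = Cfam_flux[OF assms(1) U'(1) V', unfolded five]
  have "Cfam 4 S (\<lambda>s z. (1/\<epsilon>) * ((U s z - 1/2) ^ 3 - (1/4) * (U s z - 1/2)) - (\<epsilon> + \<alpha>) * laplacian (U s) z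
      + \<eta>\<^sup>2 * laplacian (laplacian (U s)) z
      + \<alpha> * (pdx (\<lambda>w. V s w * pdx (U s) w / reg_grad_norm \<delta> (U s) w) z + pdy (\<lambda>w. V s w * pdy (U s) w / reg_grad_norm \<delta> (U s) w) z))"
    by (intro Cfam_add Cfam_diff Cfam_cmult Cfam_power Cfam_const U'(2) Cfam_laplacian[OF U'(3)]
        Cfam_laplacian[OF Cfam_laplacian[OF U'(4)]] Cfam_pdx[OF F(1)] Cfam_pdy[OF F(2)])
  then show ?thesis
    by (rule Cfam_cong) (rule ext, simp add: mu_phi_def divergence_def deriv_double_well)
qed

lemma Cfam_mu_rho:
  assumes "\<delta> > 0" and U: "Cfam 8 S U" and V: "Cfam 6 S V" and c: "c > 0" "\<And>s z. s \<in> S \<Longrightarrow> c \<le> V s z \<and> V s z \<le> 1 - c"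
  shows "Cfam 4 S (\<lambda>s. mu_rho \<alpha> \<beta> \<xi> \<delta> (U s) (V s))"
proof -
  have U': "Cfam (Suc 4) S U" and V': "Cfam 4 S V" "Cfam (Suc (Suc 4)) S V"
    by (rule Cfam_le[OF U], simp) (rule Cfam_le[OF V], simp)+
  have b: "c \<le> V s z" "V s z \<le> 1" "c \<le> 1 - V s z" "1 - V s z \<le> 1" if "s \<in> S" for s z
    using c(2)[OF that, of z] c(1) by auto
  have l: "Cfam 4 S (\<lambda>s z. ln (V s z))" "Cfam 4 S (\<lambda>s z. ln (1 - V s z))"
    by (rule Cfam_ln[OF c(1)], erule b, erule b, rule V')
      (rule Cfam_ln[OF c(1)], erule b, erule b, rule Cfam_diff[OF Cfam_const V'(1)])
  have "Cfam 4 S (\<lambda>s z. \<alpha> * V s z - \<alpha> * reg_grad_norm \<delta> (U s) z - \<xi> * laplacian (V s) z + \<beta> * (ln (V s z) - ln (1 - V s z)))"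
    by (intro Cfam_add Cfam_diff Cfam_cmult V'(1) l Cfam_reg_grad_norm[OF assms(1) U'] Cfam_laplacian[OF V'(2)])
  then show ?thesis
  proof (rule Cfam_cong)
    fix s assume s: "s \<in> S"
    have "0 < V s z" "V s z < 1" for z using b[OF s, of z] c(1) by linarith+
    then show "(\<lambda>z. \<alpha> * V s z - \<alpha> * reg_grad_norm \<delta> (U s) z - \<xi> * laplacian (V s) z + \<beta> * (ln (V s z) - ln (1 - V s z))) =
      mu_rho \<alpha> \<beta> \<xi> \<delta> (U s) (V s)"
      by (intro ext) (simp only: mu_rho_def deriv_mixing_entropy)
  qed
qed

lemma xy_periodic_laplacian: "xy_periodic L u \<Longrightarrow> xy_periodic L (laplacian u)"
  using xy_periodic_pd(1)[OF xy_periodic_pd(1)] xy_periodic_pd(2)[OF xy_periodic_pd(2)]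
  unfolding xy_periodic_def[of L "laplacian u"] laplacian_def by (simp add: xy_periodic_def)

lemma xy_periodic_flux:
  assumes "xy_periodic L u" "xy_periodic L v"
  shows "xy_periodic L (\<lambda>z. v z * pdx u z / reg_grad_norm \<delta> u z)" "xy_periodic L (\<lambda>z. v z * pdy u z / reg_grad_norm \<delta> u z)"
  using assms xy_periodic_pd[OF assms(1)] unfolding xy_periodic_def reg_grad_norm_def by simp_all

lemma xy_periodic_mu:
  assumes "xy_periodic L u" "xy_periodic L v"
  shows "xy_periodic L (mu_phi \<alpha> \<epsilon> \<eta> \<delta> u v)" "xy_periodic L (mu_rho \<alpha> \<beta> \<xi> \<delta> u v)"
  using assms xy_periodic_pd[OF assms(1)] xy_periodic_laplacian[OF assms(1)] xy_periodic_laplacian[OF assms(2)]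
    xy_periodic_laplacian[OF xy_periodic_laplacian[OF assms(1)]]
    xy_periodic_pd(1)[OF xy_periodic_flux(1)[OF assms, of \<delta>]] xy_periodic_pd(2)[OF xy_periodic_flux(2)[OF assms, of \<delta>]]
  unfolding xy_periodic_def mu_phi_def mu_rho_def divergence_def reg_grad_norm_def by simp_all

lemma periodic_cell:
  assumes "xy_periodic L u" "L > 0"
  shows "\<exists>w\<in>cbox (0, 0) (L, L). u z = u w"
proof -
  have p: "\<And>x y. u (x + L, y) = u (x, y)" "\<And>x y. u (x, y + L) = u (x, y)" using assms(1) by (auto simp: xy_periodic_def)
  obtain x y where z: "z = (x, y)" by (cases z)
  define m where "m = \<lfloor>x / L\<rfloor>"
  define n where "n = \<lfloor>y / L\<rfloor>"
  have "0 \<le> x - of_int m * L" "x - of_int m * L \<le> L" "0 \<le> y - of_int n * L" "y - of_int n * L \<le> L"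
    using floor_divide_lower[OF assms(2), of x] floor_divide_upper[OF assms(2), of x]
      floor_divide_lower[OF assms(2), of y] floor_divide_upper[OF assms(2), of y]
    by (auto simp: m_def n_def algebra_simps)
  moreover have "u (x - of_int m * L + of_int m * L, y - of_int n * L) = u (x - of_int m * L, y - of_int n * L)"
    by (rule periodic_int_shift[where f = "\<lambda>x. u (x, y - of_int n * L)"]) (rule p)
  moreover have "u (x, y - of_int n * L + of_int n * L) = u (x, y - of_int n * L)"
    by (rule periodic_int_shift[where f = "\<lambda>y. u (x, y)"]) (rule p)
  ultimately show ?thesis by (intro bexI[of _ "(x - of_int m * L, y - of_int n * L)"]) (auto simp: z cbox_Pair_iff)
qed

text \<open>The exceptional set has measure zero and cannot contain a nonempty open
  interval.\<close>

lemma AE_times_dense: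
  assumes "AE t in lebesgue_on {0<..<T}. P t" "0 \<le> a" "a < b" "b \<le> (T :: real)"
  shows "\<exists>s. P s \<and> a < s \<and> s < b"
proof (rule ccontr)
  assume "\<not> ?thesis"
  then have n: "\<And>s. a < s \<Longrightarrow> s < b \<Longrightarrow> \<not> P s" by blast
  have "AE t in lebesgue. t \<in> {0<..<T} \<longrightarrow> P t" using assms(1) by (subst (asm) AE_restrict_space_iff) auto
  then have "AE t in lebesgue. t \<notin> {a<..<b}" by (rule AE_mp) (rule AE_I2, use n assms in auto)
  then have "{a<..<b} \<in> null_sets lebesgue" by (subst AE_iff_null_sets) auto
  then have "negligible {a<..<b}" by (simp add: negligible_iff_null_sets)
  moreover have "{a<..<b} \<noteq> {}" using assms by simp
  ultimately show False using open_not_negligible[of "{a<..<b}"] by simp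
qed

text \<open>The minimum of \<open>V\<close> and \<open>1 - V\<close> is continuous in time and space
  and, by periodicity, attained on a compact set; the strict inequalities thereby become a uniform
  margin.\<close>

lemma strict_interior_bound:
  assumes H: "H2_C_per T L V" and "L > 0" "T > 0" and V: "\<And>t z. t \<in> {0..T} \<Longrightarrow> 0 < V t z \<and> V t z < 1"
  shows "\<exists>c>0. \<forall>t\<in>{0..T}. \<forall>z. c \<le> V t z \<and> V t z \<le> 1 - c"
proof -
  let ?K = "{0..T} \<times> cbox (0 :: real, 0 :: real) (L, L)"
  have c: "continuous_on ?K (\<lambda>(t, z). V t z)"
    by (rule continuous_on_subset[of "{0..T} \<times> UNIV"]) (use H in \<open>auto simp: H2_C_per_def\<close>)
  have c': "continuous_on ?K (\<lambda>p. min (case p of (t, z) \<Rightarrow> V t z) (1 - (case p of (t, z) \<Rightarrow> V t z)))"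
    by (intro continuous_on_min continuous_on_diff continuous_on_const c)
  have "compact ?K" by (intro compact_Times compact_cbox) simp
  moreover have "(0, (0, 0)) \<in> ?K" using assms by (simp add: cbox_Pair_iff)
  then have "?K \<noteq> {}" by blast
  ultimately obtain p where p: "p \<in> ?K" "\<And>q. q \<in> ?K \<Longrightarrow> min (case p of (t, z) \<Rightarrow> V t z) (1 - (case p of (t, z) \<Rightarrow> V t z))
      \<le> min (case q of (t, z) \<Rightarrow> V t z) (1 - (case q of (t, z) \<Rightarrow> V t z))"
    using continuous_attains_inf[OF _ _ c'] by blast
  obtain t0 z0 where p0: "p = (t0, z0)" "t0 \<in> {0..T}" using p(1) by auto
  define c0 where "c0 = min (V t0 z0) (1 - V t0 z0)"
  have "c0 > 0" using V[OF p0(2), of z0] by (simp add: c0_def)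
  moreover have "c0 \<le> V t z \<and> V t z \<le> 1 - c0" if t: "t \<in> {0..T}" for t z
  proof -
    have "xy_periodic L (V t)" using H t by (intro C_per_xy_periodic) (simp add: H2_C_per_def)
    then obtain w where w: "w \<in> cbox (0, 0) (L, L)" "V t z = V t w" using periodic_cell assms(2) by blast
    have "c0 \<le> min (V t w) (1 - V t w)" using p(2)[of "(t, w)"] t w(1) by (simp add: p0(1) c0_def)
    then show ?thesis by (simp add: w(2))
  qed
  ultimately show ?thesis by blast
qed

lemma xy_periodic_fourier_proj:
  assumes "L > 0"
  shows "xy_periodic L (fourier_proj L K u)"
proof -
  have "cis (2 * pi * (of_int k * (x + L) + of_int l * y) / L) = cis (2 * pi * (of_int k * x + of_int l * y) / L)"
    "cis (2 * pi * (of_int k * x + of_int l * (y + L)) / L) = cis (2 * pi * (of_int k * x + of_int l * y) / L)" for k l :: int and x y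
  proof -
    have e: "2 * pi * (of_int k * (x + L) + of_int l * y) / L = 2 * pi * (of_int k * x + of_int l * y) / L + 2 * pi * of_int k"
      "2 * pi * (of_int k * x + of_int l * (y + L)) / L = 2 * pi * (of_int k * x + of_int l * y) / L + 2 * pi * of_int l"
      using assms by (simp_all add: field_simps)
    have m: "cis (2 * pi * of_int m) = 1" for m :: int by (rule cis_multiple_2pi) simp
    show "cis (2 * pi * (of_int k * (x + L) + of_int l * y) / L) = cis (2 * pi * (of_int k * x + of_int l * y) / L)"
      "cis (2 * pi * (of_int k * x + of_int l * (y + L)) / L) = cis (2 * pi * (of_int k * x + of_int l * y) / L)"
      unfolding e cis_mult[symmetric] m by simp_all
  qed
  then show ?thesis by (simp add: xy_periodic_def fourier_proj_def fourier_mode_def)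
qed

subsection \<open>Reference grid functions and their consistency\<close>

lemma lap_h_tendsto:
  assumes "\<And>i j. (\<lambda>k. U k i j) \<longlonglongrightarrow> u i j"
  shows "(\<lambda>k. lap_h h (U k) i j) \<longlonglongrightarrow> lap_h h u i j"
proof (cases "h = 0")
  case False
  then show ?thesis unfolding lap_h_explicit
    by (intro tendsto_add tendsto_diff tendsto_divide tendsto_mult tendsto_const assms) simp_all
qed (simp add: lap_h_explicit)

lemma Dx_tendsto:
  assumes "\<And>i j. (\<lambda>k. U k i j) \<longlonglongrightarrow> u i j" "h \<noteq> 0"
  shows "(\<lambda>k. Dx h (U k) i j) \<longlonglongrightarrow> Dx h u i j" "(\<lambda>k. Dy h (U k) i j) \<longlonglongrightarrow> Dy h u i j"
  unfolding Dx_def Dy_def by (intro tendsto_diff tendsto_divide tendsto_const assms)+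

lemma avg_grad_norm_tendsto:
  assumes "\<And>i j. (\<lambda>k. U k i j) \<longlonglongrightarrow> u i j" "h \<noteq> 0"
  shows "(\<lambda>k. avg_grad_norm \<delta> h (U k) i j) \<longlonglongrightarrow> avg_grad_norm \<delta> h u i j"
  unfolding avg_grad_norm_def
  by (intro tendsto_real_sqrt tendsto_add tendsto_mult tendsto_power tendsto_const Dx_tendsto assms)

lemma mu_phi_h_tendsto:
  assumes U: "\<And>i j. (\<lambda>k. U k i j) \<longlonglongrightarrow> u i j" and R: "\<And>i j. (\<lambda>k. R k i j) \<longlonglongrightarrow> \<rho> i j" and h: "h \<noteq> 0" "\<delta> > 0"
  shows "(\<lambda>k. mu_phi_h \<alpha> \<epsilon> \<eta> \<delta> h f (U k) (R k) i j) \<longlonglongrightarrow> mu_phi_h \<alpha> \<epsilon> \<eta> \<delta> h f u \<rho> i j"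
proof -
  have nz: "avg_grad_norm \<delta> h u i j \<noteq> 0" for i j using avg_grad_norm_ge[OF h(2), of h u i j] h(2) by linarith
  have q: "(\<lambda>k. R k i j / avg_grad_norm \<delta> h (U k) i j) \<longlonglongrightarrow> \<rho> i j / avg_grad_norm \<delta> h u i j" for i j
    by (intro tendsto_divide R avg_grad_norm_tendsto U h nz)
  have d: "(\<lambda>k. div_h h (edge_mult (edge_avg (\<lambda>i j. R k i j / avg_grad_norm \<delta> h (U k) i j)) (grad_h h (U k))) i j)
    \<longlonglongrightarrow> div_h h (edge_mult (edge_avg (\<lambda>i j. \<rho> i j / avg_grad_norm \<delta> h u i j)) (grad_h h u)) i j"
    unfolding div_h_def edge_mult_def edge_avg_def grad_h_def fst_conv snd_conv
    by (intro tendsto_add tendsto_diff tendsto_divide tendsto_mult tendsto_const q Dx_tendsto U h) simp_all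
  show ?thesis
    unfolding mu_phi_h_def
    by (intro tendsto_add tendsto_diff tendsto_mult tendsto_power tendsto_const U d lap_h_tendsto)
qed

lemma mu_rho_h_tendsto:
  assumes U: "\<And>i j. (\<lambda>k. U k i j) \<longlonglongrightarrow> u i j" and R: "\<And>i j. (\<lambda>k. R k i j) \<longlonglongrightarrow> \<rho> i j" and h: "h \<noteq> 0"
    and \<rho>: "\<And>i j. 0 < \<rho> i j \<and> \<rho> i j < 1"
  shows "(\<lambda>k. mu_rho_h \<alpha> \<beta> \<xi> \<delta> h f (U k) (R k) i j) \<longlonglongrightarrow> mu_rho_h \<alpha> \<beta> \<xi> \<delta> h f u \<rho> i j"
  unfolding mu_rho_h_def
  by (intro tendsto_add tendsto_diff tendsto_mult tendsto_const R lap_h_tendsto avg_grad_norm_tendsto U h tendsto_ln)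
    (use \<rho>[of i j] in simp_all)

lemma grid_inner_tendsto:
  assumes "\<And>i j. (\<lambda>k. F k i j) \<longlonglongrightarrow> f i j"
  shows "(\<lambda>k. grid_inner h N (F k) v) \<longlonglongrightarrow> grid_inner h N f v"
  unfolding grid_inner_def by (intro tendsto_mult tendsto_sum tendsto_const assms)

text \<open>Both components share the set \<open>S\<close>, because each potential involves both
  fields at the same time; \<open>c0\<close> is the margin that keeps the exact density inside the
  unit interval.\<close>

locale surfactant_solution =
  fixes \<alpha> \<beta> \<epsilon> \<eta> \<xi> \<delta> M T L :: real and \<Phi> \<Psi> :: "real \<Rightarrow> real \<times> real \<Rightarrow> real" and S :: "real set" and c0 :: real
  assumes par: "\<alpha> > 0" "\<beta> > 0" "\<epsilon> > 0" "\<eta> > 0" "\<xi> > 0" "\<delta> > 0"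
    and comp: "diffusion_component T L M 8 \<Phi> (\<lambda>s. mu_phi \<alpha> \<epsilon> \<eta> \<delta> (\<Phi> s) (\<Psi> s)) S"
      "diffusion_component T L M 6 \<Psi> (\<lambda>s. mu_rho \<alpha> \<beta> \<xi> \<delta> (\<Phi> s) (\<Psi> s)) S"
    and c0: "c0 > 0" "\<And>t z. t \<in> {0..T} \<Longrightarrow> c0 \<le> \<Psi> t z \<and> \<Psi> t z \<le> 1 - c0"
begin

sublocale phi: diffusion_component T L M 8 \<Phi> "\<lambda>s. mu_phi \<alpha> \<epsilon> \<eta> \<delta> (\<Phi> s) (\<Psi> s)" S by (rule comp(1))
sublocale psi: diffusion_component T L M 6 \<Psi> "\<lambda>s. mu_rho \<alpha> \<beta> \<xi> \<delta> (\<Phi> s) (\<Psi> s)" S by (rule comp(2))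

abbreviation (input) NN :: "nat \<Rightarrow> nat" where "NN K \<equiv> 2 * K + 1"
abbreviation (input) hh :: "nat \<Rightarrow> real" where "hh K \<equiv> L / real (2 * K + 1)"

text \<open>A constant shift is invisible to every difference operator; it enters only the
  polynomial terms of the potential.\<close>

definition ref_phi :: "nat \<Rightarrow> real \<Rightarrow> grid_fun" where
  "ref_phi K t i j = grid_interp (hh K) (\<Phi> t) i j - (gmean (NN K) (grid_interp (hh K) (\<Phi> t)) - phi.mass)"

text \<open>The factor \<open>a\<close> will be \<open>1\<close> on fine grids and \<open>0\<close> on coarse ones, which keeps the values inside \<open>(0, 1)\<close>.\<close>

definition ref_rho :: "real \<Rightarrow> nat \<Rightarrow> real \<Rightarrow> grid_fun" where
  "ref_rho a K t i j = psi.mass + a * (grid_interp (hh K) (\<Psi> t) i j - gmean (NN K) (grid_interp (hh K) (\<Psi> t)))"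

lemma hh: "hh K > 0" "real (NN K) * hh K = L" "hh K \<le> L"
  using phi.pos by (simp_all add: field_simps)

lemma gmean_ref_phi: "gmean (NN K) (ref_phi K t) = phi.mass"
  unfolding ref_phi_def by (simp add: gmean_diff gmean_const del: of_nat_Suc of_nat_add)

lemma gmean_ref_rho: "gmean (NN K) (ref_rho a K t) = psi.mass"
  unfolding ref_rho_def by (simp add: gmean_add gmean_scale gmean_diff gmean_const del: of_nat_Suc of_nat_add)

lemma grid_per_ref:
  assumes "t \<in> {0..T}"
  shows "grid_per (NN K) (ref_phi K t)" "grid_per (NN K) (ref_rho a K t)"
  unfolding ref_phi_def ref_rho_def
  by (intro grid_per_diff grid_per_add grid_per_scale grid_per_const grid_per_interp(1)[OF phi.per_U[OF assms] hh(2)]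
      grid_per_interp(1)[OF psi.per_U[OF assms] hh(2)])+

lemma ref_Lipschitz:
  "\<exists>C\<ge>0. \<forall>K a. 0 \<le> a \<longrightarrow> a \<le> 1 \<longrightarrow> (\<forall>t1\<in>{0..T}. \<forall>t2\<in>{0..T}. \<forall>i j.
     \<bar>ref_phi K t2 i j - ref_phi K t1 i j\<bar> \<le> C * \<bar>t2 - t1\<bar> \<and> \<bar>ref_rho a K t2 i j - ref_rho a K t1 i j\<bar> \<le> C * \<bar>t2 - t1\<bar>)"
proof -
  obtain C1 where C1: "C1 \<ge> 0" "\<And>t1 t2 z. t1 \<in> {0..T} \<Longrightarrow> t2 \<in> {0..T} \<Longrightarrow> \<bar>\<Phi> t2 z - \<Phi> t1 z\<bar> \<le> C1 * \<bar>t2 - t1\<bar>"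
    using phi.time_Lipschitz by blast
  obtain C2 where C2: "C2 \<ge> 0" "\<And>t1 t2 z. t1 \<in> {0..T} \<Longrightarrow> t2 \<in> {0..T} \<Longrightarrow> \<bar>\<Psi> t2 z - \<Psi> t1 z\<bar> \<le> C2 * \<bar>t2 - t1\<bar>"
    using psi.time_Lipschitz by blast
  have "\<bar>ref_phi K t2 i j - ref_phi K t1 i j\<bar> \<le> (2 * C1 + 2 * C2) * \<bar>t2 - t1\<bar>
      \<and> \<bar>ref_rho a K t2 i j - ref_rho a K t1 i j\<bar> \<le> (2 * C1 + 2 * C2) * \<bar>t2 - t1\<bar>"
    if a: "0 \<le> a" "a \<le> 1" and t: "t1 \<in> {0..T}" "t2 \<in> {0..T}" for K a t1 t2 i j
  proof -
    let ?P = "\<lambda>u. grid_interp (hh K) u" and ?g = "gmean (NN K)"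
    have p: "\<bar>?P (\<Phi> t2) i j - ?P (\<Phi> t1) i j\<bar> \<le> C1 * \<bar>t2 - t1\<bar>" "\<bar>?P (\<Psi> t2) i j - ?P (\<Psi> t1) i j\<bar> \<le> C2 * \<bar>t2 - t1\<bar>" for i j
      unfolding grid_interp_def by (rule C1(2)[OF t], rule C2(2)[OF t])
    have g: "\<bar>?g (?P (\<Phi> t2)) - ?g (?P (\<Phi> t1))\<bar> \<le> C1 * \<bar>t2 - t1\<bar>" "\<bar>?g (?P (\<Psi> t2)) - ?g (?P (\<Psi> t1))\<bar> \<le> C2 * \<bar>t2 - t1\<bar>"
      unfolding gmean_diff[symmetric] by (rule gmean_bound, simp, rule p)+
    have nn: "0 \<le> C1 * \<bar>t2 - t1\<bar>" "0 \<le> C2 * \<bar>t2 - t1\<bar>" using C1 C2 by simp_all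
    have e: "(2 * C1 + 2 * C2) * \<bar>t2 - t1\<bar> = 2 * (C1 * \<bar>t2 - t1\<bar>) + 2 * (C2 * \<bar>t2 - t1\<bar>)" by (simp add: algebra_simps)
    have 1: "\<bar>ref_phi K t2 i j - ref_phi K t1 i j\<bar> \<le> 2 * (C1 * \<bar>t2 - t1\<bar>)"
      unfolding ref_phi_def using p(1)[of i j] g(1) by linarith
    have "ref_rho a K t2 i j - ref_rho a K t1 i j = a * ((?P (\<Psi> t2) i j - ?P (\<Psi> t1) i j) - (?g (?P (\<Psi> t2)) - ?g (?P (\<Psi> t1))))"
      by (simp only: ref_rho_def) (simp add: algebra_simps)
    also have "\<bar>\<dots>\<bar> \<le> 1 * (2 * (C2 * \<bar>t2 - t1\<bar>))"
      unfolding abs_mult using a p(2)[of i j] g(2) by (intro mult_mono) auto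
    finally show ?thesis using 1 nn unfolding e by linarith
  qed
  then show ?thesis using C1 C2 by (intro exI[of _ "2 * C1 + 2 * C2"]) auto
qed

text \<open>The grid means of the initial density lie in this closed interval and converge to the
  mass.\<close>

lemma mass_bounds: "c0 \<le> psi.mass" "psi.mass \<le> 1 - c0"
proof -
  obtain C where C: "\<And>t K. t \<in> {0..T} \<Longrightarrow> \<bar>gmean (2 * K + 1) (grid_interp (hh K) (\<Psi> t)) - Re (fourier_coeff L (\<Psi> t) 0 0)\<bar>
    \<le> C * (hh K) ^ (6 - 3)" using psi.gmean_error by blast
  have t0: "0 \<in> {0..T}" using phi.pos by simp
  have g: "c0 \<le> gmean (NN K) (grid_interp (hh K) (\<Psi> 0))" "gmean (NN K) (grid_interp (hh K) (\<Psi> 0)) \<le> 1 - c0" for K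
    using gmean_mono[of "\<lambda>i j. c0" "grid_interp (hh K) (\<Psi> 0)" "NN K"] gmean_mono[of "grid_interp (hh K) (\<Psi> 0)" "\<lambda>i j. 1 - c0" "NN K"]
      c0(2)[OF t0] by (simp_all add: gmean_const grid_interp_def)
  have lim: "(\<lambda>K. C * (hh K) ^ (6 - 3)) \<longlonglongrightarrow> C * 0 ^ (6 - 3)" by (intro tendsto_intros mesh_tendsto_0)
  have "c0 - psi.mass \<le> C * (hh K) ^ (6 - 3)" "psi.mass - (1 - c0) \<le> C * (hh K) ^ (6 - 3)" for K
    using C[OF t0, of K] g[of K] by linarith+
  then have "c0 - psi.mass \<le> C * 0 ^ (6 - 3)" "psi.mass - (1 - c0) \<le> C * 0 ^ (6 - 3)"
    by (intro LIMSEQ_le_const[OF lim]; blast)+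
  then show "c0 \<le> psi.mass" "psi.mass \<le> 1 - c0" by simp_all
qed

text \<open>The mean correction can use up the margin only where \<open>C * h^3\<close> exceeds
  \<open>c0 / 2\<close>. On such coarse grids \<open>h^3\<close> is bounded from below, so the
  constant function with the right mass is an acceptable reference: its distance from the density,
  at most 1, is already of order \<open>h^3\<close>.\<close>

lemma ref_rho_properties:
  "\<exists>C\<ge>0. \<forall>K. \<exists>a. 0 \<le> a \<and> a \<le> 1 \<and> 1 - a \<le> C * (hh K) ^ 3 \<and> (\<forall>t\<in>{0..T}. \<forall>i j.
     c0 / 2 \<le> ref_rho a K t i j \<and> ref_rho a K t i j \<le> 1 - c0 / 2 \<and> \<bar>ref_rho a K t i j - grid_interp (hh K) (\<Psi> t) i j\<bar> \<le> C * (hh K) ^ 3)"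
proof -
  obtain C where C: "C \<ge> 0" "\<And>t K. t \<in> {0..T} \<Longrightarrow> \<bar>gmean (2 * K + 1) (grid_interp (hh K) (\<Psi> t)) - Re (fourier_coeff L (\<Psi> t) 0 0)\<bar>
    \<le> C * (hh K) ^ (6 - 3)" using psi.gmean_error by blast
  \<comment> \<open>The first summand serves the coarse grids, the second the fine ones.\<close>
  define C' where "C' = 2 * C / c0 + C"
  have C': "C' \<ge> 0" using C c0 by (simp add: C'_def)
  have "\<exists>a. 0 \<le> a \<and> a \<le> 1 \<and> 1 - a \<le> C' * (hh K) ^ 3 \<and> (\<forall>t\<in>{0..T}. \<forall>i j.
     c0 / 2 \<le> ref_rho a K t i j \<and> ref_rho a K t i j \<le> 1 - c0 / 2 \<and> \<bar>ref_rho a K t i j - grid_interp (hh K) (\<Psi> t) i j\<bar> \<le> C' * (hh K) ^ 3)" for K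
  proof -
    have h3: "0 \<le> hh K ^ 3" using hh(1)[of K] by simp
    have Ch: "0 \<le> C * hh K ^ 3" using C h3 by simp
    have g: "\<bar>gmean (NN K) (grid_interp (hh K) (\<Psi> t)) - psi.mass\<bar> \<le> C * (hh K) ^ 3" if "t \<in> {0..T}" for t
      using C(2)[OF that, of K] psi.mass_conserved[OF that] by simp
    have p: "c0 \<le> grid_interp (hh K) (\<Psi> t) i j" "grid_interp (hh K) (\<Psi> t) i j \<le> 1 - c0" if "t \<in> {0..T}" for t i j
      using c0(2)[OF that] by (simp_all add: grid_interp_def)
    show ?thesis
    proof (cases "C * (hh K) ^ 3 \<le> c0 / 2")
      case True
      have "C * hh K ^ 3 \<le> C' * hh K ^ 3" using h3 C c0 by (intro mult_right_mono) (auto simp: C'_def)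
      moreover have "0 \<le> C' * hh K ^ 3" using C' h3 by simp
      ultimately have "c0 / 2 \<le> ref_rho 1 K t i j \<and> ref_rho 1 K t i j \<le> 1 - c0 / 2 \<and> \<bar>ref_rho 1 K t i j - grid_interp (hh K) (\<Psi> t) i j\<bar> \<le> C' * (hh K) ^ 3"
        if "t \<in> {0..T}" for t i j
        unfolding ref_rho_def using g[OF that] p[OF that, of i j] True by (auto simp: abs_le_iff)
      then show ?thesis using \<open>0 \<le> C' * hh K ^ 3\<close> by (intro exI[of _ 1]) auto
    next
      case False
      then have "1 \<le> 2 * C / c0 * hh K ^ 3" using c0 by (simp add: field_simps)
      then have one: "1 \<le> C' * hh K ^ 3" using Ch by (simp add: C'_def distrib_right)
      have "c0 / 2 \<le> ref_rho 0 K t i j \<and> ref_rho 0 K t i j \<le> 1 - c0 / 2 \<and> \<bar>ref_rho 0 K t i j - grid_interp (hh K) (\<Psi> t) i j\<bar> \<le> C' * (hh K) ^ 3"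
        if "t \<in> {0..T}" for t i j
      proof -
        have "\<bar>psi.mass - grid_interp (hh K) (\<Psi> t) i j\<bar> \<le> 1"
          using mass_bounds p[OF that, of i j] c0(1) by linarith
        then show ?thesis using mass_bounds c0(1) one unfolding ref_rho_def by simp
      qed
      then show ?thesis using one by (intro exI[of _ 0]) auto
    qed
  qed
  then show ?thesis using C' by blast
qed

end

lemma Cfam_uniform:
  assumes "Cfam k S U"
  shows "\<exists>B\<ge>0. \<forall>s\<in>S. Cb k B (U s)"
proof -
  obtain B where B: "\<And>s. s \<in> S \<Longrightarrow> Cb k B (U s)" using assms unfolding Cfam_def by blast
  have "Cb k \<bar>B\<bar> (U s)" if "s \<in> S" for s by (rule Cb_mono[OF B[OF that]]) simp
  then show ?thesis by (intro exI[of _ "\<bar>B\<bar>"]) simp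
qed

lemma LIMSEQ_affine_bound:
  fixes x :: real
  assumes "X \<longlonglongrightarrow> x" "\<And>k. \<bar>a + b * X k\<bar> \<le> R"
  shows "\<bar>a + b * x\<bar> \<le> R"
proof (rule LIMSEQ_le_const2)
  show "(\<lambda>k. \<bar>a + b * X k\<bar>) \<longlonglongrightarrow> \<bar>a + b * x\<bar>" by (intro tendsto_intros assms(1))
qed (use assms(2) in blast)

context surfactant_solution
begin

text \<open>The bound on \<open>1 - a\<close> is included because the equation for the density will
  be multiplied by \<open>a\<close>, and the missing fraction of the potential then counts as
  truncation error.\<close>

definition admissible :: "real \<Rightarrow> nat \<Rightarrow> real \<Rightarrow> bool" where
  "admissible A K a \<longleftrightarrow> 0 \<le> a \<and> a \<le> 1 \<and> 1 - a \<le> A * (hh K) ^ 3 \<and> (\<forall>t\<in>{0..T}. \<forall>i j.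
     c0 / 2 \<le> ref_rho a K t i j \<and> ref_rho a K t i j \<le> 1 - c0 / 2 \<and> \<bar>ref_rho a K t i j - grid_interp (hh K) (\<Psi> t) i j\<bar> \<le> A * (hh K) ^ 3)"

text \<open>The truncation error of one step: the mesh, the variation over the step, and the
  integrals of the two second time derivatives. The integrals are well controlled only after
  summation of their squares, so the quantity has to depend on the step.\<close>

definition theta :: "nat \<Rightarrow> real \<Rightarrow> real \<Rightarrow> real" where
  "theta K t1 t2 = (hh K)\<^sup>2 + (t2 - t1) + phi.\<omega> t1 t2 + psi.\<omega> t1 t2"

lemma common_bound:
  "\<exists>B\<ge>0. \<forall>s\<in>S. Cb 4 B (\<Phi> s) \<and> Cb 4 B (laplacian (\<Phi> s)) \<and> Cb 2 B (\<lambda>z. (pdx (\<Phi> s) z)\<^sup>2) \<and> Cb 2 B (\<lambda>z. (pdy (\<Phi> s) z)\<^sup>2)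
    \<and> Cb 2 B (\<lambda>z. \<Psi> s z / reg_grad_norm \<delta> (\<Phi> s) z)
    \<and> Cb 3 B (\<lambda>z. \<Psi> s z * pdx (\<Phi> s) z / reg_grad_norm \<delta> (\<Phi> s) z)
    \<and> Cb 3 B (\<lambda>z. \<Psi> s z * pdy (\<Phi> s) z / reg_grad_norm \<delta> (\<Phi> s) z)
    \<and> Cb 4 B (\<Psi> s) \<and> Cb 4 B (laplacian (\<Psi> s)) \<and> Cb 4 B (mu_rho \<alpha> \<beta> \<xi> \<delta> (\<Phi> s) (\<Psi> s))"
proof -
  note U = phi.fam(1) and V = psi.fam(1)
  have U': "Cfam 4 S \<Phi>" "Cfam (Suc (Suc 4)) S \<Phi>" "Cfam (Suc 2) S \<Phi>" "Cfam (Suc 3) S \<Phi>" by (rule Cfam_le[OF U], simp)+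
  have V': "Cfam 4 S \<Psi>" "Cfam (Suc (Suc 4)) S \<Psi>" "Cfam 2 S \<Psi>" "Cfam 3 S \<Psi>" by (rule Cfam_le[OF V], simp)+
  obtain B1 where B1: "B1 \<ge> 0" "\<And>s. s \<in> S \<Longrightarrow> Cb 4 B1 (\<Phi> s)" using Cfam_uniform[OF U'(1)] by blast
  obtain B2 where B2: "B2 \<ge> 0" "\<And>s. s \<in> S \<Longrightarrow> Cb 4 B2 (laplacian (\<Phi> s))" using Cfam_uniform[OF Cfam_laplacian[OF U'(2)]] by blast
  obtain B3 where B3: "B3 \<ge> 0" "\<And>s. s \<in> S \<Longrightarrow> Cb 2 B3 (\<lambda>z. (pdx (\<Phi> s) z)\<^sup>2)" using Cfam_uniform[OF Cfam_power[OF Cfam_pdx[OF U'(3)]]] by blast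
  obtain B4 where B4: "B4 \<ge> 0" "\<And>s. s \<in> S \<Longrightarrow> Cb 2 B4 (\<lambda>z. (pdy (\<Phi> s) z)\<^sup>2)" using Cfam_uniform[OF Cfam_power[OF Cfam_pdy[OF U'(3)]]] by blast
  obtain B5 where B5: "B5 \<ge> 0" "\<And>s. s \<in> S \<Longrightarrow> Cb 2 B5 (\<lambda>z. \<Psi> s z / reg_grad_norm \<delta> (\<Phi> s) z)"
    using Cfam_uniform[OF Cfam_divide_reg_grad_norm[OF par(6) V'(3) U'(3)]] by blast
  obtain B6 where B6: "B6 \<ge> 0" "\<And>s. s \<in> S \<Longrightarrow> Cb 3 B6 (\<lambda>z. \<Psi> s z * pdx (\<Phi> s) z / reg_grad_norm \<delta> (\<Phi> s) z)"
    using Cfam_uniform[OF Cfam_flux(1)[OF par(6) U'(4) V'(4)]] by blast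
  obtain B7 where B7: "B7 \<ge> 0" "\<And>s. s \<in> S \<Longrightarrow> Cb 3 B7 (\<lambda>z. \<Psi> s z * pdy (\<Phi> s) z / reg_grad_norm \<delta> (\<Phi> s) z)"
    using Cfam_uniform[OF Cfam_flux(2)[OF par(6) U'(4) V'(4)]] by blast
  obtain B8 where B8: "B8 \<ge> 0" "\<And>s. s \<in> S \<Longrightarrow> Cb 4 B8 (\<Psi> s)" using Cfam_uniform[OF V'(1)] by blast
  obtain B9 where B9: "B9 \<ge> 0" "\<And>s. s \<in> S \<Longrightarrow> Cb 4 B9 (laplacian (\<Psi> s))" using Cfam_uniform[OF Cfam_laplacian[OF V'(2)]] by blast
  obtain B10 where B10: "B10 \<ge> 0" "\<And>s. s \<in> S \<Longrightarrow> Cb 4 B10 (mu_rho \<alpha> \<beta> \<xi> \<delta> (\<Phi> s) (\<Psi> s))" using psi.lap_mu_bounded by blast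
  define B where "B = B1 + B2 + B3 + B4 + B5 + B6 + B7 + B8 + B9 + B10"
  have le: "B1 \<le> B" "B2 \<le> B" "B3 \<le> B" "B4 \<le> B" "B5 \<le> B" "B6 \<le> B" "B7 \<le> B" "B8 \<le> B" "B9 \<le> B" "B10 \<le> B" "0 \<le> B"
    unfolding B_def using B1(1) B2(1) B3(1) B4(1) B5(1) B6(1) B7(1) B8(1) B9(1) B10(1) by linarith+
  show ?thesis
    by (intro exI[of _ B] conjI ballI le(11) Cb_mono[OF B1(2) le(1)] Cb_mono[OF B2(2) le(2)] Cb_mono[OF B3(2) le(3)]
        Cb_mono[OF B4(2) le(4)] Cb_mono[OF B5(2) le(5)] Cb_mono[OF B6(2) le(6)] Cb_mono[OF B7(2) le(7)]
        Cb_mono[OF B8(2) le(8)] Cb_mono[OF B9(2) le(9)] Cb_mono[OF B10(2) le(10)])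
qed

text \<open>The end point \<open>t2\<close> need not be a good time; it is approached by good times
  from inside the step.\<close>

lemma good_times_left:
  assumes "0 \<le> t1" "t1 < t2" "t2 \<le> T"
  shows "\<exists>s. \<forall>k. s k \<in> S \<and> t1 < s k \<and> s k < t2 \<and> \<bar>s k - t2\<bar> \<le> inverse (real (Suc k))"
proof -
  have "\<exists>s. s \<in> S \<and> t1 < s \<and> s < t2 \<and> \<bar>s - t2\<bar> \<le> inverse (real (Suc k))" for k
  proof -
    have "0 < inverse (real (Suc k))" by simp
    then have "max t1 (t2 - inverse (real (Suc k))) < t2" "0 \<le> max t1 (t2 - inverse (real (Suc k)))" using assms by auto
    then obtain s where "s \<in> S" "max t1 (t2 - inverse (real (Suc k))) < s" "s < t2" using phi.S(2) assms(3) by blast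
    then show ?thesis by (intro exI[of _ s]) auto
  qed
  then show ?thesis by metis
qed

lemma ref_tendsto:
  assumes a: "0 \<le> a" "a \<le> 1" and t: "t \<in> {0..T}" and s: "\<And>k. s k \<in> S \<and> \<bar>s k - t\<bar> \<le> inverse (real (Suc k))"
  shows "(\<lambda>k. ref_phi K (s k) i j) \<longlonglongrightarrow> ref_phi K t i j" "(\<lambda>k. ref_rho a K (s k) i j) \<longlonglongrightarrow> ref_rho a K t i j"
proof -
  obtain C where C: "C \<ge> 0" "\<And>K t1 t2 i j. t1 \<in> {0..T} \<Longrightarrow> t2 \<in> {0..T} \<Longrightarrow>
     \<bar>ref_phi K t2 i j - ref_phi K t1 i j\<bar> \<le> C * \<bar>t2 - t1\<bar> \<and> \<bar>ref_rho a K t2 i j - ref_rho a K t1 i j\<bar> \<le> C * \<bar>t2 - t1\<bar>"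
    using ref_Lipschitz a by meson
  have sT: "s k \<in> {0..T}" for k using phi.S_in s by blast
  have lim: "(\<lambda>k. C * inverse (real (Suc k))) \<longlonglongrightarrow> 0"
    by (rule tendsto_mult_right_zero[OF LIMSEQ_inverse_real_of_nat])
  have cl: "C * \<bar>s k - t\<bar> \<le> C * inverse (real (Suc k))" for k using s C(1) by (intro mult_left_mono) auto
  have "norm (ref_phi K (s k) i j - ref_phi K t i j) \<le> C * inverse (real (Suc k))" for k
    using C(2)[OF t sT, of K k i j] cl[of k] unfolding real_norm_def by linarith
  then have "(\<lambda>k. ref_phi K (s k) i j - ref_phi K t i j) \<longlonglongrightarrow> 0" by (intro Lim_null_comparison[OF always_eventually lim]) blast
  then show "(\<lambda>k. ref_phi K (s k) i j) \<longlonglongrightarrow> ref_phi K t i j" by (rule LIM_zero_cancel)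
  have "norm (ref_rho a K (s k) i j - ref_rho a K t i j) \<le> C * inverse (real (Suc k))" for k
    using C(2)[OF t sT, of K k i j] cl[of k] unfolding real_norm_def by linarith
  then have "(\<lambda>k. ref_rho a K (s k) i j - ref_rho a K t i j) \<longlonglongrightarrow> 0" by (intro Lim_null_comparison[OF always_eventually lim]) blast
  then show "(\<lambda>k. ref_rho a K (s k) i j) \<longlonglongrightarrow> ref_rho a K t i j" by (rule LIM_zero_cancel)
qed

lemma mesh_powers: "hh K ^ 3 \<le> L * (hh K)\<^sup>2" "hh K ^ 5 \<le> L * hh K ^ 4" "hh K ^ 5 \<le> L ^ 3 * (hh K)\<^sup>2" "(hh K)\<^sup>2 \<le> L\<^sup>2"
proof -
  have h: "0 \<le> hh K" "hh K \<le> L" using hh[of K] by auto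
  have m: "hh K * x \<le> L * x" if "0 \<le> x" for x using h that by (intro mult_right_mono)
  show "hh K ^ 3 \<le> L * (hh K)\<^sup>2" "hh K ^ 5 \<le> L * hh K ^ 4"
    using m[of "(hh K)\<^sup>2"] m[of "hh K ^ 4"] h by (simp_all add: power_numeral_reduce)
  have "hh K ^ 3 * (hh K)\<^sup>2 \<le> L ^ 3 * (hh K)\<^sup>2" using h by (intro mult_right_mono power_mono) auto
  then show "hh K ^ 5 \<le> L ^ 3 * (hh K)\<^sup>2" by (simp add: power_add[symmetric])
  show "(hh K)\<^sup>2 \<le> L\<^sup>2" using h by (intro power_mono)
qed

text \<open>At a good time \<open>s\<close> inside the step the equation accounts for the time
  difference and \<open>mu_phi_h_consistent\<close> for the potential, with the explicit argument
  kept at \<open>t1\<close>. Only then does \<open>s\<close> tend to \<open>t2\<close>: on a fixed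
  grid the discrete potential is continuous, and the bound does not depend on
  \<open>s\<close>.\<close>

lemma phi_consistent:
  assumes A: "A \<ge> 0"
  shows "\<exists>C\<ge>0. \<forall>K a t1 t2. admissible A K a \<longrightarrow> 0 \<le> t1 \<longrightarrow> t1 < t2 \<longrightarrow> t2 \<le> T \<longrightarrow>
    consistent_phi \<alpha> \<epsilon> \<eta> \<delta> M (hh K) (NN K) (t2 - t1) (C * theta K t1 t2) (ref_phi K t1) (ref_phi K t2) (ref_rho a K t2)"
proof -
  obtain B where B: "B \<ge> 0" and reg: "\<And>s. s \<in> S \<Longrightarrow> Cb 4 B (\<Phi> s) \<and> Cb 4 B (laplacian (\<Phi> s)) \<and> Cb 2 B (\<lambda>z. (pdx (\<Phi> s) z)\<^sup>2) \<and> Cb 2 B (\<lambda>z. (pdy (\<Phi> s) z)\<^sup>2)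
    \<and> Cb 2 B (\<lambda>z. \<Psi> s z / reg_grad_norm \<delta> (\<Phi> s) z)
    \<and> Cb 3 B (\<lambda>z. \<Psi> s z * pdx (\<Phi> s) z / reg_grad_norm \<delta> (\<Phi> s) z)
    \<and> Cb 3 B (\<lambda>z. \<Psi> s z * pdy (\<Phi> s) z / reg_grad_norm \<delta> (\<Phi> s) z)
    \<and> Cb 4 B (\<Psi> s) \<and> Cb 4 B (laplacian (\<Psi> s)) \<and> Cb 4 B (mu_rho \<alpha> \<beta> \<xi> \<delta> (\<Phi> s) (\<Psi> s))"
    using common_bound by meson
  obtain C1 where C1: "C1 \<ge> 0" "\<And>N h t1 s t2 v. N > 0 \<Longrightarrow> h > 0 \<Longrightarrow> real N * h = L \<Longrightarrow> 0 \<le> t1 \<Longrightarrow> t1 < s \<Longrightarrow> s < t2 \<Longrightarrow> t2 \<le> T \<Longrightarrow> s \<in> S \<Longrightarrow>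
     grid_per N v \<Longrightarrow> mean_zero N v \<Longrightarrow>
     \<bar>grid_inner h N (\<lambda>i j. grid_interp h (\<Phi> t2) i j - grid_interp h (\<Phi> t1) i j) (inv_neg_lap_h h N v)
       + (t2 - t1) * M * grid_inner h N (grid_interp h (mu_phi \<alpha> \<epsilon> \<eta> \<delta> (\<Phi> s) (\<Psi> s))) v\<bar>
     \<le> (t2 - t1) * (C1 * (phi.\<omega> t1 t2 + h\<^sup>2)) * norm_m1 h N v"
    using phi.weak_time_step by meson
  obtain CL where CL: "CL \<ge> 0" "\<And>K a t1 t2 i j. 0 \<le> a \<Longrightarrow> a \<le> 1 \<Longrightarrow> t1 \<in> {0..T} \<Longrightarrow> t2 \<in> {0..T} \<Longrightarrow>
     \<bar>ref_phi K t2 i j - ref_phi K t1 i j\<bar> \<le> CL * \<bar>t2 - t1\<bar> \<and> \<bar>ref_rho a K t2 i j - ref_rho a K t1 i j\<bar> \<le> CL * \<bar>t2 - t1\<bar>"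
    using ref_Lipschitz by meson
  obtain CG where CG: "CG \<ge> 0" "\<And>t K. t \<in> {0..T} \<Longrightarrow> \<bar>gmean (NN K) (grid_interp (hh K) (\<Phi> t)) - Re (fourier_coeff L (\<Phi> t) 0 0)\<bar>
    \<le> CG * (hh K) ^ (8 - 3)" using phi.gmean_error by meson
  \<comment> \<open>One summand each for the mesh, the mass correction of order \<open>h^5\<close>,
    the shift in time, and the deviation of the reference density.\<close>
  define Ck where "Ck = 1 + CG * L ^ 3 + CL + A * L"
  have L: "L > 0" "T > 0" "M > 0" using phi.pos by auto
  have Ck: "1 \<le> Ck" "CG * L ^ 3 \<le> Ck" "CL \<le> Ck" "A * L \<le> Ck" using CG(1) CL(1) A L by (simp_all add: Ck_def)
  have K0: "0 \<le> Ck * (L\<^sup>2 + T)" using Ck(1) L by simp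
  obtain C2 where C2: "C2 \<ge> 0" "\<forall>N h \<kappa> u \<psi> f c \<rho> v. N > 0 \<longrightarrow> h > 0 \<longrightarrow> real N * h = L \<longrightarrow> h\<^sup>2 \<le> \<kappa> \<longrightarrow> \<kappa> \<le> Ck * (L\<^sup>2 + T) \<longrightarrow>
    Cb 4 B u \<longrightarrow> Cb 4 B (laplacian u) \<longrightarrow> Cb 2 B (\<lambda>z. (pdx u z)\<^sup>2) \<longrightarrow> Cb 2 B (\<lambda>z. (pdy u z)\<^sup>2) \<longrightarrow>
    Cb 2 B (\<lambda>z. \<psi> z / reg_grad_norm \<delta> u z) \<longrightarrow>
    Cb 3 B (\<lambda>z. \<psi> z * pdx u z / reg_grad_norm \<delta> u z) \<longrightarrow> Cb 3 B (\<lambda>z. \<psi> z * pdy u z / reg_grad_norm \<delta> u z) \<longrightarrow>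
    (\<forall>z. \<bar>\<psi> z\<bar> \<le> 1) \<longrightarrow>
    grid_per N (grid_interp h u) \<longrightarrow> grid_per N f \<longrightarrow> grid_per N \<rho> \<longrightarrow> grid_per N v \<longrightarrow>
    grid_per N (edge_x h (\<lambda>z. \<psi> z * pdx u z / reg_grad_norm \<delta> u z)) \<longrightarrow>
    grid_per N (edge_y h (\<lambda>z. \<psi> z * pdy u z / reg_grad_norm \<delta> u z)) \<longrightarrow>
    grid_per N (grid_interp h (laplacian u)) \<longrightarrow>
    \<bar>c\<bar> \<le> \<kappa> \<longrightarrow> (\<forall>i j. \<bar>f i j - (grid_interp h u i j - c)\<bar> \<le> \<kappa>) \<longrightarrow>
    (\<forall>i j. \<bar>\<rho> i j - grid_interp h \<psi> i j\<bar> \<le> \<kappa>) \<longrightarrow>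
    \<bar>grid_inner h N (grid_interp h (mu_phi \<alpha> \<epsilon> \<eta> \<delta> u \<psi>)) v
      - grid_inner h N (mu_phi_h \<alpha> \<epsilon> \<eta> \<delta> h f (\<lambda>i j. grid_interp h u i j - c) \<rho>) v\<bar>
    \<le> C2 * \<kappa> * (grid_norm2 h N v + grad_norm2 h N v + grid_norm2 h N (lap_h h v))"
    using mu_phi_h_consistent[OF par(1,3,4,6) B L(1) K0] by (rule exE) (erule conjE, rule that)
  define C where "C = C1 + M * C2 * Ck * (L + 1)"
  have C: "C \<ge> 0" using C1(1) C2(1) Ck(1) L by (simp add: C_def)
  have main: "consistent_phi \<alpha> \<epsilon> \<eta> \<delta> M (hh K) (NN K) (t2 - t1) (C * theta K t1 t2) (ref_phi K t1) (ref_phi K t2) (ref_rho a K t2)"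
    if ad: "admissible A K a" and t: "0 \<le> t1" "t1 < t2" "t2 \<le> T" for K a t1 t2
    unfolding consistent_phi_def
  proof (intro allI impI)
    fix v assume v: "grid_per (NN K) v" "mean_zero (NN K) v"
    have a: "0 \<le> a" "a \<le> 1" using ad by (auto simp: admissible_def)
    define N where "N = NN K"
    define h where "h = hh K"
    have N: "N > 0" "h > 0" "real N * h = L" "h \<le> L" using hh[of K] by (simp_all add: N_def h_def)
    note mp = mesh_powers[of K, folded h_def]
    let ?P = "\<lambda>u. grid_interp h u" and ?i = "inv_neg_lap_h h N v"
    let ?c = "\<lambda>t. gmean N (?P (\<Phi> t)) - phi.mass"
    let ?G = "grid_norm2 h N v" and ?D = "grad_norm2 h N v" and ?W = "grid_norm2 h N (lap_h h v)" and ?m = "norm_m1 h N v"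
    define \<kappa> where "\<kappa> = Ck * (h\<^sup>2 + (t2 - t1))"
    have h2: "0 \<le> h\<^sup>2" by simp
    have sum_le: "x * h\<^sup>2 \<le> \<kappa>" "y * (t2 - t1) \<le> \<kappa>" if "x \<le> Ck" "y \<le> Ck" for x y
    proof -
      have "x * h\<^sup>2 \<le> Ck * h\<^sup>2" "y * (t2 - t1) \<le> Ck * (t2 - t1)" using that t by (auto intro: mult_right_mono)
      moreover have "0 \<le> Ck * h\<^sup>2" "0 \<le> Ck * (t2 - t1)" using Ck(1) t by auto
      ultimately show "x * h\<^sup>2 \<le> \<kappa>" "y * (t2 - t1) \<le> \<kappa>" unfolding \<kappa>_def distrib_left by linarith+
    qed
    have k1: "h\<^sup>2 \<le> \<kappa>" using sum_le(1)[OF Ck(1) Ck(1)] by simp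
    have k2: "\<kappa> \<le> Ck * (L\<^sup>2 + T)" unfolding \<kappa>_def using Ck(1) t mp(4) by (intro mult_left_mono) auto
    have ref_eq: "ref_phi K t = (\<lambda>i j. ?P (\<Phi> t) i j - ?c t)" for t by (intro ext) (simp only: ref_phi_def h_def N_def)
    have tT: "t1 \<in> {0..T}" "t2 \<in> {0..T}" using t by auto
    have per: "grid_per N (ref_phi K t)" "grid_per N (ref_rho a K t)" if "t \<in> {0..T}" for t
      unfolding N_def by (rule grid_per_ref[OF that])+
    have good: "\<bar>grid_inner h N (\<lambda>i j. ref_phi K t2 i j - ref_phi K t1 i j) ?i
        + ((t2 - t1) * M) * grid_inner h N (mu_phi_h \<alpha> \<epsilon> \<eta> \<delta> h (ref_phi K t1) (ref_phi K s) (ref_rho a K s)) v\<bar>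
      \<le> (t2 - t1) * (C * theta K t1 t2) * (?m + ?D + ?W)"
      if s: "s \<in> S" "t1 < s" "s < t2" for s
    proof -
      have sT: "s \<in> {0..T}" using phi.S_in s by blast
      have xp: "xy_periodic L (\<Phi> s)" "xy_periodic L (\<Psi> s)" using phi.per_U[OF sT] psi.per_U[OF sT] .
      have g: "\<bar>?c s\<bar> \<le> \<kappa>"
      proof -
        have "\<bar>?c s\<bar> \<le> CG * h ^ 5" using CG(2)[OF sT, of K] phi.mass_conserved[OF sT] by (simp add: h_def N_def)
        also have "\<dots> \<le> CG * (L ^ 3 * h\<^sup>2)" by (intro mult_left_mono mp CG(1))
        also have "\<dots> \<le> \<kappa>" using sum_le(1)[OF Ck(2) Ck(1)] by (simp add: mult.assoc)
        finally show ?thesis .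
      qed
      have lip: "\<bar>ref_phi K t1 i j - (?P (\<Phi> s) i j - ?c s)\<bar> \<le> \<kappa>" for i j
      proof -
        have "\<bar>ref_phi K t1 i j - ref_phi K s i j\<bar> \<le> CL * \<bar>t1 - s\<bar>" using CL(2)[OF a sT tT(1), of K i j] by blast
        also have "\<dots> \<le> CL * (t2 - t1)" using s CL(1) by (intro mult_left_mono) auto
        also have "\<dots> \<le> \<kappa>" by (rule sum_le(2)[OF Ck(1) Ck(3)])
        finally show ?thesis unfolding ref_eq[of s] .
      qed
      have rh: "\<bar>ref_rho a K s i j - ?P (\<Psi> s) i j\<bar> \<le> \<kappa>" for i j
      proof -
        have "\<bar>ref_rho a K s i j - ?P (\<Psi> s) i j\<bar> \<le> A * h ^ 3" using ad sT unfolding admissible_def h_def by blast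
        also have "\<dots> \<le> A * (L * h\<^sup>2)" by (intro mult_left_mono mp A)
        also have "\<dots> \<le> \<kappa>" using sum_le(1)[OF Ck(4) Ck(1)] by (simp add: mult.assoc)
        finally show ?thesis .
      qed
      have one: "\<bar>\<Psi> s z\<bar> \<le> 1" for z
      proof -
        show "\<bar>\<Psi> s z\<bar> \<le> 1" using c0(2)[OF sT, of z] c0(1) by linarith
      qed
      note r = reg[OF s(1)]
      have e2: "\<bar>grid_inner h N (?P (mu_phi \<alpha> \<epsilon> \<eta> \<delta> (\<Phi> s) (\<Psi> s))) v
          - grid_inner h N (mu_phi_h \<alpha> \<epsilon> \<eta> \<delta> h (ref_phi K t1) (ref_phi K s) (ref_rho a K s)) v\<bar> \<le> C2 * \<kappa> * (?G + ?D + ?W)"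
        unfolding ref_eq[of s]
        by (rule C2(2)[rule_format, OF N(1-3) k1 k2]; (use r in blast)?;
            (rule one grid_per_interp[OF xp(1) N(3)] per[OF tT(1)] per[OF sT] v[folded N_def]
              grid_per_interp(2)[OF xy_periodic_flux(1)[OF xp] N(3)] grid_per_interp(3)[OF xy_periodic_flux(2)[OF xp] N(3)]
              grid_per_interp(1)[OF xy_periodic_laplacian[OF xp(1)] N(3)] g)?; (rule lip rh)?)
      note e1 = C1(2)[OF N(1-3) t(1) s(2,3) t(3) s(1) v[folded N_def]]
      have z: "mean_zero N ?i" by (rule inv_neg_lap_spec(2)[OF v[folded N_def] N(1,2)])
      \<comment> \<open>The constants by which the references are shifted drop out, because the test
        function has mean zero.\<close>
      have "(\<lambda>i j. ref_phi K t2 i j - ref_phi K t1 i j) = (\<lambda>i j. (?P (\<Phi> t2) i j - ?P (\<Phi> t1) i j) - (?c t2 - ?c t1))"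
        by (intro ext) (simp add: ref_eq)
      then have inn: "grid_inner h N (\<lambda>i j. ref_phi K t2 i j - ref_phi K t1 i j) ?i = grid_inner h N (\<lambda>i j. ?P (\<Phi> t2) i j - ?P (\<Phi> t1) i j) ?i"
        by (simp only: grid_inner_diff_left[of h N "\<lambda>i j. ?P (\<Phi> t2) i j - ?P (\<Phi> t1) i j" "\<lambda>i j. ?c t2 - ?c t1"]
            grid_inner_const_mean_zero[OF z] diff_0_right)
      have dtM: "0 \<le> (t2 - t1) * M" using t L by simp
      let ?a = "grid_inner h N (?P (mu_phi \<alpha> \<epsilon> \<eta> \<delta> (\<Phi> s) (\<Psi> s))) v"
      let ?b = "grid_inner h N (mu_phi_h \<alpha> \<epsilon> \<eta> \<delta> h (ref_phi K t1) (ref_phi K s) (ref_rho a K s)) v"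
      have e3: "\<bar>((t2 - t1) * M) * ?a - ((t2 - t1) * M) * ?b\<bar> \<le> ((t2 - t1) * M) * (C2 * \<kappa> * (?G + ?D + ?W))"
        unfolding right_diff_distrib[symmetric] abs_mult[of "(t2 - t1) * M"] abs_of_nonneg[OF dtM] by (rule mult_left_mono[OF e2 dtM])
      have nn: "0 \<le> ?m" "0 \<le> ?D" "0 \<le> ?W" "0 \<le> ?G"
        using norm_m1_nonneg[OF v[folded N_def] N(1,2)] by (auto simp: grad_norm2_nonneg grid_norm2_nonneg)
      have G: "?G \<le> L * ?D" using Poincare_grid[OF v(2)[folded N_def] N(2)] unfolding N(3) .
      define th where "th = theta K t1 t2"
      have w: "0 \<le> phi.\<omega> t1 t2" "0 \<le> psi.\<omega> t1 t2" by (rule phi.\<omega>_nonneg, rule psi.\<omega>_nonneg)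
      have th: "phi.\<omega> t1 t2 + h\<^sup>2 \<le> th" "h\<^sup>2 + (t2 - t1) \<le> th" "0 \<le> th"
        unfolding th_def theta_def h_def[symmetric] using w t h2 by linarith+
      have "(t2 - t1) * (C1 * (phi.\<omega> t1 t2 + h\<^sup>2)) * ?m \<le> (t2 - t1) * (C1 * th) * (?m + ?D + ?W)"
        using t C1(1) th(1,2) nn w h2 by (intro mult_mono mult_left_mono mult_nonneg_nonneg th(3)) auto
      moreover have "((t2 - t1) * M) * (C2 * \<kappa> * (?G + ?D + ?W)) \<le> ((t2 - t1) * M) * (C2 * (Ck * th) * ((L + 1) * (?m + ?D + ?W)))"
      proof (intro mult_left_mono[OF _ dtM] mult_mono)
        show "\<kappa> \<le> Ck * th" unfolding \<kappa>_def using th Ck by (intro mult_left_mono) auto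
        have "0 \<le> L * ?m" "0 \<le> L * ?W" using nn L by auto
        then show "?G + ?D + ?W \<le> (L + 1) * (?m + ?D + ?W)" using G nn by (simp add: algebra_simps)
      qed (use C2(1) Ck th nn order_trans[OF h2 k1] in auto)
      moreover have "(t2 - t1) * (C1 * th) * (?m + ?D + ?W) + ((t2 - t1) * M) * (C2 * (Ck * th) * ((L + 1) * (?m + ?D + ?W)))
        = (t2 - t1) * (C * th) * (?m + ?D + ?W)" by (simp add: C_def algebra_simps)
      ultimately show ?thesis using e1 e3 unfolding inn th_def[symmetric] by linarith
    qed
    obtain s where s: "\<And>k. s k \<in> S \<and> t1 < s k \<and> s k < t2 \<and> \<bar>s k - t2\<bar> \<le> inverse (real (Suc k))"
      using good_times_left[OF t] by blast
    have lims: "(\<lambda>k. ref_phi K (s k) i j) \<longlonglongrightarrow> ref_phi K t2 i j" "(\<lambda>k. ref_rho a K (s k) i j) \<longlonglongrightarrow> ref_rho a K t2 i j" for i j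
      using ref_tendsto[OF a tT(2)] s by blast+
    have "(\<lambda>k. grid_inner h N (mu_phi_h \<alpha> \<epsilon> \<eta> \<delta> h (ref_phi K t1) (ref_phi K (s k)) (ref_rho a K (s k))) v)
      \<longlonglongrightarrow> grid_inner h N (mu_phi_h \<alpha> \<epsilon> \<eta> \<delta> h (ref_phi K t1) (ref_phi K t2) (ref_rho a K t2)) v"
      by (intro grid_inner_tendsto mu_phi_h_tendsto lims) (use N par in auto)
    from LIMSEQ_affine_bound[OF this, of _ "(t2 - t1) * M"] good s
    show "\<bar>grid_inner (hh K) (NN K) (\<lambda>i j. ref_phi K t2 i j - ref_phi K t1 i j) (inv_neg_lap_h (hh K) (NN K) v)
        + (t2 - t1) * M * grid_inner (hh K) (NN K) (mu_phi_h \<alpha> \<epsilon> \<eta> \<delta> (hh K) (ref_phi K t1) (ref_phi K t2) (ref_rho a K t2)) v\<bar>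
      \<le> (t2 - t1) * (C * theta K t1 t2) * (norm_m1 (hh K) (NN K) v + grad_norm2 (hh K) (NN K) v + grid_norm2 (hh K) (NN K) (lap_h (hh K) v))"
      unfolding h_def N_def by blast
  qed
  show ?thesis using C main by blast
qed

end

context surfactant_solution
begin

text \<open>The argument for the phase field with one change: the reference moves by
  \<open>a\<close> times the increment of the density, up to a constant, so the equation enters
  multiplied by \<open>a\<close>. The remaining \<open>1 - a\<close> times the potential is of order
  \<open>h^3\<close>.\<close>

lemma rho_consistent:
  assumes A: "A \<ge> 0"
  shows "\<exists>C\<ge>0. \<forall>K a t1 t2. admissible A K a \<longrightarrow> 0 \<le> t1 \<longrightarrow> t1 < t2 \<longrightarrow> t2 \<le> T \<longrightarrow>
    consistent_rho \<alpha> \<beta> \<xi> \<delta> M (hh K) (NN K) (t2 - t1) (C * theta K t1 t2) (ref_rho a K t1) (ref_phi K t2) (ref_rho a K t2)"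
proof -
  obtain B where B: "B \<ge> 0" and reg: "\<And>s. s \<in> S \<Longrightarrow> Cb 4 B (\<Phi> s) \<and> Cb 4 B (laplacian (\<Phi> s)) \<and> Cb 2 B (\<lambda>z. (pdx (\<Phi> s) z)\<^sup>2) \<and> Cb 2 B (\<lambda>z. (pdy (\<Phi> s) z)\<^sup>2)
    \<and> Cb 2 B (\<lambda>z. \<Psi> s z / reg_grad_norm \<delta> (\<Phi> s) z)
    \<and> Cb 3 B (\<lambda>z. \<Psi> s z * pdx (\<Phi> s) z / reg_grad_norm \<delta> (\<Phi> s) z)
    \<and> Cb 3 B (\<lambda>z. \<Psi> s z * pdy (\<Phi> s) z / reg_grad_norm \<delta> (\<Phi> s) z)
    \<and> Cb 4 B (\<Psi> s) \<and> Cb 4 B (laplacian (\<Psi> s)) \<and> Cb 4 B (mu_rho \<alpha> \<beta> \<xi> \<delta> (\<Phi> s) (\<Psi> s))"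
    using common_bound by meson
  obtain C1 where C1: "C1 \<ge> 0" "\<And>N h t1 s t2 v. N > 0 \<Longrightarrow> h > 0 \<Longrightarrow> real N * h = L \<Longrightarrow> 0 \<le> t1 \<Longrightarrow> t1 < s \<Longrightarrow> s < t2 \<Longrightarrow> t2 \<le> T \<Longrightarrow> s \<in> S \<Longrightarrow>
     grid_per N v \<Longrightarrow> mean_zero N v \<Longrightarrow>
     \<bar>grid_inner h N (\<lambda>i j. grid_interp h (\<Psi> t2) i j - grid_interp h (\<Psi> t1) i j) (inv_neg_lap_h h N v)
       + (t2 - t1) * M * grid_inner h N (grid_interp h (mu_rho \<alpha> \<beta> \<xi> \<delta> (\<Phi> s) (\<Psi> s))) v\<bar>
     \<le> (t2 - t1) * (C1 * (psi.\<omega> t1 t2 + h\<^sup>2)) * norm_m1 h N v"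
    using psi.weak_time_step by meson
  obtain CL where CL: "CL \<ge> 0" "\<And>K a t1 t2 i j. 0 \<le> a \<Longrightarrow> a \<le> 1 \<Longrightarrow> t1 \<in> {0..T} \<Longrightarrow> t2 \<in> {0..T} \<Longrightarrow>
     \<bar>ref_phi K t2 i j - ref_phi K t1 i j\<bar> \<le> CL * \<bar>t2 - t1\<bar> \<and> \<bar>ref_rho a K t2 i j - ref_rho a K t1 i j\<bar> \<le> CL * \<bar>t2 - t1\<bar>"
    using ref_Lipschitz by meson
  \<comment> \<open>In this order: distance of the reference from the density, shift in time,
    discrete Laplacian with its factor \<open>a\<close>, regularised norm.\<close>
  define Ck where "Ck = A * L + CL + (2 * B + A * L * B) + (2 * B\<^sup>2 + B) / \<delta>"
  have L: "L > 0" "T > 0" "M > 0" using phi.pos by auto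
  have nnk: "0 \<le> A * L" "0 \<le> A * L * B" "0 \<le> (2 * B\<^sup>2 + B) / \<delta>" using A L B par by auto
  have Ck: "A * L \<le> Ck" "CL \<le> Ck" "2 * B + A * L * B \<le> Ck" "(2 * B\<^sup>2 + B) / \<delta> \<le> Ck" "0 \<le> Ck"
    unfolding Ck_def using nnk CL(1) B by linarith+
  define C3 where "C3 = 3 * \<alpha> + \<xi> + 2 * \<beta> / (c0 / 2)"
  have C3: "C3 \<ge> 0" using par c0(1) by (simp add: C3_def)
  define Cr where "Cr = C3 * Ck + A * L * B"
  have Cr: "Cr \<ge> 0" using C3 Ck(5) nnk by (simp add: Cr_def)
  define C where "C = C1 + M * Cr * L * L"
  have C: "C \<ge> 0" using C1(1) Cr L by (simp add: C_def)
  have main: "consistent_rho \<alpha> \<beta> \<xi> \<delta> M (hh K) (NN K) (t2 - t1) (C * theta K t1 t2) (ref_rho a K t1) (ref_phi K t2) (ref_rho a K t2)"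
    if ad: "admissible A K a" and t: "0 \<le> t1" "t1 < t2" "t2 \<le> T" for K a t1 t2
    unfolding consistent_rho_def
  proof (intro allI impI)
    fix v assume v: "grid_per (NN K) v" "mean_zero (NN K) v"
    define N where "N = NN K"
    define h where "h = hh K"
    have N: "N > 0" "h > 0" "real N * h = L" "h \<le> L" using hh[of K] by (simp_all add: N_def h_def)
    have a: "0 \<le> a" "a \<le> 1" "1 - a \<le> A * h ^ 3" using ad by (auto simp: admissible_def h_def)
    note mp = mesh_powers[of K, folded h_def]
    have h3: "A * h ^ 3 \<le> (A * L) * h\<^sup>2" unfolding mult.assoc by (intro mult_left_mono mp A)
    have a3: "1 - a \<le> (A * L) * h\<^sup>2" using a(3) h3 by linarith
    let ?P = "\<lambda>u. grid_interp h u" and ?i = "inv_neg_lap_h h N v"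
    let ?c = "\<lambda>t. gmean N (?P (\<Psi> t))" and ?c' = "\<lambda>t. gmean N (?P (\<Phi> t)) - phi.mass"
    let ?G = "grid_norm2 h N v" and ?D = "grad_norm2 h N v" and ?m = "norm_m1 h N v"
    define \<kappa> where "\<kappa> = Ck * (h\<^sup>2 + (t2 - t1))"
    have h2: "0 \<le> h\<^sup>2" by simp
    have sum_le: "x * h\<^sup>2 \<le> \<kappa>" "x * (t2 - t1) \<le> \<kappa>" if "x \<le> Ck" for x
    proof -
      have "x * h\<^sup>2 \<le> Ck * h\<^sup>2" "x * (t2 - t1) \<le> Ck * (t2 - t1)" using that t by (auto intro: mult_right_mono)
      moreover have "0 \<le> Ck * h\<^sup>2" "0 \<le> Ck * (t2 - t1)" using Ck(5) t by auto
      ultimately show "x * h\<^sup>2 \<le> \<kappa>" "x * (t2 - t1) \<le> \<kappa>" unfolding \<kappa>_def distrib_left by linarith+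
    qed
    have ref_eq: "ref_rho a K t = (\<lambda>i j. a * ?P (\<Psi> t) i j - (a * ?c t - psi.mass))"
      "ref_phi K t = (\<lambda>i j. ?P (\<Phi> t) i j - ?c' t)" for t
      by (intro ext; simp only: ref_rho_def ref_phi_def h_def N_def; simp add: algebra_simps)+
    have tT: "t1 \<in> {0..T}" "t2 \<in> {0..T}" using t by auto
    have c2: "0 < c0 / 2" using c0(1) by simp
    have good: "\<bar>grid_inner h N (\<lambda>i j. ref_rho a K t2 i j - ref_rho a K t1 i j) ?i
        + ((t2 - t1) * M) * grid_inner h N (mu_rho_h \<alpha> \<beta> \<xi> \<delta> h (ref_rho a K t1) (ref_phi K s) (ref_rho a K s)) v\<bar>
      \<le> (t2 - t1) * (C * theta K t1 t2) * (?m + ?D)"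
      if s: "s \<in> S" "t1 < s" "s < t2" for s
    proof -
      have sT: "s \<in> {0..T}" using phi.S_in s by blast
      note r = reg[OF s(1)]
      have r': "Cb 4 B (\<Psi> s)" "Cb 3 B (\<Phi> s)" "Cb 2 B (\<lambda>z. (pdx (\<Phi> s) z)\<^sup>2)" "Cb 2 B (\<lambda>z. (pdy (\<Phi> s) z)\<^sup>2)"
        "Cb 4 B (laplacian (\<Psi> s))" "Cb 4 B (mu_rho \<alpha> \<beta> \<xi> \<delta> (\<Phi> s) (\<Psi> s))"
        using r Cb_le[of 4 B "\<Phi> s" 3] by auto
      let ?mu = "mu_rho \<alpha> \<beta> \<xi> \<delta> (\<Phi> s) (\<Psi> s)" and ?mh = "mu_rho_h \<alpha> \<beta> \<xi> \<delta> h (ref_rho a K t1) (ref_phi K s) (ref_rho a K s)"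
      have pw: "\<bar>?P ?mu i j - ?mh i j\<bar> \<le> C3 * \<kappa>" for i j
        unfolding C3_def
      proof (rule mu_rho_h_consistent[where p = "(of_int i - 1/2) * h" and q = "(of_int j - 1/2) * h", OF par(1,2,5) c2])
        let ?p = "(of_int i - 1/2) * h" and ?q = "(of_int j - 1/2) * h"
        show "c0 / 2 \<le> \<Psi> s (?p, ?q)" "\<Psi> s (?p, ?q) \<le> 1 - c0 / 2" using c0(2)[OF sT, of "(?p, ?q)"] c0(1) by linarith+
        show "c0 / 2 \<le> ref_rho a K s i j" "ref_rho a K s i j \<le> 1 - c0 / 2" using ad sT unfolding admissible_def by blast+
        have "\<bar>ref_rho a K s i j - ?P (\<Psi> s) i j\<bar> \<le> A * h ^ 3" using ad sT unfolding admissible_def h_def by blast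
        then show "\<bar>ref_rho a K s i j - \<Psi> s (?p, ?q)\<bar> \<le> \<kappa>" using h3 sum_le(1)[OF Ck(1)] by (simp add: grid_interp_def)
        have "\<bar>ref_rho a K t1 i j - ref_rho a K s i j\<bar> \<le> CL * \<bar>t1 - s\<bar>" using CL(2)[OF a(1,2) sT tT(1), of K i j] by blast
        also have "\<dots> \<le> CL * (t2 - t1)" using s CL(1) by (intro mult_left_mono) auto
        also have "\<dots> \<le> \<kappa>" by (rule sum_le(2)[OF Ck(2)])
        finally show "\<bar>ref_rho a K t1 i j - ref_rho a K s i j\<bar> \<le> \<kappa>" .
        have le: "lap_h h (ref_rho a K s) i j = a * lap_h h (?P (\<Psi> s)) i j"
          unfolding ref_eq(1) lap_h_minus_const lap_h_scale ..
        let ?X = "lap_h h (?P (\<Psi> s)) i j" and ?Y = "?P (laplacian (\<Psi> s)) i j"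
        have "\<bar>a * (?X - ?Y)\<bar> \<le> 1 * (2 * B * h\<^sup>2)"
          unfolding abs_mult using lap_h_consistent[OF r'(1) N(2), of i j] a by (intro mult_mono) auto
        moreover have "\<bar>(1 - a) * ?Y\<bar> \<le> ((A * L) * h\<^sup>2) * B"
          unfolding abs_mult using a a3 Cb_bound[OF r'(5)] A L by (intro mult_mono) (auto simp: grid_interp_def)
        moreover have "2 * B * h\<^sup>2 + ((A * L) * h\<^sup>2) * B \<le> \<kappa>" using sum_le(1)[OF Ck(3)] by (simp add: algebra_simps)
        moreover have "a * ?X - ?Y = a * (?X - ?Y) - (1 - a) * ?Y" by (simp add: algebra_simps)
        ultimately have "\<bar>a * ?X - ?Y\<bar> \<le> \<kappa>" by linarith
        then show "\<bar>lap_h h (ref_rho a K s) i j - laplacian (\<Psi> s) (?p, ?q)\<bar> \<le> \<kappa>" unfolding le by (simp add: grid_interp_def)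
        have "\<bar>avg_grad_norm \<delta> h (?P (\<Phi> s)) i j - ?P (reg_grad_norm \<delta> (\<Phi> s)) i j\<bar> \<le> \<kappa>"
          using avg_grad_norm_consistent[OF r'(2-4) N(2) par(6), of i j] sum_le(1)[OF Ck(4)] by linarith
        then show "\<bar>avg_grad_norm \<delta> h (ref_phi K s) i j - reg_grad_norm \<delta> (\<Phi> s) (?p, ?q)\<bar> \<le> \<kappa>"
          unfolding ref_eq(2) avg_grad_norm_minus_const grid_interp_def[of h "reg_grad_norm \<delta> (\<Phi> s)"] .
      qed (rule refl)+
      define th where "th = theta K t1 t2"
      have w: "0 \<le> phi.\<omega> t1 t2" "0 \<le> psi.\<omega> t1 t2" by (rule phi.\<omega>_nonneg, rule psi.\<omega>_nonneg)
      have th: "psi.\<omega> t1 t2 + h\<^sup>2 \<le> th" "h\<^sup>2 + (t2 - t1) \<le> th" "h\<^sup>2 \<le> th" "0 \<le> th"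
        unfolding th_def theta_def h_def[symmetric] using w t h2 by linarith+
      \<comment> \<open>The discrete potential minus \<open>a\<close> times the exact one, arranged
        as a truncation error plus the fraction lost through the contraction.\<close>
      have R: "\<bar>(?mh i j - ?P ?mu i j) + (1 - a) * ?P ?mu i j\<bar> \<le> Cr * th" for i j
      proof -
        have "\<bar>(1 - a) * ?P ?mu i j\<bar> \<le> ((A * L) * h\<^sup>2) * B"
          unfolding abs_mult using a a3 Cb_bound[OF r'(6)] A L by (intro mult_mono) (auto simp: grid_interp_def)
        moreover have "((A * L) * h\<^sup>2) * B \<le> ((A * L) * th) * B" using nnk th B by (intro mult_right_mono mult_left_mono) auto
        moreover have "C3 * \<kappa> \<le> C3 * (Ck * th)" unfolding \<kappa>_def using C3 Ck(5) th by (intro mult_left_mono) auto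
        moreover have "C3 * (Ck * th) + ((A * L) * th) * B = Cr * th" by (simp add: Cr_def algebra_simps)
        ultimately show ?thesis using pw[of i j] by linarith
      qed
      let ?R = "\<lambda>i j. (?mh i j - ?P ?mu i j) + (1 - a) * ?P ?mu i j"
      have nn: "0 \<le> ?m" "0 \<le> ?D" "0 \<le> ?G"
        using norm_m1_nonneg[OF v[folded N_def] N(1,2)] by (auto simp: grad_norm2_nonneg grid_norm2_nonneg)
      have "\<bar>grid_inner h N ?R v\<bar> \<le> (Cr * th) * (real N * h) * ?G"
        by (rule grid_inner_sup_le[where r = ?R, OF _ N(2)]) (rule R)
      also have "\<dots> = (Cr * th) * L * ?G" by (simp only: N(3))
      also have "\<dots> \<le> (Cr * th) * L * (L * ?D)"
        using Poincare_grid[OF v(2)[folded N_def] N(2), unfolded N(3)] Cr th L by (intro mult_left_mono) auto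
      finally have e2: "\<bar>grid_inner h N ?R v\<bar> \<le> (Cr * th) * L * (L * ?D)" .
      note e1 = C1(2)[OF N(1-3) t(1) s(2,3) t(3) s(1) v[folded N_def]]
      have z: "mean_zero N ?i" by (rule inv_neg_lap_spec(2)[OF v[folded N_def] N(1,2)])
      have "(\<lambda>i j. ref_rho a K t2 i j - ref_rho a K t1 i j) = (\<lambda>i j. a * (?P (\<Psi> t2) i j - ?P (\<Psi> t1) i j) - a * (?c t2 - ?c t1))"
        by (intro ext) (simp add: ref_eq algebra_simps)
      then have inn: "grid_inner h N (\<lambda>i j. ref_rho a K t2 i j - ref_rho a K t1 i j) ?i = a * grid_inner h N (\<lambda>i j. ?P (\<Psi> t2) i j - ?P (\<Psi> t1) i j) ?i"
        by (simp only: grid_inner_diff_left[of h N "\<lambda>i j. a * (?P (\<Psi> t2) i j - ?P (\<Psi> t1) i j)" "\<lambda>i j. a * (?c t2 - ?c t1)"]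
            grid_inner_const_mean_zero[OF z] diff_0_right grid_inner_scale_left)
      have RR: "grid_inner h N ?R v = grid_inner h N ?mh v - a * grid_inner h N (?P ?mu) v"
        by (simp add: grid_inner_add_left grid_inner_diff_left grid_inner_scale_left algebra_simps)
      define I where "I = grid_inner h N (\<lambda>i j. ?P (\<Psi> t2) i j - ?P (\<Psi> t1) i j) ?i"
      define m1 where "m1 = grid_inner h N (?P ?mu) v"
      define m2 where "m2 = grid_inner h N ?mh v"
      have "\<bar>a * (I + (t2 - t1) * M * m1)\<bar> \<le> 1 * ((t2 - t1) * (C1 * (psi.\<omega> t1 t2 + h\<^sup>2)) * ?m)"
        unfolding abs_mult[of a] I_def m1_def using a by (intro mult_mono e1) auto
      also have "\<dots> \<le> (t2 - t1) * (C1 * th) * ?m"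
        unfolding mult_1_left using t C1(1) th(1,2) nn by (intro mult_right_mono mult_left_mono) auto
      also have "\<dots> \<le> (t2 - t1) * (C1 * th) * (?m + ?D)"
        using t C1(1) nn th(4) by (intro mult_left_mono mult_nonneg_nonneg) auto
      finally have f1: "\<bar>a * (I + (t2 - t1) * M * m1)\<bar> \<le> (t2 - t1) * (C1 * th) * (?m + ?D)" .
      have "\<bar>((t2 - t1) * M) * (m2 - a * m1)\<bar> \<le> ((t2 - t1) * M) * ((Cr * th) * L * (L * ?D))"
        using e2[unfolded RR] t L unfolding abs_mult[of "(t2 - t1) * M"] m1_def m2_def by (intro mult_mono) auto
      also have "\<dots> \<le> ((t2 - t1) * M) * ((Cr * th) * L * (L * (?m + ?D)))"
        using t L Cr th(4) nn by (intro mult_left_mono mult_nonneg_nonneg) auto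
      finally have f2: "\<bar>((t2 - t1) * M) * (m2 - a * m1)\<bar> \<le> ((t2 - t1) * M) * ((Cr * th) * L * (L * (?m + ?D)))" .
      have "a * I + (t2 - t1) * M * m2 = a * (I + (t2 - t1) * M * m1) + ((t2 - t1) * M) * (m2 - a * m1)"
        by (simp add: algebra_simps)
      moreover have "(t2 - t1) * (C1 * th) * (?m + ?D) + ((t2 - t1) * M) * ((Cr * th) * L * (L * (?m + ?D))) = (t2 - t1) * (C * th) * (?m + ?D)"
        by (simp add: C_def algebra_simps)
      ultimately show ?thesis using f1 f2 unfolding inn th_def[symmetric] I_def[symmetric] m2_def[symmetric] by linarith
    qed
    obtain s where s: "\<And>k. s k \<in> S \<and> t1 < s k \<and> s k < t2 \<and> \<bar>s k - t2\<bar> \<le> inverse (real (Suc k))"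
      using good_times_left[OF t] by blast
    have lims: "(\<lambda>k. ref_phi K (s k) i j) \<longlonglongrightarrow> ref_phi K t2 i j" "(\<lambda>k. ref_rho a K (s k) i j) \<longlonglongrightarrow> ref_rho a K t2 i j" for i j
      using ref_tendsto[OF a(1,2) tT(2)] s by blast+
    have q: "0 < ref_rho a K t2 i j \<and> ref_rho a K t2 i j < 1" for i j
    proof -
      have "c0 / 2 \<le> ref_rho a K t2 i j" "ref_rho a K t2 i j \<le> 1 - c0 / 2" using ad tT(2) unfolding admissible_def by blast+
      then show ?thesis using c0(1) by linarith
    qed
    have "(\<lambda>k. grid_inner h N (mu_rho_h \<alpha> \<beta> \<xi> \<delta> h (ref_rho a K t1) (ref_phi K (s k)) (ref_rho a K (s k))) v)
      \<longlonglongrightarrow> grid_inner h N (mu_rho_h \<alpha> \<beta> \<xi> \<delta> h (ref_rho a K t1) (ref_phi K t2) (ref_rho a K t2)) v"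
      by (intro grid_inner_tendsto mu_rho_h_tendsto lims q) (use N in auto)
    from LIMSEQ_affine_bound[OF this, of _ "(t2 - t1) * M"] good s
    show "\<bar>grid_inner (hh K) (NN K) (\<lambda>i j. ref_rho a K t2 i j - ref_rho a K t1 i j) (inv_neg_lap_h (hh K) (NN K) v)
        + (t2 - t1) * M * grid_inner (hh K) (NN K) (mu_rho_h \<alpha> \<beta> \<xi> \<delta> (hh K) (ref_rho a K t1) (ref_phi K t2) (ref_rho a K t2)) v\<bar>
      \<le> (t2 - t1) * (C * theta K t1 t2) * (norm_m1 (hh K) (NN K) v + grad_norm2 (hh K) (NN K) v)"
      unfolding h_def N_def by blast
  qed
  show ?thesis using C main by blast
qed

end

subsection \<open>Error estimate\<close>

text \<open>Inverse estimates: a second difference of a function bounded by \<open>R\<close> is at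
  most \<open>4 * R / h^2\<close> in each direction, and the gradient follows by interpolation
  between the function and its Laplacian.\<close>

lemma grid_norms_le_sup:
  assumes h: "h > 0" "N > 0" "real N * h = L" and u: "grid_per N u" "mean_zero N u" and R: "\<And>i j. \<bar>u i j\<bar> \<le> R"
  shows "norm_m1 h N u \<le> L * (L * R)" "(grad_norm2 h N u)\<^sup>2 \<le> (L * R) * (8 * R / h\<^sup>2 * L)" "grid_norm2 h N (lap_h h u) \<le> 8 * R / h\<^sup>2 * L"
proof -
  have sup: "grid_norm2 h N w \<le> Q * L" if Q: "\<And>i j. \<bar>w i j\<bar> \<le> Q" for w Q
  proof (cases "grid_norm2 h N w = 0")
    case True
    have "0 \<le> Q" using Q[of 0 0] by linarith
    moreover have "0 \<le> L" using h by auto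
    ultimately show ?thesis using True by simp
  next
    case False
    then have "0 < grid_norm2 h N w" using grid_norm2_nonneg[of h N w] by linarith
    moreover have "grid_norm2 h N w * grid_norm2 h N w \<le> (Q * L) * grid_norm2 h N w"
      using grid_inner_sup_le[where r = w and v = w and N = N, OF Q h(1)] grid_norm2_sq[of h N w] h(3)
      by (simp add: power2_eq_square)
    ultimately show ?thesis by simp
  qed
  have u2: "grid_norm2 h N u \<le> L * R" using sup[of u R] R by (simp add: mult.commute)
  have "\<bar>lap_h h u i j\<bar> \<le> 8 * R / h\<^sup>2" for i j
  proof -
    have h2: "0 < h\<^sup>2" using h by simp
    have q: "\<bar>(x - 2 * y + z) / h\<^sup>2\<bar> \<le> 4 * R / h\<^sup>2" if "\<bar>x\<bar> \<le> R" "\<bar>y\<bar> \<le> R" "\<bar>z\<bar> \<le> R" for x y z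
    proof -
      have "\<bar>x - 2 * y + z\<bar> \<le> 4 * R" using that by linarith
      then show ?thesis using h2 by (simp add: divide_right_mono)
    qed
    have "\<bar>lap_h h u i j\<bar> \<le> 4 * R / h\<^sup>2 + 4 * R / h\<^sup>2"
      unfolding lap_h_explicit by (rule order_trans[OF abs_triangle_ineq]) (intro add_mono q R)
    then show ?thesis by simp
  qed
  then show l: "grid_norm2 h N (lap_h h u) \<le> 8 * R / h\<^sup>2 * L" by (rule sup)
  have L: "0 \<le> L" using h by auto
  show "norm_m1 h N u \<le> L * (L * R)"
    using norm_m1_le[OF u h(2,1)] mult_left_mono[OF u2 L] unfolding h(3) by linarith
  have "(grad_norm2 h N u)\<^sup>2 \<le> grid_norm2 h N u * grid_norm2 h N (lap_h h u)" by (rule grad_norm2_sq_interpolation[OF u(1)])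
  also have "\<dots> \<le> (L * R) * (8 * R / h\<^sup>2 * L)"
    using u2 l L order_trans[OF grid_norm2_nonneg u2] by (intro mult_mono grid_norm2_nonneg) auto
  finally show "(grad_norm2 h N u)\<^sup>2 \<le> (L * R) * (8 * R / h\<^sup>2 * L)" .
qed

text \<open>The exponents 4 and 3 are what the norms require: two differences of a quantity of size
  \<open>h^4\<close>, and one difference of a quantity of size \<open>h^3\<close>, are both of size
  \<open>h^2\<close>. Excess powers of \<open>h\<close> are bounded by powers of
  \<open>L\<close>.\<close>

lemma err_small:
  fixes \<epsilon> \<eta> \<xi> L c :: real
  assumes par: "\<epsilon> > 0" "\<xi> > 0" "L > 0" "c \<ge> 0"
  shows "\<exists>C\<ge>0. \<forall>h N e d. h > 0 \<longrightarrow> N > 0 \<longrightarrow> real N * h = L \<longrightarrow> h \<le> L \<longrightarrow> grid_per N e \<longrightarrow> grid_per N d \<longrightarrow> mean_zero N e \<longrightarrow> mean_zero N d \<longrightarrow>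
    (\<forall>i j. \<bar>e i j\<bar> \<le> c * h ^ 4) \<longrightarrow> (\<forall>i j. \<bar>d i j\<bar> \<le> c * h ^ 3) \<longrightarrow> err_low h N e d \<le> C * h ^ 4 \<and> err_high \<epsilon> \<eta> \<xi> h N e d \<le> C * h ^ 4"
proof -
  define Cl where "Cl = (L * (L * c))\<^sup>2 * (L ^ 4 + L\<^sup>2)"
  define Ch where "Ch = \<eta>\<^sup>2 * (8 * c * L)\<^sup>2 + \<epsilon> * (8 * (L * c)\<^sup>2 * L\<^sup>2) + \<xi> * (8 * (L * c)\<^sup>2)"
  have nn: "0 \<le> Cl" "0 \<le> Ch" using par by (simp_all add: Cl_def Ch_def)
  have "err_low h N e d \<le> (Cl + Ch) * h ^ 4 \<and> err_high \<epsilon> \<eta> \<xi> h N e d \<le> (Cl + Ch) * h ^ 4"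
    if h: "h > 0" "N > 0" "real N * h = L" "h \<le> L" and per: "grid_per N e" "grid_per N d" and mz: "mean_zero N e" "mean_zero N d"
      and e: "\<forall>i j. \<bar>e i j\<bar> \<le> c * h ^ 4" and d: "\<forall>i j. \<bar>d i j\<bar> \<le> c * h ^ 3" for h N e d
  proof -
    have eb: "\<bar>e i j\<bar> \<le> c * h ^ 4" for i j using e by blast
    have db: "\<bar>d i j\<bar> \<le> c * h ^ 3" for i j using d by blast
    note E = grid_norms_le_sup[OF h(1-3) per(1) mz(1) eb] and D = grid_norms_le_sup[OF h(1-3) per(2) mz(2) db]
    have hp: "0 \<le> h ^ 4" "h\<^sup>2 \<le> L\<^sup>2" "h ^ 4 \<le> L ^ 4" using h by (auto intro: power_mono)
    have "(norm_m1 h N e)\<^sup>2 \<le> (L * (L * (c * h ^ 4)))\<^sup>2" "(norm_m1 h N d)\<^sup>2 \<le> (L * (L * (c * h ^ 3)))\<^sup>2"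
      by (rule power_mono[OF E(1) norm_m1_nonneg[OF per(1) mz(1) h(2,1)]], rule power_mono[OF D(1) norm_m1_nonneg[OF per(2) mz(2) h(2,1)]])
    then have "err_low h N e d \<le> (L * (L * (c * h ^ 4)))\<^sup>2 + (L * (L * (c * h ^ 3)))\<^sup>2" unfolding err_low_def by linarith
    also have "\<dots> = (L * (L * c))\<^sup>2 * (h ^ 4 + h\<^sup>2) * h ^ 4" by (simp add: power_numeral_reduce algebra_simps)
    also have "\<dots> \<le> Cl * h ^ 4" unfolding Cl_def using hp by (intro mult_right_mono mult_left_mono add_mono) auto
    finally have low: "err_low h N e d \<le> Cl * h ^ 4" .
    have "(grid_norm2 h N (lap_h h e))\<^sup>2 \<le> (8 * (c * h ^ 4) / h\<^sup>2 * L)\<^sup>2" by (rule power_mono[OF E(3) grid_norm2_nonneg])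
    also have "8 * (c * h ^ 4) / h\<^sup>2 * L = (8 * c * L) * h\<^sup>2" using h(1) by (simp add: field_simps power_numeral_reduce)
    also have "((8 * c * L) * h\<^sup>2)\<^sup>2 = (8 * c * L)\<^sup>2 * h ^ 4" by (simp add: power_mult_distrib)
    finally have 1: "(grid_norm2 h N (lap_h h e))\<^sup>2 \<le> (8 * c * L)\<^sup>2 * h ^ 4" .
    have "(L * (c * h ^ 4)) * (8 * (c * h ^ 4) / h\<^sup>2 * L) = (8 * (L * c)\<^sup>2 * h\<^sup>2) * h ^ 4" using h(1) by (simp add: field_simps power_numeral_reduce)
    moreover have "\<dots> \<le> (8 * (L * c)\<^sup>2 * L\<^sup>2) * h ^ 4" using hp by (intro mult_right_mono mult_left_mono) auto
    ultimately have 2: "(grad_norm2 h N e)\<^sup>2 \<le> (8 * (L * c)\<^sup>2 * L\<^sup>2) * h ^ 4" using E(2) by linarith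
    have "(L * (c * h ^ 3)) * (8 * (c * h ^ 3) / h\<^sup>2 * L) = (8 * (L * c)\<^sup>2) * h ^ 4" using h(1) by (simp add: field_simps power_numeral_reduce)
    then have 3: "(grad_norm2 h N d)\<^sup>2 \<le> (8 * (L * c)\<^sup>2) * h ^ 4" using D(2) by linarith
    have "err_high \<epsilon> \<eta> \<xi> h N e d \<le> \<eta>\<^sup>2 * ((8 * c * L)\<^sup>2 * h ^ 4) + \<epsilon> * ((8 * (L * c)\<^sup>2 * L\<^sup>2) * h ^ 4) + \<xi> * ((8 * (L * c)\<^sup>2) * h ^ 4)"
      unfolding err_high_def using 1 2 3 par by (intro add_mono mult_left_mono) auto
    also have "\<dots> = Ch * h ^ 4" by (simp add: Ch_def algebra_simps)
    finally have high: "err_high \<epsilon> \<eta> \<xi> h N e d \<le> Ch * h ^ 4" .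
    have "0 \<le> Cl * h ^ 4" "0 \<le> Ch * h ^ 4" using nn hp by auto
    then show ?thesis using low high unfolding distrib_right by linarith
  qed
  then show ?thesis using nn by (intro exI[of _ "Cl + Ch"]) auto
qed

text \<open>The parallelogram identity with the squared norm of the difference dropped.\<close>

lemma grid_norm_add_le:
  "(grid_norm2 h N (\<lambda>i j. f i j + g i j))\<^sup>2 \<le> 2 * (grid_norm2 h N f)\<^sup>2 + 2 * (grid_norm2 h N g)\<^sup>2"
  "(grad_norm2 h N (\<lambda>i j. f i j + g i j))\<^sup>2 \<le> 2 * (grad_norm2 h N f)\<^sup>2 + 2 * (grad_norm2 h N g)\<^sup>2"
  using grid_inner_self_nonneg[of h N "\<lambda>i j. f i j - g i j"] grad_inner_self_nonneg[of h N "\<lambda>i j. f i j - g i j"]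
  unfolding grid_norm2_sq grad_norm2_sq
  by (simp_all add: grid_inner_add_left grid_inner_add_right grid_inner_diff_left grid_inner_diff_right
      grad_inner_add_left grad_inner_add_right grad_inner_diff_left grad_inner_diff_right)

lemma norm_m1_add_le:
  assumes "grid_per N f" "mean_zero N f" "grid_per N g" "mean_zero N g" "N > 0" "h > 0"
  shows "(norm_m1 h N (\<lambda>i j. f i j + g i j))\<^sup>2 \<le> 2 * (norm_m1 h N f)\<^sup>2 + 2 * (norm_m1 h N g)\<^sup>2"
  unfolding norm_m1_eq[OF grid_per_add[OF assms(1,3)] mean_zero_add[OF assms(2,4)] assms(5,6)]
    norm_m1_eq[OF assms(1,2,5,6)] norm_m1_eq[OF assms(3,4,5,6)] inv_neg_lap_add[OF assms]
  by (rule grid_norm_add_le(2))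

lemma err_add_le:
  assumes "grid_per N e" "mean_zero N e" "grid_per N e'" "mean_zero N e'" "grid_per N d" "mean_zero N d" "grid_per N d'" "mean_zero N d'"
    and "N > 0" "h > 0" "\<epsilon> > 0" "\<xi> > 0"
  shows "err_low h N (\<lambda>i j. e i j + e' i j) (\<lambda>i j. d i j + d' i j) \<le> 2 * err_low h N e d + 2 * err_low h N e' d'"
    "err_high \<epsilon> \<eta> \<xi> h N (\<lambda>i j. e i j + e' i j) (\<lambda>i j. d i j + d' i j) \<le> 2 * err_high \<epsilon> \<eta> \<xi> h N e d + 2 * err_high \<epsilon> \<eta> \<xi> h N e' d'"
proof -
  show "err_low h N (\<lambda>i j. e i j + e' i j) (\<lambda>i j. d i j + d' i j) \<le> 2 * err_low h N e d + 2 * err_low h N e' d'"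
    unfolding err_low_def distrib_left
    by (rule order_trans[OF add_mono[OF norm_m1_add_le[OF assms(1-4,9,10)] norm_m1_add_le[OF assms(5-8,9,10)]]]) simp
  have "\<eta>\<^sup>2 * (grid_norm2 h N (\<lambda>i j. lap_h h e i j + lap_h h e' i j))\<^sup>2 \<le> \<eta>\<^sup>2 * (2 * (grid_norm2 h N (lap_h h e))\<^sup>2 + 2 * (grid_norm2 h N (lap_h h e'))\<^sup>2)"
    "\<epsilon> * (grad_norm2 h N (\<lambda>i j. e i j + e' i j))\<^sup>2 \<le> \<epsilon> * (2 * (grad_norm2 h N e)\<^sup>2 + 2 * (grad_norm2 h N e')\<^sup>2)"
    "\<xi> * (grad_norm2 h N (\<lambda>i j. d i j + d' i j))\<^sup>2 \<le> \<xi> * (2 * (grad_norm2 h N d)\<^sup>2 + 2 * (grad_norm2 h N d')\<^sup>2)"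
    using assms by (intro mult_left_mono grid_norm_add_le; simp)+
  then show "err_high \<epsilon> \<eta> \<xi> h N (\<lambda>i j. e i j + e' i j) (\<lambda>i j. d i j + d' i j) \<le> 2 * err_high \<epsilon> \<eta> \<xi> h N e d + 2 * err_high \<epsilon> \<eta> \<xi> h N e' d'"
    unfolding err_high_def lap_h_add by (simp add: algebra_simps)
qed

lemma err_nonneg: "0 \<le> err_low h N e d" "\<epsilon> > 0 \<Longrightarrow> \<xi> > 0 \<Longrightarrow> 0 \<le> err_high \<epsilon> \<eta> \<xi> h N e d"
  by (simp_all add: err_low_def err_high_def)

text \<open>Names the conclusion of \<open>step_estimate\<close>, whose constant depends on the
  parameters alone: it is obtained before the solution and then handed to a context in which the
  solution is fixed.\<close>

definition stability_constant :: "real \<Rightarrow> real \<Rightarrow> real \<Rightarrow> real \<Rightarrow> real \<Rightarrow> real \<Rightarrow> real \<Rightarrow> real \<Rightarrow> bool" where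
  "stability_constant \<alpha> \<beta> \<epsilon> \<eta> \<xi> \<delta> M C \<longleftrightarrow> C \<ge> 0 \<and> (\<forall>N h dt \<theta> p q f r p' q' f' r'.
     N > 0 \<longrightarrow> h > 0 \<longrightarrow> dt > 0 \<longrightarrow> \<theta> \<ge> 0 \<longrightarrow>
     grid_per N p \<longrightarrow> grid_per N q \<longrightarrow> grid_per N f \<longrightarrow> grid_per N r \<longrightarrow> grid_per N p' \<longrightarrow> grid_per N q' \<longrightarrow>
     mean_zero N (\<lambda>i j. p i j - f i j) \<longrightarrow> mean_zero N (\<lambda>i j. q i j - r i j) \<longrightarrow>
     mean_zero N (\<lambda>i j. p' i j - f' i j) \<longrightarrow> mean_zero N (\<lambda>i j. q' i j - r' i j) \<longrightarrow>
     (\<forall>i j. 0 < q' i j \<and> q' i j < 1) \<longrightarrow>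
     scheme_step \<alpha> \<beta> \<epsilon> \<eta> \<xi> \<delta> M h N dt f r f' r' \<longrightarrow>
     consistent_phi \<alpha> \<epsilon> \<eta> \<delta> M h N dt \<theta> p p' q' \<longrightarrow> consistent_rho \<alpha> \<beta> \<xi> \<delta> M h N dt \<theta> q p' q' \<longrightarrow>
     err_low h N (\<lambda>i j. p' i j - f' i j) (\<lambda>i j. q' i j - r' i j)
       + 3/2 * (dt * M * err_high \<epsilon> \<eta> \<xi> h N (\<lambda>i j. p' i j - f' i j) (\<lambda>i j. q' i j - r' i j))
     \<le> err_low h N (\<lambda>i j. p i j - f i j) (\<lambda>i j. q i j - r i j)
       + 1/2 * (dt * M * err_high \<epsilon> \<eta> \<xi> h N (\<lambda>i j. p i j - f i j) (\<lambda>i j. q i j - r i j))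
       + C * dt * (err_low h N (\<lambda>i j. p i j - f i j) (\<lambda>i j. q i j - r i j)
         + err_low h N (\<lambda>i j. p' i j - f' i j) (\<lambda>i j. q' i j - r' i j) + \<theta>\<^sup>2))"

text \<open>The increment of a step is a multiple of a discrete Laplacian, whose mean over a period
  vanishes.\<close>

lemma scheme_conserves_mass:
  assumes "scheme_step \<alpha> \<beta> \<epsilon> \<eta> \<xi> \<delta> M h N dt f r f' r'" "grid_per N f" "grid_per N r" "N > 0" "h > 0" "dt > 0"
  shows "gmean N f' = gmean N f" "gmean N r' = gmean N r"
proof -
  have per: "grid_per N f'" "grid_per N r'" using assms(1) by (auto simp: scheme_step_def)
  note g = mean_zero_lap[OF grid_per_mu_phi_h[OF assms(2) per], of h \<alpha> \<epsilon> \<eta> \<delta> h]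
    mean_zero_lap[OF grid_per_mu_rho_h[OF assms(3) per], of h \<alpha> \<beta> \<xi> \<delta> h]
  have z: "gmean N (lap_h h (mu_phi_h \<alpha> \<epsilon> \<eta> \<delta> h f f' r')) = 0" "gmean N (lap_h h (mu_rho_h \<alpha> \<beta> \<xi> \<delta> h r f' r')) = 0"
    using g assms(4,5) by (auto simp: mean_zero_gmean)
  have "(\<lambda>i j. f' i j - f i j) = (\<lambda>i j. (dt * M) * lap_h h (mu_phi_h \<alpha> \<epsilon> \<eta> \<delta> h f f' r') i j)"
    "(\<lambda>i j. r' i j - r i j) = (\<lambda>i j. (dt * M) * lap_h h (mu_rho_h \<alpha> \<beta> \<xi> \<delta> h r f' r') i j)"
    using assms(1,6) by (auto simp: scheme_step_def field_simps fun_eq_iff)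
  then have "gmean N (\<lambda>i j. f' i j - f i j) = 0" "gmean N (\<lambda>i j. r' i j - r i j) = 0"
    by (simp_all only: gmean_scale z mult_zero_right)
  then show "gmean N f' = gmean N f" "gmean N r' = gmean N r" by (simp_all add: gmean_diff)
qed

lemma consistent_mono:
  assumes "\<theta> \<le> \<theta>'" "dt > 0" "N > 0" "h > 0"
  shows "consistent_phi \<alpha> \<epsilon> \<eta> \<delta> M h N dt \<theta> p p' q' \<Longrightarrow> consistent_phi \<alpha> \<epsilon> \<eta> \<delta> M h N dt \<theta>' p p' q'"
    "consistent_rho \<alpha> \<beta> \<xi> \<delta> M h N dt \<theta> q p' q' \<Longrightarrow> consistent_rho \<alpha> \<beta> \<xi> \<delta> M h N dt \<theta>' q p' q'"
proof -
  have le: "dt * \<theta> * x \<le> dt * \<theta>' * x" if "0 \<le> x" for x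
    using assms that by (intro mult_right_mono mult_left_mono) auto
  have nn: "0 \<le> norm_m1 h N v + grad_norm2 h N v + grid_norm2 h N (lap_h h v)" "0 \<le> norm_m1 h N v + grad_norm2 h N v"
    if "grid_per N v" "mean_zero N v" for v
    using norm_m1_nonneg[OF that assms(3,4)] by (simp_all add: grad_norm2_nonneg grid_norm2_nonneg)
  show "consistent_phi \<alpha> \<epsilon> \<eta> \<delta> M h N dt \<theta> p p' q' \<Longrightarrow> consistent_phi \<alpha> \<epsilon> \<eta> \<delta> M h N dt \<theta>' p p' q'"
    unfolding consistent_phi_def by (intro allI impI, rule order_trans[OF _ le[OF nn(1)]]) blast+
  show "consistent_rho \<alpha> \<beta> \<xi> \<delta> M h N dt \<theta> q p' q' \<Longrightarrow> consistent_rho \<alpha> \<beta> \<xi> \<delta> M h N dt \<theta>' q p' q'"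
    unfolding consistent_rho_def by (intro allI impI, rule order_trans[OF _ le[OF nn(2)]]) blast+
qed

context surfactant_solution
begin

lemma proj_ref:
  assumes A: "A \<ge> 0"
  shows "\<exists>c\<ge>0. \<forall>K a t i j. admissible A K a \<longrightarrow> t \<in> {0..T} \<longrightarrow>
    \<bar>grid_interp (hh K) (fourier_proj L K (\<Phi> t)) i j - ref_phi K t i j\<bar> \<le> c * hh K ^ 4 \<and>
    \<bar>grid_interp (hh K) (fourier_proj L K (\<Psi> t)) i j - ref_rho a K t i j\<bar> \<le> c * hh K ^ 3"
proof -
  obtain C1 where C1: "C1 \<ge> 0" "\<And>t K z. t \<in> {0..T} \<Longrightarrow> \<bar>fourier_proj L K (\<Phi> t) z - \<Phi> t z\<bar> \<le> C1 * hh K ^ (8 - 3)"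
    using phi.proj_error by meson
  obtain C2 where C2: "C2 \<ge> 0" "\<And>t K z. t \<in> {0..T} \<Longrightarrow> \<bar>fourier_proj L K (\<Psi> t) z - \<Psi> t z\<bar> \<le> C2 * hh K ^ (6 - 3)"
    using psi.proj_error by meson
  obtain C3 where C3: "C3 \<ge> 0" "\<And>t K. t \<in> {0..T} \<Longrightarrow> \<bar>gmean (NN K) (grid_interp (hh K) (\<Phi> t)) - Re (fourier_coeff L (\<Phi> t) 0 0)\<bar>
    \<le> C3 * (hh K) ^ (8 - 3)" using phi.gmean_error by meson
  define c where "c = (C1 + C3) * L + (C2 + A)"
  have L: "L > 0" using phi.pos by simp
  have c: "(C1 + C3) * L \<le> c" "C2 + A \<le> c" "0 \<le> c" using C1(1) C2(1) C3(1) A L by (simp_all add: c_def)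
  have "\<bar>grid_interp (hh K) (fourier_proj L K (\<Phi> t)) i j - ref_phi K t i j\<bar> \<le> c * hh K ^ 4 \<and>
    \<bar>grid_interp (hh K) (fourier_proj L K (\<Psi> t)) i j - ref_rho a K t i j\<bar> \<le> c * hh K ^ 3"
    if ad: "admissible A K a" and t: "t \<in> {0..T}" for K a t i j
  proof
    have h: "0 \<le> hh K ^ 4" "0 \<le> hh K ^ 3" using hh(1)[of K] by auto
    have "\<bar>grid_interp (hh K) (fourier_proj L K (\<Phi> t)) i j - grid_interp (hh K) (\<Phi> t) i j\<bar> \<le> C1 * hh K ^ 5"
      using C1(2)[OF t, of K] by (simp add: grid_interp_def)
    moreover have "\<bar>gmean (NN K) (grid_interp (hh K) (\<Phi> t)) - phi.mass\<bar> \<le> C3 * hh K ^ 5"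
      using C3(2)[OF t, of K] phi.mass_conserved[OF t] by simp
    ultimately have "\<bar>grid_interp (hh K) (fourier_proj L K (\<Phi> t)) i j - ref_phi K t i j\<bar> \<le> C1 * hh K ^ 5 + C3 * hh K ^ 5"
      unfolding ref_phi_def by linarith
    also have "\<dots> = (C1 + C3) * hh K ^ 5" by (simp only: distrib_right)
    also have "\<dots> \<le> (C1 + C3) * (L * hh K ^ 4)" using C1(1) C3(1) by (intro mult_left_mono mesh_powers) auto
    also have "\<dots> = ((C1 + C3) * L) * hh K ^ 4" by (simp only: mult.assoc)
    also have "\<dots> \<le> c * hh K ^ 4" by (rule mult_right_mono[OF c(1) h(1)])
    finally show "\<bar>grid_interp (hh K) (fourier_proj L K (\<Phi> t)) i j - ref_phi K t i j\<bar> \<le> c * hh K ^ 4" .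
    have "\<bar>grid_interp (hh K) (fourier_proj L K (\<Psi> t)) i j - grid_interp (hh K) (\<Psi> t) i j\<bar> \<le> C2 * hh K ^ 3"
      using C2(2)[OF t, of K] by (simp add: grid_interp_def)
    moreover have "\<bar>ref_rho a K t i j - grid_interp (hh K) (\<Psi> t) i j\<bar> \<le> A * hh K ^ 3"
      using ad t unfolding admissible_def by blast
    ultimately have "\<bar>grid_interp (hh K) (fourier_proj L K (\<Psi> t)) i j - ref_rho a K t i j\<bar> \<le> C2 * hh K ^ 3 + A * hh K ^ 3"
      by linarith
    also have "\<dots> = (C2 + A) * hh K ^ 3" by (simp only: distrib_right)
    also have "\<dots> \<le> c * hh K ^ 3" by (rule mult_right_mono[OF c(2) h(2)])
    finally show "\<bar>grid_interp (hh K) (fourier_proj L K (\<Psi> t)) i j - ref_rho a K t i j\<bar> \<le> c * hh K ^ 3" .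
  qed
  then show ?thesis using c(3) by blast
qed

text \<open>The mesh and variation parts are the same in every step and contribute through
  \<open>m * dt \<le> T\<close>; the two integrals are square summable by Cauchy-Schwarz in
  time.\<close>

lemma theta_square_sum:
  "\<exists>W\<ge>0. \<forall>K m. \<forall>dt>0. real m * dt \<le> T \<longrightarrow>
    dt * (\<Sum>k<m. (theta K (real k * dt) (real (Suc k) * dt))\<^sup>2) \<le> W * (dt + (hh K)\<^sup>2)\<^sup>2"
proof -
  obtain W1 where W1: "W1 \<ge> 0" "\<And>dt m. dt > 0 \<Longrightarrow> (\<Sum>n<m. dt * (phi.\<omega> (real n * dt) (real (Suc n) * dt))\<^sup>2) \<le> W1 * dt\<^sup>2"
    using phi.\<omega>_square_sum by meson
  obtain W2 where W2: "W2 \<ge> 0" "\<And>dt m. dt > 0 \<Longrightarrow> (\<Sum>n<m. dt * (psi.\<omega> (real n * dt) (real (Suc n) * dt))\<^sup>2) \<le> W2 * dt\<^sup>2"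
    using psi.\<omega>_square_sum by meson
  have T: "T > 0" using phi.pos by simp
  have "dt * (\<Sum>k<m. (theta K (real k * dt) (real (Suc k) * dt))\<^sup>2) \<le> (4 * (T + W1 + W2)) * (dt + (hh K)\<^sup>2)\<^sup>2"
    if dt: "dt > 0" and m: "real m * dt \<le> T" for K m dt
  proof -
    define X where "X = (dt + (hh K)\<^sup>2)\<^sup>2"
    have X: "((hh K)\<^sup>2)\<^sup>2 + dt\<^sup>2 \<le> X" "dt\<^sup>2 \<le> X"
      unfolding X_def power2_sum using dt by (simp_all add: zero_le_mult_iff)
    let ?w1 = "\<lambda>k. phi.\<omega> (real k * dt) (real (Suc k) * dt)" and ?w2 = "\<lambda>k. psi.\<omega> (real k * dt) (real (Suc k) * dt)"
    have four: "(a + b + c + d)\<^sup>2 \<le> 4 * (a\<^sup>2 + b\<^sup>2 + c\<^sup>2 + d\<^sup>2)" for a b c d :: real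
    proof -
      have "4 * (a\<^sup>2 + b\<^sup>2 + c\<^sup>2 + d\<^sup>2) - (a + b + c + d)\<^sup>2 = (a - b)\<^sup>2 + (a - c)\<^sup>2 + (a - d)\<^sup>2 + (b - c)\<^sup>2 + (b - d)\<^sup>2 + (c - d)\<^sup>2"
        by (simp add: power2_eq_square algebra_simps)
      then show ?thesis by (smt (verit) zero_le_power2)
    qed
    have e: "real (Suc k) * dt - real k * dt = dt" for k by (simp add: algebra_simps)
    have "dt * (\<Sum>k<m. (theta K (real k * dt) (real (Suc k) * dt))\<^sup>2) \<le> (\<Sum>k<m. 4 * (dt * (((hh K)\<^sup>2)\<^sup>2 + dt\<^sup>2) + dt * (?w1 k)\<^sup>2 + dt * (?w2 k)\<^sup>2))"
      unfolding sum_distrib_left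
    proof (rule sum_mono)
      fix k
      have "(theta K (real k * dt) (real (Suc k) * dt))\<^sup>2 \<le> 4 * (((hh K)\<^sup>2)\<^sup>2 + dt\<^sup>2 + (?w1 k)\<^sup>2 + (?w2 k)\<^sup>2)"
        unfolding theta_def e by (rule four)
      from mult_left_mono[OF this, of dt] dt
      show "dt * (theta K (real k * dt) (real (Suc k) * dt))\<^sup>2 \<le> 4 * (dt * (((hh K)\<^sup>2)\<^sup>2 + dt\<^sup>2) + dt * (?w1 k)\<^sup>2 + dt * (?w2 k)\<^sup>2)"
        by (simp add: algebra_simps)
    qed
    also have "\<dots> = 4 * ((real m * dt) * (((hh K)\<^sup>2)\<^sup>2 + dt\<^sup>2) + (\<Sum>k<m. dt * (?w1 k)\<^sup>2) + (\<Sum>k<m. dt * (?w2 k)\<^sup>2))"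
      by (simp only: sum_distrib_left[symmetric] sum.distrib sum_constant card_lessThan) (simp only: distrib_left mult_ac)
    also have "\<dots> \<le> 4 * (T * X + W1 * X + W2 * X)"
    proof (intro mult_left_mono add_mono)
      show "(real m * dt) * (((hh K)\<^sup>2)\<^sup>2 + dt\<^sup>2) \<le> T * X" using m X T by (intro mult_mono) auto
      show "(\<Sum>k<m. dt * (?w1 k)\<^sup>2) \<le> W1 * X" by (rule order_trans[OF W1(2)[OF dt] mult_left_mono[OF X(2) W1(1)]])
      show "(\<Sum>k<m. dt * (?w2 k)\<^sup>2) \<le> W2 * X" by (rule order_trans[OF W2(2)[OF dt] mult_left_mono[OF X(2) W2(1)]])
    qed simp
    also have "\<dots> = (4 * (T + W1 + W2)) * X" by (simp add: algebra_simps)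
    finally show ?thesis unfolding X_def .
  qed
  moreover have "0 \<le> 4 * (T + W1 + W2)" using T W1(1) W2(1) by simp
  ultimately show ?thesis by blast
qed

text \<open>Stability is applied not to the error itself but to \<open>e\<close> and
  \<open>d\<close>, the differences between references and numerical solution. The remaining parts
  \<open>De\<close> and \<open>Dd\<close> are independent of the scheme and are added at the
  end.\<close>

lemma error_estimate:
  assumes st: "stability_constant \<alpha> \<beta> \<epsilon> \<eta> \<xi> \<delta> M Cs"
  shows "\<exists>C\<ge>0. \<forall>K dt f r m. 0 < dt \<longrightarrow> Cs * dt \<le> 1/2 \<longrightarrow> numerical_solution \<alpha> \<beta> \<epsilon> \<eta> \<xi> \<delta> M T L K dt (\<Phi> 0) (\<Psi> 0) f r \<longrightarrow>
    1 \<le> m \<longrightarrow> real m * dt \<le> T \<longrightarrow>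
    err_low (hh K) (NN K) (grid_error L K dt \<Phi> f m) (grid_error L K dt \<Psi> r m) \<le> C * (dt + (hh K)\<^sup>2)\<^sup>2 \<and>
    M * dt * (\<Sum>k=0..m. err_high \<epsilon> \<eta> \<xi> (hh K) (NN K) (grid_error L K dt \<Phi> f k) (grid_error L K dt \<Psi> r k)) \<le> C * (dt + (hh K)\<^sup>2)\<^sup>2"
proof -
  have Cs: "Cs \<ge> 0" using st by (simp add: stability_constant_def)
  note stable = st[unfolded stability_constant_def, THEN conjunct2, rule_format]
  have LTM: "L > 0" "T > 0" "M > 0" using phi.pos by auto
  obtain A where A: "A \<ge> 0" "\<And>K. \<exists>a. admissible A K a" using ref_rho_properties unfolding admissible_def by meson
  obtain Cp where Cp: "Cp \<ge> 0" "\<And>K a t1 t2. admissible A K a \<Longrightarrow> 0 \<le> t1 \<Longrightarrow> t1 < t2 \<Longrightarrow> t2 \<le> T \<Longrightarrow>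
    consistent_phi \<alpha> \<epsilon> \<eta> \<delta> M (hh K) (NN K) (t2 - t1) (Cp * theta K t1 t2) (ref_phi K t1) (ref_phi K t2) (ref_rho a K t2)"
    using phi_consistent[OF A(1)] by meson
  obtain Cq where Cq: "Cq \<ge> 0" "\<And>K a t1 t2. admissible A K a \<Longrightarrow> 0 \<le> t1 \<Longrightarrow> t1 < t2 \<Longrightarrow> t2 \<le> T \<Longrightarrow>
    consistent_rho \<alpha> \<beta> \<xi> \<delta> M (hh K) (NN K) (t2 - t1) (Cq * theta K t1 t2) (ref_rho a K t1) (ref_phi K t2) (ref_rho a K t2)"
    using rho_consistent[OF A(1)] by meson
  obtain c where c: "c \<ge> 0" "\<And>K a t i j. admissible A K a \<Longrightarrow> t \<in> {0..T} \<Longrightarrow>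
    \<bar>grid_interp (hh K) (fourier_proj L K (\<Phi> t)) i j - ref_phi K t i j\<bar> \<le> c * hh K ^ 4 \<and>
    \<bar>grid_interp (hh K) (fourier_proj L K (\<Psi> t)) i j - ref_rho a K t i j\<bar> \<le> c * hh K ^ 3"
    using proj_ref[OF A(1)] by meson
  obtain Ce where Ce: "Ce \<ge> 0" "\<And>h N e d. h > 0 \<Longrightarrow> N > 0 \<Longrightarrow> real N * h = L \<Longrightarrow> h \<le> L \<Longrightarrow> grid_per N e \<Longrightarrow> grid_per N d \<Longrightarrow> mean_zero N e \<Longrightarrow> mean_zero N d \<Longrightarrow>
    (\<forall>i j. \<bar>e i j\<bar> \<le> c * h ^ 4) \<Longrightarrow> (\<forall>i j. \<bar>d i j\<bar> \<le> c * h ^ 3) \<Longrightarrow> err_low h N e d \<le> Ce * h ^ 4 \<and> err_high \<epsilon> \<eta> \<xi> h N e d \<le> Ce * h ^ 4"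
    using err_small[OF par(3,5) LTM(1) c(1)] by meson
  obtain W where W: "W \<ge> 0" "\<And>K m dt. dt > 0 \<Longrightarrow> real m * dt \<le> T \<Longrightarrow>
    dt * (\<Sum>k<m. (theta K (real k * dt) (real (Suc k) * dt))\<^sup>2) \<le> W * (dt + (hh K)\<^sup>2)\<^sup>2"
    using theta_square_sum by meson
  \<comment> \<open>The growth over the whole time interval, times the bounds for the initial error,
    the initial dissipation and the accumulated truncation errors.\<close>
  define Z where "Z = exp (4 * Cs * T) * (Ce + T * M * Ce + 2 * Cs * ((Cp + Cq)\<^sup>2 * W))"
  define C where "C = 2 * Ce + 2 * Z + (4 * T * M * Ce + 2 * (T * M * Ce + Z))"
  have nnZ: "0 \<le> Z" unfolding Z_def using Ce(1) LTM Cs W(1) by simp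
  have TMC: "0 \<le> T * M * Ce" using Ce(1) LTM by simp
  have C: "C \<ge> 0"
  proof -
    have "0 \<le> 4 * T * M * Ce" using Ce(1) LTM by simp
    then show ?thesis unfolding C_def using nnZ TMC Ce(1) by (intro add_nonneg_nonneg) auto
  qed
  have main: "err_low (hh K) (NN K) (grid_error L K dt \<Phi> f m) (grid_error L K dt \<Psi> r m) \<le> C * (dt + (hh K)\<^sup>2)\<^sup>2 \<and>
    M * dt * (\<Sum>k=0..m. err_high \<epsilon> \<eta> \<xi> (hh K) (NN K) (grid_error L K dt \<Phi> f k) (grid_error L K dt \<Psi> r k)) \<le> C * (dt + (hh K)\<^sup>2)\<^sup>2"
    if dt: "0 < dt" "Cs * dt \<le> 1/2" and num: "numerical_solution \<alpha> \<beta> \<epsilon> \<eta> \<xi> \<delta> M T L K dt (\<Phi> 0) (\<Psi> 0) f r"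
      and m: "1 \<le> m" "real m * dt \<le> T" for K dt f r m
  proof -
    obtain a where ad: "admissible A K a" using A(2) by blast
    define N where "N = NN K"
    define h where "h = hh K"
    define X where "X = (dt + h\<^sup>2)\<^sup>2"
    have N: "N > 0" "h > 0" "real N * h = L" "h \<le> L" using hh[of K] by (simp_all add: N_def h_def)
    have hX: "h ^ 4 \<le> X" "0 \<le> X" "0 \<le> h ^ 4"
    proof -
      have "h ^ 4 = (h\<^sup>2)\<^sup>2" by (simp add: power_mult[symmetric])
      also have "\<dots> \<le> X" unfolding X_def using dt by (intro power_mono) auto
      finally show "h ^ 4 \<le> X" .
    qed (simp_all add: X_def)
    have CeX: "Ce * h ^ 4 \<le> Ce * X" by (rule mult_left_mono[OF hX(1) Ce(1)])
    let ?t = "\<lambda>n. real n * dt"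
    have le: "?t n \<le> T" if "n \<le> m" for n
    proof -
      have "real n * dt \<le> real m * dt" using that dt(1) by (intro mult_right_mono) auto
      then show ?thesis using m(2) by linarith
    qed
    have tin: "?t n \<in> {0..T}" if "n \<le> m" for n using le[OF that] dt by simp
    have dtT: "dt \<le> T" using le[OF m(1)] by simp
    let ?P = "\<lambda>u. grid_interp h u"
    have init: "f 0 = ?P (fourier_proj L K (\<Phi> 0))" "r 0 = ?P (fourier_proj L K (\<Psi> 0))"
      and step: "\<And>n. ?t (Suc n) \<le> T \<Longrightarrow> scheme_step \<alpha> \<beta> \<epsilon> \<eta> \<xi> \<delta> M h N dt (f n) (r n) (f (Suc n)) (r (Suc n))"
      using num unfolding numerical_solution_def Let_def N_def h_def by blast+
    have perP: "grid_per N (?P (fourier_proj L K u))" for u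
      by (rule grid_per_interp(1)[OF xy_periodic_fourier_proj[OF LTM(1)] N(3)])
    have gP: "gmean N (?P (fourier_proj L K (\<Phi> t))) = phi.mass" "gmean N (?P (fourier_proj L K (\<Psi> t))) = psi.mass" if "t \<in> {0..T}" for t
      unfolding N_def h_def phi.gmean_proj[OF that] psi.gmean_proj[OF that] by (rule phi.mass_conserved[OF that], rule psi.mass_conserved[OF that])
    have t0: "0 \<in> {0..T}" using LTM by simp
    have fr: "grid_per N (f n) \<and> grid_per N (r n) \<and> gmean N (f n) = phi.mass \<and> gmean N (r n) = psi.mass" if "n \<le> m" for n
      using that
    proof (induction n)
      case 0
      show ?case unfolding init by (intro conjI perP gP t0)
    next
      case (Suc n)
      then have IH: "grid_per N (f n)" "grid_per N (r n)" "gmean N (f n) = phi.mass" "gmean N (r n) = psi.mass" by auto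
      note s = step[OF le[OF Suc.prems]]
      have "grid_per N (f (Suc n))" "grid_per N (r (Suc n))" using s by (auto simp: scheme_step_def)
      then show ?case using scheme_conserves_mass[OF s IH(1,2) N(1,2) dt(1)] IH(3,4) by simp
    qed
    define p where "p n = ref_phi K (?t n)" for n
    define q where "q n = ref_rho a K (?t n)" for n
    define e where "e n = (\<lambda>i j. p n i j - f n i j)" for n
    define d where "d n = (\<lambda>i j. q n i j - r n i j)" for n
    define De where "De n = (\<lambda>i j. ?P (fourier_proj L K (\<Phi> (?t n))) i j - p n i j)" for n
    define Dd where "Dd n = (\<lambda>i j. ?P (fourier_proj L K (\<Psi> (?t n))) i j - q n i j)" for n
    have ge: "grid_error L K dt \<Phi> f n = (\<lambda>i j. De n i j + e n i j)" "grid_error L K dt \<Psi> r n = (\<lambda>i j. Dd n i j + d n i j)" for n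
      by (intro ext; simp only: grid_error_def De_def e_def Dd_def d_def h_def; simp)+
    have pq: "grid_per N (p n)" "grid_per N (q n)" "gmean N (p n) = phi.mass" "gmean N (q n) = psi.mass" if "n \<le> m" for n
      unfolding p_def q_def N_def using grid_per_ref[OF tin[OF that]] gmean_ref_phi gmean_ref_rho by blast+
    have perE: "grid_per N (e n)" "grid_per N (d n)" "grid_per N (De n)" "grid_per N (Dd n)" if "n \<le> m" for n
      unfolding e_def d_def De_def Dd_def using fr[OF that] pq[OF that] perP by (auto intro: grid_per_diff)
    have mzE: "mean_zero N (e n)" "mean_zero N (d n)" "mean_zero N (De n)" "mean_zero N (Dd n)" if "n \<le> m" for n
      unfolding mean_zero_gmean[OF N(1)] e_def d_def De_def Dd_def gmean_diff
      using fr[OF that] pq[OF that] gP[OF tin[OF that]] by auto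
    have supD: "\<bar>De n i j\<bar> \<le> c * h ^ 4" "\<bar>Dd n i j\<bar> \<le> c * h ^ 3" if "n \<le> m" for n i j
      unfolding De_def Dd_def p_def q_def h_def using c(2)[OF ad tin[OF that]] by blast+
    have smallD: "err_low h N (De n) (Dd n) \<le> Ce * X" "err_high \<epsilon> \<eta> \<xi> h N (De n) (Dd n) \<le> Ce * X" if "n \<le> m" for n
      using Ce(2)[OF N(2,1,3,4) perE(3,4)[OF that] mzE(3,4)[OF that]] supD[OF that] CeX by force+
    \<comment> \<open>The scheme starts from the projections, so initially \<open>e\<close> and
      \<open>d\<close> are, up to sign, the deviations of the projections from the
      references.\<close>
    have e0: "\<bar>e 0 i j\<bar> \<le> c * h ^ 4" "\<bar>d 0 i j\<bar> \<le> c * h ^ 3" for i j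
      using supD[of 0 i j] by (simp_all add: e_def d_def De_def Dd_def init abs_minus_commute)
    have small0: "err_low h N (e 0) (d 0) \<le> Ce * X" "err_high \<epsilon> \<eta> \<xi> h N (e 0) (d 0) \<le> Ce * X"
      using Ce(2)[OF N(2,1,3,4) perE(1,2)[of 0] mzE(1,2)[of 0]] e0 CeX by force+
    \<comment> \<open>One truncation error for both equations, as the stability estimate takes a
      single \<open>\<theta>\<close>.\<close>
    let ?th = "\<lambda>n. (Cp + Cq) * theta K (?t n) (?t (Suc n))"
    have th0: "0 \<le> theta K (?t n) (?t (Suc n))" for n
    proof -
      have "?t (Suc n) - ?t n = dt" by (simp add: algebra_simps)
      then show ?thesis unfolding theta_def using phi.\<omega>_nonneg psi.\<omega>_nonneg dt by (intro add_nonneg_nonneg) auto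
    qed
    let ?b = "\<lambda>n. dt * M * err_high \<epsilon> \<eta> \<xi> h N (e n) (d n)"
    have dtM: "0 \<le> dt * M" using dt LTM by simp
    have b0: "0 \<le> ?b n" for n by (intro mult_nonneg_nonneg[OF dtM] err_nonneg par)
    have "err_low h N (e (Suc n)) (d (Suc n)) + 3/2 * ?b (Suc n) \<le> err_low h N (e n) (d n) + 1/2 * ?b n
      + Cs * dt * (err_low h N (e n) (d n) + err_low h N (e (Suc n)) (d (Suc n)) + (?th n)\<^sup>2)" if n: "n < m" for n
    proof -
      have nm: "n \<le> m" "Suc n \<le> m" using n by auto
      have ts: "0 \<le> ?t n" "?t n < ?t (Suc n)" "?t (Suc n) \<le> T" using dt le[OF nm(2)] by auto
      have td: "?t (Suc n) - ?t n = dt" by (simp add: algebra_simps)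
      have m1: "Cp * theta K (?t n) (?t (Suc n)) \<le> ?th n" "Cq * theta K (?t n) (?t (Suc n)) \<le> ?th n"
        using th0[of n] Cp(1) Cq(1) by (simp_all add: distrib_right)
      have cp: "consistent_phi \<alpha> \<epsilon> \<eta> \<delta> M h N dt (?th n) (p n) (p (Suc n)) (q (Suc n))"
        unfolding p_def q_def
        by (rule consistent_mono(1)[OF m1(1) dt(1) N(1,2) Cp(2)[OF ad ts, unfolded td, folded h_def, folded N_def]])
      have cq: "consistent_rho \<alpha> \<beta> \<xi> \<delta> M h N dt (?th n) (q n) (p (Suc n)) (q (Suc n))"
        unfolding p_def q_def
        by (rule consistent_mono(2)[OF m1(2) dt(1) N(1,2) Cq(2)[OF ad ts, unfolded td, folded h_def, folded N_def]])
      have q01: "0 < q (Suc n) i j \<and> q (Suc n) i j < 1" for i j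
      proof -
        have "c0 / 2 \<le> q (Suc n) i j" "q (Suc n) i j \<le> 1 - c0 / 2" using ad tin[OF nm(2)] unfolding admissible_def q_def by blast+
        then show ?thesis using c0(1) by linarith
      qed
      have thn: "0 \<le> ?th n" using th0[of n] Cp(1) Cq(1) by simp
      show ?thesis unfolding e_def d_def
        by (rule stable[OF N(1,2) dt(1) thn pq(1,2)[OF nm(1)] _ _ pq(1,2)[OF nm(2)] mzE(1,2)[OF nm(1), unfolded e_def d_def]
            mzE(1,2)[OF nm(2), unfolded e_def d_def] q01 step[OF ts(3)] cp cq]) (use fr[OF nm(1)] in auto)
    qed
    from discrete_Gronwall[where a = "\<lambda>n. err_low h N (e n) (d n)" and b = ?b and \<theta> = "\<lambda>n. (?th n)\<^sup>2" and m = m and n = m,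
        OF this err_nonneg(1) b0 zero_le_power2 Cs dt order_refl]
    have G: "err_low h N (e m) (d m) + (\<Sum>k=1..m. ?b k) \<le> exp (4 * Cs * dt * real m) *
      (err_low h N (e 0) (d 0) + ?b 0 + 2 * Cs * dt * (\<Sum>k<m. (?th k)\<^sup>2))" .
    \<comment> \<open>The dissipation at time 0 is not produced by the scheme; it is small by the
      inverse estimates and enters with a factor \<open>dt\<close>, which is at most
      \<open>T\<close>.\<close>
    have b0le: "?b 0 \<le> (T * M * Ce) * X"
    proof -
      have "?b 0 \<le> (T * M) * (Ce * X)"
        using dtT LTM small0(2) by (intro mult_mono mult_right_mono err_nonneg par) auto
      then show ?thesis by (simp only: mult.assoc)
    qed
    have "2 * Cs * dt * (\<Sum>k<m. (?th k)\<^sup>2) = 2 * Cs * ((Cp + Cq)\<^sup>2 * (dt * (\<Sum>k<m. (theta K (?t k) (?t (Suc k)))\<^sup>2)))"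
      by (simp add: power_mult_distrib sum_distrib_left mult_ac)
    also have "\<dots> \<le> 2 * Cs * ((Cp + Cq)\<^sup>2 * (W * X))"
      using W(2)[OF dt(1) m(2), of K] Cs unfolding X_def h_def by (intro mult_left_mono) auto
    finally have s3: "2 * Cs * dt * (\<Sum>k<m. (?th k)\<^sup>2) \<le> 2 * Cs * ((Cp + Cq)\<^sup>2 * (W * X))" .
    have "exp (4 * Cs * dt * real m) \<le> exp (4 * Cs * T)"
      using mult_left_mono[OF m(2), of "4 * Cs"] Cs by (simp add: mult_ac)
    moreover have "err_low h N (e 0) (d 0) + ?b 0 + 2 * Cs * dt * (\<Sum>k<m. (?th k)\<^sup>2)
        \<le> Ce * X + (T * M * Ce) * X + 2 * Cs * ((Cp + Cq)\<^sup>2 * (W * X))"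
      using small0(1) b0le s3 by (intro add_mono)
    moreover have "0 \<le> err_low h N (e 0) (d 0) + ?b 0 + 2 * Cs * dt * (\<Sum>k<m. (?th k)\<^sup>2)"
    proof -
      have "0 \<le> (\<Sum>k<m. (?th k)\<^sup>2)" by (intro sum_nonneg) simp
      then have "0 \<le> 2 * Cs * dt * (\<Sum>k<m. (?th k)\<^sup>2)" using Cs dt(1) by (intro mult_nonneg_nonneg[of "2 * Cs * dt"]) auto
      then show ?thesis using err_nonneg(1)[of h N "e 0" "d 0"] b0[of 0] by linarith
    qed
    ultimately have "exp (4 * Cs * dt * real m) * (err_low h N (e 0) (d 0) + ?b 0 + 2 * Cs * dt * (\<Sum>k<m. (?th k)\<^sup>2))
        \<le> exp (4 * Cs * T) * (Ce * X + (T * M * Ce) * X + 2 * Cs * ((Cp + Cq)\<^sup>2 * (W * X)))"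
      by (intro mult_mono) auto
    also have "\<dots> = Z * X" by (simp add: Z_def algebra_simps)
    finally have GZ: "err_low h N (e m) (d m) + (\<Sum>k=1..m. ?b k) \<le> Z * X" using G by linarith
    have sb: "0 \<le> (\<Sum>k=1..m. ?b k)" by (intro sum_nonneg b0)
    have sums: "err_low h N (grid_error L K dt \<Phi> f n) (grid_error L K dt \<Psi> r n) \<le> 2 * err_low h N (De n) (Dd n) + 2 * err_low h N (e n) (d n)"
      "err_high \<epsilon> \<eta> \<xi> h N (grid_error L K dt \<Phi> f n) (grid_error L K dt \<Psi> r n) \<le> 2 * err_high \<epsilon> \<eta> \<xi> h N (De n) (Dd n) + 2 * err_high \<epsilon> \<eta> \<xi> h N (e n) (d n)"
      if "n \<le> m" for n
      unfolding ge by (rule err_add_le[OF perE(3)[OF that] mzE(3)[OF that] perE(1)[OF that] mzE(1)[OF that] perE(4)[OF that] mzE(4)[OF that]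
            perE(2)[OF that] mzE(2)[OF that] N(1,2) par(3,5)])+
    have Cle: "(2 * Ce + 2 * Z) * X \<le> C * X" "(4 * T * M * Ce + 2 * (T * M * Ce + Z)) * X \<le> C * X"
    proof -
      have "0 \<le> 4 * T * M * Ce" using Ce(1) LTM by simp
      then have n1: "0 \<le> 4 * T * M * Ce + 2 * (T * M * Ce + Z)" using nnZ TMC by (intro add_nonneg_nonneg) auto
      have n2: "0 \<le> 2 * Ce + 2 * Z" using nnZ Ce(1) by simp
      show "(2 * Ce + 2 * Z) * X \<le> C * X" "(4 * T * M * Ce + 2 * (T * M * Ce + Z)) * X \<le> C * X"
        unfolding C_def by (rule mult_right_mono[OF add_increasing2[OF n1 order_refl] hX(2)],
          rule mult_right_mono[OF add_increasing[OF n2 order_refl] hX(2)])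
    qed
    have "err_low h N (grid_error L K dt \<Phi> f m) (grid_error L K dt \<Psi> r m) \<le> 2 * (Ce * X) + 2 * (Z * X)"
      using sums(1)[OF order_refl] smallD(1)[OF order_refl] GZ sb by linarith
    also have "\<dots> = (2 * Ce + 2 * Z) * X" by (simp add: algebra_simps)
    finally have low: "err_low h N (grid_error L K dt \<Phi> f m) (grid_error L K dt \<Psi> r m) \<le> C * X" using Cle(1) by linarith
    have "M * dt * (\<Sum>k=0..m. err_high \<epsilon> \<eta> \<xi> h N (grid_error L K dt \<Phi> f k) (grid_error L K dt \<Psi> r k))
        \<le> (\<Sum>k=0..m. 2 * ((dt * M) * (Ce * X)) + 2 * ?b k)"
      unfolding sum_distrib_left
    proof (rule sum_mono)
      fix k assume "k \<in> {0..m}"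
      then have k: "k \<le> m" by simp
      have "err_high \<epsilon> \<eta> \<xi> h N (grid_error L K dt \<Phi> f k) (grid_error L K dt \<Psi> r k) \<le> 2 * (Ce * X) + 2 * err_high \<epsilon> \<eta> \<xi> h N (e k) (d k)"
        using sums(2)[OF k] smallD(2)[OF k] by linarith
      from mult_left_mono[OF this dtM]
      show "M * dt * err_high \<epsilon> \<eta> \<xi> h N (grid_error L K dt \<Phi> f k) (grid_error L K dt \<Psi> r k) \<le> 2 * ((dt * M) * (Ce * X)) + 2 * ?b k"
        by (simp only: distrib_left mult_ac)
    qed
    \<comment> \<open>The sum has \<open>m + 1\<close> terms, and \<open>dt \<le> T\<close> absorbs
      the extra one. The term at 0 is split off because the Gronwall sum begins at 1.\<close>
    also have "\<dots> = 2 * (((real m + 1) * dt) * (M * (Ce * X))) + 2 * (?b 0 + (\<Sum>k=1..m. ?b k))"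
      by (simp add: sum.distrib sum_distrib_left[symmetric] sum.atLeast_Suc_atMost[of 0 m] algebra_simps)
    also have "\<dots> \<le> 2 * ((2 * T) * (M * (Ce * X))) + 2 * ((T * M * Ce) * X + Z * X)"
    proof (intro add_mono mult_left_mono mult_right_mono)
      show "(real m + 1) * dt \<le> 2 * T" using m(2) dtT by (simp add: algebra_simps)
      show "?b 0 \<le> (T * M * Ce) * X" by (rule b0le)
      show "(\<Sum>k=1..m. ?b k) \<le> Z * X" using GZ err_nonneg(1)[of h N "e m" "d m"] by linarith
    qed (use LTM Ce(1) hX(2) in auto)
    also have "\<dots> = (4 * T * M * Ce + 2 * (T * M * Ce + Z)) * X" by (simp add: algebra_simps)
    finally have high: "M * dt * (\<Sum>k=0..m. err_high \<epsilon> \<eta> \<xi> h N (grid_error L K dt \<Phi> f k) (grid_error L K dt \<Psi> r k)) \<le> C * X"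
      using Cle(2) by linarith
    show ?thesis using low high unfolding X_def h_def N_def by blast
  qed
  show ?thesis using C main by blast
qed

end

text \<open>\<open>S\<close> collects the times at which both regularity bounds and both equations
  hold simultaneously. Finitely many conditions that hold almost everywhere hold together almost
  everywhere, hence densely.\<close>

lemma surfactant_solution_exists:
  assumes par: "\<alpha> > 0" "\<beta> > 0" "\<epsilon> > 0" "\<eta> > 0" "\<xi> > 0" "\<delta> > 0" "M > 0" "T > 0" "L > 0"
    and H: "H2_C_per T L \<Phi>" "Linf_Ck_per T L 8 \<Phi>" "H2_C_per T L \<Psi>" "Linf_Ck_per T L 6 \<Psi>"
    and ex: "exact_solution \<alpha> \<beta> \<epsilon> \<eta> \<xi> \<delta> M T L \<Phi> \<Psi>"
  shows "\<exists>S c0. surfactant_solution \<alpha> \<beta> \<epsilon> \<eta> \<xi> \<delta> M T L \<Phi> \<Psi> S c0"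
proof -
  obtain B1 where B1: "AE t in lebesgue_on {0<..<T}. Ck_per L 8 (\<Phi> t) \<and> Ck_norm 8 (\<Phi> t) \<le> B1"
    using H(2) unfolding Linf_Ck_per_def by blast
  obtain B2 where B2: "AE t in lebesgue_on {0<..<T}. Ck_per L 6 (\<Psi> t) \<and> Ck_norm 6 (\<Psi> t) \<le> B2"
    using H(4) unfolding Linf_Ck_per_def by blast
  define good where "good t \<longleftrightarrow> Cb 8 B1 (\<Phi> t) \<and> Cb 6 B2 (\<Psi> t) \<and>
    (\<forall>z. ((\<lambda>s. \<Phi> s z) has_real_derivative M * laplacian (mu_phi \<alpha> \<epsilon> \<eta> \<delta> (\<Phi> t) (\<Psi> t)) z) (at t) \<and>
         ((\<lambda>s. \<Psi> s z) has_real_derivative M * laplacian (mu_rho \<alpha> \<beta> \<xi> \<delta> (\<Phi> t) (\<Psi> t)) z) (at t))" for t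
  have E: "AE t in lebesgue_on {0<..<T}. \<forall>z.
        ((\<lambda>s. \<Phi> s z) has_real_derivative M * laplacian (mu_phi \<alpha> \<epsilon> \<eta> \<delta> (\<Phi> t) (\<Psi> t)) z) (at t) \<and>
        ((\<lambda>s. \<Psi> s z) has_real_derivative M * laplacian (mu_rho \<alpha> \<beta> \<xi> \<delta> (\<Phi> t) (\<Psi> t)) z) (at t)"
    by (rule conjunct2[OF ex[unfolded exact_solution_def]])
  have good: "AE t in lebesgue_on {0<..<T}. good t"
    using B1 B2 E
  proof eventually_elim
    case (elim t)
    show ?case
      unfolding good_def
      by (rule conjI[OF Ck_per_imp_Cb[OF par(9) conjunct1[OF elim(1)] conjunct2[OF elim(1)]]
            conjI[OF Ck_per_imp_Cb[OF par(9) conjunct1[OF elim(2)] conjunct2[OF elim(2)]] elim(3)]])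
  qed
  define S where "S = {t \<in> {0<..<T}. good t}"
  have V: "0 < \<Psi> t z \<and> \<Psi> t z < 1" if "t \<in> {0..T}" for t z using conjunct1[OF ex[unfolded exact_solution_def]] that by blast
  obtain c0 where c0: "c0 > 0" "\<And>t z. t \<in> {0..T} \<Longrightarrow> c0 \<le> \<Psi> t z \<and> \<Psi> t z \<le> 1 - c0"
    using strict_interior_bound[OF H(3) par(9,8) V] by blast
  have SD: "S \<subseteq> {0<..<T}" by (auto simp: S_def)
  have dense: "\<exists>s\<in>S. a < s \<and> s < b" if "0 \<le> a" "a < b" "b \<le> T" for a b
  proof -
    have "\<exists>s. good s \<and> a < s \<and> s < b" by (rule AE_times_dense[OF good that])
    then obtain s where "good s" "a < s" "s < b" by blast
    then show ?thesis using that by (intro bexI[of _ s]) (auto simp: S_def)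
  qed
  have good_S: "good s" if "s \<in> S" for s using that by (simp add: S_def)
  have fU: "Cfam 8 S \<Phi>"
    unfolding Cfam_def by (rule exI[of _ B1], rule ballI) (rule conjunct1[OF good_S[unfolded good_def]])
  have fV: "Cfam 6 S \<Psi>"
    unfolding Cfam_def by (rule exI[of _ B2], rule ballI) (rule conjunct1[OF conjunct2[OF good_S[unfolded good_def]]])
  have ST: "s \<in> {0..T}" if "s \<in> S" for s using SD that by auto
  have per: "xy_periodic L (\<Phi> s)" "xy_periodic L (\<Psi> s)" if "s \<in> S" for s
    by (rule C_per_xy_periodic[OF bspec[OF conjunct1[OF H(1)[unfolded H2_C_per_def]] ST[OF that]]],
        rule C_per_xy_periodic[OF bspec[OF conjunct1[OF H(3)[unfolded H2_C_per_def]] ST[OF that]]])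
  have eqn: "((\<lambda>t. \<Phi> t z) has_real_derivative M * laplacian (mu_phi \<alpha> \<epsilon> \<eta> \<delta> (\<Phi> s) (\<Psi> s)) z) (at s)"
    "((\<lambda>t. \<Psi> t z) has_real_derivative M * laplacian (mu_rho \<alpha> \<beta> \<xi> \<delta> (\<Phi> s) (\<Psi> s)) z) (at s)" if "s \<in> S" for s z
  proof -
    note e = spec[OF conjunct2[OF conjunct2[OF good_S[OF that, unfolded good_def]]], of z]
    show "((\<lambda>t. \<Phi> t z) has_real_derivative M * laplacian (mu_phi \<alpha> \<epsilon> \<eta> \<delta> (\<Phi> s) (\<Psi> s)) z) (at s)" by (rule conjunct1[OF e])
    show "((\<lambda>t. \<Psi> t z) has_real_derivative M * laplacian (mu_rho \<alpha> \<beta> \<xi> \<delta> (\<Phi> s) (\<Psi> s)) z) (at s)" by (rule conjunct2[OF e])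
  qed
  have D1: "diffusion_component T L M 8 \<Phi> (\<lambda>s. mu_phi \<alpha> \<epsilon> \<eta> \<delta> (\<Phi> s) (\<Psi> s)) S"
  proof (rule diffusion_component.intro)
    show "T > 0" "L > 0" "M > 0" by (rule par)+
    show "(6 :: nat) \<le> 8" by simp
    show "H2_C_per T L \<Phi>" by (rule H(1))
    show "S \<subseteq> {0<..<T}" by (rule SD)
    show "\<exists>s\<in>S. a < s \<and> s < b" if "0 \<le> a" "a < b" "b \<le> T" for a b by (rule dense[OF that])
    show "Cfam 8 S \<Phi>" by (rule fU)
    show "Cfam 4 S (\<lambda>s. mu_phi \<alpha> \<epsilon> \<eta> \<delta> (\<Phi> s) (\<Psi> s))" by (rule Cfam_mu_phi[OF par(6) fU fV])
    show "xy_periodic L (mu_phi \<alpha> \<epsilon> \<eta> \<delta> (\<Phi> s) (\<Psi> s))" if "s \<in> S" for s by (rule xy_periodic_mu(1)[OF per[OF that]])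
    show "((\<lambda>t. \<Phi> t z) has_real_derivative M * laplacian (mu_phi \<alpha> \<epsilon> \<eta> \<delta> (\<Phi> s) (\<Psi> s)) z) (at s)" if "s \<in> S" for s z
      by (rule eqn(1)[OF that])
  qed
  have D2: "diffusion_component T L M 6 \<Psi> (\<lambda>s. mu_rho \<alpha> \<beta> \<xi> \<delta> (\<Phi> s) (\<Psi> s)) S"
  proof (rule diffusion_component.intro)
    show "T > 0" "L > 0" "M > 0" by (rule par)+
    show "(6 :: nat) \<le> 6" by simp
    show "H2_C_per T L \<Psi>" by (rule H(3))
    show "S \<subseteq> {0<..<T}" by (rule SD)
    show "\<exists>s\<in>S. a < s \<and> s < b" if "0 \<le> a" "a < b" "b \<le> T" for a b by (rule dense[OF that])
    show "Cfam 6 S \<Psi>" by (rule fV)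
    show "Cfam 4 S (\<lambda>s. mu_rho \<alpha> \<beta> \<xi> \<delta> (\<Phi> s) (\<Psi> s))" by (rule Cfam_mu_rho[OF par(6) fU fV c0(1)]) (rule c0(2)[OF ST])
    show "xy_periodic L (mu_rho \<alpha> \<beta> \<xi> \<delta> (\<Phi> s) (\<Psi> s))" if "s \<in> S" for s by (rule xy_periodic_mu(2)[OF per[OF that]])
    show "((\<lambda>t. \<Psi> t z) has_real_derivative M * laplacian (mu_rho \<alpha> \<beta> \<xi> \<delta> (\<Phi> s) (\<Psi> s)) z) (at s)" if "s \<in> S" for s z
      by (rule eqn(2)[OF that])
  qed
  have "surfactant_solution \<alpha> \<beta> \<epsilon> \<eta> \<xi> \<delta> M T L \<Phi> \<Psi> S c0"
    by (rule surfactant_solution.intro[OF par(1-6) D1 D2 c0(1)]) (rule c0(2))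
  then show ?thesis by blast
qed

lemma norm_m1_le_err_low: "err_low h N e d \<le> C * x\<^sup>2 \<Longrightarrow> 0 \<le> C \<Longrightarrow> 0 \<le> x \<Longrightarrow> norm_m1 h N e \<le> sqrt C * x \<and> norm_m1 h N d \<le> sqrt C * x"
proof -
  assume a: "err_low h N e d \<le> C * x\<^sup>2" "0 \<le> C" "0 \<le> x"
  have sq: "(sqrt C * x)\<^sup>2 = C * x\<^sup>2" by (simp only: power_mult_distrib real_sqrt_pow2[OF a(2)])
  have le: "(norm_m1 h N e)\<^sup>2 \<le> err_low h N e d" "(norm_m1 h N d)\<^sup>2 \<le> err_low h N e d" by (simp_all add: err_low_def)
  have n: "0 \<le> sqrt C * x" using a(2,3) by simp
  show ?thesis
    by (intro conjI power2_le_imp_le[OF _ n]) (unfold sq, rule order_trans[OF le(1) a(1)], rule order_trans[OF le(2) a(1)])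
qed

theorem theorem3p3:
  fixes \<alpha> \<beta> \<epsilon> \<eta> \<xi> \<delta> \<M> T L :: real
  assumes "\<alpha> > 0" "\<beta> > 0" "\<epsilon> > 0" "\<eta> > 0" "\<xi> > 0" "\<delta> > 0" "\<M> > 0" "T > 0" "L > 0"
  shows "\<exists>\<tau>>0. \<forall>\<Phi> \<Psi>.
    Ck_per L 8 (\<Phi> 0) \<and> Ck_per L 6 (\<Psi> 0) \<and>
    H2_C_per T L \<Phi> \<and> Linf_Ck_per T L 8 \<Phi> \<and>
    H2_C_per T L \<Psi> \<and> Linf_Ck_per T L 6 \<Psi> \<and>
    exact_solution \<alpha> \<beta> \<epsilon> \<eta> \<xi> \<delta> \<M> T L \<Phi> \<Psi> \<longrightarrow>
    (\<exists>C>0. \<forall>K dt \<phi> \<rho>.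
       0 < dt \<and> dt < \<tau> \<and>
       numerical_solution \<alpha> \<beta> \<epsilon> \<eta> \<xi> \<delta> \<M> T L K dt (\<Phi> 0) (\<Psi> 0) \<phi> \<rho> \<longrightarrow>
       (let N = 2 * K + 1; h = L / real N;
            e\<phi> = grid_error L K dt \<Phi> \<phi>; e\<rho> = grid_error L K dt \<Psi> \<rho>
        in \<forall>n\<ge>1. real (n + 1) * dt \<le> T \<longrightarrow>
             norm_m1 h N (e\<phi> (n + 1)) + norm_m1 h N (e\<rho> (n + 1))
             + sqrt (\<M> * dt * (\<Sum>k=0..n+1.
                 \<eta>\<^sup>2 * (grid_norm2 h N (lap_h h (e\<phi> k)))\<^sup>2
                 + \<epsilon> * (grad_norm2 h N (e\<phi> k))\<^sup>2
                 + \<xi> * (grad_norm2 h N (e\<rho> k))\<^sup>2))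
             \<le> C * (dt + h\<^sup>2)))"
proof -
  have "\<exists>Cs. stability_constant \<alpha> \<beta> \<epsilon> \<eta> \<xi> \<delta> \<M> Cs"
    unfolding stability_constant_def by (rule step_estimate[OF assms(1-7)])
  then obtain Cs where Cs: "stability_constant \<alpha> \<beta> \<epsilon> \<eta> \<xi> \<delta> \<M> Cs" ..
  have Cs0: "Cs \<ge> 0" using Cs by (simp add: stability_constant_def)
  \<comment> \<open>Determined by the parameters through the stability constant, with
    \<open>Cs * \<tau> \<le> 1/2\<close> as Gronwall requires; the 1 guards against
    \<open>Cs = 0\<close>.\<close>
  define \<tau> where "\<tau> = 1 / (2 * Cs + 1)"
  have \<tau>: "\<tau> > 0" using Cs0 by (simp add: \<tau>_def)
  show ?thesis
  proof (rule exI[of _ \<tau>], intro conjI \<tau> allI impI, elim conjE)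
    fix \<Phi> \<Psi>
    assume H: "H2_C_per T L \<Phi>" "Linf_Ck_per T L 8 \<Phi>" "H2_C_per T L \<Psi>" "Linf_Ck_per T L 6 \<Psi>"
      and ex: "exact_solution \<alpha> \<beta> \<epsilon> \<eta> \<xi> \<delta> \<M> T L \<Phi> \<Psi>"
    obtain S c0 where sol: "surfactant_solution \<alpha> \<beta> \<epsilon> \<eta> \<xi> \<delta> \<M> T L \<Phi> \<Psi> S c0"
      using surfactant_solution_exists[OF assms H ex] by blast
    obtain C where C: "C \<ge> 0" "\<And>K dt f r m. 0 < dt \<Longrightarrow> Cs * dt \<le> 1/2 \<Longrightarrow> numerical_solution \<alpha> \<beta> \<epsilon> \<eta> \<xi> \<delta> \<M> T L K dt (\<Phi> 0) (\<Psi> 0) f r \<Longrightarrow>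
      1 \<le> m \<Longrightarrow> real m * dt \<le> T \<Longrightarrow>
      err_low (L / real (2 * K + 1)) (2 * K + 1) (grid_error L K dt \<Phi> f m) (grid_error L K dt \<Psi> r m) \<le> C * (dt + (L / real (2 * K + 1))\<^sup>2)\<^sup>2 \<and>
      \<M> * dt * (\<Sum>k=0..m. err_high \<epsilon> \<eta> \<xi> (L / real (2 * K + 1)) (2 * K + 1) (grid_error L K dt \<Phi> f k) (grid_error L K dt \<Psi> r k))
        \<le> C * (dt + (L / real (2 * K + 1))\<^sup>2)\<^sup>2"
      using surfactant_solution.error_estimate[OF sol Cs] by meson
    show "\<exists>C>0. \<forall>K dt \<phi> \<rho>.
       0 < dt \<and> dt < \<tau> \<and>
       numerical_solution \<alpha> \<beta> \<epsilon> \<eta> \<xi> \<delta> \<M> T L K dt (\<Phi> 0) (\<Psi> 0) \<phi> \<rho> \<longrightarrow>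
       (let N = 2 * K + 1; h = L / real N;
            e\<phi> = grid_error L K dt \<Phi> \<phi>; e\<rho> = grid_error L K dt \<Psi> \<rho>
        in \<forall>n\<ge>1. real (n + 1) * dt \<le> T \<longrightarrow>
             norm_m1 h N (e\<phi> (n + 1)) + norm_m1 h N (e\<rho> (n + 1))
             + sqrt (\<M> * dt * (\<Sum>k=0..n+1.
                 \<eta>\<^sup>2 * (grid_norm2 h N (lap_h h (e\<phi> k)))\<^sup>2
                 + \<epsilon> * (grad_norm2 h N (e\<phi> k))\<^sup>2
                 + \<xi> * (grad_norm2 h N (e\<rho> k))\<^sup>2))
             \<le> C * (dt + h\<^sup>2))"
      unfolding Let_def err_high_def[symmetric]
    \<comment> \<open>One root of \<open>C\<close> for each of the two H^(-1) norms and one for the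
      dissipation sum; the 1 makes the constant positive even if \<open>C = 0\<close>.\<close>
    proof (intro exI[of _ "3 * sqrt C + 1"] conjI allI impI, goal_cases)
      case 1
      show ?case using C(1) by (simp add: add_nonneg_pos)
    next
      case (2 K dt \<phi> \<rho> n)
      then have dt: "0 < dt" "dt < \<tau>"
        and num: "numerical_solution \<alpha> \<beta> \<epsilon> \<eta> \<xi> \<delta> \<M> T L K dt (\<Phi> 0) (\<Psi> 0) \<phi> \<rho>" and n: "real (n + 1) * dt \<le> T" by blast+
      have "Cs * dt \<le> Cs * \<tau>" using dt Cs0 by (intro mult_left_mono) auto
      also have "\<dots> \<le> 1/2" using Cs0 by (simp add: \<tau>_def field_simps)
      finally have Cdt: "Cs * dt \<le> 1/2" .
      define N where "N = 2 * K + 1"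
      define h where "h = L / real N"
      define x where "x = dt + h\<^sup>2"
      have x: "0 \<le> x" using dt by (simp add: x_def)
      have "1 \<le> n + 1" by simp
      note E = C(2)[OF dt(1) Cdt num this n, folded N_def, folded h_def, folded x_def]
      note low = norm_m1_le_err_low[OF conjunct1[OF E] C(1) x]
      have "sqrt (\<M> * dt * (\<Sum>k=0..n+1. err_high \<epsilon> \<eta> \<xi> h N (grid_error L K dt \<Phi> \<phi> k) (grid_error L K dt \<Psi> \<rho> k))) \<le> sqrt (C * x\<^sup>2)"
        by (rule real_sqrt_le_mono[OF conjunct2[OF E]])
      also have "\<dots> = sqrt C * x" using x by (simp add: real_sqrt_mult)
      finally show ?case unfolding N_def[symmetric] h_def[symmetric] x_def[symmetric]
        using low x unfolding distrib_right by linarith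
    qed
  qed
qed

end
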